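(* Let $\mathcal{V}$ and $\mathcal{W}$ be symmetric monoidal model categories and let $F \colon \mathcal{W} \rightleftarrows \mathcal{V} \colon G$ (with $F$ left adjoint) be a weak monoidal Quillen adjunction such that the oplax counit $\varepsilon \colon F(\mathbb{1}_{\mathcal{W}}) \to \mathbb{1}_{\mathcal{V}}$ is an isomorphism. If $\mathcal{C}$ is a weak $\mathcal{V}$-model category, then $G_*\mathcal{C}$ (with the induced weak tensoring and weak cotensoring) is a weak $\mathcal{W}$-model category. If moreover the weak tensoring (respectively, weak cotensoring) on $\mathcal{C}$ is set-compatible, then so is the weak tensoring (respectively, weak cotensoring) on $G_*\mathcal{C}$; likewise with "set-compatible" replaced by "unital". These conditions (set-compatibility and unitality) hold in particular when $\mathcal{C}$ is a $\mathcal{V}$-model category.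
   Context: Monoidal model categories. A monoidal model category is a model category (with all small limits and colimits; factorizations not assumed functorial) with a closed monoidal structure $(\otimes,\mathbb{1})$ satisfying: the pushout-product axiom (for cofibrations $i\colon a\to b$, $k\colon x\to y$, the map $i\square k\colon (a\otimes y)\amalg_{a\otimes x}(b\otimes x)\to b\otimes y$ is a cofibration, acyclic if $i$ or $k$ is) and the unit axiom (for $x$ cofibrant and every cofibrant replacement $q\colon Q\mathbb{1}\to\mathbb{1}$, the map $x\otimes Q\mathbb{1}\to x\otimes\mathbb{1}\cong x$ is a weak equivalence). It is symmetric if the structure is closed symmetric monoidal. Internal homs are written $\underline{\mathcal{V}}(-,-)$. Weak monoidal Quillen adjunction. A Quillen adjunction $F\colon\mathcal{W}\rightleftarrows\mathcal{V}\colon G$ between monoidal model categories with a lax monoidal structure on $G$ such that for the corresponding oplax structure $\delta_{x,y}\colon F(x\otimes y)\to F(x)\otimes F(y)$, $\varepsilon\colon F(\mathbb{1}_{\mathcal{W}})\to\mathbb{1}_{\mathcal{V}}$ on $F$: (i) $\delta_{x,y}$ is a weak equivalence for all cofibrant $x,y\in\mathcal{W}$; (ii) for some (hence any) cofibrant replacement $q\colon Q\mathbb{1}_{\mathcal{W}}\to\mathbb{1}_{\mathcal{W}}$, the composite $F(Q\mathbb{1}_{\mathcal{W}})\xrightarrow{F(q)}F(\mathbb{1}_{\mathcal{W}})\xrightarrow{\varepsilon}\mathbb{1}_{\mathcal{V}}$ is a weak equivalence. Enriched model categories. For a $\mathcal{V}$-category $\mathcal{C}$ with hom-objects $\underline{\mathcal{C}}(x,y)$,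 the underlying category $\mathcal{C}_0$ has hom-sets $\mathcal{C}(x,y)=\mathcal{V}(\mathbb{1},\underline{\mathcal{C}}(x,y))$; write $U=\mathcal{V}(\mathbb{1},-)\colon\mathcal{V}\to\mathrm{Set}$. A $\mathcal{V}$-enriched model category is a $\mathcal{V}$-category with a model structure on $\mathcal{C}_0$. It satisfies SM7 if for each cofibration $i\colon a\to b$ and fibration $p\colon x\to y$ in $\mathcal{C}_0$, the map $\underline{\mathcal{C}}(b,x)\to\underline{\mathcal{C}}(a,x)\times_{\underline{\mathcal{C}}(a,y)}\underline{\mathcal{C}}(b,y)$ is a fibration in $\mathcal{V}$, acyclic if $i$ or $p$ is. For $G$ lax monoidal, $G_*\mathcal{C}$ is the $\mathcal{W}$-category with the same objects and hom-objects $G(\underline{\mathcal{C}}(x,y))$. When $\varepsilon$ is an isomorphism, the underlying category of $G_*\mathcal{C}$ is identified with $\mathcal{C}_0$ and is given the same model structure. Weak (co)tensoring. Let $\mathcal{C}$ be a $\mathcal{V}$-enriched model category satisfying SM7. A weak tensoring of $\mathcal{C}$ over $\mathcal{V}$ is a bifunctor $\otimes\colon\mathcal{C}\times\mathcal{V}\to\mathcal{C}$ (on underlying categories) satisfying the external pushout-product axiom (for cofibrations $i\colon x\to y$ in $\mathcal{C}_0$ and $k\colon a\to b$ in $\mathcal{V}$, $(x\otimes b)\amalg_{x\otimes a}(y\otimes a)\to y\otimes b$ is a cofibration, acyclic if $i$ or $k$ is), with a natural map $\varphi_{v,x,y}\colon\underline{\mathcal{C}}(x\otimes v,y)\to\underline{\mathcal{V}}(v,\underline{\mathcal{C}}(x,y))$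 in $\mathcal{V}$ that is a weak equivalence for $v,x$ cofibrant and $y$ fibrant, and a natural map $\rho_x\colon x\otimes\mathbb{1}\to x$ such that $\varphi_{\mathbb{1},x,y}\circ\rho_x^*$ is the canonical isomorphism $\underline{\mathcal{C}}(x,y)\cong\underline{\mathcal{V}}(\mathbb{1},\underline{\mathcal{C}}(x,y))$. A weak cotensoring is a bifunctor $(x,v)\mapsto x^v$, $\mathcal{C}\times\mathcal{V}^{\mathrm{op}}\to\mathcal{C}$, satisfying the external pullback-power axiom (for a cofibration $i\colon a\to b$ in $\mathcal{V}$ and a fibration $p\colon x\to y$ in $\mathcal{C}_0$, $x^b\to x^a\times_{y^a}y^b$ is a fibration, acyclic if $i$ or $p$ is), with a natural map $\psi_{v,x,y}\colon\underline{\mathcal{C}}(x,y^v)\to\underline{\mathcal{V}}(v,\underline{\mathcal{C}}(x,y))$ that is a weak equivalence for $v,x$ cofibrant and $y$ fibrant, and a natural map $\eta_y\colon y\to y^{\mathbb{1}}$ such that $\psi_{\mathbb{1},x,y}\circ(\eta_y)_*$ is the canonical isomorphism. The weak tensoring (cotensoring) is set-compatible if $U\varphi_{v,x,y}$ (resp. $U\psi_{v,x,y}$) is a bijection for all $v,x,y$, and unital if $\rho_x$ (resp. $\eta_y$) is an isomorphism for all objects. Weak $\mathcal{V}$-model category. A $\mathcal{V}$-enriched model category, weakly tensored and weakly cotensored over $\mathcal{V}$, satisfying SM7 and the $\pi_0$ of mapping space axiom: for cofibrant $x$ and fibrant $y$ in $\mathcal{C}$, the canonical map $[x,y]\to[\mathbb{1},\underline{\mathcal{C}}(x,y)]$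 is a bijection, where $[x,y]$ is the hom-set in $\mathrm{Ho}(\mathcal{C})$, the target is a hom-set in $\mathrm{Ho}(\mathcal{V})$, and the map is induced by $\mathcal{C}(x,y)\cong\mathcal{V}(\mathbb{1},\underline{\mathcal{C}}(x,y))\to[\mathbb{1},\underline{\mathcal{C}}(x,y)]$. $\mathcal{V}$-model category. A tensored and cotensored $\mathcal{V}$-category with a model structure on $\mathcal{C}_0$ satisfying the external pushout-product axiom and the external unit axiom (for cofibrant $x\in\mathcal{C}_0$ and every cofibrant replacement $q\colon Q\mathbb{1}\to\mathbb{1}$ in $\mathcal{V}$, $x\otimes Q\mathbb{1}\to x\otimes\mathbb{1}\cong x$ is a weak equivalence). It is regarded as a weak $\mathcal{V}$-model category via its tensoring and cotensoring. Induced weak (co)tensoring on $G_*\mathcal{C}$. For $w\in\mathcal{W}$, $v\in\mathcal{V}$, let $\theta_{w,v}\colon G\underline{\mathcal{V}}(Fw,v)\to\underline{\mathcal{W}}(w,Gv)$ be the map corresponding by the tensor-hom adjunction and $F\dashv G$ to the composite $F(A\otimes w)\xrightarrow{\delta}FA\otimes Fw\to\underline{\mathcal{V}}(Fw,v)\otimes Fw\xrightarrow{\mathrm{ev}}v$, where $A=G\underline{\mathcal{V}}(Fw,v)$. The induced weak tensoring is $x\otimes w:=x\otimes Fw$ with structure maps $\theta_{w,\underline{\mathcal{C}}(x,y)}\circ G\varphi_{Fw,x,y}$ and $x\otimes F(\mathbb{1}_{\mathcal{W}})\xrightarrow{x\otimes\varepsilon}x\otimes\mathbb{1}_{\mathcal{V}}\xrightarrow{\rho_x}x$;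 the induced weak cotensoring is $y^w:=y^{Fw}$ with structure maps $\theta_{w,\underline{\mathcal{C}}(x,y)}\circ G\psi_{Fw,x,y}$ and $y\xrightarrow{\eta_y}y^{\mathbb{1}_{\mathcal{V}}}\xrightarrow{y^{\varepsilon}}y^{F(\mathbb{1}_{\mathcal{W}})}$.
   Formalization: Weak V-model categories are also required (in hypothesis and conclusion) to have C(x,y) fibrant, x⊗v cofibrant and y^v fibrant for x, v cofibrant and y fibrant; without this the claim fails, e.g. for the identity adjunction from Joyal to Kan–Quillen simplicial sets. *)

theory Defs
  imports Main "HOL-Library.Equipollence"
begin

section \<open>Categories\<close>

record ('o, 'm) cat =
  Obj :: "'o set"
  Arr :: "'m set"
  Dom :: "'m \<Rightarrow> 'o"
  Cod :: "'m \<Rightarrow> 'o"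
  idn :: "'o \<Rightarrow> 'm"
  Comp :: "'m \<Rightarrow> 'm \<Rightarrow> 'm"  (infixr "\<cdot>\<index>" 70)

definition hom :: "('o, 'm, 'x) cat_scheme \<Rightarrow> 'o \<Rightarrow> 'o \<Rightarrow> 'm set"
  where "hom C x y = {f \<in> Arr C. Dom C f = x \<and> Cod C f = y}"

locale category =
  fixes C :: "('o, 'm, 'x) cat_scheme"
  assumes Dom_in_Obj: "f \<in> Arr C \<Longrightarrow> Dom C f \<in> Obj C"
    and Cod_in_Obj: "f \<in> Arr C \<Longrightarrow> Cod C f \<in> Obj C"
    and idn_in_hom: "x \<in> Obj C \<Longrightarrow> idn C x \<in> hom C x x"
    and Comp_in_hom: "f \<in> hom C x y \<Longrightarrow> g \<in> hom C y z \<Longrightarrow> g \<cdot>\<^bsub>C\<^esub> f \<in> hom C x z"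
    and Comp_idn_left: "f \<in> hom C x y \<Longrightarrow> idn C y \<cdot>\<^bsub>C\<^esub> f = f"
    and Comp_idn_right: "f \<in> hom C x y \<Longrightarrow> f \<cdot>\<^bsub>C\<^esub> idn C x = f"
    and Comp_assoc: "f \<in> hom C w x \<Longrightarrow> g \<in> hom C x y \<Longrightarrow> h \<in> hom C y z \<Longrightarrow>
          h \<cdot>\<^bsub>C\<^esub> (g \<cdot>\<^bsub>C\<^esub> f) = (h \<cdot>\<^bsub>C\<^esub> g) \<cdot>\<^bsub>C\<^esub> f"

definition op_cat :: "('o, 'm, 'x) cat_scheme \<Rightarrow> ('o, 'm) cat"
  where "op_cat C = \<lparr>Obj = Obj C, Arr = Arr C, Dom = Cod C, Cod = Dom C, idn = idn C,
    Comp = (\<lambda>g f. f \<cdot>\<^bsub>C\<^esub> g)\<rparr>"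

definition prod_cat ::
  "('o, 'm, 'x) cat_scheme \<Rightarrow> ('p, 'n, 'y) cat_scheme \<Rightarrow> ('o \<times> 'p, 'm \<times> 'n) cat"
  where "prod_cat A B = \<lparr>Obj = Obj A \<times> Obj B, Arr = Arr A \<times> Arr B,
    Dom = map_prod (Dom A) (Dom B), Cod = map_prod (Cod A) (Cod B),
    idn = map_prod (idn A) (idn B),
    Comp = (\<lambda>(g, g') (f, f'). (g \<cdot>\<^bsub>A\<^esub> f, g' \<cdot>\<^bsub>B\<^esub> f'))\<rparr>"

definition inverse_arr :: "('o, 'm, 'x) cat_scheme \<Rightarrow> 'm \<Rightarrow> 'm \<Rightarrow> bool"
  where "inverse_arr C f g \<longleftrightarrow> g \<in> hom C (Cod C f) (Dom C f)
    \<and> g \<cdot>\<^bsub>C\<^esub> f = idn C (Dom C f) \<and> f \<cdot>\<^bsub>C\<^esub> g = idn C (Cod C f)"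

definition iso :: "('o, 'm, 'x) cat_scheme \<Rightarrow> 'm \<Rightarrow> bool"
  where "iso C f \<longleftrightarrow> f \<in> Arr C \<and> (\<exists>g. inverse_arr C f g)"

definition inv_arr :: "('o, 'm, 'x) cat_scheme \<Rightarrow> 'm \<Rightarrow> 'm"
  where "inv_arr C f = (THE g. inverse_arr C f g)"

definition is_functor ::
  "('o, 'm, 'x) cat_scheme \<Rightarrow> ('p, 'n, 'y) cat_scheme \<Rightarrow> ('o \<Rightarrow> 'p) \<Rightarrow> ('m \<Rightarrow> 'n) \<Rightarrow> bool"
  where "is_functor A B Fo Fa \<longleftrightarrow>
      (\<forall>x\<in>Obj A. Fo x \<in> Obj B)
    \<and> (\<forall>x y. \<forall>f\<in>hom A x y. Fa f \<in> hom B (Fo x) (Fo y))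
    \<and> (\<forall>x\<in>Obj A. Fa (idn A x) = idn B (Fo x))
    \<and> (\<forall>x y z. \<forall>f\<in>hom A x y. \<forall>g\<in>hom A y z. Fa (g \<cdot>\<^bsub>A\<^esub> f) = Fa g \<cdot>\<^bsub>B\<^esub> Fa f)"

definition is_bifunctor ::
  "('o, 'm, 'x) cat_scheme \<Rightarrow> ('p, 'n, 'y) cat_scheme \<Rightarrow> ('q, 'k, 'z) cat_scheme
    \<Rightarrow> ('o \<Rightarrow> 'p \<Rightarrow> 'q) \<Rightarrow> ('m \<Rightarrow> 'n \<Rightarrow> 'k) \<Rightarrow> bool"
  where "is_bifunctor A B D To Ta \<longleftrightarrow>
    is_functor (prod_cat A B) D (case_prod To) (case_prod Ta)"


subsection \<open>Limits\<close>

definition is_cone ::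
  "('i, 'j, 'x) cat_scheme \<Rightarrow> ('o, 'm, 'y) cat_scheme \<Rightarrow> ('i \<Rightarrow> 'o) \<Rightarrow> ('j \<Rightarrow> 'm)
    \<Rightarrow> 'o \<Rightarrow> ('i \<Rightarrow> 'm) \<Rightarrow> bool"
  where "is_cone J C Do Da a q \<longleftrightarrow> a \<in> Obj C \<and> (\<forall>j\<in>Obj J. q j \<in> hom C a (Do j))
    \<and> (\<forall>u\<in>Arr J. Da u \<cdot>\<^bsub>C\<^esub> q (Dom J u) = q (Cod J u))"

definition is_limit ::
  "('i, 'j, 'x) cat_scheme \<Rightarrow> ('o, 'm, 'y) cat_scheme \<Rightarrow> ('i \<Rightarrow> 'o) \<Rightarrow> ('j \<Rightarrow> 'm)
    \<Rightarrow> 'o \<Rightarrow> ('i \<Rightarrow> 'm) \<Rightarrow> bool"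
  where "is_limit J C Do Da l p \<longleftrightarrow> is_cone J C Do Da l p
    \<and> (\<forall>a q. is_cone J C Do Da a q \<longrightarrow> (\<exists>!h. h \<in> hom C a l \<and> (\<forall>j\<in>Obj J. p j \<cdot>\<^bsub>C\<^esub> h = q j)))"

text \<open>Smallness is relative to a universe, given as a type \<open>'u\<close>: a set is small if its
  cardinality is strictly below that of \<open>'u\<close>. Every small category is isomorphic to one whose
  objects and arrows are drawn from \<open>'u\<close>, so only those need to be considered. A Grothendieck
  universe of cardinality \<open>\<kappa>\<close> is the case where \<open>'u\<close> has \<open>\<kappa>\<close> elements.\<close>

definition has_small_limits :: "'u itself \<Rightarrow> ('o, 'm, 'x) cat_scheme \<Rightarrow> bool"
  where "has_small_limits U C \<longleftrightarrow> (\<forall>J :: ('u, 'u) cat. category J \<and> Arr J \<prec> (UNIV :: 'u set) \<longrightarrow>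
    (\<forall>Do Da. is_functor J C Do Da \<longrightarrow> (\<exists>l p. is_limit J C Do Da l p)))"

definition has_small_colimits :: "'u itself \<Rightarrow> ('o, 'm, 'x) cat_scheme \<Rightarrow> bool"
  where "has_small_colimits U C \<longleftrightarrow> has_small_limits U (op_cat C)"

definition is_initial :: "('o, 'm, 'x) cat_scheme \<Rightarrow> 'o \<Rightarrow> bool"
  where "is_initial C z \<longleftrightarrow> z \<in> Obj C \<and> (\<forall>x\<in>Obj C. \<exists>!f. f \<in> hom C z x)"

definition is_terminal :: "('o, 'm, 'x) cat_scheme \<Rightarrow> 'o \<Rightarrow> bool"
  where "is_terminal C z \<longleftrightarrow> z \<in> Obj C \<and> (\<forall>x\<in>Obj C. \<exists>!f. f \<in> hom C x z)"

definition is_pullback ::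
  "('o, 'm, 'x) cat_scheme \<Rightarrow> 'm \<Rightarrow> 'm \<Rightarrow> 'o \<Rightarrow> 'm \<Rightarrow> 'm \<Rightarrow> bool"
  where "is_pullback C f g p s t \<longleftrightarrow>
      f \<in> Arr C \<and> g \<in> Arr C \<and> Cod C f = Cod C g \<and> p \<in> Obj C
    \<and> s \<in> hom C p (Dom C f) \<and> t \<in> hom C p (Dom C g) \<and> f \<cdot>\<^bsub>C\<^esub> s = g \<cdot>\<^bsub>C\<^esub> t
    \<and> (\<forall>a. \<forall>s'\<in>hom C a (Dom C f). \<forall>t'\<in>hom C a (Dom C g). f \<cdot>\<^bsub>C\<^esub> s' = g \<cdot>\<^bsub>C\<^esub> t' \<longrightarrow>
         (\<exists>!h. h \<in> hom C a p \<and> s \<cdot>\<^bsub>C\<^esub> h = s' \<and> t \<cdot>\<^bsub>C\<^esub> h = t'))"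

definition is_pushout ::
  "('o, 'm, 'x) cat_scheme \<Rightarrow> 'm \<Rightarrow> 'm \<Rightarrow> 'o \<Rightarrow> 'm \<Rightarrow> 'm \<Rightarrow> bool"
  where "is_pushout C f g p s t \<longleftrightarrow>
      f \<in> Arr C \<and> g \<in> Arr C \<and> Dom C f = Dom C g \<and> p \<in> Obj C
    \<and> s \<in> hom C (Cod C f) p \<and> t \<in> hom C (Cod C g) p \<and> s \<cdot>\<^bsub>C\<^esub> f = t \<cdot>\<^bsub>C\<^esub> g
    \<and> (\<forall>a. \<forall>s'\<in>hom C (Cod C f) a. \<forall>t'\<in>hom C (Cod C g) a. s' \<cdot>\<^bsub>C\<^esub> f = t' \<cdot>\<^bsub>C\<^esub> g \<longrightarrow>
         (\<exists>!h. h \<in> hom C p a \<and> h \<cdot>\<^bsub>C\<^esub> s = s' \<and> h \<cdot>\<^bsub>C\<^esub> t = t'))"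


section \<open>Model categories\<close>

record 'm model_structure =
  Weq :: "'m set"
  Cof :: "'m set"
  Fib :: "'m set"

definition has_lift :: "('o, 'm, 'x) cat_scheme \<Rightarrow> 'm \<Rightarrow> 'm \<Rightarrow> bool"
  where "has_lift C i p \<longleftrightarrow>
    (\<forall>f\<in>hom C (Dom C i) (Dom C p). \<forall>g\<in>hom C (Cod C i) (Cod C p). p \<cdot>\<^bsub>C\<^esub> f = g \<cdot>\<^bsub>C\<^esub> i \<longrightarrow>
      (\<exists>h\<in>hom C (Cod C i) (Dom C p). h \<cdot>\<^bsub>C\<^esub> i = f \<and> p \<cdot>\<^bsub>C\<^esub> h = g))"

definition retract_of :: "('o, 'm, 'x) cat_scheme \<Rightarrow> 'm \<Rightarrow> 'm \<Rightarrow> bool"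
  where "retract_of C f g \<longleftrightarrow> f \<in> Arr C \<and> g \<in> Arr C \<and>
    (\<exists>s\<in>hom C (Dom C f) (Dom C g). \<exists>r\<in>hom C (Dom C g) (Dom C f).
     \<exists>s'\<in>hom C (Cod C f) (Cod C g). \<exists>r'\<in>hom C (Cod C g) (Cod C f).
       r \<cdot>\<^bsub>C\<^esub> s = idn C (Dom C f) \<and> r' \<cdot>\<^bsub>C\<^esub> s' = idn C (Cod C f)
     \<and> g \<cdot>\<^bsub>C\<^esub> s = s' \<cdot>\<^bsub>C\<^esub> f \<and> f \<cdot>\<^bsub>C\<^esub> r = r' \<cdot>\<^bsub>C\<^esub> g)"

definition wide_subcategory :: "('o, 'm, 'x) cat_scheme \<Rightarrow> 'm set \<Rightarrow> bool"
  where "wide_subcategory C K \<longleftrightarrow> K \<subseteq> Arr C \<and> (\<forall>x\<in>Obj C. idn C x \<in> K)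
    \<and> (\<forall>f\<in>K. \<forall>g\<in>K. Cod C f = Dom C g \<longrightarrow> g \<cdot>\<^bsub>C\<^esub> f \<in> K)"

locale model_category = category C
  for U :: "'u itself" and C :: "('o, 'm, 'x) cat_scheme" +
  fixes M :: "'m model_structure"
  assumes limits: "has_small_limits U C"
    and colimits: "has_small_colimits U C"
    and Weq_sub: "wide_subcategory C (Weq M)"
    and Cof_sub: "wide_subcategory C (Cof M)"
    and Fib_sub: "wide_subcategory C (Fib M)"
    and two_of_three_left: "f \<in> hom C x y \<Longrightarrow> g \<in> hom C y z \<Longrightarrow>
          g \<in> Weq M \<Longrightarrow> g \<cdot>\<^bsub>C\<^esub> f \<in> Weq M \<Longrightarrow> f \<in> Weq M"
    and two_of_three_right: "f \<in> hom C x y \<Longrightarrow> g \<in> hom C y z \<Longrightarrow>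
          f \<in> Weq M \<Longrightarrow> g \<cdot>\<^bsub>C\<^esub> f \<in> Weq M \<Longrightarrow> g \<in> Weq M"
    and Weq_retract: "retract_of C f g \<Longrightarrow> g \<in> Weq M \<Longrightarrow> f \<in> Weq M"
    and Cof_retract: "retract_of C f g \<Longrightarrow> g \<in> Cof M \<Longrightarrow> f \<in> Cof M"
    and Fib_retract: "retract_of C f g \<Longrightarrow> g \<in> Fib M \<Longrightarrow> f \<in> Fib M"
    and lift_acyclic_Cof: "i \<in> Cof M \<inter> Weq M \<Longrightarrow> p \<in> Fib M \<Longrightarrow> has_lift C i p"
    and lift_acyclic_Fib: "i \<in> Cof M \<Longrightarrow> p \<in> Fib M \<inter> Weq M \<Longrightarrow> has_lift C i p"
    and factor_acyclic_Cof: "f \<in> Arr C \<Longrightarrow>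
          \<exists>i\<in>Cof M \<inter> Weq M. \<exists>p\<in>Fib M. Cod C i = Dom C p \<and> f = p \<cdot>\<^bsub>C\<^esub> i"
    and factor_acyclic_Fib: "f \<in> Arr C \<Longrightarrow>
          \<exists>i\<in>Cof M. \<exists>p\<in>Fib M \<inter> Weq M. Cod C i = Dom C p \<and> f = p \<cdot>\<^bsub>C\<^esub> i"

definition cofibrant :: "('o, 'm, 'x) cat_scheme \<Rightarrow> 'm model_structure \<Rightarrow> 'o \<Rightarrow> bool"
  where "cofibrant C M x \<longleftrightarrow> x \<in> Obj C \<and> (\<exists>z. is_initial C z \<and> (\<exists>f\<in>hom C z x. f \<in> Cof M))"

definition fibrant :: "('o, 'm, 'x) cat_scheme \<Rightarrow> 'm model_structure \<Rightarrow> 'o \<Rightarrow> bool"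
  where "fibrant C M x \<longleftrightarrow> x \<in> Obj C \<and> (\<exists>z. is_terminal C z \<and> (\<exists>f\<in>hom C x z. f \<in> Fib M))"

definition cofibrant_replacement ::
  "('o, 'm, 'x) cat_scheme \<Rightarrow> 'm model_structure \<Rightarrow> 'o \<Rightarrow> 'm \<Rightarrow> bool"
  where "cofibrant_replacement C M x q \<longleftrightarrow>
    q \<in> Weq M \<and> Cod C q = x \<and> cofibrant C M (Dom C q)"

text \<open>For \<open>i : a \<rightarrow> b\<close> and \<open>k : x \<rightarrow> y\<close>, the map \<open>h\<close> below is the corner map
  \<open>(b \<otimes> x) \<amalg>\<^bsub>a \<otimes> x\<^esub> (a \<otimes> y) \<rightarrow> b \<otimes> y\<close>, for an arbitrary choice \<open>p\<close> of the pushout.\<close>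

definition pushout_product_axiom ::
  "('o, 'm, 'x) cat_scheme \<Rightarrow> 'm model_structure
    \<Rightarrow> ('p, 'n, 'y) cat_scheme \<Rightarrow> 'n model_structure
    \<Rightarrow> ('q, 'k, 'z) cat_scheme \<Rightarrow> 'k model_structure
    \<Rightarrow> ('o \<Rightarrow> 'p \<Rightarrow> 'q) \<Rightarrow> ('m \<Rightarrow> 'n \<Rightarrow> 'k) \<Rightarrow> bool"
  where "pushout_product_axiom A MA B MB D MD To Ta \<longleftrightarrow>
    (\<forall>i\<in>Cof MA. \<forall>k\<in>Cof MB. \<forall>p s t. \<forall>h\<in>hom D p (To (Cod A i) (Cod B k)).
        is_pushout D (Ta i (idn B (Dom B k))) (Ta (idn A (Dom A i)) k) p s t
      \<and> h \<cdot>\<^bsub>D\<^esub> s = Ta (idn A (Cod A i)) k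
      \<and> h \<cdot>\<^bsub>D\<^esub> t = Ta i (idn B (Cod B k))
      \<longrightarrow> h \<in> Cof MD \<and> (i \<in> Weq MA \<or> k \<in> Weq MB \<longrightarrow> h \<in> Weq MD))"

text \<open>The dual for a functor \<open>H : A\<^sup>o\<^sup>p \<times> B \<rightarrow> D\<close>: for \<open>i : a \<rightarrow> b\<close> and \<open>q : x \<rightarrow> y\<close>, the map
  \<open>h\<close> below is \<open>H(b, x) \<rightarrow> H(a, x) \<times>\<^bsub>H(a, y)\<^esub> H(b, y)\<close>.\<close>

definition pullback_corner_axiom ::
  "('o, 'm, 'x) cat_scheme \<Rightarrow> 'm model_structure
    \<Rightarrow> ('p, 'n, 'y) cat_scheme \<Rightarrow> 'n model_structure
    \<Rightarrow> ('q, 'k, 'z) cat_scheme \<Rightarrow> 'k model_structure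
    \<Rightarrow> ('o \<Rightarrow> 'p \<Rightarrow> 'q) \<Rightarrow> ('m \<Rightarrow> 'n \<Rightarrow> 'k) \<Rightarrow> bool"
  where "pullback_corner_axiom A MA B MB D MD Ho Ha \<longleftrightarrow>
    (\<forall>i\<in>Cof MA. \<forall>q\<in>Fib MB. \<forall>p s t. \<forall>h\<in>hom D (Ho (Cod A i) (Dom B q)) p.
        is_pullback D (Ha (idn A (Dom A i)) q) (Ha i (idn B (Cod B q))) p s t
      \<and> s \<cdot>\<^bsub>D\<^esub> h = Ha i (idn B (Dom B q))
      \<and> t \<cdot>\<^bsub>D\<^esub> h = Ha (idn A (Cod A i)) q
      \<longrightarrow> h \<in> Fib MD \<and> (i \<in> Weq MA \<or> q \<in> Weq MB \<longrightarrow> h \<in> Weq MD))"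


subsection \<open>Homotopy category\<close>

text \<open>The localization at the weak equivalences. Its arrows are represented by zigzags, written
  as paths read from source to target: \<open>Inl f\<close> is a step along \<open>f\<close>, and \<open>Inr w\<close> is a step
  against the weak equivalence \<open>w\<close>.\<close>

inductive zigzag ::
  "('o, 'm, 'x) cat_scheme \<Rightarrow> 'm model_structure \<Rightarrow> 'o \<Rightarrow> ('m + 'm) list \<Rightarrow> 'o \<Rightarrow> bool"
  for C M where
  zz_nil: "x \<in> Obj C \<Longrightarrow> zigzag C M x [] x"
| zz_fwd: "f \<in> hom C x y \<Longrightarrow> zigzag C M y r z \<Longrightarrow> zigzag C M x (Inl f # r) z"
| zz_bwd: "w \<in> hom C y x \<Longrightarrow> w \<in> Weq M \<Longrightarrow> zigzag C M y r z \<Longrightarrow> zigzag C M x (Inr w # r) z"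

inductive zz_equiv ::
  "('o, 'm, 'x) cat_scheme \<Rightarrow> 'm model_structure \<Rightarrow> 'o \<Rightarrow> 'o
    \<Rightarrow> ('m + 'm) list \<Rightarrow> ('m + 'm) list \<Rightarrow> bool"
  for C M where
  zze_refl: "zigzag C M x r y \<Longrightarrow> zz_equiv C M x y r r"
| zze_sym: "zz_equiv C M x y r s \<Longrightarrow> zz_equiv C M x y s r"
| zze_trans: "zz_equiv C M x y r s \<Longrightarrow> zz_equiv C M x y s t \<Longrightarrow> zz_equiv C M x y r t"
| zze_cong: "zigzag C M a r x \<Longrightarrow> zz_equiv C M x y s t \<Longrightarrow> zigzag C M y u b \<Longrightarrow>
    zz_equiv C M a b (r @ s @ u) (r @ t @ u)"
| zze_idn: "x \<in> Obj C \<Longrightarrow> zz_equiv C M x x [Inl (idn C x)] []"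
| zze_Comp: "f \<in> hom C x y \<Longrightarrow> g \<in> hom C y z \<Longrightarrow>
    zz_equiv C M x z [Inl f, Inl g] [Inl (g \<cdot>\<^bsub>C\<^esub> f)]"
| zze_inv_right: "w \<in> hom C x y \<Longrightarrow> w \<in> Weq M \<Longrightarrow> zz_equiv C M x x [Inl w, Inr w] []"
| zze_inv_left: "w \<in> hom C x y \<Longrightarrow> w \<in> Weq M \<Longrightarrow> zz_equiv C M y y [Inr w, Inl w] []"

definition ho_hom ::
  "('o, 'm, 'x) cat_scheme \<Rightarrow> 'm model_structure \<Rightarrow> 'o \<Rightarrow> 'o \<Rightarrow> ('m + 'm) list set set"
  where "ho_hom C M x y = {r. zigzag C M x r y} // {(r, s). zz_equiv C M x y r s}"

definition ho_class ::
  "('o, 'm, 'x) cat_scheme \<Rightarrow> 'm model_structure \<Rightarrow> 'm \<Rightarrow> ('m + 'm) list set"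
  where "ho_class C M f = {r. zz_equiv C M (Dom C f) (Cod C f) [Inl f] r}"


section \<open>Symmetric monoidal model categories\<close>

record ('o, 'm) smc = "('o, 'm) cat" +
  tensO :: "'o \<Rightarrow> 'o \<Rightarrow> 'o"  (infixr "\<otimes>\<index>" 75)
  tensA :: "'m \<Rightarrow> 'm \<Rightarrow> 'm"  (infixr "\<odot>\<index>" 75)
  munit :: "'o"  ("\<one>\<index>")
  assoc :: "'o \<Rightarrow> 'o \<Rightarrow> 'o \<Rightarrow> 'm"
  lunit :: "'o \<Rightarrow> 'm"
  runit :: "'o \<Rightarrow> 'm"
  braid :: "'o \<Rightarrow> 'o \<Rightarrow> 'm"
  ihom :: "'o \<Rightarrow> 'o \<Rightarrow> 'o"
  ev :: "'o \<Rightarrow> 'o \<Rightarrow> 'm"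

text \<open>\<open>ihom V x -\<close> is right adjoint to \<open>- \<otimes> x\<close>, with counit \<open>ev V x\<close>.\<close>

locale symmetric_monoidal_closed = category V
  for V :: "('o, 'm, 'x) smc_scheme" +
  assumes tens_bifunctor: "is_bifunctor V V V (tensO V) (tensA V)"
    and munit_Obj: "\<one>\<^bsub>V\<^esub> \<in> Obj V"
    and assoc_hom: "x \<in> Obj V \<Longrightarrow> y \<in> Obj V \<Longrightarrow> z \<in> Obj V \<Longrightarrow>
          assoc V x y z \<in> hom V ((x \<otimes>\<^bsub>V\<^esub> y) \<otimes>\<^bsub>V\<^esub> z) (x \<otimes>\<^bsub>V\<^esub> (y \<otimes>\<^bsub>V\<^esub> z)) \<and> iso V (assoc V x y z)"
    and assoc_natural: "f \<in> hom V x x' \<Longrightarrow> g \<in> hom V y y' \<Longrightarrow> h \<in> hom V z z' \<Longrightarrow>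
          assoc V x' y' z' \<cdot>\<^bsub>V\<^esub> ((f \<odot>\<^bsub>V\<^esub> g) \<odot>\<^bsub>V\<^esub> h) = (f \<odot>\<^bsub>V\<^esub> (g \<odot>\<^bsub>V\<^esub> h)) \<cdot>\<^bsub>V\<^esub> assoc V x y z"
    and lunit_hom: "x \<in> Obj V \<Longrightarrow> lunit V x \<in> hom V (\<one>\<^bsub>V\<^esub> \<otimes>\<^bsub>V\<^esub> x) x \<and> iso V (lunit V x)"
    and lunit_natural: "f \<in> hom V x y \<Longrightarrow>
          lunit V y \<cdot>\<^bsub>V\<^esub> (idn V \<one>\<^bsub>V\<^esub> \<odot>\<^bsub>V\<^esub> f) = f \<cdot>\<^bsub>V\<^esub> lunit V x"
    and runit_hom: "x \<in> Obj V \<Longrightarrow> runit V x \<in> hom V (x \<otimes>\<^bsub>V\<^esub> \<one>\<^bsub>V\<^esub>) x \<and> iso V (runit V x)"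
    and runit_natural: "f \<in> hom V x y \<Longrightarrow>
          runit V y \<cdot>\<^bsub>V\<^esub> (f \<odot>\<^bsub>V\<^esub> idn V \<one>\<^bsub>V\<^esub>) = f \<cdot>\<^bsub>V\<^esub> runit V x"
    and pentagon: "w \<in> Obj V \<Longrightarrow> x \<in> Obj V \<Longrightarrow> y \<in> Obj V \<Longrightarrow> z \<in> Obj V \<Longrightarrow>
          assoc V w x (y \<otimes>\<^bsub>V\<^esub> z) \<cdot>\<^bsub>V\<^esub> assoc V (w \<otimes>\<^bsub>V\<^esub> x) y z =
          (idn V w \<odot>\<^bsub>V\<^esub> assoc V x y z) \<cdot>\<^bsub>V\<^esub> assoc V w (x \<otimes>\<^bsub>V\<^esub> y) z
            \<cdot>\<^bsub>V\<^esub> (assoc V w x y \<odot>\<^bsub>V\<^esub> idn V z)"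
    and triangle: "x \<in> Obj V \<Longrightarrow> y \<in> Obj V \<Longrightarrow>
          (idn V x \<odot>\<^bsub>V\<^esub> lunit V y) \<cdot>\<^bsub>V\<^esub> assoc V x \<one>\<^bsub>V\<^esub> y = runit V x \<odot>\<^bsub>V\<^esub> idn V y"
    and braid_hom: "x \<in> Obj V \<Longrightarrow> y \<in> Obj V \<Longrightarrow> braid V x y \<in> hom V (x \<otimes>\<^bsub>V\<^esub> y) (y \<otimes>\<^bsub>V\<^esub> x)"
    and braid_natural: "f \<in> hom V x x' \<Longrightarrow> g \<in> hom V y y' \<Longrightarrow>
          braid V x' y' \<cdot>\<^bsub>V\<^esub> (f \<odot>\<^bsub>V\<^esub> g) = (g \<odot>\<^bsub>V\<^esub> f) \<cdot>\<^bsub>V\<^esub> braid V x y"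
    and braid_symmetric: "x \<in> Obj V \<Longrightarrow> y \<in> Obj V \<Longrightarrow>
          braid V y x \<cdot>\<^bsub>V\<^esub> braid V x y = idn V (x \<otimes>\<^bsub>V\<^esub> y)"
    and hexagon: "x \<in> Obj V \<Longrightarrow> y \<in> Obj V \<Longrightarrow> z \<in> Obj V \<Longrightarrow>
          assoc V y z x \<cdot>\<^bsub>V\<^esub> braid V x (y \<otimes>\<^bsub>V\<^esub> z) \<cdot>\<^bsub>V\<^esub> assoc V x y z =
          (idn V y \<odot>\<^bsub>V\<^esub> braid V x z) \<cdot>\<^bsub>V\<^esub> assoc V y x z \<cdot>\<^bsub>V\<^esub> (braid V x y \<odot>\<^bsub>V\<^esub> idn V z)"
    and ev_hom: "x \<in> Obj V \<Longrightarrow> z \<in> Obj V \<Longrightarrow>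
          ihom V x z \<in> Obj V \<and> ev V x z \<in> hom V (ihom V x z \<otimes>\<^bsub>V\<^esub> x) z"
    and ev_universal: "a \<in> Obj V \<Longrightarrow> x \<in> Obj V \<Longrightarrow> z \<in> Obj V \<Longrightarrow> h \<in> hom V (a \<otimes>\<^bsub>V\<^esub> x) z \<Longrightarrow>
          \<exists>!k. k \<in> hom V a (ihom V x z) \<and> ev V x z \<cdot>\<^bsub>V\<^esub> (k \<odot>\<^bsub>V\<^esub> idn V x) = h"

definition curry_arr ::
  "('o, 'm, 'x) smc_scheme \<Rightarrow> 'o \<Rightarrow> 'o \<Rightarrow> 'o \<Rightarrow> 'm \<Rightarrow> 'm"
  where "curry_arr V a x z h =
    (THE k. k \<in> hom V a (ihom V x z) \<and> ev V x z \<cdot>\<^bsub>V\<^esub> (k \<odot>\<^bsub>V\<^esub> idn V x) = h)"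

text \<open>Functoriality of internal homs: for \<open>f : x' \<rightarrow> x\<close> and \<open>g : z \<rightarrow> z'\<close>, the map
  \<open>ihom V x z \<rightarrow> ihom V x' z'\<close>.\<close>

definition ihom_arr :: "('o, 'm, 'x) smc_scheme \<Rightarrow> 'm \<Rightarrow> 'm \<Rightarrow> 'm"
  where "ihom_arr V f g =
    (let x' = Dom V f; x = Cod V f; z = Dom V g; z' = Cod V g in
     curry_arr V (ihom V x z) x' z' (g \<cdot>\<^bsub>V\<^esub> ev V x z \<cdot>\<^bsub>V\<^esub> (idn V (ihom V x z) \<odot>\<^bsub>V\<^esub> f)))"

text \<open>The canonical isomorphism \<open>z \<cong> ihom V \<one> z\<close>.\<close>

definition unit_ihom :: "('o, 'm, 'x) smc_scheme \<Rightarrow> 'o \<Rightarrow> 'm"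
  where "unit_ihom V z = curry_arr V z \<one>\<^bsub>V\<^esub> z (runit V z)"

locale symmetric_monoidal_model_category =
  symmetric_monoidal_closed V + model_category U V M
  for U :: "'u itself" and V :: "('o, 'm, 'x) smc_scheme" and M :: "'m model_structure" +
  assumes pushout_product: "pushout_product_axiom V M V M V M (tensO V) (tensA V)"
    and unit_axiom: "cofibrant V M x \<Longrightarrow> cofibrant_replacement V M \<one>\<^bsub>V\<^esub> q \<Longrightarrow>
          runit V x \<cdot>\<^bsub>V\<^esub> (idn V x \<odot>\<^bsub>V\<^esub> q) \<in> Weq M"


section \<open>Weak monoidal Quillen adjunctions\<close>

text \<open>An adjunction \<open>F : W \<rightleftarrows> V : G\<close> with unit \<open>adj_unit\<close>, counit \<open>adj_counit\<close>, and structure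
  maps \<open>lax_mult v v' : G v \<otimes> G v' \<rightarrow> G (v \<otimes> v')\<close> and \<open>lax_unit : \<one> \<rightarrow> G \<one>\<close> on \<open>G\<close>.\<close>

record ('wo, 'wm, 'vo, 'vm) lax_adjunction =
  FO :: "'wo \<Rightarrow> 'vo"
  FA :: "'wm \<Rightarrow> 'vm"
  GO :: "'vo \<Rightarrow> 'wo"
  GA :: "'vm \<Rightarrow> 'wm"
  adj_unit :: "'wo \<Rightarrow> 'wm"
  adj_counit :: "'vo \<Rightarrow> 'vm"
  lax_mult :: "'vo \<Rightarrow> 'vo \<Rightarrow> 'wm"
  lax_unit :: "'wm"

definition is_adjunction ::
  "('wo, 'wm, 'x) cat_scheme \<Rightarrow> ('vo, 'vm, 'y) cat_scheme
    \<Rightarrow> ('wo, 'wm, 'vo, 'vm) lax_adjunction \<Rightarrow> bool"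
  where "is_adjunction W V A \<longleftrightarrow>
      is_functor W V (FO A) (FA A) \<and> is_functor V W (GO A) (GA A)
    \<and> (\<forall>w\<in>Obj W. adj_unit A w \<in> hom W w (GO A (FO A w)))
    \<and> (\<forall>w w'. \<forall>f\<in>hom W w w'. adj_unit A w' \<cdot>\<^bsub>W\<^esub> f = GA A (FA A f) \<cdot>\<^bsub>W\<^esub> adj_unit A w)
    \<and> (\<forall>v\<in>Obj V. adj_counit A v \<in> hom V (FO A (GO A v)) v)
    \<and> (\<forall>v v'. \<forall>g\<in>hom V v v'. adj_counit A v' \<cdot>\<^bsub>V\<^esub> FA A (GA A g) = g \<cdot>\<^bsub>V\<^esub> adj_counit A v)
    \<and> (\<forall>w\<in>Obj W. adj_counit A (FO A w) \<cdot>\<^bsub>V\<^esub> FA A (adj_unit A w) = idn V (FO A w))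
    \<and> (\<forall>v\<in>Obj V. GA A (adj_counit A v) \<cdot>\<^bsub>W\<^esub> adj_unit A (GO A v) = idn W (GO A v))"

definition is_lax_monoidal ::
  "('wo, 'wm, 'x) smc_scheme \<Rightarrow> ('vo, 'vm, 'y) smc_scheme
    \<Rightarrow> ('wo, 'wm, 'vo, 'vm) lax_adjunction \<Rightarrow> bool"
  where "is_lax_monoidal W V A \<longleftrightarrow>
      (\<forall>x\<in>Obj V. \<forall>y\<in>Obj V.
         lax_mult A x y \<in> hom W (GO A x \<otimes>\<^bsub>W\<^esub> GO A y) (GO A (x \<otimes>\<^bsub>V\<^esub> y)))
    \<and> (\<forall>x x' y y'. \<forall>f\<in>hom V x x'. \<forall>g\<in>hom V y y'.
         lax_mult A x' y' \<cdot>\<^bsub>W\<^esub> (GA A f \<odot>\<^bsub>W\<^esub> GA A g) = GA A (f \<odot>\<^bsub>V\<^esub> g) \<cdot>\<^bsub>W\<^esub> lax_mult A x y)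
    \<and> lax_unit A \<in> hom W \<one>\<^bsub>W\<^esub> (GO A \<one>\<^bsub>V\<^esub>)
    \<and> (\<forall>x\<in>Obj V. \<forall>y\<in>Obj V. \<forall>z\<in>Obj V.
         GA A (assoc V x y z) \<cdot>\<^bsub>W\<^esub> lax_mult A (x \<otimes>\<^bsub>V\<^esub> y) z
             \<cdot>\<^bsub>W\<^esub> (lax_mult A x y \<odot>\<^bsub>W\<^esub> idn W (GO A z)) =
         lax_mult A x (y \<otimes>\<^bsub>V\<^esub> z) \<cdot>\<^bsub>W\<^esub> (idn W (GO A x) \<odot>\<^bsub>W\<^esub> lax_mult A y z)
             \<cdot>\<^bsub>W\<^esub> assoc W (GO A x) (GO A y) (GO A z))
    \<and> (\<forall>x\<in>Obj V. GA A (lunit V x) \<cdot>\<^bsub>W\<^esub> lax_mult A \<one>\<^bsub>V\<^esub> x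
             \<cdot>\<^bsub>W\<^esub> (lax_unit A \<odot>\<^bsub>W\<^esub> idn W (GO A x)) = lunit W (GO A x))
    \<and> (\<forall>x\<in>Obj V. GA A (runit V x) \<cdot>\<^bsub>W\<^esub> lax_mult A x \<one>\<^bsub>V\<^esub>
             \<cdot>\<^bsub>W\<^esub> (idn W (GO A x) \<odot>\<^bsub>W\<^esub> lax_unit A) = runit W (GO A x))"

definition oplax_mult ::
  "('wo, 'wm, 'x) smc_scheme \<Rightarrow> ('vo, 'vm, 'y) smc_scheme
    \<Rightarrow> ('wo, 'wm, 'vo, 'vm) lax_adjunction \<Rightarrow> 'wo \<Rightarrow> 'wo \<Rightarrow> 'vm"
  where "oplax_mult W V A x y = adj_counit A (FO A x \<otimes>\<^bsub>V\<^esub> FO A y)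
    \<cdot>\<^bsub>V\<^esub> FA A (lax_mult A (FO A x) (FO A y) \<cdot>\<^bsub>W\<^esub> (adj_unit A x \<odot>\<^bsub>W\<^esub> adj_unit A y))"

definition oplax_counit ::
  "('vo, 'vm, 'y) smc_scheme \<Rightarrow> ('wo, 'wm, 'vo, 'vm) lax_adjunction \<Rightarrow> 'vm"
  where "oplax_counit V A = adj_counit A \<one>\<^bsub>V\<^esub> \<cdot>\<^bsub>V\<^esub> FA A (lax_unit A)"

definition weak_monoidal_Quillen_adjunction ::
  "('wo, 'wm, 'x) smc_scheme \<Rightarrow> 'wm model_structure
    \<Rightarrow> ('vo, 'vm, 'y) smc_scheme \<Rightarrow> 'vm model_structure
    \<Rightarrow> ('wo, 'wm, 'vo, 'vm) lax_adjunction \<Rightarrow> bool"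
  where "weak_monoidal_Quillen_adjunction W MW V MV A \<longleftrightarrow>
      is_adjunction W V A
    \<and> (\<forall>i\<in>Cof MW. FA A i \<in> Cof MV)
    \<and> (\<forall>i\<in>Cof MW \<inter> Weq MW. FA A i \<in> Cof MV \<inter> Weq MV)
    \<and> is_lax_monoidal W V A
    \<and> (\<forall>x y. cofibrant W MW x \<and> cofibrant W MW y \<longrightarrow> oplax_mult W V A x y \<in> Weq MV)
    \<and> (\<exists>q. cofibrant_replacement W MW \<one>\<^bsub>W\<^esub> q \<and> oplax_counit V A \<cdot>\<^bsub>V\<^esub> FA A q \<in> Weq MV)"

text \<open>The comparison \<open>\<theta>\<^bsub>w,v\<^esub> : G (ihom V (F w) v) \<rightarrow> ihom W w (G v)\<close>.\<close>

definition theta ::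
  "('wo, 'wm, 'x) smc_scheme \<Rightarrow> ('vo, 'vm, 'y) smc_scheme
    \<Rightarrow> ('wo, 'wm, 'vo, 'vm) lax_adjunction \<Rightarrow> 'wo \<Rightarrow> 'vo \<Rightarrow> 'wm"
  where "theta W V A w v =
    (let h = ihom V (FO A w) v; a = GO A h;
         m = ev V (FO A w) v \<cdot>\<^bsub>V\<^esub> (adj_counit A h \<odot>\<^bsub>V\<^esub> idn V (FO A w)) \<cdot>\<^bsub>V\<^esub> oplax_mult W V A a w
     in curry_arr W a w (GO A v) (GA A m \<cdot>\<^bsub>W\<^esub> adj_unit A (a \<otimes>\<^bsub>W\<^esub> w)))"


section \<open>Enriched categories\<close>

text \<open>\<open>EComp x y z : EHom y z \<otimes> EHom x y \<rightarrow> EHom x z\<close>.\<close>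

record ('c, 'o, 'm) vcat =
  EObj :: "'c set"
  EHom :: "'c \<Rightarrow> 'c \<Rightarrow> 'o"
  EId :: "'c \<Rightarrow> 'm"
  EComp :: "'c \<Rightarrow> 'c \<Rightarrow> 'c \<Rightarrow> 'm"

definition enriched_category :: "('o, 'm, 'x) smc_scheme \<Rightarrow> ('c, 'o, 'm) vcat \<Rightarrow> bool"
  where "enriched_category V C \<longleftrightarrow>
      (\<forall>x\<in>EObj C. \<forall>y\<in>EObj C. EHom C x y \<in> Obj V)
    \<and> (\<forall>x\<in>EObj C. EId C x \<in> hom V \<one>\<^bsub>V\<^esub> (EHom C x x))
    \<and> (\<forall>x\<in>EObj C. \<forall>y\<in>EObj C. \<forall>z\<in>EObj C.
         EComp C x y z \<in> hom V (EHom C y z \<otimes>\<^bsub>V\<^esub> EHom C x y) (EHom C x z))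
    \<and> (\<forall>w\<in>EObj C. \<forall>x\<in>EObj C. \<forall>y\<in>EObj C. \<forall>z\<in>EObj C.
         EComp C w x z \<cdot>\<^bsub>V\<^esub> (EComp C x y z \<odot>\<^bsub>V\<^esub> idn V (EHom C w x)) =
         EComp C w y z \<cdot>\<^bsub>V\<^esub> (idn V (EHom C y z) \<odot>\<^bsub>V\<^esub> EComp C w x y)
           \<cdot>\<^bsub>V\<^esub> assoc V (EHom C y z) (EHom C x y) (EHom C w x))
    \<and> (\<forall>x\<in>EObj C. \<forall>y\<in>EObj C.
         EComp C x y y \<cdot>\<^bsub>V\<^esub> (EId C y \<odot>\<^bsub>V\<^esub> idn V (EHom C x y)) = lunit V (EHom C x y))
    \<and> (\<forall>x\<in>EObj C. \<forall>y\<in>EObj C.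
         EComp C x x y \<cdot>\<^bsub>V\<^esub> (idn V (EHom C x y) \<odot>\<^bsub>V\<^esub> EId C x) = runit V (EHom C x y))"

text \<open>Arrows \<open>x \<rightarrow> y\<close> of the underlying category are triples \<open>(x, y, f)\<close> with \<open>f : \<one> \<rightarrow> EHom C x y\<close>;
  the endpoints are recorded because distinct hom-objects may coincide.\<close>

definition underlying ::
  "('o, 'm, 'x) smc_scheme \<Rightarrow> ('c, 'o, 'm) vcat \<Rightarrow> ('c, 'c \<times> 'c \<times> 'm) cat"
  where "underlying V C =
    \<lparr>Obj = EObj C,
     Arr = {(x, y, f). x \<in> EObj C \<and> y \<in> EObj C \<and> f \<in> hom V \<one>\<^bsub>V\<^esub> (EHom C x y)},
     Dom = (\<lambda>(x, y, f). x),
     Cod = (\<lambda>(x, y, f). y),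
     idn = (\<lambda>x. (x, x, EId C x)),
     Comp = (\<lambda>(y, z, g) (x, y', f).
       (x, z, EComp C x y z \<cdot>\<^bsub>V\<^esub> (g \<odot>\<^bsub>V\<^esub> f) \<cdot>\<^bsub>V\<^esub> inv_arr V (lunit V \<one>\<^bsub>V\<^esub>)))\<rparr>"

text \<open>Functoriality of \<open>EHom C\<close> on the underlying category: for \<open>f : x' \<rightarrow> x\<close> and \<open>g : y \<rightarrow> y'\<close>,
  the map \<open>EHom C x y \<rightarrow> EHom C x' y'\<close>, first postcomposing with \<open>g\<close> and then precomposing
  with \<open>f\<close>.\<close>

definition ehom_arr ::
  "('o, 'm, 'x) smc_scheme \<Rightarrow> ('c, 'o, 'm) vcat \<Rightarrow> 'c \<times> 'c \<times> 'm \<Rightarrow> 'c \<times> 'c \<times> 'm \<Rightarrow> 'm"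
  where "ehom_arr V C = (\<lambda>(x', x, f) (y, y', g).
    (EComp C x' x y' \<cdot>\<^bsub>V\<^esub> (idn V (EHom C x y') \<odot>\<^bsub>V\<^esub> f) \<cdot>\<^bsub>V\<^esub> inv_arr V (runit V (EHom C x y')))
    \<cdot>\<^bsub>V\<^esub>
    (EComp C x y y' \<cdot>\<^bsub>V\<^esub> (g \<odot>\<^bsub>V\<^esub> idn V (EHom C x y)) \<cdot>\<^bsub>V\<^esub> inv_arr V (lunit V (EHom C x y))))"


section \<open>Weak tensorings and cotensorings\<close>

record ('c, 'o, 'm) tensor_data =
  tO :: "'c \<Rightarrow> 'o \<Rightarrow> 'c"
  tA :: "'c \<times> 'c \<times> 'm \<Rightarrow> 'm \<Rightarrow> 'c \<times> 'c \<times> 'm"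
  phi :: "'o \<Rightarrow> 'c \<Rightarrow> 'c \<Rightarrow> 'm"
  rho :: "'c \<Rightarrow> 'c \<times> 'c \<times> 'm"

record ('c, 'o, 'm) cotensor_data =
  cO :: "'c \<Rightarrow> 'o \<Rightarrow> 'c"
  cA :: "'c \<times> 'c \<times> 'm \<Rightarrow> 'm \<Rightarrow> 'c \<times> 'c \<times> 'm"
  psi :: "'o \<Rightarrow> 'c \<Rightarrow> 'c \<Rightarrow> 'm"
  eta :: "'c \<Rightarrow> 'c \<times> 'c \<times> 'm"

text \<open>The bifunctor and the structure maps of a (weak) tensoring, without homotopical conditions.\<close>

definition pre_tensoring ::
  "('o, 'm, 'x) smc_scheme \<Rightarrow> ('c, 'o, 'm) vcat \<Rightarrow> ('c, 'o, 'm) tensor_data \<Rightarrow> bool"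
  where "pre_tensoring V C T \<longleftrightarrow> (let C0 = underlying V C in
      is_bifunctor C0 V C0 (tO T) (tA T)
    \<and> (\<forall>v\<in>Obj V. \<forall>x\<in>EObj C. \<forall>y\<in>EObj C.
         phi T v x y \<in> hom V (EHom C (tO T x v) y) (ihom V v (EHom C x y)))
    \<and> (\<forall>v' v x' x y y'. \<forall>k\<in>hom V v' v. \<forall>f\<in>hom C0 x' x. \<forall>g\<in>hom C0 y y'.
         phi T v' x' y' \<cdot>\<^bsub>V\<^esub> ehom_arr V C (tA T f k) g =
         ihom_arr V k (ehom_arr V C f g) \<cdot>\<^bsub>V\<^esub> phi T v x y)
    \<and> (\<forall>x\<in>EObj C. rho T x \<in> hom C0 (tO T x \<one>\<^bsub>V\<^esub>) x)
    \<and> (\<forall>x y. \<forall>f\<in>hom C0 x y. rho T y \<cdot>\<^bsub>C0\<^esub> tA T f (idn V \<one>\<^bsub>V\<^esub>) = f \<cdot>\<^bsub>C0\<^esub> rho T x)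
    \<and> (\<forall>x\<in>EObj C. \<forall>y\<in>EObj C.
         phi T \<one>\<^bsub>V\<^esub> x y \<cdot>\<^bsub>V\<^esub> ehom_arr V C (rho T x) (idn C0 y) = unit_ihom V (EHom C x y)))"

definition pre_cotensoring ::
  "('o, 'm, 'x) smc_scheme \<Rightarrow> ('c, 'o, 'm) vcat \<Rightarrow> ('c, 'o, 'm) cotensor_data \<Rightarrow> bool"
  where "pre_cotensoring V C S \<longleftrightarrow> (let C0 = underlying V C in
      is_bifunctor C0 (op_cat V) C0 (cO S) (cA S)
    \<and> (\<forall>v\<in>Obj V. \<forall>x\<in>EObj C. \<forall>y\<in>EObj C.
         psi S v x y \<in> hom V (EHom C x (cO S y v)) (ihom V v (EHom C x y)))
    \<and> (\<forall>v' v x' x y y'. \<forall>k\<in>hom V v' v. \<forall>f\<in>hom C0 x' x. \<forall>g\<in>hom C0 y y'.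
         psi S v' x' y' \<cdot>\<^bsub>V\<^esub> ehom_arr V C f (cA S g k) =
         ihom_arr V k (ehom_arr V C f g) \<cdot>\<^bsub>V\<^esub> psi S v x y)
    \<and> (\<forall>y\<in>EObj C. eta S y \<in> hom C0 y (cO S y \<one>\<^bsub>V\<^esub>))
    \<and> (\<forall>x y. \<forall>f\<in>hom C0 x y. cA S f (idn V \<one>\<^bsub>V\<^esub>) \<cdot>\<^bsub>C0\<^esub> eta S x = eta S y \<cdot>\<^bsub>C0\<^esub> f)
    \<and> (\<forall>x\<in>EObj C. \<forall>y\<in>EObj C.
         psi S \<one>\<^bsub>V\<^esub> x y \<cdot>\<^bsub>V\<^esub> ehom_arr V C (idn C0 x) (eta S y) = unit_ihom V (EHom C x y)))"

definition SM7 ::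
  "('o, 'm, 'x) smc_scheme \<Rightarrow> 'm model_structure \<Rightarrow> ('c, 'o, 'm) vcat
    \<Rightarrow> ('c \<times> 'c \<times> 'm) model_structure \<Rightarrow> bool"
  where "SM7 V MV C MC \<longleftrightarrow>
    pullback_corner_axiom (underlying V C) MC (underlying V C) MC V MV (EHom C) (ehom_arr V C)"

definition weak_tensoring ::
  "('o, 'm, 'x) smc_scheme \<Rightarrow> 'm model_structure \<Rightarrow> ('c, 'o, 'm) vcat
    \<Rightarrow> ('c \<times> 'c \<times> 'm) model_structure \<Rightarrow> ('c, 'o, 'm) tensor_data \<Rightarrow> bool"
  where "weak_tensoring V MV C MC T \<longleftrightarrow> (let C0 = underlying V C in
      pre_tensoring V C T
    \<and> pushout_product_axiom C0 MC V MV C0 MC (tO T) (tA T)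
    \<and> (\<forall>v x y. cofibrant V MV v \<and> cofibrant C0 MC x \<and> fibrant C0 MC y \<longrightarrow> phi T v x y \<in> Weq MV))"

definition weak_cotensoring ::
  "('o, 'm, 'x) smc_scheme \<Rightarrow> 'm model_structure \<Rightarrow> ('c, 'o, 'm) vcat
    \<Rightarrow> ('c \<times> 'c \<times> 'm) model_structure \<Rightarrow> ('c, 'o, 'm) cotensor_data \<Rightarrow> bool"
  where "weak_cotensoring V MV C MC S \<longleftrightarrow> (let C0 = underlying V C in
      pre_cotensoring V C S
    \<and> pullback_corner_axiom V MV C0 MC C0 MC (\<lambda>v x. cO S x v) (\<lambda>k f. cA S f k)
    \<and> (\<forall>v x y. cofibrant V MV v \<and> cofibrant C0 MC x \<and> fibrant C0 MC y \<longrightarrow> psi S v x y \<in> Weq MV))"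

definition tensor_set_compatible ::
  "('o, 'm, 'x) smc_scheme \<Rightarrow> ('c, 'o, 'm) vcat \<Rightarrow> ('c, 'o, 'm) tensor_data \<Rightarrow> bool"
  where "tensor_set_compatible V C T \<longleftrightarrow> (\<forall>v\<in>Obj V. \<forall>x\<in>EObj C. \<forall>y\<in>EObj C.
    bij_betw (\<lambda>h. phi T v x y \<cdot>\<^bsub>V\<^esub> h)
      (hom V \<one>\<^bsub>V\<^esub> (EHom C (tO T x v) y)) (hom V \<one>\<^bsub>V\<^esub> (ihom V v (EHom C x y))))"

definition cotensor_set_compatible ::
  "('o, 'm, 'x) smc_scheme \<Rightarrow> ('c, 'o, 'm) vcat \<Rightarrow> ('c, 'o, 'm) cotensor_data \<Rightarrow> bool"
  where "cotensor_set_compatible V C S \<longleftrightarrow> (\<forall>v\<in>Obj V. \<forall>x\<in>EObj C. \<forall>y\<in>EObj C.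
    bij_betw (\<lambda>h. psi S v x y \<cdot>\<^bsub>V\<^esub> h)
      (hom V \<one>\<^bsub>V\<^esub> (EHom C x (cO S y v))) (hom V \<one>\<^bsub>V\<^esub> (ihom V v (EHom C x y))))"

definition tensor_unital ::
  "('o, 'm, 'x) smc_scheme \<Rightarrow> ('c, 'o, 'm) vcat \<Rightarrow> ('c, 'o, 'm) tensor_data \<Rightarrow> bool"
  where "tensor_unital V C T \<longleftrightarrow> (\<forall>x\<in>EObj C. iso (underlying V C) (rho T x))"

definition cotensor_unital ::
  "('o, 'm, 'x) smc_scheme \<Rightarrow> ('c, 'o, 'm) vcat \<Rightarrow> ('c, 'o, 'm) cotensor_data \<Rightarrow> bool"
  where "cotensor_unital V C S \<longleftrightarrow> (\<forall>y\<in>EObj C. iso (underlying V C) (eta S y))"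


section \<open>Weak enriched model categories\<close>

text \<open>For cofibrant \<open>x\<close> and fibrant \<open>y\<close> every class in \<open>[x, y]\<close> is represented by a map \<open>x \<rightarrow> y\<close>,
  so the first condition determines the canonical map \<open>\<kappa>\<close>.\<close>

definition pi0_axiom ::
  "('o, 'm, 'x) smc_scheme \<Rightarrow> 'm model_structure \<Rightarrow> ('c, 'o, 'm) vcat
    \<Rightarrow> ('c \<times> 'c \<times> 'm) model_structure \<Rightarrow> bool"
  where "pi0_axiom V MV C MC \<longleftrightarrow> (let C0 = underlying V C in
    \<forall>x y. cofibrant C0 MC x \<and> fibrant C0 MC y \<longrightarrow>
      (\<exists>\<kappa>. (\<forall>f. (x, y, f) \<in> hom C0 x y \<longrightarrow> \<kappa> (ho_class C0 MC (x, y, f)) = ho_class V MV f)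
         \<and> bij_betw \<kappa> (ho_hom C0 MC x y) (ho_hom V MV \<one>\<^bsub>V\<^esub> (EHom C x y))))"

text \<open>The absolute forms of SM7, of the external pushout-product axiom and of the external
  pullback-power axiom. They are the instances \<open>\<emptyset> \<rightarrow> x\<close>, \<open>\<emptyset> \<rightarrow> v\<close>, \<open>y \<rightarrow> *\<close> of these axioms
  whenever \<open>x \<otimes> \<emptyset>\<close> and \<open>\<emptyset> \<otimes> v\<close> are initial and \<open>y\<^sup>\<emptyset>\<close>, \<open>*\<^sup>v\<close>, \<open>EHom C \<emptyset> y\<close>, \<open>EHom C x *\<close>
  are terminal; so they are automatic for a tensored and cotensored category, and more generally
  if the weak tensoring and cotensoring are both set-compatible. For bare bifunctors they are
  independent, and without them weak enriched model categories are not stable under change of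
  enrichment: a one-object category enriched in simplicial sets, whose endomorphism object is the
  nerve of the one-object category on the multiplicative monoid \<open>{0, 1}\<close>, satisfies all other
  clauses for the Kan-Quillen model structure but not for the Joyal model structure, although
  the identity is a monoidal Quillen adjunction between the two.\<close>

definition absolute_axioms ::
  "('o, 'm, 'x) smc_scheme \<Rightarrow> 'm model_structure \<Rightarrow> ('c, 'o, 'm) vcat
    \<Rightarrow> ('c \<times> 'c \<times> 'm) model_structure
    \<Rightarrow> ('c, 'o, 'm) tensor_data \<Rightarrow> ('c, 'o, 'm) cotensor_data \<Rightarrow> bool"
  where "absolute_axioms V MV C MC T S \<longleftrightarrow> (let C0 = underlying V C in
      (\<forall>x y. cofibrant C0 MC x \<and> fibrant C0 MC y \<longrightarrow> fibrant V MV (EHom C x y))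
    \<and> (\<forall>x v. cofibrant C0 MC x \<and> cofibrant V MV v \<longrightarrow> cofibrant C0 MC (tO T x v))
    \<and> (\<forall>y v. fibrant C0 MC y \<and> cofibrant V MV v \<longrightarrow> fibrant C0 MC (cO S y v)))"

definition weak_model_category ::
  "'u itself \<Rightarrow> ('o, 'm, 'x) smc_scheme \<Rightarrow> 'm model_structure \<Rightarrow> ('c, 'o, 'm) vcat
    \<Rightarrow> ('c \<times> 'c \<times> 'm) model_structure
    \<Rightarrow> ('c, 'o, 'm) tensor_data \<Rightarrow> ('c, 'o, 'm) cotensor_data \<Rightarrow> bool"
  where "weak_model_category U V MV C MC T S \<longleftrightarrow>
      enriched_category V C
    \<and> model_category U (underlying V C) MC
    \<and> SM7 V MV C MC
    \<and> weak_tensoring V MV C MC T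
    \<and> weak_cotensoring V MV C MC S
    \<and> absolute_axioms V MV C MC T S
    \<and> pi0_axiom V MV C MC"


section \<open>Enriched model categories\<close>

text \<open>A tensoring: \<open>\<phi>\<close> is an isomorphism, \<open>V\<close>-natural in \<open>y\<close>, i.e. compatible with the actions of
  \<open>EHom C y z\<close> on \<open>EHom C (x \<otimes> v) y\<close> and on \<open>ihom V v (EHom C x y)\<close>. This
  determines the bifunctor and its structure of \<open>V\<close>-functor, and the equation for \<open>rho\<close>
  determines the canonical map \<open>x \<otimes> \<one> \<rightarrow> x\<close>.\<close>

definition tensoring ::
  "('o, 'm, 'x) smc_scheme \<Rightarrow> ('c, 'o, 'm) vcat \<Rightarrow> ('c, 'o, 'm) tensor_data \<Rightarrow> bool"
  where "tensoring V C T \<longleftrightarrow> pre_tensoring V C T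
    \<and> (\<forall>v\<in>Obj V. \<forall>x\<in>EObj C. \<forall>y\<in>EObj C. iso V (phi T v x y))
    \<and> (\<forall>v\<in>Obj V. \<forall>x\<in>EObj C. \<forall>y\<in>EObj C. \<forall>z\<in>EObj C.
         phi T v x z \<cdot>\<^bsub>V\<^esub> EComp C (tO T x v) y z =
         curry_arr V (EHom C y z \<otimes>\<^bsub>V\<^esub> EHom C (tO T x v) y) v (EHom C x z)
          (EComp C x y z
            \<cdot>\<^bsub>V\<^esub> (idn V (EHom C y z) \<odot>\<^bsub>V\<^esub> ev V v (EHom C x y))
            \<cdot>\<^bsub>V\<^esub> assoc V (EHom C y z) (ihom V v (EHom C x y)) v
            \<cdot>\<^bsub>V\<^esub> ((idn V (EHom C y z) \<odot>\<^bsub>V\<^esub> phi T v x y) \<odot>\<^bsub>V\<^esub> idn V v)))"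

definition cotensoring ::
  "('o, 'm, 'x) smc_scheme \<Rightarrow> ('c, 'o, 'm) vcat \<Rightarrow> ('c, 'o, 'm) cotensor_data \<Rightarrow> bool"
  where "cotensoring V C S \<longleftrightarrow> pre_cotensoring V C S
    \<and> (\<forall>v\<in>Obj V. \<forall>x\<in>EObj C. \<forall>y\<in>EObj C. iso V (psi S v x y))
    \<and> (\<forall>v\<in>Obj V. \<forall>x'\<in>EObj C. \<forall>x\<in>EObj C. \<forall>y\<in>EObj C.
         psi S v x' y \<cdot>\<^bsub>V\<^esub> EComp C x' x (cO S y v) =
         curry_arr V (EHom C x (cO S y v) \<otimes>\<^bsub>V\<^esub> EHom C x' x) v (EHom C x' y)
          (EComp C x' x y
            \<cdot>\<^bsub>V\<^esub> (ev V v (EHom C x y) \<odot>\<^bsub>V\<^esub> idn V (EHom C x' x))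
            \<cdot>\<^bsub>V\<^esub> inv_arr V (assoc V (ihom V v (EHom C x y)) v (EHom C x' x))
            \<cdot>\<^bsub>V\<^esub> (idn V (ihom V v (EHom C x y)) \<odot>\<^bsub>V\<^esub> braid V (EHom C x' x) v)
            \<cdot>\<^bsub>V\<^esub> assoc V (ihom V v (EHom C x y)) (EHom C x' x) v
            \<cdot>\<^bsub>V\<^esub> ((psi S v x y \<odot>\<^bsub>V\<^esub> idn V (EHom C x' x)) \<odot>\<^bsub>V\<^esub> idn V v)))"

definition enriched_model_category ::
  "'u itself \<Rightarrow> ('o, 'm, 'x) smc_scheme \<Rightarrow> 'm model_structure \<Rightarrow> ('c, 'o, 'm) vcat
    \<Rightarrow> ('c \<times> 'c \<times> 'm) model_structure
    \<Rightarrow> ('c, 'o, 'm) tensor_data \<Rightarrow> ('c, 'o, 'm) cotensor_data \<Rightarrow> bool"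
  where "enriched_model_category U V MV C MC T S \<longleftrightarrow> (let C0 = underlying V C in
      enriched_category V C
    \<and> tensoring V C T \<and> cotensoring V C S
    \<and> model_category U C0 MC
    \<and> pushout_product_axiom C0 MC V MV C0 MC (tO T) (tA T)
    \<and> (\<forall>x q. cofibrant C0 MC x \<and> cofibrant_replacement V MV \<one>\<^bsub>V\<^esub> q \<longrightarrow>
         rho T x \<cdot>\<^bsub>C0\<^esub> tA T (idn C0 x) q \<in> Weq MC))"


section \<open>Change of enrichment\<close>

definition change_base ::
  "('wo, 'wm, 'x) smc_scheme \<Rightarrow> ('wo, 'wm, 'vo, 'vm) lax_adjunction
    \<Rightarrow> ('c, 'vo, 'vm) vcat \<Rightarrow> ('c, 'wo, 'wm) vcat"
  where "change_base W A C =
    \<lparr>EObj = EObj C,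
     EHom = (\<lambda>x y. GO A (EHom C x y)),
     EId = (\<lambda>x. GA A (EId C x) \<cdot>\<^bsub>W\<^esub> lax_unit A),
     EComp = (\<lambda>x y z. GA A (EComp C x y z) \<cdot>\<^bsub>W\<^esub> lax_mult A (EHom C y z) (EHom C x y))\<rparr>"

text \<open>The identification of the arrows of \<open>underlying V C\<close> with those of
  \<open>underlying W (change_base W A C)\<close>, bijective if the oplax counit is an isomorphism.\<close>

definition base_arr ::
  "('wo, 'wm, 'x) smc_scheme \<Rightarrow> ('wo, 'wm, 'vo, 'vm) lax_adjunction
    \<Rightarrow> 'c \<times> 'c \<times> 'vm \<Rightarrow> 'c \<times> 'c \<times> 'wm"
  where "base_arr W A = (\<lambda>(x, y, f). (x, y, GA A f \<cdot>\<^bsub>W\<^esub> lax_unit A))"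

definition unbase_arr ::
  "('wo, 'wm, 'x) smc_scheme \<Rightarrow> ('vo, 'vm, 'y) smc_scheme \<Rightarrow> ('wo, 'wm, 'vo, 'vm) lax_adjunction
    \<Rightarrow> ('c, 'vo, 'vm) vcat \<Rightarrow> 'c \<times> 'c \<times> 'wm \<Rightarrow> 'c \<times> 'c \<times> 'vm"
  where "unbase_arr W V A C = inv_into (Arr (underlying V C)) (base_arr W A)"

definition change_base_model ::
  "('wo, 'wm, 'x) smc_scheme \<Rightarrow> ('wo, 'wm, 'vo, 'vm) lax_adjunction
    \<Rightarrow> ('c \<times> 'c \<times> 'vm) model_structure \<Rightarrow> ('c \<times> 'c \<times> 'wm) model_structure"
  where "change_base_model W A M =
    \<lparr>Weq = base_arr W A ` Weq M, Cof = base_arr W A ` Cof M, Fib = base_arr W A ` Fib M\<rparr>"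

definition change_base_tensor ::
  "('wo, 'wm, 'x) smc_scheme \<Rightarrow> ('vo, 'vm, 'y) smc_scheme \<Rightarrow> ('wo, 'wm, 'vo, 'vm) lax_adjunction
    \<Rightarrow> ('c, 'vo, 'vm) vcat \<Rightarrow> ('c, 'vo, 'vm) tensor_data \<Rightarrow> ('c, 'wo, 'wm) tensor_data"
  where "change_base_tensor W V A C T =
    \<lparr>tO = (\<lambda>x w. tO T x (FO A w)),
     tA = (\<lambda>f k. base_arr W A (tA T (unbase_arr W V A C f) (FA A k))),
     phi = (\<lambda>w x y. theta W V A w (EHom C x y) \<cdot>\<^bsub>W\<^esub> GA A (phi T (FO A w) x y)),
     rho = (\<lambda>x. base_arr W A
       (rho T x \<cdot>\<^bsub>underlying V C\<^esub> tA T (idn (underlying V C) x) (oplax_counit V A)))\<rparr>"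

definition change_base_cotensor ::
  "('wo, 'wm, 'x) smc_scheme \<Rightarrow> ('vo, 'vm, 'y) smc_scheme \<Rightarrow> ('wo, 'wm, 'vo, 'vm) lax_adjunction
    \<Rightarrow> ('c, 'vo, 'vm) vcat \<Rightarrow> ('c, 'vo, 'vm) cotensor_data \<Rightarrow> ('c, 'wo, 'wm) cotensor_data"
  where "change_base_cotensor W V A C S =
    \<lparr>cO = (\<lambda>y w. cO S y (FO A w)),
     cA = (\<lambda>f k. base_arr W A (cA S (unbase_arr W V A C f) (FA A k))),
     psi = (\<lambda>w x y. theta W V A w (EHom C x y) \<cdot>\<^bsub>W\<^esub> GA A (psi S (FO A w) x y)),
     eta = (\<lambda>y. base_arr W A
       (cA S (idn (underlying V C) y) (oplax_counit V A) \<cdot>\<^bsub>underlying V C\<^esub> eta S y))\<rparr>"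

end

theory Submission
  imports Defs
begin

text \<open>Let \<open>u : \<one> \<rightarrow> G \<one>\<close> be the lax unit. It is the adjunct of \<open>\<epsilon>\<close>, so \<open>f \<mapsto> G f \<cdot> u\<close> sends
  \<open>f : \<one> \<rightarrow> x\<close> to the adjunct of \<open>f \<cdot> \<epsilon>\<close>; as \<open>\<epsilon>\<close> is invertible, it is a bijection
  \<open>V(\<one>, x) \<cong> W(\<one>, G x)\<close>. On hom-objects this is an isomorphism between the underlying categories of
  \<open>C\<close> and of \<open>G\<^sub>* C\<close> (\<open>cat_iso_base_arr\<close>), which carries the model structure, and on which \<open>G\<^sub>* C\<close>
  has the hom-functor \<open>G (EHom C - -)\<close>. It remains to treat the axioms on hom-objects one by one.

  SM7 holds since \<open>G\<close> preserves pullbacks and (acyclic) fibrations, so that the new corner maps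
  are the images of the old ones. The pushout-product and pullback-power axioms hold since \<open>F\<close>
  preserves (acyclic) cofibrations.

  The structure map of the weak tensoring is \<open>\<theta> \<cdot> G \<phi>\<close>. Here \<open>G \<phi>\<close> is a weak equivalence by Ken
  Brown's lemma, because \<open>\<phi>\<close> is one between fibrant objects. The main point is that
  \<open>\<theta> : G (ihom (F w) v) \<rightarrow> ihom w (G v)\<close> is a weak equivalence for cofibrant \<open>w\<close> and fibrant \<open>v\<close>
  (\<open>theta_Weq\<close>): for cofibrant \<open>a\<close> it induces on \<open>[a, -]\<close> the composite of four adjunction bijections
  and of precomposition with \<open>\<delta>\<close>, which is a weak equivalence. To conclude from this, one needs that a
  map between fibrant objects is a weak equivalence if it is bijective on \<open>[a, -]\<close> for all cofibrant
  \<open>a\<close> (\<open>Weq_if_ho_bijective\<close>). This rests on the fact that for cofibrant \<open>a\<close> and fibrant \<open>x\<close> the classes of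
  zigzags from \<open>a\<close> to \<open>x\<close> are the homotopy classes of maps \<open>a \<rightarrow> x\<close> (\<open>zigzag_represented\<close> and
  \<open>ho_eq_iff_homotopic\<close>). To prove it, a zigzag is made to act on homotopy classes of maps from
  \<open>a\<close> into fibrant replacements.

  For the axiom on \<open>\<pi>\<^sub>0\<close>, let \<open>Q \<rightarrow> \<one>\<close> be a cofibrant replacement of the unit of \<open>W\<close> such that
  \<open>F Q \<rightarrow> F \<one> \<rightarrow> \<one>\<close> is a weak equivalence. For cofibrant \<open>x\<close> and fibrant \<open>y\<close>, with \<open>E = EHom C x y\<close>,
  one has \<open>[x, y] \<cong> [\<one>, E] \<cong> [F Q, E] \<cong> [Q, G E] \<cong> [\<one>, G E]\<close>. Set-compatibility is inherited since
  \<open>\<delta>\<close> is compatible with the unit constraints, so that \<open>\<delta>\<close> is invertible on \<open>\<one> \<otimes> w\<close>, and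
  therefore \<open>\<theta>\<close> is bijective on elements; unitality is inherited since \<open>\<epsilon>\<close> is invertible.

  For a \<open>V\<close>-model category, the tensoring and the cotensoring give adjunctions of two variables,
  under which the lifting properties of pullback corner maps are those of pushout-products. This
  gives SM7 and the pullback-power axiom. The absolute axioms hold because \<open>x \<otimes> \<emptyset>\<close>
  and \<open>\<emptyset> \<otimes> v\<close> are initial, so that \<open>x \<otimes> -\<close> and \<open>- \<otimes> v\<close> are left Quillen for cofibrant \<open>x\<close> and
  \<open>v\<close>. The axiom on \<open>\<pi>\<^sub>0\<close> follows from the unit axiom, and unitality from the Yoneda lemma.\<close>


section \<open>Categories\<close>

context category
begin

lemma hom_Obj: "f \<in> hom C x y \<Longrightarrow> x \<in> Obj C" "f \<in> hom C x y \<Longrightarrow> y \<in> Obj C"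
  using Dom_in_Obj Cod_in_Obj unfolding hom_def by auto

declare Dom_in_Obj [simp] Cod_in_Obj [simp]

lemma Comp_simps [simp]:
  assumes "f \<in> Arr C" "g \<in> Arr C" "Cod C f = Dom C g"
  shows "g \<cdot>\<^bsub>C\<^esub> f \<in> Arr C" "Dom C (g \<cdot>\<^bsub>C\<^esub> f) = Dom C f" "Cod C (g \<cdot>\<^bsub>C\<^esub> f) = Cod C g"
  using Comp_in_hom [of f "Dom C f" "Cod C f" g "Cod C g"] assms unfolding hom_def by auto

lemma idn_simps [simp]:
  assumes "x \<in> Obj C"
  shows "idn C x \<in> Arr C" "Dom C (idn C x) = x" "Cod C (idn C x) = x"
  using idn_in_hom [OF assms] unfolding hom_def by auto

lemma idn_left [simp]: "f \<in> Arr C \<Longrightarrow> Cod C f = y \<Longrightarrow> idn C y \<cdot>\<^bsub>C\<^esub> f = f"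
  using Comp_idn_left [of f "Dom C f" y] by (simp add: hom_def)

lemma idn_right [simp]: "f \<in> Arr C \<Longrightarrow> Dom C f = x \<Longrightarrow> f \<cdot>\<^bsub>C\<^esub> idn C x = f"
  using Comp_idn_right [of f x "Cod C f"] by (simp add: hom_def)

lemma Comp_assoc_right [simp]:
  assumes "f \<in> Arr C" "g \<in> Arr C" "h \<in> Arr C" "Cod C f = Dom C g" "Cod C g = Dom C h"
  shows "(h \<cdot>\<^bsub>C\<^esub> g) \<cdot>\<^bsub>C\<^esub> f = h \<cdot>\<^bsub>C\<^esub> (g \<cdot>\<^bsub>C\<^esub> f)"
  using Comp_assoc [of f "Dom C f" "Cod C f" g "Cod C g" h "Cod C h"] assms
  by (simp add: hom_def)

lemma Comp_extend:
  assumes "g \<cdot>\<^bsub>C\<^esub> f = h" "f \<in> Arr C" "g \<in> Arr C" "Cod C f = Dom C g" "k \<in> Arr C" "Cod C k = Dom C f"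
  shows "g \<cdot>\<^bsub>C\<^esub> (f \<cdot>\<^bsub>C\<^esub> k) = h \<cdot>\<^bsub>C\<^esub> k"
  using assms(2-) by (simp flip: assms(1))

lemma inverse_arr_unique:
  assumes "f \<in> Arr C" "inverse_arr C f g" "inverse_arr C f h"
  shows "g = h"
proof -
  have "g = (h \<cdot>\<^bsub>C\<^esub> f) \<cdot>\<^bsub>C\<^esub> g"
    using assms unfolding inverse_arr_def hom_def by (metis (mono_tags, lifting) idn_left mem_Collect_eq)
  also have "\<dots> = h \<cdot>\<^bsub>C\<^esub> (f \<cdot>\<^bsub>C\<^esub> g)"
    using assms unfolding inverse_arr_def hom_def by (intro Comp_assoc_right) auto
  also have "\<dots> = h"
    using assms unfolding inverse_arr_def hom_def by auto
  finally show ?thesis .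
qed

lemma inv_arr_eqI: "f \<in> Arr C \<Longrightarrow> inverse_arr C f g \<Longrightarrow> inv_arr C f = g"
  unfolding inv_arr_def using inverse_arr_unique by blast

lemma inv_arr:
  assumes "iso C f"
  shows "inverse_arr C f (inv_arr C f)"
  using assms inv_arr_eqI unfolding iso_def by metis

lemma inv_simps [simp]:
  assumes "iso C f"
  shows "f \<in> Arr C" "inv_arr C f \<in> Arr C" "Dom C (inv_arr C f) = Cod C f"
    "Cod C (inv_arr C f) = Dom C f" "inv_arr C f \<cdot>\<^bsub>C\<^esub> f = idn C (Dom C f)"
    "f \<cdot>\<^bsub>C\<^esub> inv_arr C f = idn C (Cod C f)"
  using inv_arr [OF assms] assms unfolding inverse_arr_def hom_def iso_def by auto

lemma inv_cancel [simp]: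
  assumes "iso C f" "g \<in> Arr C"
  shows "Cod C g = Dom C f \<Longrightarrow> inv_arr C f \<cdot>\<^bsub>C\<^esub> (f \<cdot>\<^bsub>C\<^esub> g) = g"
    "Cod C g = Cod C f \<Longrightarrow> f \<cdot>\<^bsub>C\<^esub> (inv_arr C f \<cdot>\<^bsub>C\<^esub> g) = g"
  using assms by (simp_all del: Comp_assoc_right add: Comp_assoc_right [symmetric])

lemma isoI:
  assumes "f \<in> hom C x y" "g \<in> hom C y x" "g \<cdot>\<^bsub>C\<^esub> f = idn C x" "f \<cdot>\<^bsub>C\<^esub> g = idn C y"
  shows "iso C f" "inv_arr C f = g"
  using assms inv_arr_eqI unfolding iso_def inverse_arr_def hom_def by auto

lemma iso_inv: "iso C f \<Longrightarrow> iso C (inv_arr C f)"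
  by (rule isoI [of _ "Cod C f" "Dom C f" f]) (auto simp: hom_def)

lemma iso_idn [simp]: "x \<in> Obj C \<Longrightarrow> iso C (idn C x)"
  by (rule isoI [of _ x x "idn C x"]) (auto simp: hom_def)

lemma iso_Comp:
  assumes "iso C f" "iso C g" "Cod C f = Dom C g"
  shows "iso C (g \<cdot>\<^bsub>C\<^esub> f)"
  by (rule isoI [of _ "Dom C f" "Cod C g" "inv_arr C f \<cdot>\<^bsub>C\<^esub> inv_arr C g"])
    (use assms in \<open>auto simp: hom_def\<close>)

lemma iso_monic:
  assumes "iso C f" "f \<cdot>\<^bsub>C\<^esub> g = f \<cdot>\<^bsub>C\<^esub> h" "g \<in> Arr C" "h \<in> Arr C" "Cod C g = Dom C f" "Cod C h = Dom C f"
  shows "g = h"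
  using assms inv_cancel(1) by metis

lemma iso_epic:
  assumes "iso C f" "g \<cdot>\<^bsub>C\<^esub> f = h \<cdot>\<^bsub>C\<^esub> f" "g \<in> Arr C" "h \<in> Arr C" "Dom C g = Cod C f" "Dom C h = Cod C f"
  shows "g = h"
proof -
  have "k = (k \<cdot>\<^bsub>C\<^esub> f) \<cdot>\<^bsub>C\<^esub> inv_arr C f" if "k \<in> Arr C" "Dom C k = Cod C f" for k
    using assms(1) that by simp
  then show ?thesis using assms by metis
qed

lemma category_op: "category (op_cat C)"
  by unfold_locales (auto simp: op_cat_def hom_def)

end

lemma op_cat_simps [simp]:
  "Obj (op_cat C) = Obj C" "Arr (op_cat C) = Arr C" "Dom (op_cat C) = Cod C" "Cod (op_cat C) = Dom C"
  "idn (op_cat C) = idn C" "g \<cdot>\<^bsub>op_cat C\<^esub> f = f \<cdot>\<^bsub>C\<^esub> g"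
  by (simp_all add: op_cat_def)

lemma hom_op [simp]: "hom (op_cat C) x y = hom C y x"
  by (auto simp: hom_def)

lemma pullback_op: "is_pullback (op_cat C) f g p s t \<longleftrightarrow> is_pushout C f g p s t"
  unfolding is_pullback_def is_pushout_def by simp

lemma terminal_op: "is_terminal (op_cat C) = is_initial C"
  unfolding is_terminal_def is_initial_def by (simp add: fun_eq_iff)

lemma pullbackD:
  assumes "is_pullback C f g p s t"
  shows "f \<in> Arr C" "g \<in> Arr C" "Cod C f = Cod C g" "p \<in> Obj C"
    "s \<in> hom C p (Dom C f)" "t \<in> hom C p (Dom C g)" "f \<cdot>\<^bsub>C\<^esub> s = g \<cdot>\<^bsub>C\<^esub> t"
    "\<lbrakk>s' \<in> hom C a (Dom C f); t' \<in> hom C a (Dom C g); f \<cdot>\<^bsub>C\<^esub> s' = g \<cdot>\<^bsub>C\<^esub> t'\<rbrakk> \<Longrightarrow>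
      \<exists>h\<in>hom C a p. s \<cdot>\<^bsub>C\<^esub> h = s' \<and> t \<cdot>\<^bsub>C\<^esub> h = t'"
  using assms unfolding is_pullback_def by (simp_all) blast

lemma (in category) pullback_ext:
  assumes "is_pullback C f g p s t" "h \<in> hom C a p" "h' \<in> hom C a p"
    "s \<cdot>\<^bsub>C\<^esub> h = s \<cdot>\<^bsub>C\<^esub> h'" "t \<cdot>\<^bsub>C\<^esub> h = t \<cdot>\<^bsub>C\<^esub> h'"
  shows "h = h'"
proof -
  note D = pullbackD [OF assms(1)]
  have "f \<cdot>\<^bsub>C\<^esub> (s \<cdot>\<^bsub>C\<^esub> h) = (g \<cdot>\<^bsub>C\<^esub> t) \<cdot>\<^bsub>C\<^esub> h"
    using D assms(2) by (simp flip: D(7)) (simp add: hom_def)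
  moreover have "\<dots> = g \<cdot>\<^bsub>C\<^esub> (t \<cdot>\<^bsub>C\<^esub> h)"
    using D assms(2) by (simp add: hom_def)
  moreover have "s \<cdot>\<^bsub>C\<^esub> h \<in> hom C a (Dom C f)" "t \<cdot>\<^bsub>C\<^esub> h \<in> hom C a (Dom C g)"
    using D assms(2) by (auto simp: hom_def)
  ultimately have "\<exists>!k. k \<in> hom C a p \<and> s \<cdot>\<^bsub>C\<^esub> k = s \<cdot>\<^bsub>C\<^esub> h \<and> t \<cdot>\<^bsub>C\<^esub> k = t \<cdot>\<^bsub>C\<^esub> h"
    using assms(1) unfolding is_pullback_def by simp
  thus ?thesis using assms by metis
qed

lemma pushoutD:
  assumes "is_pushout C f g p s t"
  shows "f \<in> Arr C" "g \<in> Arr C" "Dom C f = Dom C g" "p \<in> Obj C"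
    "s \<in> hom C (Cod C f) p" "t \<in> hom C (Cod C g) p" "s \<cdot>\<^bsub>C\<^esub> f = t \<cdot>\<^bsub>C\<^esub> g"
    "\<lbrakk>s' \<in> hom C (Cod C f) a; t' \<in> hom C (Cod C g) a; s' \<cdot>\<^bsub>C\<^esub> f = t' \<cdot>\<^bsub>C\<^esub> g\<rbrakk> \<Longrightarrow>
      \<exists>h\<in>hom C p a. h \<cdot>\<^bsub>C\<^esub> s = s' \<and> h \<cdot>\<^bsub>C\<^esub> t = t'"
  using assms unfolding is_pushout_def by (simp_all) blast

lemma (in category) pushout_ext:
  assumes "is_pushout C f g p s t" "h \<in> hom C p a" "h' \<in> hom C p a"
    "h \<cdot>\<^bsub>C\<^esub> s = h' \<cdot>\<^bsub>C\<^esub> s" "h \<cdot>\<^bsub>C\<^esub> t = h' \<cdot>\<^bsub>C\<^esub> t"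
  shows "h = h'"
  using category.pullback_ext [OF category_op, of f g p s t h a h'] assms by (simp add: pullback_op)

lemma pushout_swap: "is_pushout C f g p s t \<Longrightarrow> is_pushout C g f p t s"
  unfolding is_pushout_def by (auto simp: conj_commute)

lemma functorD:
  assumes "is_functor A B Fo Fa"
  shows "x \<in> Obj A \<Longrightarrow> Fo x \<in> Obj B"
    "f \<in> hom A x y \<Longrightarrow> Fa f \<in> hom B (Fo x) (Fo y)"
    "x \<in> Obj A \<Longrightarrow> Fa (idn A x) = idn B (Fo x)"
    "f \<in> hom A x y \<Longrightarrow> g \<in> hom A y z \<Longrightarrow> Fa (g \<cdot>\<^bsub>A\<^esub> f) = Fa g \<cdot>\<^bsub>B\<^esub> Fa f"
  using assms unfolding is_functor_def by blast+

lemma functor_simps: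
  assumes "is_functor A B Fo Fa" "f \<in> Arr A"
  shows "Fa f \<in> Arr B" "Dom B (Fa f) = Fo (Dom A f)" "Cod B (Fa f) = Fo (Cod A f)"
    "g \<in> Arr A \<Longrightarrow> Cod A f = Dom A g \<Longrightarrow> Fa (g \<cdot>\<^bsub>A\<^esub> f) = Fa g \<cdot>\<^bsub>B\<^esub> Fa f"
  using functorD(2) [OF assms(1), of f "Dom A f" "Cod A f"]
    functorD(4) [OF assms(1), of f "Dom A f" "Cod A f" g "Cod A g"] assms
  by (auto simp: hom_def)

lemma functor_iso:
  assumes "category A" "category B" "is_functor A B Fo Fa" "iso A f"
  shows "iso B (Fa f)"
proof -
  interpret A: category A by fact
  interpret B: category B by fact
  note F = functor_simps [OF assms(3)] functorD(3) [OF assms(3)]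
  show ?thesis
    by (rule B.isoI [of _ "Fo (Dom A f)" "Fo (Cod A f)" "Fa (inv_arr A f)"])
      (use assms(4) in \<open>auto simp: hom_def F simp flip: F(4)\<close>)
qed

lemma bifunctorD:
  assumes "is_bifunctor A B D To Ta"
  shows "x \<in> Obj A \<Longrightarrow> y \<in> Obj B \<Longrightarrow> To x y \<in> Obj D"
    "f \<in> hom A x x' \<Longrightarrow> g \<in> hom B y y' \<Longrightarrow> Ta f g \<in> hom D (To x y) (To x' y')"
    "x \<in> Obj A \<Longrightarrow> y \<in> Obj B \<Longrightarrow> Ta (idn A x) (idn B y) = idn D (To x y)"
    "f \<in> hom A x x' \<Longrightarrow> f' \<in> hom A x' x'' \<Longrightarrow> g \<in> hom B y y' \<Longrightarrow> g' \<in> hom B y' y'' \<Longrightarrow>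
      Ta (f' \<cdot>\<^bsub>A\<^esub> f) (g' \<cdot>\<^bsub>B\<^esub> g) = Ta f' g' \<cdot>\<^bsub>D\<^esub> Ta f g"
proof -
  note F = functorD [OF assms [unfolded is_bifunctor_def]]
  show "x \<in> Obj A \<Longrightarrow> y \<in> Obj B \<Longrightarrow> To x y \<in> Obj D"
    using F(1) [of "(x, y)"] by (simp add: prod_cat_def)
  show "f \<in> hom A x x' \<Longrightarrow> g \<in> hom B y y' \<Longrightarrow> Ta f g \<in> hom D (To x y) (To x' y')"
    using F(2) [of "(f, g)" "(x, y)" "(x', y')"] by (simp add: prod_cat_def hom_def)
  show "x \<in> Obj A \<Longrightarrow> y \<in> Obj B \<Longrightarrow> Ta (idn A x) (idn B y) = idn D (To x y)"
    using F(3) [of "(x, y)"] by (simp add: prod_cat_def)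
  show "f \<in> hom A x x' \<Longrightarrow> f' \<in> hom A x' x'' \<Longrightarrow> g \<in> hom B y y' \<Longrightarrow> g' \<in> hom B y' y'' \<Longrightarrow>
      Ta (f' \<cdot>\<^bsub>A\<^esub> f) (g' \<cdot>\<^bsub>B\<^esub> g) = Ta f' g' \<cdot>\<^bsub>D\<^esub> Ta f g"
    using F(4) [of "(f, g)" "(x, y)" "(x', y')" "(f', g')" "(x'', y'')"]
    by (simp add: prod_cat_def hom_def)
qed

lemma bifunctorI:
  assumes "\<And>x y. x \<in> Obj A \<Longrightarrow> y \<in> Obj B \<Longrightarrow> To x y \<in> Obj D"
    "\<And>f x x' g y y'. f \<in> hom A x x' \<Longrightarrow> g \<in> hom B y y' \<Longrightarrow> Ta f g \<in> hom D (To x y) (To x' y')"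
    "\<And>x y. x \<in> Obj A \<Longrightarrow> y \<in> Obj B \<Longrightarrow> Ta (idn A x) (idn B y) = idn D (To x y)"
    "\<And>f x x' f' x'' g y y' g' y''.
      f \<in> hom A x x' \<Longrightarrow> f' \<in> hom A x' x'' \<Longrightarrow> g \<in> hom B y y' \<Longrightarrow> g' \<in> hom B y' y'' \<Longrightarrow>
      Ta (f' \<cdot>\<^bsub>A\<^esub> f) (g' \<cdot>\<^bsub>B\<^esub> g) = Ta f' g' \<cdot>\<^bsub>D\<^esub> Ta f g"
  shows "is_bifunctor A B D To Ta"
  unfolding is_bifunctor_def is_functor_def prod_cat_def using assms
  by (auto simp: hom_def)

lemma bifunctor_simps:
  assumes "is_bifunctor A B D To Ta" "f \<in> Arr A" "g \<in> Arr B"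
  shows "Ta f g \<in> Arr D" "Dom D (Ta f g) = To (Dom A f) (Dom B g)"
    "Cod D (Ta f g) = To (Cod A f) (Cod B g)"
    "f' \<in> Arr A \<Longrightarrow> g' \<in> Arr B \<Longrightarrow> Dom A f' = Cod A f \<Longrightarrow> Dom B g' = Cod B g \<Longrightarrow>
      Ta f' g' \<cdot>\<^bsub>D\<^esub> Ta f g = Ta (f' \<cdot>\<^bsub>A\<^esub> f) (g' \<cdot>\<^bsub>B\<^esub> g)"
  using bifunctorD(2) [OF assms(1), of f "Dom A f" "Cod A f" g "Dom B g" "Cod B g"]
    bifunctorD(4) [OF assms(1), of f "Dom A f" "Cod A f" f' "Cod A f'" g "Dom B g" "Cod B g" g' "Cod B g'"]
    assms(2,3) by (auto simp: hom_def)

section \<open>Transport along an isomorphism of categories\<close>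

text \<open>An isomorphism of categories that is the identity on objects. Whatever is defined in terms of
  composition is transported along it. The inverse \<open>\<psi>\<close> is again of this kind, and so is \<open>\<phi>\<close>
  between the opposite categories.\<close>

locale cat_iso = category C for C :: "('o, 'm, 'x) cat_scheme" +
  fixes D :: "('o, 'n, 'y) cat_scheme" and \<phi> :: "'m \<Rightarrow> 'n"
  assumes Obj_eq: "Obj D = Obj C"
    and bij: "bij_betw \<phi> (Arr C) (Arr D)"
    and Dom_\<phi>: "f \<in> Arr C \<Longrightarrow> Dom D (\<phi> f) = Dom C f"
    and Cod_\<phi>: "f \<in> Arr C \<Longrightarrow> Cod D (\<phi> f) = Cod C f"
    and idn_\<phi>: "x \<in> Obj C \<Longrightarrow> \<phi> (idn C x) = idn D x"
    and Comp_\<phi>: "f \<in> Arr C \<Longrightarrow> g \<in> Arr C \<Longrightarrow> Cod C f = Dom C g \<Longrightarrow> \<phi> (g \<cdot>\<^bsub>C\<^esub> f) = \<phi> g \<cdot>\<^bsub>D\<^esub> \<phi> f"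
begin

abbreviation \<psi> where "\<psi> \<equiv> inv_into (Arr C) \<phi>"

lemma Arr_\<phi>: "f \<in> Arr C \<Longrightarrow> \<phi> f \<in> Arr D"
  using bij by (auto simp: bij_betw_def)

lemma Arr_eq: "Arr D = \<phi> ` Arr C"
  using bij by (auto simp: bij_betw_def)

lemma \<psi>_\<phi>: "f \<in> Arr C \<Longrightarrow> \<psi> (\<phi> f) = f"
  using bij by (simp add: bij_betw_def)

lemma \<phi>_\<psi>: "g \<in> Arr D \<Longrightarrow> \<phi> (\<psi> g) = g"
  using bij by (simp add: bij_betw_inv_into_right)

lemma hom_eq: "hom D x y = \<phi> ` hom C x y"
  by (auto simp: hom_def Arr_eq Dom_\<phi> Cod_\<phi>)

lemma hom_\<phi>: "f \<in> hom C x y \<Longrightarrow> \<phi> f \<in> hom D x y"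
  by (simp add: hom_eq)

lemma \<psi>_\<phi>_hom: "f \<in> hom C x y \<Longrightarrow> \<psi> (\<phi> f) = f"
  by (simp add: \<psi>_\<phi> hom_def)

lemma hom_\<psi>: "g \<in> hom D x y \<Longrightarrow> \<psi> g \<in> hom C x y"
  by (auto simp: hom_eq \<psi>_\<phi>_hom)

lemma \<phi>_inject: "f \<in> Arr C \<Longrightarrow> g \<in> Arr C \<Longrightarrow> \<phi> f = \<phi> g \<longleftrightarrow> f = g"
  using bij by (auto simp: bij_betw_def inj_on_def)

lemma Comp_\<phi>_hom: "f \<in> hom C x y \<Longrightarrow> g \<in> hom C y z \<Longrightarrow> \<phi> g \<cdot>\<^bsub>D\<^esub> \<phi> f = \<phi> (g \<cdot>\<^bsub>C\<^esub> f)"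
  by (simp add: hom_def Comp_\<phi>)

lemma category_D: "category D"
proof
  fix f g h w x y z
  show "f \<in> Arr D \<Longrightarrow> Dom D f \<in> Obj D" "f \<in> Arr D \<Longrightarrow> Cod D f \<in> Obj D"
    by (auto simp: Arr_eq Obj_eq Dom_\<phi> Cod_\<phi>)
  show "x \<in> Obj D \<Longrightarrow> idn D x \<in> hom D x x"
    unfolding hom_eq Obj_eq by (rule image_eqI [of _ _ "idn C x"]) (simp_all add: idn_\<phi> idn_in_hom)
  show "f \<in> hom D x y \<Longrightarrow> g \<in> hom D y z \<Longrightarrow> g \<cdot>\<^bsub>D\<^esub> f \<in> hom D x z"
    by (auto simp: hom_eq Comp_\<phi>_hom intro!: Comp_in_hom)
  show "f \<in> hom D x y \<Longrightarrow> idn D y \<cdot>\<^bsub>D\<^esub> f = f"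
    using idn_in_hom [of y] by (auto simp: hom_eq Comp_idn_left Comp_\<phi>_hom hom_Obj(2) simp flip: idn_\<phi>)
  show "f \<in> hom D x y \<Longrightarrow> f \<cdot>\<^bsub>D\<^esub> idn D x = f"
    using idn_in_hom [of x] by (auto simp: hom_eq Comp_idn_right Comp_\<phi>_hom hom_Obj(1) simp flip: idn_\<phi>)
  show "f \<in> hom D w x \<Longrightarrow> g \<in> hom D x y \<Longrightarrow> h \<in> hom D y z \<Longrightarrow>
          h \<cdot>\<^bsub>D\<^esub> (g \<cdot>\<^bsub>D\<^esub> f) = (h \<cdot>\<^bsub>D\<^esub> g) \<cdot>\<^bsub>D\<^esub> f"
  proof -
    assume "f \<in> hom D w x" "g \<in> hom D x y" "h \<in> hom D y z"
    then obtain f' g' h' where *: "f = \<phi> f'" "g = \<phi> g'" "h = \<phi> h'" and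
      [simp]: "f' \<in> hom C w x" "g' \<in> hom C x y" "h' \<in> hom C y z" by (auto simp: hom_eq)
    have "g' \<cdot>\<^bsub>C\<^esub> f' \<in> hom C w y" by (rule Comp_in_hom [of _ _ x]) simp_all
    moreover have "h' \<cdot>\<^bsub>C\<^esub> g' \<in> hom C x z" by (rule Comp_in_hom [of _ _ y]) simp_all
    ultimately show ?thesis
      using Comp_assoc [of f' w x g' y h' z] Comp_\<phi>_hom [of f' w x g' y] Comp_\<phi>_hom [of g' x y h' z]
        Comp_\<phi>_hom [of "g' \<cdot>\<^bsub>C\<^esub> f'" w y h' z] Comp_\<phi>_hom [of f' w x "h' \<cdot>\<^bsub>C\<^esub> g'" z]
      by (simp add: * del: Comp_assoc_right)
  qed
qed

lemma functor_\<phi>: "is_functor C D (\<lambda>x. x) \<phi>"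
  by (auto simp: is_functor_def Obj_eq hom_\<phi> idn_\<phi> Comp_\<phi>_hom)

lemma \<psi>_Comp: "f \<in> hom D x y \<Longrightarrow> g \<in> hom D y z \<Longrightarrow> \<psi> (g \<cdot>\<^bsub>D\<^esub> f) = \<psi> g \<cdot>\<^bsub>C\<^esub> \<psi> f"
  by (auto simp: hom_eq Comp_\<phi>_hom \<psi>_\<phi>_hom \<psi>_\<phi>_hom [OF Comp_in_hom])

lemma cat_iso_\<psi>: "cat_iso D C \<psi>"
proof -
  interpret D: category D by (rule category_D)
  show ?thesis
  proof
    fix f g x
    show "Obj C = Obj D" by (simp add: Obj_eq)
    show "bij_betw \<psi> (Arr D) (Arr C)" by (rule bij_betw_inv_into [OF bij])
    show "f \<in> Arr D \<Longrightarrow> Dom C (\<psi> f) = Dom D f" "f \<in> Arr D \<Longrightarrow> Cod C (\<psi> f) = Cod D f"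
      using hom_\<psi> [of f "Dom D f" "Cod D f"] by (auto simp: hom_def)
    show "x \<in> Obj D \<Longrightarrow> \<psi> (idn D x) = idn C x"
      by (simp add: Obj_eq \<psi>_\<phi> flip: idn_\<phi>)
    show "f \<in> Arr D \<Longrightarrow> g \<in> Arr D \<Longrightarrow> Cod D f = Dom D g \<Longrightarrow> \<psi> (g \<cdot>\<^bsub>D\<^esub> f) = \<psi> g \<cdot>\<^bsub>C\<^esub> \<psi> f"
      by (rule \<psi>_Comp [of _ "Dom D f" "Cod D f" _ "Cod D g"]) (auto simp: hom_def)
  qed
qed

lemma cat_iso_op: "cat_iso (op_cat C) (op_cat D) \<phi>"
proof -
  interpret op: category "op_cat C" by (rule category_op)
  show ?thesis
    by unfold_locales (auto simp: Obj_eq bij Dom_\<phi> Cod_\<phi> idn_\<phi> Comp_\<phi>)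
qed

lemma iso_\<phi>: "iso C f \<Longrightarrow> iso D (\<phi> f)"
  by (rule functor_iso [OF category_axioms category_D functor_\<phi>])

lemma pullback_\<phi>:
  assumes "is_pullback C f g p s t"
  shows "is_pullback D (\<phi> f) (\<phi> g) p (\<phi> s) (\<phi> t)"
proof -
  note P = pullbackD [OF assms]
  have fg: "f \<in> hom C (Dom C f) (Cod C g)" "g \<in> hom C (Dom C g) (Cod C g)"
    using P by (auto simp: hom_def)
  show ?thesis
    unfolding is_pullback_def
  proof (intro conjI allI ballI impI)
    show "\<phi> f \<in> Arr D" "\<phi> g \<in> Arr D" "Cod D (\<phi> f) = Cod D (\<phi> g)" "p \<in> Obj D"
      using P by (auto simp: Arr_\<phi> Cod_\<phi> Obj_eq)
    show "\<phi> s \<in> hom D p (Dom D (\<phi> f))" "\<phi> t \<in> hom D p (Dom D (\<phi> g))"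
      using P by (auto simp: Dom_\<phi> hom_\<phi>)
    show "\<phi> f \<cdot>\<^bsub>D\<^esub> \<phi> s = \<phi> g \<cdot>\<^bsub>D\<^esub> \<phi> t"
      using P Comp_\<phi>_hom [OF P(5) fg(1)] Comp_\<phi>_hom [OF P(6) fg(2)] by simp
    fix a s' t'
    assume "s' \<in> hom D a (Dom D (\<phi> f))" "t' \<in> hom D a (Dom D (\<phi> g))" and
      eq: "\<phi> f \<cdot>\<^bsub>D\<^esub> s' = \<phi> g \<cdot>\<^bsub>D\<^esub> t'"
    then obtain s0 t0 where s0: "s' = \<phi> s0" "s0 \<in> hom C a (Dom C f)"
      and t0: "t' = \<phi> t0" "t0 \<in> hom C a (Dom C g)"
      using P by (auto simp: hom_eq Dom_\<phi>)
    have "\<phi> (f \<cdot>\<^bsub>C\<^esub> s0) = \<phi> (g \<cdot>\<^bsub>C\<^esub> t0)"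
      using eq s0 t0 Comp_\<phi>_hom [OF s0(2) fg(1)] Comp_\<phi>_hom [OF t0(2) fg(2)] by simp
    then have "f \<cdot>\<^bsub>C\<^esub> s0 = g \<cdot>\<^bsub>C\<^esub> t0"
      using s0 t0 P(1-3) by (subst (asm) \<phi>_inject) (auto simp: hom_def)
    then obtain h where h: "h \<in> hom C a p" "s \<cdot>\<^bsub>C\<^esub> h = s0" "t \<cdot>\<^bsub>C\<^esub> h = t0"
      using P(8) s0 t0 by blast
    show "\<exists>!h. h \<in> hom D a p \<and> \<phi> s \<cdot>\<^bsub>D\<^esub> h = s' \<and> \<phi> t \<cdot>\<^bsub>D\<^esub> h = t'"
    proof (rule ex1I [of _ "\<phi> h"])
      show "\<phi> h \<in> hom D a p \<and> \<phi> s \<cdot>\<^bsub>D\<^esub> \<phi> h = s' \<and> \<phi> t \<cdot>\<^bsub>D\<^esub> \<phi> h = t'"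
        using h s0 t0 P(5,6) by (simp add: hom_\<phi> Comp_\<phi>_hom)
      fix k assume k: "k \<in> hom D a p \<and> \<phi> s \<cdot>\<^bsub>D\<^esub> k = s' \<and> \<phi> t \<cdot>\<^bsub>D\<^esub> k = t'"
      then obtain k0 where k0: "k = \<phi> k0" "k0 \<in> hom C a p" by (auto simp: hom_eq)
      have "s \<cdot>\<^bsub>C\<^esub> k0 = s0" "t \<cdot>\<^bsub>C\<^esub> k0 = t0"
        using k k0 P(5,6) s0 t0 Comp_\<phi>_hom [OF k0(2) P(5)] Comp_\<phi>_hom [OF k0(2) P(6)]
          \<psi>_\<phi>_hom [OF s0(2)] \<psi>_\<phi>_hom [OF t0(2)]
          \<psi>_\<phi>_hom [OF Comp_in_hom [OF k0(2) P(5)]] \<psi>_\<phi>_hom [OF Comp_in_hom [OF k0(2) P(6)]]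
        by metis+
      then show "k = \<phi> h"
        using pullback_ext [OF assms k0(2) h(1)] h k0 by simp
    qed
  qed
qed

lemma pushout_\<phi>: "is_pushout C f g p s t \<Longrightarrow> is_pushout D (\<phi> f) (\<phi> g) p (\<phi> s) (\<phi> t)"
  using cat_iso.pullback_\<phi> [OF cat_iso_op] by (simp add: pullback_op)

lemma terminal_\<phi>: "is_terminal C z \<Longrightarrow> is_terminal D z"
  unfolding is_terminal_def hom_eq Obj_eq by blast

lemma initial_\<phi>: "is_initial C z \<Longrightarrow> is_initial D z"
  using cat_iso.terminal_\<phi> [OF cat_iso_op] by (simp add: terminal_op)

lemma lift_\<phi>:
  assumes "has_lift C i p" "i \<in> Arr C" "p \<in> Arr C"
  shows "has_lift D (\<phi> i) (\<phi> p)"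
  unfolding has_lift_def
proof (intro ballI impI)
  fix f g assume *: "f \<in> hom D (Dom D (\<phi> i)) (Dom D (\<phi> p))" "g \<in> hom D (Cod D (\<phi> i)) (Cod D (\<phi> p))"
    "\<phi> p \<cdot>\<^bsub>D\<^esub> f = g \<cdot>\<^bsub>D\<^esub> \<phi> i"
  then obtain f0 g0 where f0: "f = \<phi> f0" "f0 \<in> hom C (Dom C i) (Dom C p)"
    and g0: "g = \<phi> g0" "g0 \<in> hom C (Cod C i) (Cod C p)"
    using assms by (auto simp: hom_eq Dom_\<phi> Cod_\<phi>)
  have [simp]: "i \<in> hom C (Dom C i) (Cod C i)" "p \<in> hom C (Dom C p) (Cod C p)"
    using assms by (auto simp: hom_def)
  have "\<phi> (p \<cdot>\<^bsub>C\<^esub> f0) = \<phi> (g0 \<cdot>\<^bsub>C\<^esub> i)"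
    using * f0 g0 assms by (simp add: Comp_\<phi> hom_def)
  then have "p \<cdot>\<^bsub>C\<^esub> f0 = g0 \<cdot>\<^bsub>C\<^esub> i"
    using f0 g0 assms by (subst (asm) \<phi>_inject) (auto simp: hom_def)
  then obtain h where h: "h \<in> hom C (Cod C i) (Dom C p)" "h \<cdot>\<^bsub>C\<^esub> i = f0" "p \<cdot>\<^bsub>C\<^esub> h = g0"
    using assms(1) f0 g0 unfolding has_lift_def by blast
  then show "\<exists>h\<in>hom D (Cod D (\<phi> i)) (Dom D (\<phi> p)). h \<cdot>\<^bsub>D\<^esub> \<phi> i = f \<and> \<phi> p \<cdot>\<^bsub>D\<^esub> h = g"
    using assms f0 g0 by (intro bexI [of _ "\<phi> h"]) (auto simp: Dom_\<phi> Cod_\<phi> Arr_\<phi> hom_def simp flip: Comp_\<phi>)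
qed

lemma retract_\<phi>:
  assumes "retract_of C f g"
  shows "retract_of D (\<phi> f) (\<phi> g)"
proof -
  obtain s r s' r' where *: "s \<in> hom C (Dom C f) (Dom C g)" "r \<in> hom C (Dom C g) (Dom C f)"
    "s' \<in> hom C (Cod C f) (Cod C g)" "r' \<in> hom C (Cod C g) (Cod C f)"
    "r \<cdot>\<^bsub>C\<^esub> s = idn C (Dom C f)" "r' \<cdot>\<^bsub>C\<^esub> s' = idn C (Cod C f)"
    "g \<cdot>\<^bsub>C\<^esub> s = s' \<cdot>\<^bsub>C\<^esub> f" "f \<cdot>\<^bsub>C\<^esub> r = r' \<cdot>\<^bsub>C\<^esub> g" and fg: "f \<in> Arr C" "g \<in> Arr C"
    using assms unfolding retract_of_def by blast
  have fg': "f \<in> hom C (Dom C f) (Cod C f)" "g \<in> hom C (Dom C g) (Cod C g)"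
    using fg by (auto simp: hom_def)
  have "\<phi> r \<cdot>\<^bsub>D\<^esub> \<phi> s = idn D (Dom C f)" "\<phi> r' \<cdot>\<^bsub>D\<^esub> \<phi> s' = idn D (Cod C f)"
    using Comp_\<phi>_hom [OF *(1,2)] Comp_\<phi>_hom [OF *(3,4)] *(5,6) fg by (simp_all add: idn_\<phi>)
  moreover have "\<phi> g \<cdot>\<^bsub>D\<^esub> \<phi> s = \<phi> s' \<cdot>\<^bsub>D\<^esub> \<phi> f" "\<phi> f \<cdot>\<^bsub>D\<^esub> \<phi> r = \<phi> r' \<cdot>\<^bsub>D\<^esub> \<phi> g"
    using Comp_\<phi>_hom [OF *(1) fg'(2)] Comp_\<phi>_hom [OF fg'(1) *(3)]
      Comp_\<phi>_hom [OF *(2) fg'(1)] Comp_\<phi>_hom [OF fg'(2) *(4)] *(7,8) by simp_all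
  ultimately show ?thesis
    unfolding retract_of_def Dom_\<phi> [OF fg(1)] Dom_\<phi> [OF fg(2)] Cod_\<phi> [OF fg(1)] Cod_\<phi> [OF fg(2)]
    using Arr_\<phi> [OF fg(1)] Arr_\<phi> [OF fg(2)] *(1-4)[THEN hom_\<phi>] by blast
qed

lemma limit_\<phi>:
  assumes "is_limit J C Do Da l p" "\<And>u. u \<in> Arr J \<Longrightarrow> Dom J u \<in> Obj J \<and> Cod J u \<in> Obj J"
    "\<And>u. u \<in> Arr J \<Longrightarrow> Da u \<in> hom C (Do (Dom J u)) (Do (Cod J u))"
  shows "is_limit J D Do (\<phi> \<circ> Da) l (\<phi> \<circ> p)"
proof -
  have cone: "is_cone J D Do (\<phi> \<circ> Da) a (\<phi> \<circ> q)" if "is_cone J C Do Da a q" for a q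
    using that assms(2,3) unfolding is_cone_def
    by (fastforce simp: Obj_eq hom_\<phi> simp: Comp_\<phi>_hom)
  have l: "is_cone J C Do Da l p" using assms(1) by (simp add: is_limit_def)
  show ?thesis
    unfolding is_limit_def
  proof (intro conjI allI impI)
    show "is_cone J D Do (\<phi> \<circ> Da) l (\<phi> \<circ> p)" by (rule cone [OF l])
    fix a q assume q: "is_cone J D Do (\<phi> \<circ> Da) a q"
    have q\<psi>: "\<psi> (q j) \<in> hom C a (Do j)" if "j \<in> Obj J" for j
      using that q by (auto simp: is_cone_def hom_\<psi>)
    have "is_cone J C Do Da a (\<psi> \<circ> q)"
      unfolding is_cone_def
    proof (intro conjI ballI)
      show "a \<in> Obj C" using q by (simp add: is_cone_def Obj_eq)
      show "(\<psi> \<circ> q) j \<in> hom C a (Do j)" if "j \<in> Obj J" for j using q\<psi> that by simp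
      fix u assume u: "u \<in> Arr J"
      have "\<psi> (\<phi> (Da u) \<cdot>\<^bsub>D\<^esub> q (Dom J u)) = \<psi> (q (Cod J u))"
        using q u by (simp add: is_cone_def)
      moreover have "\<psi> (\<phi> (Da u) \<cdot>\<^bsub>D\<^esub> q (Dom J u)) = Da u \<cdot>\<^bsub>C\<^esub> \<psi> (q (Dom J u))"
        using q u assms(2,3) [OF u]
        by (subst \<psi>_Comp [of _ a "Do (Dom J u)" _ "Do (Cod J u)"]) (auto simp: is_cone_def hom_\<phi> \<psi>_\<phi>_hom)
      ultimately show "Da u \<cdot>\<^bsub>C\<^esub> (\<psi> \<circ> q) (Dom J u) = (\<psi> \<circ> q) (Cod J u)" by simp
    qed
    then have "\<exists>!h. h \<in> hom C a l \<and> (\<forall>j\<in>Obj J. p j \<cdot>\<^bsub>C\<^esub> h = \<psi> (q j))"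
      using assms(1) unfolding is_limit_def comp_def by blast
    moreover have "(\<forall>j\<in>Obj J. p j \<cdot>\<^bsub>C\<^esub> h = \<psi> (q j)) \<longleftrightarrow> (\<forall>j\<in>Obj J. (\<phi> \<circ> p) j \<cdot>\<^bsub>D\<^esub> \<phi> h = q j)"
      if h: "h \<in> hom C a l" for h
    proof (intro ball_cong refl)
      fix j assume j: "j \<in> Obj J"
      have pj: "p j \<in> hom C l (Do j)" using l j by (simp add: is_cone_def)
      have "q j \<in> Arr D" using q j by (auto simp: is_cone_def hom_def)
      then have "q j = \<phi> (\<psi> (q j))" by (simp add: \<phi>_\<psi>)
      moreover have "p j \<cdot>\<^bsub>C\<^esub> h \<in> Arr C" "\<psi> (q j) \<in> Arr C" using pj h q\<psi> [OF j] by (auto simp: hom_def)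
      ultimately show "p j \<cdot>\<^bsub>C\<^esub> h = \<psi> (q j) \<longleftrightarrow> (\<phi> \<circ> p) j \<cdot>\<^bsub>D\<^esub> \<phi> h = q j"
        using Comp_\<phi>_hom [OF h pj] \<phi>_inject by (metis comp_apply)
    qed
    ultimately have ex: "\<exists>h. h \<in> hom C a l \<and> (\<forall>j\<in>Obj J. (\<phi> \<circ> p) j \<cdot>\<^bsub>D\<^esub> \<phi> h = q j)"
      and un: "\<And>h h'. h \<in> hom C a l \<Longrightarrow> \<forall>j\<in>Obj J. (\<phi> \<circ> p) j \<cdot>\<^bsub>D\<^esub> \<phi> h = q j \<Longrightarrow>
         h' \<in> hom C a l \<Longrightarrow> \<forall>j\<in>Obj J. (\<phi> \<circ> p) j \<cdot>\<^bsub>D\<^esub> \<phi> h' = q j \<Longrightarrow> h = h'"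
      by metis+
    show "\<exists>!h. h \<in> hom D a l \<and> (\<forall>j\<in>Obj J. (\<phi> \<circ> p) j \<cdot>\<^bsub>D\<^esub> h = q j)"
      unfolding hom_eq using ex un by (smt (verit) image_iff)
  qed
qed

lemma has_small_limits_\<phi>:
  assumes "has_small_limits U C"
  shows "has_small_limits U D"
  unfolding has_small_limits_def
proof (intro allI impI)
  fix J :: "('a, 'a) cat" and Do Da
  assume J: "category J \<and> Arr J \<prec> (UNIV :: 'a set)" and F: "is_functor J D Do Da"
  interpret J: category J using J by simp
  have Da: "Da u \<in> hom D (Do (Dom J u)) (Do (Cod J u))" if "u \<in> Arr J" for u
    using F that by (auto simp: is_functor_def hom_def)
  note F = functorD [OF F]
  have "is_functor J C Do (\<psi> \<circ> Da)"
    unfolding is_functor_def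
  proof (intro conjI ballI allI)
    show "Do x \<in> Obj C" if "x \<in> Obj J" for x using F(1) that by (simp add: Obj_eq)
    show "(\<psi> \<circ> Da) f \<in> hom C (Do x) (Do y)" if "f \<in> hom J x y" for f x y
      using F(2) [OF that] by (simp add: hom_\<psi>)
    show "(\<psi> \<circ> Da) (idn J x) = idn C (Do x)" if "x \<in> Obj J" for x
      using F(1,3) [OF that] by (simp add: Obj_eq \<psi>_\<phi> flip: idn_\<phi>)
    show "(\<psi> \<circ> Da) (g \<cdot>\<^bsub>J\<^esub> f) = (\<psi> \<circ> Da) g \<cdot>\<^bsub>C\<^esub> (\<psi> \<circ> Da) f"
      if "f \<in> hom J x y" "g \<in> hom J y z" for f g x y z
      using F(4) [OF that] \<psi>_Comp [OF F(2) [OF that(1)] F(2) [OF that(2)]] by simp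
  qed
  then obtain l p where l: "is_limit J C Do (\<psi> \<circ> Da) l p"
    using assms J unfolding has_small_limits_def by blast
  have "is_limit J D Do (\<phi> \<circ> (\<psi> \<circ> Da)) l (\<phi> \<circ> p)"
    by (rule limit_\<phi> [OF l]) (auto simp: Da hom_\<psi>)
  moreover have "is_cone J D Do (\<phi> \<circ> (\<psi> \<circ> Da)) a q \<longleftrightarrow> is_cone J D Do Da a q" for a q
    using Da unfolding is_cone_def by (auto simp: \<phi>_\<psi> hom_def)
  ultimately have "is_limit J D Do Da l (\<phi> \<circ> p)"
    by (simp add: is_limit_def)
  then show "\<exists>l p. is_limit J D Do Da l p" by blast
qed

end


section \<open>Model categories\<close>

subsection \<open>Pullbacks and terminal objects from small limits\<close>

text \<open>A pullback is a limit over the cospan category, which has to be realised inside the universe \<open>'u\<close>.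
  Its objects are \<open>e 0\<close>, \<open>e 1\<close>, \<open>e 2\<close>, identified with their identities, and its other arrows are
  \<open>e 3 : e 0 \<rightarrow> e 2\<close> and \<open>e 4 : e 1 \<rightarrow> e 2\<close>.\<close>

lemma (in category) pullback_exists:
  assumes lim: "has_small_limits (U :: 'u itself) C" and inf: "infinite (UNIV :: 'u set)"
    and f: "f \<in> Arr C" and g: "g \<in> Arr C" and fg: "Cod C f = Cod C g"
  shows "\<exists>p s t. is_pullback C f g p s t"
proof -
  obtain e :: "nat \<Rightarrow> 'u" where e: "inj e"
    using inf infinite_countable_subset by blast
  note [simp] = inj_eq [OF e]
  define J :: "('u, 'u) cat" where "J = \<lparr>Obj = {e 0, e 1, e 2}, Arr = {e 0, e 1, e 2, e 3, e 4},
    Dom = (\<lambda>u. if u = e 3 then e 0 else if u = e 4 then e 1 else u),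
    Cod = (\<lambda>u. if u = e 3 \<or> u = e 4 then e 2 else u),
    idn = (\<lambda>u. u), Comp = (\<lambda>v u. if v \<in> {e 0, e 1, e 2} then u else v)\<rparr>"
  have J: "category J"
    by unfold_locales (auto simp: J_def hom_def split: if_splits)
  define Do where "Do = (\<lambda>u. if u = e 0 then Dom C f else if u = e 1 then Dom C g else Cod C f)"
  define Da where "Da = (\<lambda>u. if u = e 3 then f else if u = e 4 then g else idn C (Do u))"
  have "is_functor J C Do Da"
    unfolding is_functor_def
  proof (intro conjI allI ballI)
    fix x y z u v
    show "x \<in> Obj J \<Longrightarrow> Do x \<in> Obj C" using f g by (auto simp: Do_def)
    have cases: "u = e 0 \<and> x = e 0 \<and> y = e 0 \<or> u = e 1 \<and> x = e 1 \<and> y = e 1 \<or>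
        u = e 2 \<and> x = e 2 \<and> y = e 2 \<or> u = e 3 \<and> x = e 0 \<and> y = e 2 \<or> u = e 4 \<and> x = e 1 \<and> y = e 2"
      if "u \<in> hom J x y" for u x y
    proof -
      have *: "x = Dom J u" "y = Cod J u" and "u = e 0 \<or> u = e 1 \<or> u = e 2 \<or> u = e 3 \<or> u = e 4"
        using that by (auto simp: J_def hom_def)
      then show ?thesis by (elim disjE; simp add: J_def)
    qed
    show "u \<in> hom J x y \<Longrightarrow> Da u \<in> hom C (Do x) (Do y)"
      using f g fg by (drule_tac cases) (elim disjE conjE; simp add: Do_def Da_def hom_def)
    show "x \<in> Obj J \<Longrightarrow> Da (idn J x) = idn C (Do x)"
      by (auto simp: Do_def Da_def J_def)
    show "u \<in> hom J x y \<Longrightarrow> v \<in> hom J y z \<Longrightarrow> Da (v \<cdot>\<^bsub>J\<^esub> u) = Da v \<cdot>\<^bsub>C\<^esub> Da u"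
      using f g fg
      by (drule_tac cases, drule_tac cases) (elim disjE conjE; simp add: Do_def Da_def J_def hom_def)
  qed
  moreover have "Arr J \<prec> (UNIV :: 'u set)"
    by (rule finite_lesspoll_infinite [OF inf]) (simp add: J_def)
  ultimately obtain l p where l: "is_limit J C Do Da l p"
    using lim J unfolding has_small_limits_def by blast
  then have cone: "is_cone J C Do Da l p" by (simp add: is_limit_def)
  have p: "p (e 0) \<in> hom C l (Dom C f)" "p (e 1) \<in> hom C l (Dom C g)" "p (e 2) \<in> hom C l (Cod C f)"
    "f \<cdot>\<^bsub>C\<^esub> p (e 0) = p (e 2)" "g \<cdot>\<^bsub>C\<^esub> p (e 1) = p (e 2)"
    using cone by (auto simp: is_cone_def J_def Do_def Da_def)
  have "is_pullback C f g l (p (e 0)) (p (e 1))"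
    unfolding is_pullback_def
  proof (intro conjI allI ballI impI)
    show "l \<in> Obj C" using cone by (simp add: is_cone_def)
    fix a s' t' assume *: "s' \<in> hom C a (Dom C f)" "t' \<in> hom C a (Dom C g)" "f \<cdot>\<^bsub>C\<^esub> s' = g \<cdot>\<^bsub>C\<^esub> t'"
    define q where "q = (\<lambda>u. if u = e 0 then s' else if u = e 1 then t' else f \<cdot>\<^bsub>C\<^esub> s')"
    have "is_cone J C Do Da a q"
      using * hom_Obj [OF *(1)] f g fg
      by (auto simp: is_cone_def J_def Do_def Da_def q_def hom_def)
    then have "\<exists>!h. h \<in> hom C a l \<and> (\<forall>j\<in>Obj J. p j \<cdot>\<^bsub>C\<^esub> h = q j)"
      using l by (simp add: is_limit_def)
    moreover have "(\<forall>j\<in>Obj J. p j \<cdot>\<^bsub>C\<^esub> h = q j) \<longleftrightarrow> p (e 0) \<cdot>\<^bsub>C\<^esub> h = s' \<and> p (e 1) \<cdot>\<^bsub>C\<^esub> h = t'"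
      if h: "h \<in> hom C a l" for h
    proof -
      have "p (e 2) \<cdot>\<^bsub>C\<^esub> h = f \<cdot>\<^bsub>C\<^esub> (p (e 0) \<cdot>\<^bsub>C\<^esub> h)"
        using p h f unfolding p(4) [symmetric] by (simp add: hom_def)
      then show ?thesis by (auto simp: J_def q_def)
    qed
    ultimately show "\<exists>!h. h \<in> hom C a l \<and> p (e 0) \<cdot>\<^bsub>C\<^esub> h = s' \<and> p (e 1) \<cdot>\<^bsub>C\<^esub> h = t'"
      by (smt (verit))
  qed (use f g fg p in auto)
  then show ?thesis by blast
qed

lemma (in category) terminal_exists:
  assumes lim: "has_small_limits (U :: 'u itself) C"
  shows "\<exists>z. is_terminal C z"
proof -
  define J :: "('u, 'u) cat" where "J = \<lparr>Obj = {}, Arr = {}, Dom = (\<lambda>u. u), Cod = (\<lambda>u. u),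
    idn = (\<lambda>u. u), Comp = (\<lambda>v u. u)\<rparr>"
  have "category J" by unfold_locales (auto simp: J_def hom_def)
  moreover have "Arr J \<prec> (UNIV :: 'u set)"
    using eqpoll_sym [of "{} :: 'u set"] by (auto simp: J_def lesspoll_def)
  moreover have "is_functor J C undefined undefined"
    by (simp add: is_functor_def J_def hom_def)
  ultimately obtain l p where "is_limit J C undefined undefined l p"
    using lim unfolding has_small_limits_def by blast
  then have "is_terminal C l"
    by (auto simp: is_limit_def is_cone_def is_terminal_def J_def)
  then show ?thesis by blast
qed

definition image_model :: "('m \<Rightarrow> 'n) \<Rightarrow> 'm model_structure \<Rightarrow> 'n model_structure" where
  "image_model \<phi> M = \<lparr>Weq = \<phi> ` Weq M, Cof = \<phi> ` Cof M, Fib = \<phi> ` Fib M\<rparr>"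

lemma image_model_simps [simp]:
  "Weq (image_model \<phi> M) = \<phi> ` Weq M" "Cof (image_model \<phi> M) = \<phi> ` Cof M" "Fib (image_model \<phi> M) = \<phi> ` Fib M"
  by (simp_all add: image_model_def)

lemma cat_iso_model_category:
  assumes "cat_iso C D \<phi>" "model_category U C M"
  shows "model_category U D (image_model \<phi> M)"
proof -
  interpret cat_iso C D \<phi> by fact
  interpret M: model_category U C M by fact
  interpret D: category D by (rule category_D)
  have wide: "wide_subcategory D (\<phi> ` K)" if "wide_subcategory C K" for K
  proof -
    have K: "K \<subseteq> Arr C" using that by (simp add: wide_subcategory_def)
    have "\<phi> g \<cdot>\<^bsub>D\<^esub> \<phi> f \<in> \<phi> ` K" if "f \<in> K" "g \<in> K" "Cod C f = Dom C g" for f g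
      using that K \<open>wide_subcategory C K\<close> by (auto simp: wide_subcategory_def subset_iff simp flip: Comp_\<phi>)
    then show ?thesis
      using that K by (auto simp: wide_subcategory_def Arr_\<phi> Obj_eq subset_iff Dom_\<phi> Cod_\<phi> simp flip: idn_\<phi>)
  qed
  have sub: "Weq M \<subseteq> Arr C" "Cof M \<subseteq> Arr C" "Fib M \<subseteq> Arr C"
    using M.Weq_sub M.Cof_sub M.Fib_sub by (auto simp: wide_subcategory_def)
  have mem: "\<phi> f \<in> \<phi> ` K \<longleftrightarrow> f \<in> K" if "K \<subseteq> Arr C" "f \<in> Arr C" for f K
    using that \<phi>_inject by blast
  have retract: "f \<in> \<phi> ` K" if "retract_of D f g" "g \<in> \<phi> ` K" "K \<subseteq> Arr C"
    "\<And>f g. retract_of C f g \<Longrightarrow> g \<in> K \<Longrightarrow> f \<in> K" for f g K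
  proof -
    interpret I: cat_iso D C \<psi> by (rule cat_iso_\<psi>)
    have "\<psi> g \<in> K" using that(2,3) by (auto simp: \<psi>_\<phi> subset_iff)
    then have "\<psi> f \<in> K" using that(4) I.retract_\<phi> [OF that(1)] by blast
    moreover have "f \<in> Arr D" using that(1) by (simp add: retract_of_def)
    ultimately show ?thesis using \<phi>_\<psi> [of f] by (metis image_eqI)
  qed
  show ?thesis
  proof
    show "has_small_limits U D" using M.limits by (rule has_small_limits_\<phi>)
    show "has_small_colimits U D"
      using M.colimits cat_iso.has_small_limits_\<phi> [OF cat_iso_op] by (auto simp: has_small_colimits_def)
    fix f g i p x y z
    show "f \<in> Arr D \<Longrightarrow> \<exists>i\<in>Cof (image_model \<phi> M)
        \<inter> Weq (image_model \<phi> M).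
       \<exists>p\<in>Fib (image_model \<phi> M). Cod D i = Dom D p \<and> f = p \<cdot>\<^bsub>D\<^esub> i"
    proof -
      assume "f \<in> Arr D"
      then obtain f0 where f0: "f0 \<in> Arr C" "f = \<phi> f0" using Arr_eq by auto
      obtain i p where ip: "i \<in> Cof M" "i \<in> Weq M" "p \<in> Fib M" "Cod C i = Dom C p" "f0 = p \<cdot>\<^bsub>C\<^esub> i"
        using M.factor_acyclic_Cof [OF f0(1)] by blast
      have "i \<in> Arr C" "p \<in> Arr C" using ip sub by auto
      then show ?thesis
        using ip f0 by (intro bexI [of _ "\<phi> p"] bexI [of _ "\<phi> i"]) (auto simp: Dom_\<phi> Cod_\<phi> Comp_\<phi>)
    qed
    show "f \<in> Arr D \<Longrightarrow> \<exists>i\<in>Cof (image_model \<phi> M).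
       \<exists>p\<in>Fib (image_model \<phi> M)
        \<inter> Weq (image_model \<phi> M). Cod D i = Dom D p \<and> f = p \<cdot>\<^bsub>D\<^esub> i"
    proof -
      assume "f \<in> Arr D"
      then obtain f0 where f0: "f0 \<in> Arr C" "f = \<phi> f0" using Arr_eq by auto
      obtain i p where ip: "i \<in> Cof M" "p \<in> Weq M" "p \<in> Fib M" "Cod C i = Dom C p" "f0 = p \<cdot>\<^bsub>C\<^esub> i"
        using M.factor_acyclic_Fib [OF f0(1)] by blast
      have "i \<in> Arr C" "p \<in> Arr C" using ip sub by auto
      then show ?thesis
        using ip f0 by (intro bexI [of _ "\<phi> p"] bexI [of _ "\<phi> i"]) (auto simp: Dom_\<phi> Cod_\<phi> Comp_\<phi>)
    qed
  next
    fix f g x y z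
    assume "f \<in> hom D x y" "g \<in> hom D y z"
    then obtain f0 g0 where f0: "f0 \<in> hom C x y" "f = \<phi> f0" and g0: "g0 \<in> hom C y z" "g = \<phi> g0"
      by (auto simp: hom_eq)
    have arr: "f0 \<in> Arr C" "g0 \<in> Arr C" "g0 \<cdot>\<^bsub>C\<^esub> f0 \<in> Arr C" using f0 g0 by (auto simp: hom_def)
    show "f \<in> Weq (image_model \<phi> M)"
      if "g \<in> Weq (image_model \<phi> M)"
        "g \<cdot>\<^bsub>D\<^esub> f \<in> Weq (image_model \<phi> M)"
      using that arr sub M.two_of_three_left [OF f0(1) g0(1)]
      by (simp add: f0 g0 Comp_\<phi>_hom [OF f0(1) g0(1)] mem)
    show "g \<in> Weq (image_model \<phi> M)"
      if "f \<in> Weq (image_model \<phi> M)"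
        "g \<cdot>\<^bsub>D\<^esub> f \<in> Weq (image_model \<phi> M)"
      using that arr sub M.two_of_three_right [OF f0(1) g0(1)]
      by (simp add: f0 g0 Comp_\<phi>_hom [OF f0(1) g0(1)] mem)
  next
    fix i p
    show "has_lift D i p" if "i \<in> Cof (image_model \<phi> M)
        \<inter> Weq (image_model \<phi> M)"
      "p \<in> Fib (image_model \<phi> M)"
    proof -
      obtain i0 p0 where "i0 \<in> Cof M" "i = \<phi> i0" "i \<in> \<phi> ` Weq M" "p0 \<in> Fib M" "p = \<phi> p0"
        using \<open>i \<in> _\<close> \<open>p \<in> _\<close> by auto
      moreover from this have "i0 \<in> Weq M" "i0 \<in> Arr C" "p0 \<in> Arr C" using mem [of "Weq M" i0] sub by auto
      ultimately show ?thesis using lift_\<phi> M.lift_acyclic_Cof by simp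
    qed
    show "has_lift D i p" if "i \<in> Cof (image_model \<phi> M)"
      "p \<in> Fib (image_model \<phi> M)
        \<inter> Weq (image_model \<phi> M)"
    proof -
      obtain i0 p0 where "i0 \<in> Cof M" "i = \<phi> i0" "p \<in> \<phi> ` Weq M" "p0 \<in> Fib M" "p = \<phi> p0"
        using \<open>i \<in> _\<close> \<open>p \<in> _\<close> by auto
      moreover from this have "p0 \<in> Weq M" "i0 \<in> Arr C" "p0 \<in> Arr C" using mem [of "Weq M" p0] sub by auto
      ultimately show ?thesis using lift_\<phi> M.lift_acyclic_Fib by simp
    qed
  qed (use wide [OF M.Weq_sub] wide [OF M.Cof_sub] wide [OF M.Fib_sub]
      retract [OF _ _ sub(1) M.Weq_retract] retract [OF _ _ sub(2) M.Cof_retract]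
      retract [OF _ _ sub(3) M.Fib_retract] in simp_all)
qed

subsection \<open>Lifting properties\<close>

text \<open>An infinite universe has room for the cospan category, so that pullbacks and pushouts exist.\<close>

locale complete_model_category = model_category U C M
  for U :: "'u itself" and C :: "('o, 'm, 'x) cat_scheme" (structure) and M :: "'m model_structure" +
  assumes infinite_UNIV: "infinite (UNIV :: 'u set)"
begin

lemma model_Arr [simp]: "f \<in> Weq M \<Longrightarrow> f \<in> Arr C" "f \<in> Cof M \<Longrightarrow> f \<in> Arr C" "f \<in> Fib M \<Longrightarrow> f \<in> Arr C"
  using Weq_sub Cof_sub Fib_sub by (auto simp: wide_subcategory_def)

lemma model_Comp:
  assumes "Cod C f = Dom C g"
  shows "f \<in> Weq M \<Longrightarrow> g \<in> Weq M \<Longrightarrow> g \<cdot> f \<in> Weq M"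
    "f \<in> Cof M \<Longrightarrow> g \<in> Cof M \<Longrightarrow> g \<cdot> f \<in> Cof M"
    "f \<in> Fib M \<Longrightarrow> g \<in> Fib M \<Longrightarrow> g \<cdot> f \<in> Fib M"
  using Weq_sub Cof_sub Fib_sub assms by (auto simp: wide_subcategory_def)

lemma model_idn [simp]:
  assumes "x \<in> Obj C"
  shows "idn C x \<in> Weq M" "idn C x \<in> Cof M" "idn C x \<in> Fib M"
  using Weq_sub Cof_sub Fib_sub assms by (auto simp: wide_subcategory_def)

lemma iso_retract_of_idn:
  assumes "iso C f"
  shows "retract_of C f (idn C (Dom C f))"
  unfolding retract_of_def
  by (intro conjI bexI [of _ "idn C (Dom C f)"] bexI [of _ "inv_arr C f"] bexI [of _ f])
    (use assms in \<open>auto simp: hom_def\<close>)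

lemma model_iso:
  assumes "iso C f"
  shows "f \<in> Weq M" "f \<in> Cof M" "f \<in> Fib M"
  using iso_retract_of_idn [OF assms] Weq_retract Cof_retract Fib_retract assms by (metis Dom_in_Obj inv_simps(1) model_idn)+

lemma liftD:
  assumes "has_lift C i p" "f \<in> hom C (Dom C i) (Dom C p)" "g \<in> hom C (Cod C i) (Cod C p)" "p \<cdot> f = g \<cdot> i"
  shows "\<exists>h\<in>hom C (Cod C i) (Dom C p). h \<cdot> i = f \<and> p \<cdot> h = g"
  using assms unfolding has_lift_def by blast

text \<open>The retract argument: a lift of \<open>p \<cdot> i\<close> against \<open>p\<close> exhibits \<open>p \<cdot> i\<close> as a retract of \<open>i\<close>. With the two
  factorizations it shows that the lifting properties characterise the (acyclic) cofibrations and
  fibrations.\<close>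

lemma retract_of_left_factor:
  assumes "i \<in> Arr C" "p \<in> Arr C" "Cod C i = Dom C p" "has_lift C (p \<cdot> i) p"
  shows "retract_of C (p \<cdot> i) i"
proof -
  have "p \<cdot> i = idn C (Cod C p) \<cdot> (p \<cdot> i)" using assms by simp
  then obtain h where "h \<in> hom C (Cod C p) (Dom C p)" "h \<cdot> (p \<cdot> i) = i" "p \<cdot> h = idn C (Cod C p)"
    using liftD [OF assms(4), of i "idn C (Cod C p)"] assms(1-3) by (auto simp: hom_def)
  then show ?thesis
    unfolding retract_of_def using assms(1-3)
    by (intro conjI bexI [of _ "idn C (Dom C i)"] bexI [of _ h] bexI [of _ p]) (auto simp: hom_def)
qed

lemma retract_of_right_factor:
  assumes "i \<in> Arr C" "p \<in> Arr C" "Cod C i = Dom C p" "has_lift C i (p \<cdot> i)"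
  shows "retract_of C (p \<cdot> i) p"
proof -
  have "(p \<cdot> i) \<cdot> idn C (Dom C i) = p \<cdot> i" using assms by simp
  then obtain h where "h \<in> hom C (Cod C i) (Dom C i)" "h \<cdot> i = idn C (Dom C i)" "p \<cdot> (i \<cdot> h) = p"
    using liftD [OF assms(4), of "idn C (Dom C i)" p] assms(1-3) by (auto simp: hom_def)
  then show ?thesis
    unfolding retract_of_def using assms(1-3)
    by (intro conjI bexI [of _ i] bexI [of _ h] bexI [of _ "idn C (Cod C p)"]) (auto simp: hom_def)
qed

lemma CofI:
  assumes "f \<in> Arr C" "\<And>p. p \<in> Fib M \<Longrightarrow> p \<in> Weq M \<Longrightarrow> has_lift C f p"
  shows "f \<in> Cof M"
proof -
  obtain i p where "i \<in> Cof M" "p \<in> Fib M" "p \<in> Weq M" "Cod C i = Dom C p" "f = p \<cdot> i"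
    using factor_acyclic_Fib [OF assms(1)] by blast
  then show ?thesis using retract_of_left_factor Cof_retract assms(2) by (metis model_Arr(1,2))
qed

lemma acyclic_CofI:
  assumes "f \<in> Arr C" "\<And>p. p \<in> Fib M \<Longrightarrow> has_lift C f p"
  shows "f \<in> Cof M" "f \<in> Weq M"
proof -
  obtain i p where "i \<in> Cof M" "i \<in> Weq M" "p \<in> Fib M" "Cod C i = Dom C p" "f = p \<cdot> i"
    using factor_acyclic_Cof [OF assms(1)] by blast
  then show "f \<in> Cof M" "f \<in> Weq M"
    using retract_of_left_factor Cof_retract Weq_retract assms(2) by (metis model_Arr(1,3))+
qed

lemma FibI:
  assumes "f \<in> Arr C" "\<And>i. i \<in> Cof M \<Longrightarrow> i \<in> Weq M \<Longrightarrow> has_lift C i f"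
  shows "f \<in> Fib M"
proof -
  obtain i p where "i \<in> Cof M" "i \<in> Weq M" "p \<in> Fib M" "Cod C i = Dom C p" "f = p \<cdot> i"
    using factor_acyclic_Cof [OF assms(1)] by blast
  then show ?thesis using retract_of_right_factor Fib_retract assms(2) by (metis model_Arr(1,3))
qed

lemma acyclic_FibI:
  assumes "f \<in> Arr C" "\<And>i. i \<in> Cof M \<Longrightarrow> has_lift C i f"
  shows "f \<in> Fib M" "f \<in> Weq M"
proof -
  obtain i p where "i \<in> Cof M" "p \<in> Weq M" "p \<in> Fib M" "Cod C i = Dom C p" "f = p \<cdot> i"
    using factor_acyclic_Fib [OF assms(1)] by blast
  then show "f \<in> Fib M" "f \<in> Weq M"
    using retract_of_right_factor Fib_retract Weq_retract assms(2) by (metis model_Arr(1,2))+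
qed

lemma lift_pullback:
  assumes pb: "is_pullback C f g p s t" and lift: "has_lift C i f" and i: "i \<in> Arr C"
  shows "has_lift C i t"
  unfolding has_lift_def
proof (intro ballI impI)
  note P = pullbackD [OF pb]
  fix u v assume u: "u \<in> hom C (Dom C i) (Dom C t)" and v: "v \<in> hom C (Cod C i) (Cod C t)"
    and eq: "t \<cdot> u = v \<cdot> i"
  have "f \<cdot> (s \<cdot> u) = (f \<cdot> s) \<cdot> u" using P(1-6) u by (simp add: hom_def)
  also have "\<dots> = g \<cdot> (t \<cdot> u)" unfolding P(7) using P(1-6) u by (simp add: hom_def)
  also have "\<dots> = (g \<cdot> v) \<cdot> i" unfolding eq using P(1-6) v i by (simp add: hom_def)
  finally obtain h where h: "h \<in> hom C (Cod C i) (Dom C f)" "h \<cdot> i = s \<cdot> u" "f \<cdot> h = g \<cdot> v"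
    using liftD [OF lift, of "s \<cdot> u" "g \<cdot> v"] P(1-6) u v by (auto simp: hom_def)
  have v': "v \<in> hom C (Cod C i) (Dom C g)" using v P(6) by (simp add: hom_def)
  obtain k where k: "k \<in> hom C (Cod C i) p" "s \<cdot> k = h" "t \<cdot> k = v"
    using P(8) [OF h(1) v' h(3)] by blast
  have "k \<cdot> i = u"
  proof (rule pullback_ext [OF pb])
    show "k \<cdot> i \<in> hom C (Dom C i) p" "u \<in> hom C (Dom C i) p"
      using k(1) u i P(6) by (auto simp: hom_def)
    have "s \<cdot> (k \<cdot> i) = (s \<cdot> k) \<cdot> i" "t \<cdot> (k \<cdot> i) = (t \<cdot> k) \<cdot> i"
      using P(5,6) k(1) i by (auto simp: hom_def)
    then show "s \<cdot> (k \<cdot> i) = s \<cdot> u" "t \<cdot> (k \<cdot> i) = t \<cdot> u"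
      unfolding k(2,3) using h(2) eq by simp_all
  qed
  then show "\<exists>h\<in>hom C (Cod C i) (Dom C t). h \<cdot> i = u \<and> t \<cdot> h = v"
    using k P(6) by (auto simp: hom_def)
qed

lemma lift_pushout:
  assumes "is_pushout C f g p s t" "has_lift C f q" "f \<in> Arr C" "q \<in> Arr C"
  shows "has_lift C t q"
proof -
  show ?thesis
    unfolding has_lift_def
  proof (intro ballI impI)
    note P = pushoutD [OF assms(1)]
    fix u v assume u: "u \<in> hom C (Dom C t) (Dom C q)" and v: "v \<in> hom C (Cod C t) (Cod C q)"
      and eq: "q \<cdot> u = v \<cdot> t"
    have "q \<cdot> (u \<cdot> g) = (q \<cdot> u) \<cdot> g" using P(1-6) u assms(4) by (simp add: hom_def)
    also have "\<dots> = v \<cdot> (t \<cdot> g)" unfolding eq using P(1-6) v by (simp add: hom_def)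
    also have "\<dots> = (v \<cdot> s) \<cdot> f" unfolding P(7) [symmetric] using P(1-6) v by (simp add: hom_def)
    finally obtain h where h: "h \<in> hom C (Cod C f) (Dom C q)" "h \<cdot> f = u \<cdot> g" "q \<cdot> h = v \<cdot> s"
      using liftD [OF assms(2), of "u \<cdot> g" "v \<cdot> s"] P(1-6) u v by (auto simp: hom_def)
    have u': "u \<in> hom C (Cod C g) (Dom C q)" using u P(6) by (simp add: hom_def)
    obtain k where k: "k \<in> hom C p (Dom C q)" "k \<cdot> s = h" "k \<cdot> t = u"
      using P(8) [OF h(1) u' h(2)] by blast
    have "q \<cdot> k = v"
    proof (rule pushout_ext [OF assms(1)])
      show "q \<cdot> k \<in> hom C p (Cod C q)" "v \<in> hom C p (Cod C q)"
        using k(1) v assms(4) P(6) by (auto simp: hom_def)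
      have "(q \<cdot> k) \<cdot> s = q \<cdot> (k \<cdot> s)" "(q \<cdot> k) \<cdot> t = q \<cdot> (k \<cdot> t)"
        using P(5,6) k(1) assms(4) by (auto simp: hom_def)
      then show "(q \<cdot> k) \<cdot> s = v \<cdot> s" "(q \<cdot> k) \<cdot> t = v \<cdot> t"
        unfolding k(2,3) using h(3) eq by simp_all
    qed
    then show "\<exists>h\<in>hom C (Cod C t) (Dom C q). h \<cdot> t = u \<and> q \<cdot> h = v"
      using k P(6) by (auto simp: hom_def)
  qed
qed

lemma Fib_pullback:
  assumes "is_pullback C f g p s t" "f \<in> Fib M"
  shows "t \<in> Fib M"
  using lift_pullback [OF assms(1)] assms lift_acyclic_Cof pullbackD(6) [OF assms(1)]
  by (intro FibI) (auto simp: hom_def)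

lemma Cof_pushout:
  assumes "is_pushout C f g p s t" "f \<in> Cof M"
  shows "t \<in> Cof M"
  using lift_pushout [OF assms(1)] assms lift_acyclic_Fib pushoutD(6) [OF assms(1)]
  by (intro CofI) (auto simp: hom_def)

lemma acyclic_Cof_pushout:
  assumes "is_pushout C f g p s t" "f \<in> Cof M" "f \<in> Weq M"
  shows "t \<in> Cof M" "t \<in> Weq M"
  using lift_pushout [OF assms(1)] assms lift_acyclic_Cof pushoutD(6) [OF assms(1)]
  by (auto intro!: acyclic_CofI simp: hom_def)

lemma pullbacks: "f \<in> Arr C \<Longrightarrow> g \<in> Arr C \<Longrightarrow> Cod C f = Cod C g \<Longrightarrow> \<exists>p s t. is_pullback C f g p s t"
  using pullback_exists [OF limits infinite_UNIV] .

lemma pushouts: "f \<in> Arr C \<Longrightarrow> g \<in> Arr C \<Longrightarrow> Dom C f = Dom C g \<Longrightarrow> \<exists>p s t. is_pushout C f g p s t"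
  using category.pullback_exists [OF category_op colimits [unfolded has_small_colimits_def] infinite_UNIV]
  by (simp add: pullback_op)

lemma terminal: "\<exists>z. is_terminal C z"
  using terminal_exists [OF limits] .

lemma initial: "\<exists>z. is_initial C z"
  using category.terminal_exists [OF category_op colimits [unfolded has_small_colimits_def]]
  by (simp add: terminal_op)


subsection \<open>Cofibrant and fibrant objects\<close>

lemma cofibrant_Obj: "cofibrant C M x \<Longrightarrow> x \<in> Obj C"
  by (simp add: cofibrant_def)

lemma fibrant_Obj: "fibrant C M x \<Longrightarrow> x \<in> Obj C"
  by (simp add: fibrant_def)

lemma initial_unique: "is_initial C z \<Longrightarrow> f \<in> hom C z x \<Longrightarrow> g \<in> hom C z x \<Longrightarrow> f = g"
  using hom_Obj(2) unfolding is_initial_def by blast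

lemma terminal_unique: "is_terminal C z \<Longrightarrow> f \<in> hom C x z \<Longrightarrow> g \<in> hom C x z \<Longrightarrow> f = g"
  using hom_Obj(1) unfolding is_terminal_def by blast

lemma cofibrant_initial_Cof:
  assumes "cofibrant C M x" "is_initial C z" "f \<in> hom C z x"
  shows "f \<in> Cof M"
proof -
  obtain w g where w: "is_initial C w" "g \<in> hom C w x" "g \<in> Cof M"
    using assms(1) unfolding cofibrant_def by blast
  obtain u v where u: "u \<in> hom C z w" and v: "v \<in> hom C w z"
    using w(1) assms(2) unfolding is_initial_def by blast
  have "v \<cdot> u = idn C z" "u \<cdot> v = idn C w"
    using initial_unique [OF assms(2) Comp_in_hom [OF u v]]
      initial_unique [OF w(1) Comp_in_hom [OF v u]] hom_Obj [OF u] idn_in_hom by blast+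
  then have "iso C u" using u v by (rule_tac isoI) auto
  moreover have "f = g \<cdot> u"
    using initial_unique [OF assms(2) assms(3)] w u Comp_in_hom by blast
  ultimately show ?thesis using model_Comp(2) [of u g] model_iso(2) w u by (simp add: hom_def)
qed

lemma fibrant_terminal_Fib:
  assumes "fibrant C M x" "is_terminal C z" "f \<in> hom C x z"
  shows "f \<in> Fib M"
proof -
  obtain w g where w: "is_terminal C w" "g \<in> hom C x w" "g \<in> Fib M"
    using assms(1) unfolding fibrant_def by blast
  obtain u v where u: "u \<in> hom C w z" and v: "v \<in> hom C z w"
    using w(1) assms(2) unfolding is_terminal_def by blast
  have "v \<cdot> u = idn C w" "u \<cdot> v = idn C z"
    using terminal_unique [OF assms(2) Comp_in_hom [OF v u]]
      terminal_unique [OF w(1) Comp_in_hom [OF u v]] hom_Obj [OF u] idn_in_hom by blast+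
  then have "iso C u" using u v by (rule_tac isoI) auto
  moreover have "f = u \<cdot> g"
    using terminal_unique [OF assms(2) assms(3)] w u Comp_in_hom by blast
  ultimately show ?thesis using model_Comp(3) [of g u] model_iso(3) w u by (simp add: hom_def)
qed

lemma cofibrant_lift:
  assumes "cofibrant C M a" "q \<in> Fib M" "q \<in> Weq M" "q \<in> hom C x y" "k \<in> hom C a y"
  shows "\<exists>h\<in>hom C a x. q \<cdot> h = k"
proof -
  obtain z f where z: "is_initial C z" "f \<in> hom C z a" "f \<in> Cof M"
    using assms(1) unfolding cofibrant_def by blast
  obtain u where u: "u \<in> hom C z x"
    using z(1) hom_Obj [OF assms(4)] unfolding is_initial_def by blast
  have "q \<cdot> u = k \<cdot> f"
    using initial_unique [OF z(1)] Comp_in_hom u assms z by blast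
  then show ?thesis
    using liftD [OF lift_acyclic_Fib, of f q u k] z u assms by (auto simp: hom_def)
qed

lemma fibrant_extend:
  assumes "fibrant C M x" "j \<in> Cof M" "j \<in> Weq M" "j \<in> hom C a b" "f \<in> hom C a x"
  shows "\<exists>g\<in>hom C b x. g \<cdot> j = f"
proof -
  obtain z p where z: "is_terminal C z" "p \<in> hom C x z" "p \<in> Fib M"
    using assms(1) unfolding fibrant_def by blast
  obtain u where u: "u \<in> hom C b z"
    using z(1) hom_Obj [OF assms(4)] unfolding is_terminal_def by blast
  have "p \<cdot> f = u \<cdot> j"
    using terminal_unique [OF z(1)] Comp_in_hom u assms z by blast
  then show ?thesis
    using liftD [OF lift_acyclic_Cof, of j p f u] z u assms by (auto simp: hom_def)
qed

lemma fibrantI: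
  assumes "x \<in> Obj C"
    and "\<And>a b j f. j \<in> Cof M \<Longrightarrow> j \<in> Weq M \<Longrightarrow> j \<in> hom C a b \<Longrightarrow> f \<in> hom C a x \<Longrightarrow> \<exists>g\<in>hom C b x. g \<cdot> j = f"
  shows "fibrant C M x"
proof -
  obtain z where z: "is_terminal C z" using terminal by blast
  obtain p where p: "p \<in> hom C x z" using z assms(1) unfolding is_terminal_def by blast
  have "p \<in> Fib M"
  proof (rule FibI)
    show "p \<in> Arr C" using p by (simp add: hom_def)
    fix j assume j: "j \<in> Cof M" "j \<in> Weq M"
    show "has_lift C j p"
      unfolding has_lift_def
    proof (intro ballI impI)
      fix u v assume u: "u \<in> hom C (Dom C j) (Dom C p)" and v: "v \<in> hom C (Cod C j) (Cod C p)"
      have u': "u \<in> hom C (Dom C j) x" using u p by (simp add: hom_def)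
      obtain h where h: "h \<in> hom C (Cod C j) x" "h \<cdot> j = u"
        using assms(2) [OF j _ u'] j by (auto simp: hom_def)
      have "p \<cdot> h \<in> hom C (Cod C j) z" "v \<in> hom C (Cod C j) z"
        using h p v by (auto simp: hom_def)
      then have "p \<cdot> h = v" by (rule terminal_unique [OF z])
      then show "\<exists>h\<in>hom C (Cod C j) (Dom C p). h \<cdot> j = u \<and> p \<cdot> h = v"
        using h p by (auto simp: hom_def)
    qed
  qed
  then show ?thesis unfolding fibrant_def using z p assms(1) by blast
qed

lemma Cof_cofibrant:
  assumes "cofibrant C M a" "i \<in> Cof M" "i \<in> hom C a b"
  shows "cofibrant C M b"
proof -
  obtain z f where z: "is_initial C z" "f \<in> hom C z a" "f \<in> Cof M"
    using assms(1) unfolding cofibrant_def by blast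
  have "i \<cdot> f \<in> hom C z b" "i \<cdot> f \<in> Cof M"
    using z assms model_Comp(2) [of f i] by (auto simp: hom_def)
  then show ?thesis unfolding cofibrant_def using z(1) hom_Obj(2) by blast
qed

lemma Fib_fibrant:
  assumes "fibrant C M y" "p \<in> Fib M" "p \<in> hom C x y"
  shows "fibrant C M x"
proof -
  obtain z f where z: "is_terminal C z" "f \<in> hom C y z" "f \<in> Fib M"
    using assms(1) unfolding fibrant_def by blast
  have "f \<cdot> p \<in> hom C x z" "f \<cdot> p \<in> Fib M"
    using z assms model_Comp(3) [of p f] by (auto simp: hom_def)
  then show ?thesis unfolding fibrant_def using z(1) hom_Obj(1) by blast
qed

lemma cofibrant_replacement_exists:
  assumes "x \<in> Obj C"
  shows "\<exists>a q. cofibrant C M a \<and> q \<in> hom C a x \<and> q \<in> Fib M \<and> q \<in> Weq M"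
proof -
  obtain z where z: "is_initial C z" using initial by blast
  obtain f where f: "f \<in> hom C z x" using z assms unfolding is_initial_def by blast
  obtain i q where "i \<in> Cof M" "q \<in> Fib M" "q \<in> Weq M" "Cod C i = Dom C q" "f = q \<cdot> i"
    using factor_acyclic_Fib [of f] f by (auto simp: hom_def)
  moreover from this have "i \<in> hom C z (Dom C q)" "q \<in> hom C (Dom C q) x"
    using f by (auto simp: hom_def)
  ultimately show ?thesis unfolding cofibrant_def using z hom_Obj(2) by blast
qed

lemma fibrant_replacement_exists:
  assumes "x \<in> Obj C"
  shows "\<exists>y j. fibrant C M y \<and> j \<in> hom C x y \<and> j \<in> Cof M \<and> j \<in> Weq M"
proof -
  obtain z where z: "is_terminal C z" using terminal by blast
  obtain f where f: "f \<in> hom C x z" using z assms unfolding is_terminal_def by blast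
  obtain j p where "j \<in> Cof M" "j \<in> Weq M" "p \<in> Fib M" "Cod C j = Dom C p" "f = p \<cdot> j"
    using factor_acyclic_Cof [of f] f by (auto simp: hom_def)
  moreover from this have "j \<in> hom C x (Dom C p)" "p \<in> hom C (Dom C p) z"
    using f by (auto simp: hom_def)
  ultimately show ?thesis unfolding fibrant_def using z hom_Obj(1) by blast
qed

lemma fibrant_product:
  assumes "fibrant C M x" "fibrant C M y"
  shows "\<exists>P p1 p2. p1 \<in> hom C P x \<and> p1 \<in> Fib M \<and> p2 \<in> hom C P y \<and> p2 \<in> Fib M
    \<and> (\<forall>a. \<forall>s\<in>hom C a x. \<forall>t\<in>hom C a y. \<exists>h\<in>hom C a P. p1 \<cdot> h = s \<and> p2 \<cdot> h = t)
    \<and> (\<forall>a. \<forall>h\<in>hom C a P. \<forall>k\<in>hom C a P. p1 \<cdot> h = p1 \<cdot> k \<longrightarrow> p2 \<cdot> h = p2 \<cdot> k \<longrightarrow> h = k)"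
proof -
  obtain z where z: "is_terminal C z" using terminal by blast
  obtain u v where u: "u \<in> hom C x z" and v: "v \<in> hom C y z"
    using z assms[THEN fibrant_Obj] unfolding is_terminal_def by blast
  obtain P p1 p2 where P: "is_pullback C u v P p1 p2"
    using pullbacks [of u v] u v by (auto simp: hom_def)
  note PD = pullbackD [OF P]
  have D: "Dom C u = x" "Dom C v = y" using u v by (auto simp: hom_def)
  have "is_pullback C v u P p2 p1"
    using P unfolding is_pullback_def by (auto simp: conj_commute)
  then have "p1 \<in> Fib M" "p2 \<in> Fib M"
    using P Fib_pullback fibrant_terminal_Fib [OF _ z] assms u v by blast+
  moreover have "\<exists>h\<in>hom C a P. p1 \<cdot> h = s \<and> p2 \<cdot> h = t" if "s \<in> hom C a x" "t \<in> hom C a y" for a s t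
    using PD(8) [of s a t] that D
      terminal_unique [OF z Comp_in_hom [OF that(1) u] Comp_in_hom [OF that(2) v]] by simp
  ultimately show ?thesis
    using PD(5,6) D pullback_ext [OF P] by (intro exI [of _ P] exI [of _ p1] exI [of _ p2]) auto
qed

lemma cofibrant_coproduct:
  assumes "cofibrant C M x" "cofibrant C M y"
  shows "\<exists>P p1 p2. p1 \<in> hom C x P \<and> p1 \<in> Cof M \<and> p2 \<in> hom C y P \<and> p2 \<in> Cof M
    \<and> (\<forall>a. \<forall>s\<in>hom C x a. \<forall>t\<in>hom C y a. \<exists>h\<in>hom C P a. h \<cdot> p1 = s \<and> h \<cdot> p2 = t)
    \<and> (\<forall>a. \<forall>h\<in>hom C P a. \<forall>k\<in>hom C P a. h \<cdot> p1 = k \<cdot> p1 \<longrightarrow> h \<cdot> p2 = k \<cdot> p2 \<longrightarrow> h = k)"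
proof -
  obtain z where z: "is_initial C z" using initial by blast
  obtain u v where u: "u \<in> hom C z x" and v: "v \<in> hom C z y"
    using z assms[THEN cofibrant_Obj] unfolding is_initial_def by blast
  obtain P p1 p2 where P: "is_pushout C u v P p1 p2"
    using pushouts [of u v] u v by (auto simp: hom_def)
  note PD = pushoutD [OF P]
  have D: "Cod C u = x" "Cod C v = y" using u v by (auto simp: hom_def)
  have "p1 \<in> Cof M" "p2 \<in> Cof M"
    using P pushout_swap [OF P] Cof_pushout cofibrant_initial_Cof [OF _ z] assms u v by blast+
  moreover have "\<exists>h\<in>hom C P a. h \<cdot> p1 = s \<and> h \<cdot> p2 = t" if "s \<in> hom C x a" "t \<in> hom C y a" for a s t
    using PD(8) [of s a t] that D
      initial_unique [OF z Comp_in_hom [OF u that(1)] Comp_in_hom [OF v that(2)]] by simp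
  ultimately show ?thesis
    using PD(5,6) D pushout_ext [OF P] by (intro exI [of _ P] exI [of _ p1] exI [of _ p2]) auto
qed

text \<open>The graph \<open>(id, w) : x \<rightarrow> x \<times> y\<close> is factored into an acyclic cofibration \<open>i\<close> and a fibration \<open>(p1, p2)\<close>.
  For \<open>w = id\<close> this is a path object of \<open>x\<close>. The last clause, the lifting property of \<open>(p1, p2)\<close>, is
  expressed without the product.\<close>

lemma graph_factorization:
  assumes x: "fibrant C M x" and y: "fibrant C M y" and w: "w \<in> hom C x y"
  obtains e i p1 p2 where "i \<in> hom C x e" "i \<in> Cof M" "i \<in> Weq M"
    "p1 \<in> hom C e x" "p1 \<in> Fib M" "p1 \<in> Weq M" "p2 \<in> hom C e y" "p2 \<in> Fib M"
    "p1 \<cdot> i = idn C x" "p2 \<cdot> i = w"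
    "\<And>j a b f u v. \<lbrakk>j \<in> Cof M; j \<in> Weq M; j \<in> hom C a b; f \<in> hom C a e; u \<in> hom C b x; v \<in> hom C b y;
      p1 \<cdot> f = u \<cdot> j; p2 \<cdot> f = v \<cdot> j\<rbrakk> \<Longrightarrow>
      \<exists>k\<in>hom C b e. k \<cdot> j = f \<and> p1 \<cdot> k = u \<and> p2 \<cdot> k = v"
proof -
  obtain P p1 p2 where p: "p1 \<in> hom C P x" "p1 \<in> Fib M" "p2 \<in> hom C P y" "p2 \<in> Fib M"
    and pair: "\<And>a s t. s\<in>hom C a x \<Longrightarrow> t\<in>hom C a y \<Longrightarrow> \<exists>h\<in>hom C a P. p1 \<cdot> h = s \<and> p2 \<cdot> h = t"
    and ext: "\<And>a h k. h\<in>hom C a P \<Longrightarrow> k\<in>hom C a P \<Longrightarrow> p1 \<cdot> h = p1 \<cdot> k \<Longrightarrow> p2 \<cdot> h = p2 \<cdot> k \<Longrightarrow> h = k"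
    using fibrant_product [OF x y] by metis
  obtain g where g: "g \<in> hom C x P" "p1 \<cdot> g = idn C x" "p2 \<cdot> g = w"
    using pair [OF idn_in_hom w] fibrant_Obj [OF x] by blast
  obtain i q where i: "i \<in> Cof M" "i \<in> Weq M" and q: "q \<in> Fib M" and iq: "Cod C i = Dom C q" "g = q \<cdot> i"
    using factor_acyclic_Cof [of g] g by (auto simp: hom_def)
  define e where "e = Dom C q"
  have ih: "i \<in> hom C x e" and qh: "q \<in> hom C e P"
    using i q iq g(1) by (auto simp: hom_def e_def)
  have pq: "p1 \<cdot> q \<in> hom C e x" "p2 \<cdot> q \<in> hom C e y"
    using p qh Comp_in_hom by blast+
  have pqi: "(p1 \<cdot> q) \<cdot> i = idn C x" "(p2 \<cdot> q) \<cdot> i = w"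
    using g(2,3) p qh ih unfolding iq(2) by (auto simp: hom_def)
  have "p1 \<cdot> q \<in> Weq M"
    using two_of_three_right [OF ih pq(1) i(2)] pqi(1) fibrant_Obj [OF x] by simp
  moreover have "p1 \<cdot> q \<in> Fib M" "p2 \<cdot> q \<in> Fib M"
    using model_Comp(3) p q qh by (auto simp: hom_def)
  moreover have "\<exists>k\<in>hom C b e. k \<cdot> j = f \<and> (p1 \<cdot> q) \<cdot> k = u \<and> (p2 \<cdot> q) \<cdot> k = v"
    if j: "j \<in> Cof M" "j \<in> Weq M" "j \<in> hom C a b" and f: "f \<in> hom C a e" and u: "u \<in> hom C b x"
      and v: "v \<in> hom C b y" and eq: "(p1 \<cdot> q) \<cdot> f = u \<cdot> j" "(p2 \<cdot> q) \<cdot> f = v \<cdot> j" for j a b f u v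
  proof -
    obtain h where h: "h \<in> hom C b P" "p1 \<cdot> h = u" "p2 \<cdot> h = v" using pair [OF u v] by blast
    have "q \<cdot> f = h \<cdot> j"
    proof (rule ext)
      show "q \<cdot> f \<in> hom C a P" "h \<cdot> j \<in> hom C a P"
        using qh f h j Comp_in_hom by blast+
      show "p1 \<cdot> (q \<cdot> f) = p1 \<cdot> (h \<cdot> j)" "p2 \<cdot> (q \<cdot> f) = p2 \<cdot> (h \<cdot> j)"
        using eq Comp_assoc [OF f qh p(1)] Comp_assoc [OF f qh p(3)]
          Comp_assoc [OF j(3) h(1) p(1)] Comp_assoc [OF j(3) h(1) p(3)] h(2,3) by simp_all
    qed
    then obtain k where "k \<in> hom C b e" "k \<cdot> j = f" "q \<cdot> k = h"
      using liftD [OF lift_acyclic_Cof, of j q f h] j q f h qh by (auto simp: hom_def)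
    then show ?thesis using h p qh by (intro bexI [of _ k]) (auto simp: hom_def)
  qed
  ultimately show ?thesis using that [OF ih i pq(1) _ _ pq(2) _ pqi] by blast
qed

text \<open>Dually, \<open>(i0, i1) : a \<amalg> a \<rightarrow> z\<close> is factored into a cofibration \<open>(j0, j1)\<close> and an acyclic fibration \<open>q\<close>;
  the last clause is the lifting property of \<open>(j0, j1)\<close>.\<close>

lemma cylinder_factorization:
  assumes a: "cofibrant C M a" and i0: "i0 \<in> hom C a z" and i1: "i1 \<in> hom C a z"
  obtains c j0 j1 q where "j0 \<in> hom C a c" "j0 \<in> Cof M" "j1 \<in> hom C a c" "j1 \<in> Cof M"
    "q \<in> hom C c z" "q \<in> Fib M" "q \<in> Weq M" "q \<cdot> j0 = i0" "q \<cdot> j1 = i1"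
    "\<And>p x y u v h. \<lbrakk>p \<in> Fib M; p \<in> Weq M; p \<in> hom C x y; u \<in> hom C a x; v \<in> hom C a x; h \<in> hom C c y;
      h \<cdot> j0 = p \<cdot> u; h \<cdot> j1 = p \<cdot> v\<rbrakk> \<Longrightarrow>
      \<exists>k\<in>hom C c x. k \<cdot> j0 = u \<and> k \<cdot> j1 = v \<and> p \<cdot> k = h"
proof -
  obtain P p0 p1 where p: "p0 \<in> hom C a P" "p0 \<in> Cof M" "p1 \<in> hom C a P" "p1 \<in> Cof M"
    and pair: "\<And>b s t. s\<in>hom C a b \<Longrightarrow> t\<in>hom C a b \<Longrightarrow> \<exists>h\<in>hom C P b. h \<cdot> p0 = s \<and> h \<cdot> p1 = t"
    and ext: "\<And>b h k. h\<in>hom C P b \<Longrightarrow> k\<in>hom C P b \<Longrightarrow> h \<cdot> p0 = k \<cdot> p0 \<Longrightarrow> h \<cdot> p1 = k \<cdot> p1 \<Longrightarrow> h = k"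
    using cofibrant_coproduct [OF a a] by metis
  obtain g where g: "g \<in> hom C P z" "g \<cdot> p0 = i0" "g \<cdot> p1 = i1"
    using pair [OF i0 i1] by blast
  obtain j q where j: "j \<in> Cof M" and q: "q \<in> Fib M" "q \<in> Weq M" and jq: "Cod C j = Dom C q" "g = q \<cdot> j"
    using factor_acyclic_Fib [of g] g by (auto simp: hom_def)
  define c where "c = Dom C q"
  have jh: "j \<in> hom C P c" and qh: "q \<in> hom C c z"
    using j q jq g(1) by (auto simp: hom_def c_def)
  have jp: "j \<cdot> p0 \<in> hom C a c" "j \<cdot> p1 \<in> hom C a c"
    using p jh Comp_in_hom by blast+
  have "j \<cdot> p0 \<in> Cof M" "j \<cdot> p1 \<in> Cof M"
    using model_Comp(2) p j jh by (auto simp: hom_def)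
  moreover have "q \<cdot> (j \<cdot> p0) = i0" "q \<cdot> (j \<cdot> p1) = i1"
    using g(2,3) p qh jh unfolding jq(2) by (auto simp: hom_def)
  moreover have "\<exists>k\<in>hom C c x. k \<cdot> (j \<cdot> p0) = u \<and> k \<cdot> (j \<cdot> p1) = v \<and> r \<cdot> k = h"
    if r: "r \<in> Fib M" "r \<in> Weq M" "r \<in> hom C x y" and u: "u \<in> hom C a x" and v: "v \<in> hom C a x"
      and h: "h \<in> hom C c y" and eq: "h \<cdot> (j \<cdot> p0) = r \<cdot> u" "h \<cdot> (j \<cdot> p1) = r \<cdot> v" for r x y u v h
  proof -
    obtain f where f: "f \<in> hom C P x" "f \<cdot> p0 = u" "f \<cdot> p1 = v" using pair [OF u v] by blast
    have "r \<cdot> f = h \<cdot> j"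
    proof (rule ext)
      show "r \<cdot> f \<in> hom C P y" "h \<cdot> j \<in> hom C P y"
        using r f h jh Comp_in_hom by blast+
      show "(r \<cdot> f) \<cdot> p0 = (h \<cdot> j) \<cdot> p0" "(r \<cdot> f) \<cdot> p1 = (h \<cdot> j) \<cdot> p1"
        using eq Comp_assoc [OF p(1) f(1) r(3)] Comp_assoc [OF p(3) f(1) r(3)]
          Comp_assoc [OF p(1) jh h] Comp_assoc [OF p(3) jh h] f(2,3) by simp_all
    qed
    then obtain k where "k \<in> hom C c x" "k \<cdot> j = f" "r \<cdot> k = h"
      using liftD [OF lift_acyclic_Fib, of j r f h] j r f h jh by (auto simp: hom_def)
    moreover from this have "k \<cdot> (j \<cdot> p0) = (k \<cdot> j) \<cdot> p0" "k \<cdot> (j \<cdot> p1) = (k \<cdot> j) \<cdot> p1"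
      using Comp_assoc p jh by blast+
    ultimately show ?thesis using f by auto
  qed
  ultimately show ?thesis using that [OF jp(1) _ jp(2) _ qh q] by blast
qed

end


section \<open>The homotopy category\<close>

lemma zigzag_append: "zigzag C M x r y \<Longrightarrow> zigzag C M y s z \<Longrightarrow> zigzag C M x (r @ s) z"
  by (induction rule: zigzag.induct) (auto intro: zigzag.intros)

context category
begin

lemma zigzag_Obj: "zigzag C M x r y \<Longrightarrow> x \<in> Obj C \<and> y \<in> Obj C"
  by (induction rule: zigzag.induct) (auto dest: hom_Obj)

lemma zigzag_fwd: "f \<in> hom C x y \<Longrightarrow> zigzag C M x [Inl f] y"
  by (auto intro!: zigzag.intros dest: hom_Obj)

lemma zigzag_bwd: "w \<in> hom C x y \<Longrightarrow> w \<in> Weq M \<Longrightarrow> zigzag C M y [Inr w] x"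
  by (rule zz_bwd [of w C x y M "[]" x]) (auto intro: zz_nil dest: hom_Obj)

lemma zz_equiv_zigzag: "zz_equiv C M x y r s \<Longrightarrow> zigzag C M x r y \<and> zigzag C M x s y"
proof (induction rule: zz_equiv.induct)
  case (zze_cong a r x y s t u b)
  then show ?case
    using zigzag_append [OF zze_cong.hyps(1) zigzag_append [OF _ zze_cong.hyps(3)]] by blast
next
  case (zze_Comp f x y g z)
  then show ?case
    using zigzag_append [OF zigzag_fwd zigzag_fwd, of f x y g z M] zigzag_fwd [OF Comp_in_hom] by simp
next
  case (zze_inv_right w x y)
  then show ?case
    using zigzag_append [OF zigzag_fwd zigzag_bwd, of w x y w x M] zz_nil [of x C M] hom_Obj by simp
next
  case (zze_inv_left w x y)
  then show ?case
    using zigzag_append [OF zigzag_bwd zigzag_fwd, of w x y M w y] zz_nil [of y C M] hom_Obj by simp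
qed (auto intro: zz_nil zigzag_fwd idn_in_hom)

lemma zze_left: "zigzag C M a r x \<Longrightarrow> zz_equiv C M x y s t \<Longrightarrow> zz_equiv C M a y (r @ s) (r @ t)"
  using zze_cong [of C M a r x y s t "[]" y] zz_equiv_zigzag zigzag_Obj zz_nil by fastforce

lemma zze_right: "zz_equiv C M x y s t \<Longrightarrow> zigzag C M y u b \<Longrightarrow> zz_equiv C M x b (s @ u) (t @ u)"
  using zze_cong [of C M x "[]" x y s t u b] zz_equiv_zigzag zigzag_Obj zz_nil by fastforce

lemma zze_cancel_right:
  assumes "w \<in> hom C y z" "w \<in> Weq M" "zigzag C M x r y" "zigzag C M x s y"
    and "zz_equiv C M x z (r @ [Inl w]) (s @ [Inl w])"
  shows "zz_equiv C M x y r s"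
proof -
  have "zz_equiv C M x y (t @ [Inl w, Inr w]) t" if "zigzag C M x t y" for t
    using zze_left [OF that zze_inv_right [OF assms(1,2)]] by simp
  moreover have "zz_equiv C M x y (r @ [Inl w, Inr w]) (s @ [Inl w, Inr w])"
    using zze_right [OF assms(5) zigzag_bwd [OF assms(1,2)]] by simp
  ultimately show ?thesis using assms(3,4) by (blast intro: zze_trans zze_sym)
qed

lemma zze_cancel_left:
  assumes "w \<in> hom C x y" "w \<in> Weq M" "zigzag C M y r z" "zigzag C M y s z"
    and "zz_equiv C M x z (Inl w # r) (Inl w # s)"
  shows "zz_equiv C M y z r s"
proof -
  have "zz_equiv C M y z ([Inr w, Inl w] @ t) t" if "zigzag C M y t z" for t
    using zze_right [OF zze_inv_left [OF assms(1,2)] that] by simp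
  moreover have "zz_equiv C M y z ([Inr w, Inl w] @ r) ([Inr w, Inl w] @ s)"
    using zze_left [OF zigzag_bwd [OF assms(1,2)] assms(5)] by simp
  ultimately show ?thesis using assms(3,4) by (blast intro: zze_trans zze_sym)
qed

text \<open>In the localization, \<open>v \<cdot> f = g \<cdot> u\<close> implies \<open>f \<cdot> u\<inverse> = v\<inverse> \<cdot> g\<close>.\<close>

lemma zze_square:
  assumes "f \<in> hom C x y" "g \<in> hom C x' y'" "u \<in> hom C x x'" "u \<in> Weq M" "v \<in> hom C y y'" "v \<in> Weq M"
    and "v \<cdot>\<^bsub>C\<^esub> f = g \<cdot>\<^bsub>C\<^esub> u"
  shows "zz_equiv C M x' y [Inr u, Inl f] [Inl g, Inr v]"
proof -
  have u: "zigzag C M x' [Inr u] x" using assms by (intro zigzag_bwd)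
  have v: "zigzag C M y' [Inr v] y" using assms by (intro zigzag_bwd)
  have 1: "zz_equiv C M x' y [Inr u, Inl f, Inl v, Inr v] [Inr u, Inl f]"
    using zze_left [OF zigzag_append [OF u zigzag_fwd [OF assms(1)]] zze_inv_right [OF assms(5,6)]] by simp
  have 2: "zz_equiv C M x' y [Inr u, Inl f, Inl v, Inr v] [Inr u, Inl (g \<cdot>\<^bsub>C\<^esub> u), Inr v]"
    using zze_cong [OF u zze_Comp [OF assms(1,5)] v] assms(7) by simp
  have 3: "zz_equiv C M x' y [Inr u, Inl u, Inl g, Inr v] [Inr u, Inl (g \<cdot>\<^bsub>C\<^esub> u), Inr v]"
    using zze_cong [OF u zze_Comp [OF assms(3,2)] v] by simp
  have 4: "zz_equiv C M x' y [Inr u, Inl u, Inl g, Inr v] [Inl g, Inr v]"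
    using zze_right [OF zze_inv_left [OF assms(3,4)] zigzag_append [OF zigzag_fwd [OF assms(2)] v]] by simp
  from 1 2 3 4 show ?thesis by (blast intro: zze_trans zze_sym)
qed

lemma zze_inverse_square:
  assumes "w \<in> hom C y x" "w \<in> Weq M" "w' \<in> hom C y' x'" "w' \<in> Weq M"
    and "u \<in> hom C x x'" "u \<in> Weq M" "v \<in> hom C y y'" "v \<in> Weq M" "u \<cdot>\<^bsub>C\<^esub> w = w' \<cdot>\<^bsub>C\<^esub> v"
  shows "zz_equiv C M x' y [Inr u, Inr w] [Inr w', Inr v]"
proof (rule zze_cancel_right [OF assms(1,2)])
  have u: "zigzag C M x' [Inr u] x" and w: "zigzag C M x [Inr w] y"
    and v: "zigzag C M y' [Inr v] y" and w': "zigzag C M x' [Inr w'] y'"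
    using assms by (auto intro: zigzag_bwd)
  show "zigzag C M x' [Inr u, Inr w] y" "zigzag C M x' [Inr w', Inr v] y"
    using zigzag_append [OF u w] zigzag_append [OF w' v] by simp_all
  have 1: "zz_equiv C M x' x ([Inr u, Inr w] @ [Inl w]) [Inr u]"
    using zze_left [OF u zze_inv_left [OF assms(1,2)]] by simp
  have 2: "zz_equiv C M x' x [Inr w', Inr v, Inl w] [Inr w', Inl w', Inr u]"
    using zze_left [OF w' zze_square [OF assms(1,3) assms(7,8,5,6,9)]] by simp
  have 3: "zz_equiv C M x' x [Inr w', Inl w', Inr u] [Inr u]"
    using zze_right [OF zze_inv_left [OF assms(3,4)] u] by simp
  show "zz_equiv C M x' x ([Inr u, Inr w] @ [Inl w]) ([Inr w', Inr v] @ [Inl w])"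
    using zze_trans [OF 1 zze_sym [OF zze_trans [OF 2 3]]] by simp
qed

definition ho_eq where "ho_eq M x y f g \<longleftrightarrow> zz_equiv C M x y [Inl f] [Inl g]"

lemma ho_eq_refl: "f \<in> hom C x y \<Longrightarrow> ho_eq M x y f f"
  unfolding ho_eq_def by (intro zze_refl zigzag_fwd)

lemma ho_eq_sym: "ho_eq M x y f g \<Longrightarrow> ho_eq M x y g f"
  unfolding ho_eq_def by (rule zze_sym)

lemma ho_eq_trans: "ho_eq M x y f g \<Longrightarrow> ho_eq M x y g h \<Longrightarrow> ho_eq M x y f h"
  unfolding ho_eq_def by (rule zze_trans)

lemma ho_eq_left:
  assumes "f \<in> hom C x y" "f' \<in> hom C x y" "ho_eq M x y f f'" "g \<in> hom C y z"
  shows "ho_eq M x z (g \<cdot>\<^bsub>C\<^esub> f) (g \<cdot>\<^bsub>C\<^esub> f')"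
proof -
  have "zz_equiv C M x z [Inl f, Inl g] [Inl f', Inl g]"
    using zze_right [OF assms(3) [unfolded ho_eq_def] zigzag_fwd [OF assms(4)]] by simp
  then show ?thesis unfolding ho_eq_def
    using zze_Comp [OF assms(1,4)] zze_Comp [OF assms(2,4)] by (blast intro: zze_trans zze_sym)
qed

lemma ho_eq_right:
  assumes "f \<in> hom C y z" "f' \<in> hom C y z" "ho_eq M y z f f'" "g \<in> hom C x y"
  shows "ho_eq M x z (f \<cdot>\<^bsub>C\<^esub> g) (f' \<cdot>\<^bsub>C\<^esub> g)"
proof -
  have "zz_equiv C M x z [Inl g, Inl f] [Inl g, Inl f']"
    using zze_left [OF zigzag_fwd [OF assms(4)] assms(3) [unfolded ho_eq_def]] by simp
  then show ?thesis unfolding ho_eq_def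
    using zze_Comp [OF assms(4,1)] zze_Comp [OF assms(4,2)] by (blast intro: zze_trans zze_sym)
qed

lemma ho_eq_cancel_left:
  assumes "w \<in> hom C y z" "w \<in> Weq M" "f \<in> hom C x y" "f' \<in> hom C x y" "ho_eq M x z (w \<cdot>\<^bsub>C\<^esub> f) (w \<cdot>\<^bsub>C\<^esub> f')"
  shows "ho_eq M x y f f'"
  unfolding ho_eq_def
proof (rule zze_cancel_right [OF assms(1,2)])
  show "zz_equiv C M x z ([Inl f] @ [Inl w]) ([Inl f'] @ [Inl w])"
    using zze_trans [OF zze_trans [OF zze_Comp [OF assms(3,1)] assms(5) [unfolded ho_eq_def]]
      zze_sym [OF zze_Comp [OF assms(4,1)]]] by simp
qed (auto intro: zigzag_fwd assms)

lemma ho_eq_cancel_right: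
  assumes "w \<in> hom C x y" "w \<in> Weq M" "f \<in> hom C y z" "f' \<in> hom C y z" "ho_eq M x z (f \<cdot>\<^bsub>C\<^esub> w) (f' \<cdot>\<^bsub>C\<^esub> w)"
  shows "ho_eq M y z f f'"
  unfolding ho_eq_def
proof (rule zze_cancel_left [OF assms(1,2)])
  show "zz_equiv C M x z (Inl w # [Inl f]) (Inl w # [Inl f'])"
    using zze_trans [OF zze_trans [OF zze_Comp [OF assms(1,3)] assms(5) [unfolded ho_eq_def]]
      zze_sym [OF zze_Comp [OF assms(1,4)]]] by simp
qed (auto intro: zigzag_fwd assms)

lemma ho_class_eq:
  assumes "f \<in> hom C x y" "g \<in> hom C x y"
  shows "ho_class C M f = ho_class C M g \<longleftrightarrow> ho_eq M x y f g"
proof -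
  have *: "ho_class C M f = {r. zz_equiv C M x y [Inl f] r}" "ho_class C M g = {r. zz_equiv C M x y [Inl g] r}"
    using assms by (auto simp: ho_class_def hom_def)
  show ?thesis
    unfolding * ho_eq_def using zze_refl [OF zigzag_fwd [OF assms(2)]] by (blast intro: zze_trans zze_sym)
qed

lemma ho_homE:
  assumes "X \<in> ho_hom C M x y"
  obtains r where "zigzag C M x r y" "X = {s. zz_equiv C M x y r s}"
  using assms unfolding ho_hom_def quotient_def by auto

lemma ho_homI: "zigzag C M x r y \<Longrightarrow> {s. zz_equiv C M x y r s} \<in> ho_hom C M x y"
  unfolding ho_hom_def quotient_def by auto

lemma ho_class_hom: "f \<in> hom C x y \<Longrightarrow> ho_class C M f \<in> ho_hom C M x y"
  using ho_homI [OF zigzag_fwd, of f x y M] by (simp add: ho_class_def hom_def)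

lemma zz_class_eq:
  "zz_equiv C M x y r s \<Longrightarrow> {t. zz_equiv C M x y r t} = {t. zz_equiv C M x y s t}"
  by (blast intro: zze_trans zze_sym)

end

subsection \<open>Homotopies\<close>

context complete_model_category
begin

text \<open>A left homotopy on a cylinder \<open>z\<close> of \<open>a\<close> whose two ends \<open>i0\<close>, \<open>i1\<close> are acyclic cofibrations, while
  the map \<open>(i0, i1) : a \<amalg> a \<rightarrow> z\<close> is arbitrary. These cylinders can be glued along an end, which makes
  the relation transitive, and they are preserved by left Quillen functors.\<close>

definition homotopic :: "'m \<Rightarrow> 'm \<Rightarrow> bool" where
  "homotopic f g \<longleftrightarrow> (\<exists>a z x i0 i1 p h. i0 \<in> hom C a z \<and> i0 \<in> Cof M \<and> i0 \<in> Weq M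
    \<and> i1 \<in> hom C a z \<and> i1 \<in> Cof M \<and> i1 \<in> Weq M \<and> p \<in> hom C z a
    \<and> p \<cdot> i0 = idn C a \<and> p \<cdot> i1 = idn C a
    \<and> h \<in> hom C z x \<and> h \<cdot> i0 = f \<and> h \<cdot> i1 = g)"

lemma homotopicE:
  assumes "homotopic f g" "f \<in> hom C a x"
  obtains z i0 i1 p h where "i0 \<in> hom C a z" "i0 \<in> Cof M" "i0 \<in> Weq M"
    "i1 \<in> hom C a z" "i1 \<in> Cof M" "i1 \<in> Weq M" "p \<in> hom C z a"
    "p \<cdot> i0 = idn C a" "p \<cdot> i1 = idn C a"
    "h \<in> hom C z x" "h \<cdot> i0 = f" "h \<cdot> i1 = g" "g \<in> hom C a x"
proof -
  obtain a' z x' i0 i1 p h where *: "i0 \<in> hom C a' z" "i0 \<in> Cof M" "i0 \<in> Weq M"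
    "i1 \<in> hom C a' z" "i1 \<in> Cof M" "i1 \<in> Weq M" "p \<in> hom C z a'"
    "p \<cdot> i0 = idn C a'" "p \<cdot> i1 = idn C a'"
    "h \<in> hom C z x'" "h \<cdot> i0 = f" "h \<cdot> i1 = g"
    using assms unfolding homotopic_def by metis
  have "h \<cdot> i0 \<in> hom C a' x'" using * by (intro Comp_in_hom)
  then have [simp]: "a' = a" "x' = x" using assms(2) by (auto simp: hom_def *)
  have "h \<cdot> i1 \<in> hom C a x" using * by (auto intro: Comp_in_hom)
  then show ?thesis using that * by simp
qed

lemma homotopic_refl:
  assumes "f \<in> hom C a x"
  shows "homotopic f f"
  unfolding homotopic_def using assms hom_Obj [OF assms]
  by (intro exI [of _ a] exI [of _ x] exI [of _ "idn C a"] exI [of _ f])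
    (auto simp: hom_def)

lemma homotopic_sym: "homotopic f g \<Longrightarrow> homotopic g f"
  unfolding homotopic_def by metis

lemma homotopic_hom: "homotopic f g \<Longrightarrow> f \<in> hom C a x \<Longrightarrow> g \<in> hom C a x"
  using homotopicE by metis

lemma homotopic_left:
  assumes "homotopic f g" "f \<in> hom C a x" "k \<in> hom C x y"
  shows "homotopic (k \<cdot> f) (k \<cdot> g)"
proof -
  obtain z i0 i1 p h where *: "i0 \<in> hom C a z" "i0 \<in> Cof M" "i0 \<in> Weq M"
    "i1 \<in> hom C a z" "i1 \<in> Cof M" "i1 \<in> Weq M" "p \<in> hom C z a"
    "p \<cdot> i0 = idn C a" "p \<cdot> i1 = idn C a"
    and h: "h \<in> hom C z x" "h \<cdot> i0 = f" "h \<cdot> i1 = g"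
    using homotopicE [OF assms(1,2)] by metis
  have "k \<cdot> h \<in> hom C z y" "(k \<cdot> h) \<cdot> i0 = k \<cdot> f" "(k \<cdot> h) \<cdot> i1 = k \<cdot> g"
    using h * assms(3) Comp_in_hom Comp_assoc by metis+
  then show ?thesis unfolding homotopic_def using * by metis
qed

text \<open>The two cylinders are glued along the common end \<open>g\<close>; the ends of the result are acyclic
  cofibrations because these are stable under pushout.\<close>

lemma homotopic_trans:
  assumes "homotopic f g" "homotopic g k" "f \<in> hom C a x"
  shows "homotopic f k"
proof -
  obtain z i0 i1 p h where A: "i0 \<in> hom C a z" "i0 \<in> Cof M" "i0 \<in> Weq M"
    "i1 \<in> hom C a z" "i1 \<in> Cof M" "i1 \<in> Weq M" "p \<in> hom C z a"
    "p \<cdot> i0 = idn C a" "p \<cdot> i1 = idn C a"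
    "h \<in> hom C z x" "h \<cdot> i0 = f" "h \<cdot> i1 = g" and g: "g \<in> hom C a x"
    using homotopicE [OF assms(1,3)] by metis
  obtain z' i0' i1' p' h' where B: "i0' \<in> hom C a z'" "i0' \<in> Cof M" "i0' \<in> Weq M"
    "i1' \<in> hom C a z'" "i1' \<in> Cof M" "i1' \<in> Weq M" "p' \<in> hom C z' a"
    "p' \<cdot> i0' = idn C a" "p' \<cdot> i1' = idn C a"
    "h' \<in> hom C z' x" "h' \<cdot> i0' = g" "h' \<cdot> i1' = k"
    using homotopicE [OF assms(2) g] by metis
  obtain P s t where P: "is_pushout C i1 i0' P s t"
    using pushouts [of i1 i0'] A B by (auto simp: hom_def)
  note PD = pushoutD [OF P]
  have st: "s \<in> hom C z P" "t \<in> hom C z' P" using PD(5,6) A B by (auto simp: hom_def)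
  have t: "t \<in> Cof M" "t \<in> Weq M" using acyclic_Cof_pushout [OF P] A by auto
  have s: "s \<in> Cof M" "s \<in> Weq M" using acyclic_Cof_pushout [OF pushout_swap [OF P]] B by auto
  have D: "Cod C i1 = z" "Cod C i0' = z'" using A B by (auto simp: hom_def)
  have pp: "p \<cdot> i1 = p' \<cdot> i0'" "h \<cdot> i1 = h' \<cdot> i0'" using A B by simp_all
  obtain q where q: "q \<in> hom C P a" "q \<cdot> s = p" "q \<cdot> t = p'"
    using PD(8) [unfolded D, OF A(7) B(7) pp(1)] by blast
  obtain l where l: "l \<in> hom C P x" "l \<cdot> s = h" "l \<cdot> t = h'"
    using PD(8) [unfolded D, OF A(10) B(10) pp(2)] by blast
  have "s \<cdot> i0 \<in> hom C a P" "t \<cdot> i1' \<in> hom C a P" using A B st Comp_in_hom by blast+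
  moreover have "s \<cdot> i0 \<in> Cof M" "s \<cdot> i0 \<in> Weq M" "t \<cdot> i1' \<in> Cof M" "t \<cdot> i1' \<in> Weq M"
    using model_Comp A B s t st by (auto simp: hom_def)
  moreover have "q \<cdot> (s \<cdot> i0) = idn C a" "q \<cdot> (t \<cdot> i1') = idn C a"
    using Comp_assoc [OF A(1) st(1) q(1)] Comp_assoc [OF B(4) st(2) q(1)] q A B by simp_all
  moreover have "l \<cdot> (s \<cdot> i0) = f" "l \<cdot> (t \<cdot> i1') = k"
    using Comp_assoc [OF A(1) st(1) l(1)] Comp_assoc [OF B(4) st(2) l(1)] l A B by simp_all
  ultimately show ?thesis unfolding homotopic_def using q l by metis
qed

lemma homotopic_imp_ho_eq:
  assumes "homotopic f g" "f \<in> hom C a x"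
  shows "ho_eq M a x f g"
proof -
  obtain z i0 i1 p h where *: "i0 \<in> hom C a z" "i0 \<in> Weq M" "i1 \<in> hom C a z" "p \<in> hom C z a"
    "p \<cdot> i0 = idn C a" "p \<cdot> i1 = idn C a" "h \<in> hom C z x" "h \<cdot> i0 = f" "h \<cdot> i1 = g"
    using homotopicE [OF assms] by metis
  have "p \<in> Weq M" using two_of_three_right [OF *(1,4,2)] *(5) hom_Obj [OF *(1)] by simp
  then have "ho_eq M a z i0 i1"
    using ho_eq_cancel_left [OF *(4) _ *(1,3)] ho_eq_refl [OF idn_in_hom] *(5,6) hom_Obj [OF *(1)] by simp
  from ho_eq_left [OF *(1,3) this *(7)] * show ?thesis by simp
qed

text \<open>The homotopy between \<open>q \<cdot> u\<close> and \<open>q \<cdot> v\<close> lifts along \<open>q\<close> once its cylinder is replaced by one on which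
  the pair of ends is a cofibration.\<close>

lemma homotopic_acyclic_Fib:
  assumes a: "cofibrant C M a" and q: "q \<in> Fib M" "q \<in> Weq M" "q \<in> hom C x y"
    and u: "u \<in> hom C a x" and v: "v \<in> hom C a x" and "homotopic (q \<cdot> u) (q \<cdot> v)"
  shows "homotopic u v"
proof -
  obtain z i0 i1 p h where *: "i0 \<in> hom C a z" "i0 \<in> Cof M" "i0 \<in> Weq M"
    "i1 \<in> hom C a z" "i1 \<in> Cof M" "i1 \<in> Weq M" "p \<in> hom C z a"
    "p \<cdot> i0 = idn C a" "p \<cdot> i1 = idn C a"
    and h: "h \<in> hom C z y" "h \<cdot> i0 = q \<cdot> u" "h \<cdot> i1 = q \<cdot> v"
    using homotopicE [OF assms(7) Comp_in_hom [OF u q(3)]] by metis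
  obtain c j0 j1 r where c: "j0 \<in> hom C a c" "j0 \<in> Cof M" "j1 \<in> hom C a c" "j1 \<in> Cof M"
    "r \<in> hom C c z" "r \<in> Fib M" "r \<in> Weq M" "r \<cdot> j0 = i0" "r \<cdot> j1 = i1"
    and lift: "\<And>p x y u v h. \<lbrakk>p \<in> Fib M; p \<in> Weq M; p \<in> hom C x y; u \<in> hom C a x; v \<in> hom C a x; h \<in> hom C c y;
      h \<cdot> j0 = p \<cdot> u; h \<cdot> j1 = p \<cdot> v\<rbrakk> \<Longrightarrow>
      \<exists>k\<in>hom C c x. k \<cdot> j0 = u \<and> k \<cdot> j1 = v \<and> p \<cdot> k = h"
    using cylinder_factorization [OF a *(1,4)] by metis
  have "j0 \<in> Weq M" "j1 \<in> Weq M"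
    using two_of_three_left [OF c(1,5)] two_of_three_left [OF c(3,5)] c * by simp_all
  moreover have "p \<cdot> r \<in> hom C c a" using c * Comp_in_hom by blast
  moreover have "(p \<cdot> r) \<cdot> j0 = idn C a" "(p \<cdot> r) \<cdot> j1 = idn C a"
    using Comp_assoc [OF c(1,5) *(7)] Comp_assoc [OF c(3,5) *(7)] c * by simp_all
  moreover have "(h \<cdot> r) \<cdot> j0 = q \<cdot> u" "(h \<cdot> r) \<cdot> j1 = q \<cdot> v"
    using Comp_assoc [OF c(1,5) h(1)] Comp_assoc [OF c(3,5) h(1)] c h by simp_all
  moreover from lift [OF q u v Comp_in_hom [OF c(5) h(1)] this]
  obtain k where "k \<in> hom C c x" "k \<cdot> j0 = u" "k \<cdot> j1 = v" by blast
  ultimately show ?thesis unfolding homotopic_def using c by metis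
qed

text \<open>A weak equivalence between fibrant objects is \<open>p2 \<cdot> i\<close> with \<open>p2\<close> an acyclic fibration and \<open>i\<close> a section of
  an acyclic fibration \<open>p1\<close>. The case of acyclic fibrations therefore gives, here and in the next
  lemma, that it induces a bijection on homotopy classes of maps out of a cofibrant object.\<close>

lemma homotopic_weq_inj:
  assumes a: "cofibrant C M a" and x: "fibrant C M x" and y: "fibrant C M y"
    and w: "w \<in> hom C x y" "w \<in> Weq M"
    and u: "u \<in> hom C a x" and v: "v \<in> hom C a x" and h: "homotopic (w \<cdot> u) (w \<cdot> v)"
  shows "homotopic u v"
proof -
  obtain e i p1 p2 where i: "i \<in> hom C x e" "i \<in> Weq M"
    and p1: "p1 \<in> hom C e x" and p2: "p2 \<in> hom C e y" "p2 \<in> Fib M"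
    and eq: "p1 \<cdot> i = idn C x" "p2 \<cdot> i = w"
    using graph_factorization [OF x y w(1)] by metis
  have "p2 \<in> Weq M" using two_of_three_right [OF i(1) p2(1) i(2)] eq w by simp
  moreover have "homotopic (p2 \<cdot> (i \<cdot> u)) (p2 \<cdot> (i \<cdot> v))"
    using h Comp_assoc [OF u i(1) p2(1)] Comp_assoc [OF v i(1) p2(1)] eq by simp
  ultimately have "homotopic (i \<cdot> u) (i \<cdot> v)"
    using homotopic_acyclic_Fib [OF a p2(2) _ p2(1)] Comp_in_hom u v i by metis
  from homotopic_left [OF this Comp_in_hom [OF u i(1)] p1]
  show ?thesis
    using Comp_assoc [OF u i(1) p1] Comp_assoc [OF v i(1) p1] eq u v by (simp add: Comp_idn_left)
qed

lemma homotopic_weq_surj: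
  assumes a: "cofibrant C M a" and x: "fibrant C M x" and y: "fibrant C M y"
    and w: "w \<in> hom C x y" "w \<in> Weq M" and k: "k \<in> hom C a y"
  obtains h where "h \<in> hom C a x" "homotopic (w \<cdot> h) k"
proof -
  obtain e i p1 p2 where i: "i \<in> hom C x e" "i \<in> Weq M"
    and p1: "p1 \<in> hom C e x" "p1 \<in> Fib M" "p1 \<in> Weq M" and p2: "p2 \<in> hom C e y" "p2 \<in> Fib M"
    and eq: "p1 \<cdot> i = idn C x" "p2 \<cdot> i = w"
    using graph_factorization [OF x y w(1)] by metis
  have p2w: "p2 \<in> Weq M" using two_of_three_right [OF i(1) p2(1) i(2)] eq w by simp
  obtain l where l: "l \<in> hom C a e" "p2 \<cdot> l = k" using cofibrant_lift [OF a p2(2) p2w p2(1) k] by blast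
  define h where "h = p1 \<cdot> l"
  have h: "h \<in> hom C a x" using l p1 Comp_in_hom unfolding h_def by blast
  have ih: "i \<cdot> h \<in> hom C a e" using h i Comp_in_hom by blast
  have "p1 \<cdot> (i \<cdot> h) = p1 \<cdot> l"
    using Comp_assoc [OF h i(1) p1(1)] eq h by (simp add: Comp_idn_left) (simp add: h_def)
  then have "homotopic (i \<cdot> h) l"
    using homotopic_acyclic_Fib [OF a p1(2,3,1) ih l(1)] homotopic_refl [OF h] h_def by simp
  from homotopic_left [OF this ih p2(1)]
  have "homotopic (w \<cdot> h) k" using Comp_assoc [OF h i(1) p2(1)] eq l by simp
  then show ?thesis using that h by blast
qed

text \<open>Right homotopic maps out of a cofibrant object are left homotopic: the two projections of a
  path object are acyclic fibrations with a common section, hence inverse to the same map up to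
  left homotopy.\<close>

lemma path_homotopic:
  assumes a: "cofibrant C M a" and k: "k \<in> hom C a e" and i: "i \<in> hom C x e"
    and p1: "p1 \<in> hom C e x" "p1 \<in> Fib M" "p1 \<in> Weq M" and p2: "p2 \<in> hom C e x"
    and eq: "p1 \<cdot> i = idn C x" "p2 \<cdot> i = idn C x"
  shows "homotopic (p1 \<cdot> k) (p2 \<cdot> k)"
proof -
  have m: "p1 \<cdot> k \<in> hom C a x" using k p1 Comp_in_hom by blast
  have im: "i \<cdot> (p1 \<cdot> k) \<in> hom C a e" using m i Comp_in_hom by blast
  have e1: "p1 \<cdot> (i \<cdot> (p1 \<cdot> k)) = p1 \<cdot> k" "p2 \<cdot> (i \<cdot> (p1 \<cdot> k)) = p1 \<cdot> k"
    using Comp_assoc [OF m i p1(1)] Comp_assoc [OF m i p2] eq Comp_idn_left [OF m] by simp_all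
  have "homotopic (i \<cdot> (p1 \<cdot> k)) k"
    using homotopic_acyclic_Fib [OF a p1(2,3,1) im k] homotopic_refl [OF m] e1 by simp
  from homotopic_left [OF this im p2] show ?thesis using e1 by simp
qed

text \<open>Two extensions to \<open>b\<close> of a map defined on \<open>y\<close> are right homotopic, because the constant homotopy on \<open>y\<close>
  extends along \<open>j\<close>. Hence the choices made in a fibrant replacement do not matter up to homotopy.\<close>

lemma homotopic_extensions:
  assumes a: "cofibrant C M a" and x: "fibrant C M x" and j: "j \<in> hom C y b" "j \<in> Cof M" "j \<in> Weq M"
    and u: "u \<in> hom C b x" and v: "v \<in> hom C b x" and uv: "u \<cdot> j = v \<cdot> j" and h: "h \<in> hom C a b"
  shows "homotopic (u \<cdot> h) (v \<cdot> h)"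
proof -
  obtain e i p1 p2 where i: "i \<in> hom C x e"
    and p1: "p1 \<in> hom C e x" "p1 \<in> Fib M" "p1 \<in> Weq M" and p2: "p2 \<in> hom C e x"
    and eq: "p1 \<cdot> i = idn C x" "p2 \<cdot> i = idn C x"
    and lift: "\<And>j a b f u v. \<lbrakk>j \<in> Cof M; j \<in> Weq M; j \<in> hom C a b; f \<in> hom C a e; u \<in> hom C b x; v \<in> hom C b x;
      p1 \<cdot> f = u \<cdot> j; p2 \<cdot> f = v \<cdot> j\<rbrakk> \<Longrightarrow>
      \<exists>k\<in>hom C b e. k \<cdot> j = f \<and> p1 \<cdot> k = u \<and> p2 \<cdot> k = v"
    using graph_factorization [OF x x idn_in_hom] fibrant_Obj [OF x] by metis
  have uj: "u \<cdot> j \<in> hom C y x" using u j Comp_in_hom by blast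
  have "p1 \<cdot> (i \<cdot> (u \<cdot> j)) = u \<cdot> j" "p2 \<cdot> (i \<cdot> (u \<cdot> j)) = v \<cdot> j"
    using Comp_assoc [OF uj i p1(1)] Comp_assoc [OF uj i p2] eq Comp_idn_left [OF uj] uv by simp_all
  then obtain k where k: "k \<in> hom C b e" "p1 \<cdot> k = u" "p2 \<cdot> k = v"
    using lift [OF j(2,3,1) Comp_in_hom [OF uj i] u v] by blast
  show ?thesis
    using path_homotopic [OF a Comp_in_hom [OF h k(1)] i p1 p2 eq]
      Comp_assoc [OF h k(1) p1(1)] Comp_assoc [OF h k(1) p2] k by simp
qed

subsection \<open>Maps in the homotopy category from a cofibrant to a fibrant object\<close>

text \<open>A fibrant replacement \<open>RJ x : x \<rightarrow> RO x\<close> and an action \<open>RA\<close> on arrows. An extension along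
  \<open>RJ x\<close> is unique only up to homotopy, so \<open>RA\<close> is a functor only up to homotopy.\<close>

definition RO :: "'o \<Rightarrow> 'o" where
  "RO x = (SOME y. \<exists>j. fibrant C M y \<and> j \<in> hom C x y \<and> j \<in> Cof M \<and> j \<in> Weq M)"

definition RJ :: "'o \<Rightarrow> 'm" where
  "RJ x = (SOME j. j \<in> hom C x (RO x) \<and> j \<in> Cof M \<and> j \<in> Weq M)"

definition RA :: "'m \<Rightarrow> 'm" where
  "RA f = (SOME g. g \<in> hom C (RO (Dom C f)) (RO (Cod C f)) \<and> g \<cdot> RJ (Dom C f) = RJ (Cod C f) \<cdot> f)"

lemma RJ:
  assumes "x \<in> Obj C"
  shows "fibrant C M (RO x)" "RJ x \<in> hom C x (RO x)" "RJ x \<in> Cof M" "RJ x \<in> Weq M"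
proof -
  have *: "\<exists>j. fibrant C M (RO x) \<and> j \<in> hom C x (RO x) \<and> j \<in> Cof M \<and> j \<in> Weq M"
    unfolding RO_def using someI_ex [OF fibrant_replacement_exists [OF assms]] .
  then show "fibrant C M (RO x)" by blast
  from * have "\<exists>j. j \<in> hom C x (RO x) \<and> j \<in> Cof M \<and> j \<in> Weq M" by blast
  from someI_ex [OF this] show "RJ x \<in> hom C x (RO x)" "RJ x \<in> Cof M" "RJ x \<in> Weq M"
    unfolding RJ_def by blast+
qed

lemma RA:
  assumes "f \<in> hom C x y"
  shows "RA f \<in> hom C (RO x) (RO y)" "RA f \<cdot> RJ x = RJ y \<cdot> f" "f \<in> Weq M \<Longrightarrow> RA f \<in> Weq M"
proof -
  note x = RJ [OF hom_Obj(1) [OF assms]] and y = RJ [OF hom_Obj(2) [OF assms]]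
  have d: "Dom C f = x" "Cod C f = y" using assms by (auto simp: hom_def)
  have "\<exists>g. g \<in> hom C (RO x) (RO y) \<and> g \<cdot> RJ x = RJ y \<cdot> f"
    using fibrant_extend [OF y(1) x(3,4,2) Comp_in_hom [OF assms y(2)]] by blast
  from someI_ex [OF this] show *: "RA f \<in> hom C (RO x) (RO y)" "RA f \<cdot> RJ x = RJ y \<cdot> f"
    unfolding RA_def d by blast+
  show "f \<in> Weq M \<Longrightarrow> RA f \<in> Weq M"
    using two_of_three_right [OF x(2) *(1) x(4)] *(2) model_Comp(1) [of f "RJ y"] y assms by (auto simp: hom_def)
qed

text \<open>A zigzag from \<open>x\<close> to \<open>y\<close> induces a map from homotopy classes of maps \<open>a \<rightarrow> RO x\<close> to homotopy
  classes of maps \<open>a \<rightarrow> RO y\<close>, since weak equivalences between fibrant objects induce bijections.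
  The relation below is its graph. It depends only on the class of the zigzag, which
  is what separates classes in the localization.\<close>

fun track :: "'o \<Rightarrow> ('m + 'm) list \<Rightarrow> 'm \<Rightarrow> 'm \<Rightarrow> bool" where
  "track a [] h k \<longleftrightarrow> homotopic h k"
| "track a (Inl f # r) h k \<longleftrightarrow> (\<exists>m. homotopic (RA f \<cdot> h) m \<and> track a r m k)"
| "track a (Inr w # r) h k \<longleftrightarrow> (\<exists>m\<in>hom C a (RO (Dom C w)). homotopic (RA w \<cdot> m) h \<and> track a r m k)"

lemma track_homotopic:
  assumes "homotopic h h'" "zigzag C M x r y" "h \<in> hom C a (RO x)" "track a r h k"
  shows "track a r h' k"
  using assms(2)
proof cases
  case zz_nil
  then show ?thesis
    using assms homotopic_trans [OF homotopic_sym [OF assms(1)]] homotopic_hom [OF assms(1,3)] by simp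
next
  case (zz_fwd f z s)
  then have RAf: "RA f \<in> hom C (RO x) (RO z)" using RA by blast
  obtain m where m: "homotopic (RA f \<cdot> h) m" "track a s m k" using assms(4) zz_fwd by auto
  have "homotopic (RA f \<cdot> h') (RA f \<cdot> h)"
    using homotopic_left [OF assms(1,3) RAf] homotopic_sym by blast
  from homotopic_trans [OF this m(1) Comp_in_hom [OF homotopic_hom [OF assms(1,3)] RAf]] m
  show ?thesis using zz_fwd by auto
next
  case (zz_bwd w z s)
  then obtain m where m: "m \<in> hom C a (RO z)" "homotopic (RA w \<cdot> m) h" "track a s m k"
    using assms(4) by (auto simp: hom_def)
  have "RA w \<cdot> m \<in> hom C a (RO x)" using RA(1) zz_bwd m Comp_in_hom by blast
  from homotopic_trans [OF m(2) assms(1) this] m show ?thesis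
    using zz_bwd by (auto simp: hom_def)
qed

lemma track_append:
  assumes "zigzag C M x r y" "h \<in> hom C a (RO x)" "zigzag C M y s z"
  shows "track a (r @ s) h k \<longleftrightarrow> (\<exists>m\<in>hom C a (RO y). track a r h m \<and> track a s m k)"
  using assms
proof (induction arbitrary: h rule: zigzag.induct)
  case (zz_nil x)
  then show ?case
    using track_homotopic homotopic_refl homotopic_sym homotopic_hom by (simp) meson
next
  case (zz_fwd f x y r z')
  have "m \<in> hom C a (RO y)" if "homotopic (RA f \<cdot> h) m" for m
    using homotopic_hom [OF that Comp_in_hom [OF zz_fwd.prems(1) RA(1) [OF zz_fwd.hyps(1)]]] .
  with zz_fwd show ?case by (simp) blast
next
  case (zz_bwd w y x r z')
  then have "Dom C w = y" by (simp add: hom_def)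
  with zz_bwd show ?case by (simp) blast
qed

text \<open>The clauses defining the equivalence of zigzags hold for the induced maps on homotopy classes:
  \<open>RA\<close> is functorial up to homotopy by \<open>homotopic_extensions\<close>, and a weak equivalence acts bijectively.\<close>

lemma track_zz_equiv:
  assumes a: "cofibrant C M a" and "zz_equiv C M x y r s" "h \<in> hom C a (RO x)" "k \<in> hom C a (RO y)"
  shows "track a r h k \<longleftrightarrow> track a s h k"
  using assms(2-)
proof (induction arbitrary: h k rule: zz_equiv.induct)
  case (zze_cong a' r x y s t u b)
  have z: "zigzag C M x s y" "zigzag C M x t y" using zz_equiv_zigzag zze_cong by blast+
  have 1: "track a (r @ s' @ u) h k \<longleftrightarrow> (\<exists>m\<in>hom C a (RO x). track a r h m \<and> (\<exists>m'\<in>hom C a (RO y). track a s' m m' \<and> track a u m' k))"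
    if "zigzag C M x s' y" for s'
  proof -
    have "zigzag C M x (s' @ u) b" by (rule zigzag_append [OF that zze_cong.hyps(3)])
    then show ?thesis
      using track_append [OF zze_cong.hyps(1) zze_cong.prems(1)]
        track_append [OF that _ zze_cong.hyps(3)] by auto
  qed
  show ?case unfolding 1 [OF z(1)] 1 [OF z(2)] using zze_cong.IH by blast
next
  case (zze_idn x)
  have id: "RA (idn C x) \<in> hom C (RO x) (RO x)" "RA (idn C x) \<cdot> RJ x = RJ x \<cdot> idn C x"
    using RA idn_in_hom zze_idn by blast+
  note R = RJ [OF zze_idn.hyps]
  have "RA (idn C x) \<cdot> RJ x = idn C (RO x) \<cdot> RJ x"
    using id(2) R(2) by (simp add: hom_def)
  from homotopic_extensions [OF a R(1,2,3,4) id(1) idn_in_hom this zze_idn.prems(1)]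
  have *: "homotopic (RA (idn C x) \<cdot> h) h" 
    using Comp_idn_left [OF zze_idn.prems(1)] R(1) fibrant_Obj by simp
  have RAh: "RA (idn C x) \<cdot> h \<in> hom C a (RO x)" using id zze_idn.prems Comp_in_hom by blast
  show ?case
  proof
    assume "track a [Inl (idn C x)] h k"
    then obtain m where "homotopic (RA (idn C x) \<cdot> h) m" "homotopic m k" by auto
    then show "track a [] h k"
      using homotopic_trans [OF homotopic_trans [OF homotopic_sym [OF *]]] zze_idn.prems(1) by simp
  qed (use * in auto)
next
  case (zze_Comp f x y g z)
  note Rf = RA [OF zze_Comp.hyps(1)] and Rg = RA [OF zze_Comp.hyps(2)]
    and Rc = RA [OF Comp_in_hom [OF zze_Comp.hyps]]
  note x = RJ [OF hom_Obj(1) [OF zze_Comp.hyps(1)]] and y = RJ [OF hom_Obj(2) [OF zze_Comp.hyps(1)]]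
    and z = RJ [OF hom_Obj(2) [OF zze_Comp.hyps(2)]]
  have "(RA g \<cdot> RA f) \<cdot> RJ x = RA (g \<cdot> f) \<cdot> RJ x"
    using Comp_assoc [OF x(2) Rf(1) Rg(1)] Comp_assoc [OF zze_Comp.hyps(1) y(2) Rg(1)]
      Comp_assoc [OF zze_Comp.hyps z(2)] Rf(2) Rg(2) Rc(2) by simp
  from homotopic_extensions [OF a z(1) x(2,3,4) Comp_in_hom [OF Rf(1) Rg(1)] Rc(1) this zze_Comp.prems(1)]
  have *: "homotopic (RA g \<cdot> (RA f \<cdot> h)) (RA (g \<cdot> f) \<cdot> h)"
    using Comp_assoc [OF zze_Comp.prems(1) Rf(1) Rg(1)] by simp
  have fh: "RA f \<cdot> h \<in> hom C a (RO y)" using Rf(1) zze_Comp.prems(1) Comp_in_hom by blast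
  have gfh: "RA g \<cdot> (RA f \<cdot> h) \<in> hom C a (RO z)" using Rg(1) fh Comp_in_hom by blast
  have ch: "RA (g \<cdot> f) \<cdot> h \<in> hom C a (RO z)" using Rc(1) zze_Comp.prems(1) Comp_in_hom by blast
  show ?case
  proof
    assume "track a [Inl f, Inl g] h k"
    then obtain m m' where m: "homotopic (RA f \<cdot> h) m" "homotopic (RA g \<cdot> m) m'" "homotopic m' k" by auto
    have "homotopic (RA (g \<cdot> f) \<cdot> h) (RA g \<cdot> m)"
      by (rule homotopic_trans [OF homotopic_sym [OF *] homotopic_left [OF m(1) fh Rg(1)] ch])
    with m(2,3) show "track a [Inl (g \<cdot> f)] h k"
      using homotopic_trans [OF _ _ ch] by auto
  next
    assume "track a [Inl (g \<cdot> f)] h k"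
    then obtain m where m: "homotopic (RA (g \<cdot> f) \<cdot> h) m" "homotopic m k" by auto
    then show "track a [Inl f, Inl g] h k"
      using homotopic_trans [OF * _ gfh] homotopic_refl [OF fh] by auto
  qed
next
  case (zze_inv_right w x y)
  note Rw = RA [OF zze_inv_right.hyps(1)] and R = RJ [OF hom_Obj(1) [OF zze_inv_right.hyps(1)]]
    RJ [OF hom_Obj(2) [OF zze_inv_right.hyps(1)]]
  have D: "Dom C w = x" using zze_inv_right.hyps by (simp add: hom_def)
  have wh: "RA w \<cdot> h \<in> hom C a (RO y)" using Rw(1) zze_inv_right.prems(1) Comp_in_hom by blast
  show ?case
  proof
    assume "track a [Inl w, Inr w] h k"
    then obtain m m' where m: "homotopic (RA w \<cdot> h) m" "m' \<in> hom C a (RO x)"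
      "homotopic (RA w \<cdot> m') m" "homotopic m' k" using D by auto
    have "homotopic (RA w \<cdot> h) (RA w \<cdot> m')" using m homotopic_trans [OF _ _ wh] homotopic_sym by blast
    then have "homotopic h m'"
      using homotopic_weq_inj [OF a R(1) R(5) Rw(1)] Rw(3) zze_inv_right m(2) by blast
    then show "track a [] h k" using m(4) homotopic_trans zze_inv_right.prems(1) by auto
  next
    assume "track a [] h k"
    then show "track a [Inl w, Inr w] h k"
      using homotopic_refl [OF wh] zze_inv_right.prems(1) D by auto
  qed
next
  case (zze_inv_left w x y)
  note Rw = RA [OF zze_inv_left.hyps(1)] and R = RJ [OF hom_Obj(1) [OF zze_inv_left.hyps(1)]]
    RJ [OF hom_Obj(2) [OF zze_inv_left.hyps(1)]]
  have D: "Dom C w = x" using zze_inv_left.hyps by (simp add: hom_def)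
  show ?case
  proof
    assume "track a [Inr w, Inl w] h k"
    then obtain m m' where m: "m \<in> hom C a (RO x)" "homotopic (RA w \<cdot> m) h"
      "homotopic (RA w \<cdot> m) m'" "homotopic m' k" using D by auto
    then show "track a [] h k"
      using homotopic_trans [OF homotopic_trans [OF homotopic_sym [OF m(2)] m(3)] m(4)]
        zze_inv_left.prems(1) by simp
  next
    assume hk: "track a [] h k"
    obtain m where m: "m \<in> hom C a (RO x)" "homotopic (RA w \<cdot> m) h"
      using homotopic_weq_surj [OF a R(1) R(5) Rw(1) Rw(3) zze_inv_left.prems(1)] zze_inv_left.hyps by metis
    then show "track a [Inr w, Inl w] h k"
      using D hk by auto
  qed
qed auto

text \<open>The class of \<open>RJ a : a \<rightarrow> RO a\<close> is sent by \<open>f\<close> to the class of \<open>RJ x \<cdot> f\<close>, so the homotopy class of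
  \<open>RJ x \<cdot> f\<close>, and with it that of \<open>f\<close>, depends only on the image of \<open>f\<close> in the homotopy category.\<close>

theorem ho_eq_iff_homotopic:
  assumes a: "cofibrant C M a" and x: "fibrant C M x" and f: "f \<in> hom C a x" and g: "g \<in> hom C a x"
  shows "ho_eq M a x f g \<longleftrightarrow> homotopic f g"
proof
  assume "ho_eq M a x f g"
  then have zz: "zz_equiv C M a x [Inl f] [Inl g]" by (simp add: ho_eq_def)
  note A = RJ [OF cofibrant_Obj [OF a]] and X = RJ [OF fibrant_Obj [OF x]]
  have jg: "RJ x \<cdot> g \<in> hom C a (RO x)" and jf: "RJ x \<cdot> f \<in> hom C a (RO x)"
    using f g X Comp_in_hom by blast+
  have "track a [Inl g] (RJ a) (RJ x \<cdot> g)"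
    using RA(2) [OF g] homotopic_refl [OF jg] by auto
  then have "track a [Inl f] (RJ a) (RJ x \<cdot> g)"
    using track_zz_equiv [OF a zz A(2) jg] by simp
  then have "homotopic (RJ x \<cdot> f) (RJ x \<cdot> g)"
    using RA(2) [OF f] homotopic_trans [OF _ _ jf] by auto
  then show "homotopic f g"
    using homotopic_weq_inj [OF a x X(1,2,4) f g] by blast
qed (use homotopic_imp_ho_eq f in blast)

text \<open>The action of a zigzag on maps into fibrant replacements is composition in the homotopy category.\<close>

lemma zigzag_track:
  assumes "zigzag C M x r y" "h \<in> hom C a (RO x)" and a: "cofibrant C M a"
  shows "\<exists>k\<in>hom C a (RO y). zz_equiv C M a y ([Inl h, Inr (RJ x)] @ r) [Inl k, Inr (RJ y)]"
  using assms(1,2)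
proof (induction arbitrary: h rule: zigzag.induct)
  case (zz_nil x)
  then show ?case
    using zigzag_append [OF zigzag_fwd [OF zz_nil.prems] zigzag_bwd [OF RJ(2,4) [OF zz_nil.hyps]]]
    by (intro bexI [of _ h]) (auto intro: zze_refl)
next
  case (zz_fwd f x y r z)
  note x = RJ [OF hom_Obj(1) [OF zz_fwd.hyps(1)]] and y = RJ [OF hom_Obj(2) [OF zz_fwd.hyps(1)]]
  note Rf = RA [OF zz_fwd.hyps(1)]
  have fh: "RA f \<cdot> h \<in> hom C a (RO y)" using Comp_in_hom zz_fwd.prems Rf by blast
  obtain k where k: "k \<in> hom C a (RO z)" "zz_equiv C M a z ([Inl (RA f \<cdot> h), Inr (RJ y)] @ r) [Inl k, Inr (RJ z)]"
    using zz_fwd.IH [OF fh] by blast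
  have h: "zigzag C M a [Inl h] (RO x)" using zz_fwd.prems by (rule zigzag_fwd)
  have "zz_equiv C M a z ([Inl h] @ [Inr (RJ x), Inl f] @ r) ([Inl h] @ [Inl (RA f), Inr (RJ y)] @ r)"
    by (rule zze_cong [OF h zze_square [OF zz_fwd.hyps(1) Rf(1) x(2,4) y(2,4) Rf(2) [symmetric]] zz_fwd.hyps(2)])
  moreover have "zz_equiv C M a z ([Inl h, Inl (RA f)] @ [Inr (RJ y)] @ r) ([Inl (RA f \<cdot> h)] @ [Inr (RJ y)] @ r)"
    by (rule zze_right [OF zze_Comp [OF zz_fwd.prems Rf(1)] zigzag_append [OF zigzag_bwd [OF y(2,4)] zz_fwd.hyps(2)]])
  ultimately show ?case using k by (intro bexI [of _ k]) (auto intro: zze_trans)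
next
  case (zz_bwd w y x r z)
  note x = RJ [OF hom_Obj(2) [OF zz_bwd.hyps(1)]] and y = RJ [OF hom_Obj(1) [OF zz_bwd.hyps(1)]]
  note Rw = RA [OF zz_bwd.hyps(1)]
  obtain m where m: "m \<in> hom C a (RO y)" "homotopic (RA w \<cdot> m) h"
    using homotopic_weq_surj [OF a y(1) x(1) Rw(1) Rw(3) zz_bwd.prems] zz_bwd.hyps by metis
  obtain k where k: "k \<in> hom C a (RO z)" "zz_equiv C M a z ([Inl m, Inr (RJ y)] @ r) [Inl k, Inr (RJ z)]"
    using zz_bwd.IH [OF m(1)] by blast
  have h: "zigzag C M a [Inl h] (RO x)" using zz_bwd.prems by (rule zigzag_fwd)
  have mz: "zigzag C M a [Inl m] (RO y)" using m(1) by (rule zigzag_fwd)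
  have Rww: "RA w \<in> Weq M" using Rw(3) zz_bwd.hyps by blast
  have "zz_equiv C M a (RO x) [Inl h] [Inl m, Inl (RA w)]"
    using homotopic_imp_ho_eq [OF m(2) Comp_in_hom [OF m(1) Rw(1)]] zze_Comp [OF m(1) Rw(1)]
    unfolding ho_eq_def by (blast intro: zze_trans zze_sym)
  from zze_right [OF this zigzag_bwd [OF Rw(1) Rww]]
  have "zz_equiv C M a (RO y) [Inl h, Inr (RA w)] [Inl m, Inl (RA w), Inr (RA w)]" by simp
  moreover have "zz_equiv C M a (RO y) [Inl m, Inl (RA w), Inr (RA w)] [Inl m]"
    using zze_left [OF mz zze_inv_right [OF Rw(1) Rww]] by simp
  ultimately have *: "zz_equiv C M a (RO y) [Inl h, Inr (RA w)] [Inl m]" by (rule zze_trans)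
  have "zz_equiv C M a z ([Inl h] @ [Inr (RJ x), Inr w] @ r) ([Inl h] @ [Inr (RA w), Inr (RJ y)] @ r)"
    by (rule zze_cong [OF h zze_inverse_square zz_bwd.hyps(3)])
      (use zz_bwd.hyps Rw Rww x y in auto)
  moreover have "zz_equiv C M a z ([Inl h, Inr (RA w)] @ [Inr (RJ y)] @ r) ([Inl m] @ [Inr (RJ y)] @ r)"
    by (rule zze_right [OF * zigzag_append [OF zigzag_bwd [OF y(2,4)] zz_bwd.hyps(3)]])
  ultimately show ?case using k by (intro bexI [of _ k]) (auto intro: zze_trans)
qed

text \<open>A zigzag takes \<open>RJ a\<close> to some \<open>k : a \<rightarrow> RO x\<close>, and \<open>k\<close> factors through the weak equivalence \<open>RJ x\<close> up to
  homotopy because \<open>x\<close> is already fibrant.\<close>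

theorem zigzag_represented:
  assumes a: "cofibrant C M a" and x: "fibrant C M x" and r: "zigzag C M a r x"
  obtains f where "f \<in> hom C a x" "zz_equiv C M a x r [Inl f]"
proof -
  note A = RJ [OF cofibrant_Obj [OF a]] and X = RJ [OF fibrant_Obj [OF x]]
  obtain k where k: "k \<in> hom C a (RO x)" "zz_equiv C M a x ([Inl (RJ a), Inr (RJ a)] @ r) [Inl k, Inr (RJ x)]"
    using zigzag_track [OF r A(2) a] by blast
  have 1: "zz_equiv C M a x ([Inl (RJ a), Inr (RJ a)] @ r) r"
    using zze_right [OF zze_inv_right [OF A(2,4)] r] by simp
  obtain f where f: "f \<in> hom C a x" "homotopic (RJ x \<cdot> f) k"
    using homotopic_weq_surj [OF a x X(1,2,4) k(1)] by blast
  have "zz_equiv C M a (RO x) [Inl f, Inl (RJ x)] [Inl k]"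
    using homotopic_imp_ho_eq [OF f(2) Comp_in_hom [OF f(1) X(2)]] zze_Comp [OF f(1) X(2)]
    unfolding ho_eq_def by (blast intro: zze_trans zze_sym)
  from zze_right [OF this zigzag_bwd [OF X(2,4)]]
  have 2: "zz_equiv C M a x [Inl f, Inl (RJ x), Inr (RJ x)] [Inl k, Inr (RJ x)]" by simp
  have 3: "zz_equiv C M a x [Inl f, Inl (RJ x), Inr (RJ x)] [Inl f]"
    using zze_left [OF zigzag_fwd [OF f(1)] zze_inv_right [OF X(2,4)]] by simp
  have "zz_equiv C M a x r [Inl f]"
    using k 1 2 3 by (blast intro: zze_trans zze_sym)
  then show ?thesis using that f by blast
qed

lemma ho_eq_precomp_surj:
  assumes c: "cofibrant C M c" and v: "fibrant C M v" and d: "d \<in> hom C b c" "d \<in> Weq M" and l: "l \<in> hom C b v"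
  obtains k where "k \<in> hom C c v" "ho_eq M b v (k \<cdot> d) l"
proof -
  have z: "zigzag C M c [Inr d, Inl l] v"
    using zigzag_append [OF zigzag_bwd [OF d] zigzag_fwd [OF l]] by simp
  obtain k where k: "k \<in> hom C c v" "zz_equiv C M c v [Inr d, Inl l] [Inl k]"
    using zigzag_represented [OF c v z] by blast
  have "zz_equiv C M b v [Inl d, Inr d, Inl l] [Inl d, Inl k]"
    using zze_left [OF zigzag_fwd [OF d(1)] k(2)] by simp
  moreover have "zz_equiv C M b v [Inl d, Inr d, Inl l] [Inl l]"
    using zze_right [OF zze_inv_right [OF d] zigzag_fwd [OF l]] by simp
  ultimately have "ho_eq M b v (k \<cdot> d) l"
    using zze_Comp [OF d(1) k(1)] unfolding ho_eq_def by (blast intro: zze_trans zze_sym)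
  then show ?thesis using that k by blast
qed

text \<open>A form of the Yoneda lemma in the homotopy category, together with the fact that isomorphisms
  there come from weak equivalences. After cofibrant replacement the map factors as an acyclic
  cofibration and a fibration \<open>p\<close>; a homotopy inverse of \<open>p\<close> can be deformed into a section
  \<open>g\<close>, and then \<open>p\<close> is a retract of \<open>g \<cdot> p\<close>, which is homotopic to the identity.\<close>

theorem Weq_if_ho_bijective:
  assumes X: "fibrant C M x" and Y: "fibrant C M y" and f: "f \<in> hom C x y"
    and inj: "\<And>a g g'. cofibrant C M a \<Longrightarrow> g \<in> hom C a x \<Longrightarrow> g' \<in> hom C a x \<Longrightarrow>
      ho_eq M a y (f \<cdot> g) (f \<cdot> g') \<Longrightarrow> ho_eq M a x g g'"
    and surj: "\<And>a k. cofibrant C M a \<Longrightarrow> k \<in> hom C a y \<Longrightarrow> \<exists>g\<in>hom C a x. ho_eq M a y (f \<cdot> g) k"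
  shows "f \<in> Weq M"
proof -
  obtain x' qx where qx: "cofibrant C M x'" "qx \<in> hom C x' x" "qx \<in> Fib M" "qx \<in> Weq M"
    using cofibrant_replacement_exists [OF fibrant_Obj [OF X]] by blast
  obtain y' qy where qy: "cofibrant C M y'" "qy \<in> hom C y' y" "qy \<in> Fib M" "qy \<in> Weq M"
    using cofibrant_replacement_exists [OF fibrant_Obj [OF Y]] by blast
  have X': "fibrant C M x'" and Y': "fibrant C M y'" using Fib_fibrant X Y qx qy by blast+
  obtain f' where f': "f' \<in> hom C x' y'" "qy \<cdot> f' = f \<cdot> qx"
    using cofibrant_lift [OF qx(1) qy(3,4,2) Comp_in_hom [OF qx(2) f]] by blast
  obtain i p where i: "i \<in> Cof M" "i \<in> Weq M" and p: "p \<in> Fib M" and ip: "Cod C i = Dom C p" "f' = p \<cdot> i"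
    using factor_acyclic_Cof [of f'] f' by (auto simp: hom_def)
  define e where "e = Dom C p"
  have ih: "i \<in> hom C x' e" and ph: "p \<in> hom C e y'"
    using i p ip f'(1) by (auto simp: hom_def e_def)
  have E: "fibrant C M e" "cofibrant C M e"
    using Fib_fibrant [OF Y' p ph] Cof_cofibrant [OF qx(1) i(1) ih] by auto
  obtain r where r: "r \<in> hom C e x'" "r \<cdot> i = idn C x'"
    using fibrant_extend [OF X' i(1,2) ih idn_in_hom] fibrant_Obj [OF X'] by blast
  have rw: "r \<in> Weq M" using two_of_three_right [OF ih r(1) i(2)] r(2) fibrant_Obj [OF X'] by simp
  have ir: "i \<cdot> r \<in> hom C e e" using ih r Comp_in_hom by blast
  have "(i \<cdot> r) \<cdot> i = idn C e \<cdot> i"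
    using Comp_assoc [OF ih r(1) ih] r(2) ih by (simp add: hom_def)
  then have ir_id: "ho_eq M e e (i \<cdot> r) (idn C e)"
    using ho_eq_cancel_right [OF ih i(2) ir idn_in_hom] ho_eq_refl [OF ih] ih fibrant_Obj [OF E(1)]
    by (simp add: Comp_idn_left)
  \<comment> \<open>\<open>p\<close> is monic on endomorphisms of \<open>e\<close> in the homotopy category, as \<open>f\<close> is by assumption\<close>
  have p_inj: "ho_eq M e e u v" if u: "u \<in> hom C e e" and v: "v \<in> hom C e e" and uv: "p \<cdot> u = p \<cdot> v" for u v
  proof -
    have eq: "ho_eq M e y' (f' \<cdot> (r \<cdot> t)) (p \<cdot> t)" if t: "t \<in> hom C e e" for t
    proof -
      have "f' \<cdot> (r \<cdot> t) = p \<cdot> ((i \<cdot> r) \<cdot> t)"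
        using ih r(1) ph t unfolding ip(2) by (simp add: hom_def)
      moreover have "ho_eq M e e ((i \<cdot> r) \<cdot> t) t"
        using ho_eq_right [OF ir idn_in_hom ir_id t] t E(1) fibrant_Obj by (simp add: Comp_idn_left)
      ultimately show ?thesis
        using ho_eq_left [OF Comp_in_hom [OF t ir] t _ ph] by simp
    qed
    have ru: "r \<cdot> u \<in> hom C e x'" and rv: "r \<cdot> v \<in> hom C e x'" using r u v Comp_in_hom by blast+
    have "ho_eq M e y' (f' \<cdot> (r \<cdot> u)) (f' \<cdot> (r \<cdot> v))"
      using eq [OF u] eq [OF v] uv ho_eq_trans ho_eq_sym by metis
    from ho_eq_left [OF Comp_in_hom [OF ru f'(1)] Comp_in_hom [OF rv f'(1)] this qy(2)]
    have "ho_eq M e y (f \<cdot> (qx \<cdot> (r \<cdot> u))) (f \<cdot> (qx \<cdot> (r \<cdot> v)))"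
      using Comp_assoc [OF ru f'(1) qy(2)] Comp_assoc [OF rv f'(1) qy(2)]
        Comp_assoc [OF ru qx(2) f] Comp_assoc [OF rv qx(2) f] f'(2) by simp
    then have "ho_eq M e x (qx \<cdot> (r \<cdot> u)) (qx \<cdot> (r \<cdot> v))"
      using inj [OF E(2) Comp_in_hom [OF ru qx(2)] Comp_in_hom [OF rv qx(2)]] by blast
    then show ?thesis
      using ho_eq_cancel_left [OF r(1) rw u v] ho_eq_cancel_left [OF qx(2,4) ru rv] by blast
  qed
  obtain g0 where g0: "g0 \<in> hom C y' x" "ho_eq M y' y (f \<cdot> g0) qy" using surj [OF qy(1,2)] by blast
  obtain g1 where g1: "g1 \<in> hom C y' x'" "qx \<cdot> g1 = g0" using cofibrant_lift [OF qy(1) qx(3,4,2) g0(1)] by blast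
  \<comment> \<open>a right inverse of \<open>p\<close> up to homotopy\<close>
  define g2 where "g2 = i \<cdot> g1"
  have g2: "g2 \<in> hom C y' e" using g1 ih Comp_in_hom unfolding g2_def by blast
  have pg2: "p \<cdot> g2 \<in> hom C y' y'" using g2 ph Comp_in_hom by blast
  have "qy \<cdot> (p \<cdot> g2) = (qy \<cdot> f') \<cdot> g1"
    unfolding g2_def ip(2) using g1(1) ih ph qy(2) by (simp add: hom_def)
  also have "\<dots> = f \<cdot> g0" unfolding f'(2) using Comp_assoc [OF g1(1) qx(2) f] g1(2) by simp
  finally have "ho_eq M y' y (qy \<cdot> (p \<cdot> g2)) (qy \<cdot> idn C y')"
    using g0(2) qy(2) by (simp add: hom_def)
  then have "ho_eq M y' y' (p \<cdot> g2) (idn C y')"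
    using ho_eq_cancel_left [OF qy(2,4) pg2 idn_in_hom] fibrant_Obj [OF Y'] by blast
  then have "homotopic (p \<cdot> g2) (idn C y')"
    using ho_eq_iff_homotopic [OF qy(1) Y' pg2 idn_in_hom] fibrant_Obj [OF Y'] by blast
  then obtain z i0 i1 q h where *: "i0 \<in> hom C y' z" "i0 \<in> Cof M" "i0 \<in> Weq M" "i1 \<in> hom C y' z"
    "h \<in> hom C z y'" "h \<cdot> i0 = p \<cdot> g2" "h \<cdot> i1 = idn C y'"
    using homotopicE [OF _ pg2] by metis
  obtain K where K: "K \<in> hom C z e" "K \<cdot> i0 = g2" "p \<cdot> K = h"
    using liftD [OF lift_acyclic_Cof, of i0 p g2 h] * p ph g2 by (auto simp: hom_def)
  \<comment> \<open>the end of the lifted homotopy is a strict right inverse\<close>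
  define g where "g = K \<cdot> i1"
  have g: "g \<in> hom C y' e" "p \<cdot> g = idn C y'"
    using K * Comp_in_hom Comp_assoc [OF *(4) K(1) ph] unfolding g_def by auto
  have gp: "g \<cdot> p \<in> hom C e e" using g ph Comp_in_hom by blast
  have pgp: "p \<cdot> (g \<cdot> p) = p" using Comp_assoc [OF ph g(1) ph] g(2) ph by (simp add: hom_def)
  have "ho_eq M e e (g \<cdot> p) (idn C e)"
    using p_inj [OF gp idn_in_hom] pgp ph E(1) fibrant_Obj by (simp add: hom_def)
  then have "homotopic (g \<cdot> p) (idn C e)"
    using ho_eq_iff_homotopic [OF E(2,1) gp idn_in_hom] fibrant_Obj [OF E(1)] by blast
  then obtain z' j0 j1 q' h' where **: "j0 \<in> hom C e z'" "j0 \<in> Weq M" "j1 \<in> hom C e z'" "j1 \<in> Weq M"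
    "h' \<in> hom C z' e" "h' \<cdot> j0 = g \<cdot> p" "h' \<cdot> j1 = idn C e"
    using homotopicE [OF _ gp] by metis
  have "h' \<in> Weq M" using two_of_three_right [OF **(3,5,4)] **(7) fibrant_Obj [OF E(1)] by simp
  then have "g \<cdot> p \<in> Weq M"
    using model_Comp(1) [of j0 h'] ** by (auto simp: hom_def)
  moreover have "retract_of C p (g \<cdot> p)"
    unfolding retract_of_def using g ph gp pgp
    by (intro conjI bexI [of _ "idn C e"] bexI [of _ g] bexI [of _ p]) (auto simp: hom_def)
  ultimately have "p \<in> Weq M" by (rule Weq_retract [rotated])
  then have "qy \<cdot> f' \<in> Weq M"
    using model_Comp(1) [of i p] model_Comp(1) [of f' qy] i ip qy f'(1) by (auto simp: hom_def)
  then show ?thesis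
    using two_of_three_right [OF qx(2) f qx(4)] f'(2) by simp
qed

end


section \<open>Quillen adjunctions\<close>

text \<open>An adjunction is given by its natural bijection of hom-sets. This covers \<open>F \<stileturn> G\<close>, the
  tensor-hom adjunctions and the adjunctions \<open>x \<otimes> - \<stileturn> EHom C x -\<close> alike. Naturality of the
  bijection makes the right adjoint a functor.\<close>

locale hom_adjunction = W: category W + V: category V
  for W :: "('wo, 'wm, 'x) cat_scheme" and V :: "('vo, 'vm, 'y) cat_scheme" +
  fixes Fo :: "'wo \<Rightarrow> 'vo" and Fa :: "'wm \<Rightarrow> 'vm" and Go :: "'vo \<Rightarrow> 'wo" and Ga :: "'vm \<Rightarrow> 'wm"
    and sharp :: "'wo \<Rightarrow> 'vm \<Rightarrow> 'wm"
  assumes F_functor: "is_functor W V Fo Fa"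
    and Go_Obj: "v \<in> Obj V \<Longrightarrow> Go v \<in> Obj W"
    and Ga_hom: "g \<in> hom V v v' \<Longrightarrow> Ga g \<in> hom W (Go v) (Go v')"
    and sharp_bij: "w \<in> Obj W \<Longrightarrow> v \<in> Obj V \<Longrightarrow> bij_betw (sharp w) (hom V (Fo w) v) (hom W w (Go v))"
    and sharp_left: "w \<in> Obj W \<Longrightarrow> f \<in> hom V (Fo w) v \<Longrightarrow> g \<in> hom V v v' \<Longrightarrow>
          sharp w (g \<cdot>\<^bsub>V\<^esub> f) = Ga g \<cdot>\<^bsub>W\<^esub> sharp w f"
    and sharp_right: "h \<in> hom W w' w \<Longrightarrow> f \<in> hom V (Fo w) v \<Longrightarrow>
          sharp w' (f \<cdot>\<^bsub>V\<^esub> Fa h) = sharp w f \<cdot>\<^bsub>W\<^esub> h"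
begin

definition flat :: "'wo \<Rightarrow> 'vo \<Rightarrow> 'wm \<Rightarrow> 'vm" where
  "flat w v = inv_into (hom V (Fo w) v) (sharp w)"

lemmas Fo_Obj = functorD(1) [OF F_functor] and Fa_hom = functorD(2) [OF F_functor]
  and Fa_idn = functorD(3) [OF F_functor] and Fa_Comp = functorD(4) [OF F_functor]

lemma sharp_hom: "w \<in> Obj W \<Longrightarrow> f \<in> hom V (Fo w) v \<Longrightarrow> sharp w f \<in> hom W w (Go v)"
  using sharp_bij V.hom_Obj(2) by (metis bij_betw_apply)

lemma sharp_inject:
  "w \<in> Obj W \<Longrightarrow> f \<in> hom V (Fo w) v \<Longrightarrow> f' \<in> hom V (Fo w) v \<Longrightarrow> sharp w f = sharp w f' \<longleftrightarrow> f = f'"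
  using sharp_bij [of w v] V.hom_Obj(2) [of f "Fo w" v] by (auto simp: bij_betw_def inj_on_def)

lemma flat:
  assumes "g \<in> hom W w (Go v)" "v \<in> Obj V"
  shows "flat w v g \<in> hom V (Fo w) v" "sharp w (flat w v g) = g"
proof -
  note * = sharp_bij [OF W.hom_Obj(1) [OF assms(1)] assms(2)]
  show "flat w v g \<in> hom V (Fo w) v"
    unfolding flat_def using bij_betw_inv_into [OF *] assms(1) by (auto simp: bij_betw_def)
  show "sharp w (flat w v g) = g"
    unfolding flat_def using bij_betw_inv_into_right [OF * assms(1)] .
qed

lemma flatI:
  assumes "w \<in> Obj W" "f \<in> hom V (Fo w) v" "sharp w f = g"
  shows "flat w v g = f"
  using flat [of g w v] sharp_hom [OF assms(1,2)] sharp_inject assms V.hom_Obj(2) by metis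

lemma flat_right:
  assumes "h \<in> hom W w' w" "g \<in> hom W w (Go v)" "v \<in> Obj V"
  shows "flat w' v (g \<cdot>\<^bsub>W\<^esub> h) = flat w v g \<cdot>\<^bsub>V\<^esub> Fa h"
  by (rule flatI)
    (use flat [OF assms(2,3)] assms sharp_right W.hom_Obj in \<open>auto intro: V.Comp_in_hom [OF Fa_hom]\<close>)

lemma flat_left:
  assumes "g \<in> hom W w (Go v)" "k \<in> hom V v v'"
  shows "flat w v' (Ga k \<cdot>\<^bsub>W\<^esub> g) = k \<cdot>\<^bsub>V\<^esub> flat w v g"
proof -
  have v: "v \<in> Obj V" "w \<in> Obj W" using assms V.hom_Obj W.hom_Obj by blast+
  show ?thesis
    using flatI [OF v(2) V.Comp_in_hom [OF flat(1) [OF assms(1) v(1)] assms(2)]]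
      sharp_left [OF v(2) flat(1) [OF assms(1) v(1)] assms(2)] flat(2) [OF assms(1) v(1)] by simp
qed

lemma G_functor: "is_functor V W Go Ga"
proof -
  have eqI: "a = b" if "a \<in> hom W (Go v) (Go v')" "b \<in> hom W (Go v) (Go v')"
    "flat (Go v) v' a = flat (Go v) v' b" "v' \<in> Obj V" for a b v v'
    using that flat(2) by metis
  show ?thesis
    unfolding is_functor_def
  proof (intro conjI ballI allI)
    fix x y z f g
    show "x \<in> Obj V \<Longrightarrow> Go x \<in> Obj W" by (rule Go_Obj)
    show "f \<in> hom V x y \<Longrightarrow> Ga f \<in> hom W (Go x) (Go y)" by (rule Ga_hom)
    show "Ga (idn V x) = idn W (Go x)" if x: "x \<in> Obj V"
    proof -
      note id = W.idn_in_hom [OF Go_Obj [OF x]] and idx = V.idn_in_hom [OF x]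
      have "flat (Go x) x (Ga (idn V x) \<cdot>\<^bsub>W\<^esub> idn W (Go x)) = flat (Go x) x (idn W (Go x))"
        using flat_left [OF id idx] flat(1) [OF id x] by (simp add: V.Comp_idn_left)
      then show ?thesis
        using eqI Ga_hom [OF idx] id x by (simp add: W.Comp_idn_right)
    qed
    show "Ga (g \<cdot>\<^bsub>V\<^esub> f) = Ga g \<cdot>\<^bsub>W\<^esub> Ga f" if f: "f \<in> hom V x y" and g: "g \<in> hom V y z"
    proof -
      note id = W.idn_in_hom [OF Go_Obj [OF V.hom_Obj(1) [OF f]]]
      note gf = V.Comp_in_hom [OF f g] and Gf = Ga_hom [OF f] and Gg = Ga_hom [OF g]
      note fl = flat(1) [OF id V.hom_Obj(1) [OF f]]
      have "flat (Go x) z (Ga (g \<cdot>\<^bsub>V\<^esub> f) \<cdot>\<^bsub>W\<^esub> idn W (Go x)) = flat (Go x) z (Ga g \<cdot>\<^bsub>W\<^esub> (Ga f \<cdot>\<^bsub>W\<^esub> idn W (Go x)))"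
        using flat_left [OF id gf] flat_left [OF W.Comp_in_hom [OF id Gf] g] flat_left [OF id f]
          V.Comp_assoc [OF fl f g] by simp
      then have "Ga (g \<cdot>\<^bsub>V\<^esub> f) \<cdot>\<^bsub>W\<^esub> idn W (Go x) = Ga g \<cdot>\<^bsub>W\<^esub> (Ga f \<cdot>\<^bsub>W\<^esub> idn W (Go x))"
        using eqI [OF W.Comp_in_hom [OF id Ga_hom [OF gf]] W.Comp_in_hom [OF W.Comp_in_hom [OF id Gf] Gg]]
          V.hom_Obj(2) [OF g] by blast
      then show ?thesis
        using Ga_hom [OF gf] Gf by (simp add: W.Comp_idn_right)
    qed
  qed
qed

lemmas Ga_idn = functorD(3) [OF G_functor] and Ga_Comp = functorD(4) [OF G_functor]

lemma lift_adjoint: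
  assumes i: "i \<in> hom W a b" and p: "p \<in> hom V x y" and lift: "has_lift V (Fa i) p"
  shows "has_lift W i (Ga p)"
  unfolding has_lift_def
proof (intro ballI impI)
  note ab = W.hom_Obj [OF i] and xy = V.hom_Obj [OF p]
  note Fi = Fa_hom [OF i] and Gp = Ga_hom [OF p]
  have D: "Dom W i = a" "Cod W i = b" "Dom W (Ga p) = Go x" "Cod W (Ga p) = Go y"
    "Dom V (Fa i) = Fo a" "Cod V (Fa i) = Fo b" "Dom V p = x" "Cod V p = y"
    using i p Fi Gp by (auto simp: hom_def)
  fix u v assume "u \<in> hom W (Dom W i) (Dom W (Ga p))" "v \<in> hom W (Cod W i) (Cod W (Ga p))"
    and eq: "Ga p \<cdot>\<^bsub>W\<^esub> u = v \<cdot>\<^bsub>W\<^esub> i"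
  then have u: "u \<in> hom W a (Go x)" and v: "v \<in> hom W b (Go y)" by (simp_all add: D)
  have "p \<cdot>\<^bsub>V\<^esub> flat a x u = flat b y v \<cdot>\<^bsub>V\<^esub> Fa i"
    using flat_left [OF u p] flat_right [OF i v xy(2)] eq by simp
  then obtain h where h: "h \<in> hom V (Fo b) x" "h \<cdot>\<^bsub>V\<^esub> Fa i = flat a x u" "p \<cdot>\<^bsub>V\<^esub> h = flat b y v"
    using lift flat(1) [OF u xy(1)] flat(1) [OF v xy(2)] unfolding has_lift_def D by blast
  have "sharp b h \<cdot>\<^bsub>W\<^esub> i = u" "Ga p \<cdot>\<^bsub>W\<^esub> sharp b h = v"
    using sharp_right [OF i h(1)] sharp_left [OF ab(2) h(1) p] h flat(2) [OF u xy(1)] flat(2) [OF v xy(2)]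
    by simp_all
  then show "\<exists>h\<in>hom W (Cod W i) (Dom W (Ga p)). h \<cdot>\<^bsub>W\<^esub> i = u \<and> Ga p \<cdot>\<^bsub>W\<^esub> h = v"
    unfolding D using sharp_hom [OF ab(2) h(1)] by blast
qed

lemma pullback_adjoint:
  assumes "is_pullback V f g p s t"
  shows "is_pullback W (Ga f) (Ga g) (Go p) (Ga s) (Ga t)"
proof -
  note P = pullbackD [OF assms]
  define x y z where "x = Dom V f" and "y = Dom V g" and "z = Cod V g"
  have f: "f \<in> hom V x z" and g: "g \<in> hom V y z" and s: "s \<in> hom V p x" and t: "t \<in> hom V p y"
    using P by (auto simp: hom_def x_def y_def z_def)
  note ob = V.hom_Obj [OF f] V.hom_Obj [OF g] P(4)
  note G = Ga_hom [OF f] Ga_hom [OF g] Ga_hom [OF s] Ga_hom [OF t]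
  have D: "Dom W (Ga f) = Go x" "Dom W (Ga g) = Go y" "Cod W (Ga f) = Go z" "Cod W (Ga g) = Go z"
    using G by (auto simp: hom_def)
  show ?thesis
    unfolding is_pullback_def D
  proof (intro conjI allI ballI impI)
    show "Ga f \<in> Arr W" "Ga g \<in> Arr W" using G by (auto simp: hom_def)
    show "Ga f \<cdot>\<^bsub>W\<^esub> Ga s = Ga g \<cdot>\<^bsub>W\<^esub> Ga t"
      using Ga_Comp [OF s f] Ga_Comp [OF t g] P(7) by simp
    fix a s' t' assume s': "s' \<in> hom W a (Go x)" and t': "t' \<in> hom W a (Go y)"
      and eq: "Ga f \<cdot>\<^bsub>W\<^esub> s' = Ga g \<cdot>\<^bsub>W\<^esub> t'"
    have a: "a \<in> Obj W" using W.hom_Obj s' by blast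
    have "f \<cdot>\<^bsub>V\<^esub> flat a x s' = g \<cdot>\<^bsub>V\<^esub> flat a y t'"
      using flat_left [OF s' f] flat_left [OF t' g] eq by simp
    then obtain h where h: "h \<in> hom V (Fo a) p" "s \<cdot>\<^bsub>V\<^esub> h = flat a x s'" "t \<cdot>\<^bsub>V\<^esub> h = flat a y t'"
      using P(8) [folded x_def y_def, OF flat(1) [OF s' ob(1)] flat(1) [OF t' ob(3)]] by blast
    show "\<exists>!h. h \<in> hom W a (Go p) \<and> Ga s \<cdot>\<^bsub>W\<^esub> h = s' \<and> Ga t \<cdot>\<^bsub>W\<^esub> h = t'"
    proof (rule ex1I [of _ "sharp a h"])
      show "sharp a h \<in> hom W a (Go p) \<and> Ga s \<cdot>\<^bsub>W\<^esub> sharp a h = s' \<and> Ga t \<cdot>\<^bsub>W\<^esub> sharp a h = t'"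
        using sharp_hom [OF a h(1)] sharp_left [OF a h(1) s] sharp_left [OF a h(1) t] h
          flat(2) [OF s' ob(1)] flat(2) [OF t' ob(3)] by simp
      fix k assume k: "k \<in> hom W a (Go p) \<and> Ga s \<cdot>\<^bsub>W\<^esub> k = s' \<and> Ga t \<cdot>\<^bsub>W\<^esub> k = t'"
      then have kh: "k \<in> hom W a (Go p)" by blast
      have "flat a p k = h"
        using V.pullback_ext [OF assms flat(1) [OF kh ob(5)] h(1)] h k flat_left [OF kh s] flat_left [OF kh t]
        by simp
      then show "k = sharp a h" using flat(2) [OF kh ob(5)] by simp
    qed
  qed (use G P(4) Go_Obj in auto)
qed

lemma initial_adjoint:
  assumes "is_initial W z"
  shows "is_initial V (Fo z)"
  unfolding is_initial_def
proof (intro conjI ballI)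
  have z: "z \<in> Obj W" using assms by (simp add: is_initial_def)
  then show "Fo z \<in> Obj V" by (rule Fo_Obj)
  fix x assume x: "x \<in> Obj V"
  then have "\<exists>!f. f \<in> hom W z (Go x)" using assms Go_Obj by (simp add: is_initial_def)
  then show "\<exists>!f. f \<in> hom V (Fo z) x"
    using flat(1) [OF _ x] sharp_hom [OF z] sharp_inject [OF z] by metis
qed

end

text \<open>A left homotopy between maps into a fibrant object can be traded for a right homotopy on any path
  object with the lifting property of \<open>graph_factorization\<close>.\<close>

lemma (in complete_model_category) homotopic_path:
  assumes x: "fibrant C M x" and f: "f \<in> hom C a x" and h: "homotopic f g"
  obtains e i p1 p2 k where "i \<in> hom C x e" "p1 \<in> hom C e x" "p1 \<in> Fib M" "p1 \<in> Weq M" "p2 \<in> hom C e x"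
    "p1 \<cdot>\<^bsub>C\<^esub> i = idn C x" "p2 \<cdot>\<^bsub>C\<^esub> i = idn C x" "k \<in> hom C a e" "p1 \<cdot>\<^bsub>C\<^esub> k = f" "p2 \<cdot>\<^bsub>C\<^esub> k = g"
proof -
  obtain e i p1 p2 where i: "i \<in> hom C x e"
    and p1: "p1 \<in> hom C e x" "p1 \<in> Fib M" "p1 \<in> Weq M" and p2: "p2 \<in> hom C e x"
    and eq: "p1 \<cdot>\<^bsub>C\<^esub> i = idn C x" "p2 \<cdot>\<^bsub>C\<^esub> i = idn C x"
    and lift: "\<And>j a b f u v. \<lbrakk>j \<in> Cof M; j \<in> Weq M; j \<in> hom C a b; f \<in> hom C a e; u \<in> hom C b x; v \<in> hom C b x;
      p1 \<cdot>\<^bsub>C\<^esub> f = u \<cdot>\<^bsub>C\<^esub> j; p2 \<cdot>\<^bsub>C\<^esub> f = v \<cdot>\<^bsub>C\<^esub> j\<rbrakk> \<Longrightarrow>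
      \<exists>k\<in>hom C b e. k \<cdot>\<^bsub>C\<^esub> j = f \<and> p1 \<cdot>\<^bsub>C\<^esub> k = u \<and> p2 \<cdot>\<^bsub>C\<^esub> k = v"
    using graph_factorization [OF x x idn_in_hom] fibrant_Obj [OF x] by metis
  obtain z i0 i1 p h where *: "i0 \<in> hom C a z" "i0 \<in> Cof M" "i0 \<in> Weq M"
    "i1 \<in> hom C a z" "p \<in> hom C z a" "p \<cdot>\<^bsub>C\<^esub> i0 = idn C a" "p \<cdot>\<^bsub>C\<^esub> i1 = idn C a"
    and h: "h \<in> hom C z x" "h \<cdot>\<^bsub>C\<^esub> i0 = f" "h \<cdot>\<^bsub>C\<^esub> i1 = g"
    using homotopicE [OF h f] by metis
  have "p1 \<cdot>\<^bsub>C\<^esub> (i \<cdot>\<^bsub>C\<^esub> f) = (f \<cdot>\<^bsub>C\<^esub> p) \<cdot>\<^bsub>C\<^esub> i0" "p2 \<cdot>\<^bsub>C\<^esub> (i \<cdot>\<^bsub>C\<^esub> f) = h \<cdot>\<^bsub>C\<^esub> i0"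
    using Comp_assoc [OF f i p1(1)] Comp_assoc [OF f i p2] eq Comp_idn_left [OF f] Comp_idn_right [OF f]
      Comp_assoc [OF *(1,5) f] *(6) h by simp_all
  then obtain K where K: "K \<in> hom C z e" "p1 \<cdot>\<^bsub>C\<^esub> K = f \<cdot>\<^bsub>C\<^esub> p" "p2 \<cdot>\<^bsub>C\<^esub> K = h"
    using lift [OF *(2,3,1) Comp_in_hom [OF f i] Comp_in_hom [OF *(5) f] h(1)] by blast
  have "p1 \<cdot>\<^bsub>C\<^esub> (K \<cdot>\<^bsub>C\<^esub> i1) = f" "p2 \<cdot>\<^bsub>C\<^esub> (K \<cdot>\<^bsub>C\<^esub> i1) = g"
    using Comp_assoc [OF *(4) K(1) p1(1)] Comp_assoc [OF *(4) K(1) p2] K h Comp_assoc [OF *(4,5) f] *(7)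
      Comp_idn_right [OF f] by simp_all
  then show ?thesis
    using that [OF i p1 p2 eq Comp_in_hom [OF *(4) K(1)]] by blast
qed

locale quillen_adjunction = hom_adjunction W V Fo Fa Go Ga sharp
  + W: complete_model_category U W MW + V: complete_model_category U V MV
  for U :: "'u itself" and W :: "('wo, 'wm, 'x) cat_scheme" and MW
    and V :: "('vo, 'vm, 'y) cat_scheme" and MV and Fo Fa Go Ga sharp +
  assumes Fa_Cof: "i \<in> Cof MW \<Longrightarrow> Fa i \<in> Cof MV"
    and Fa_acyclic_Cof: "i \<in> Cof MW \<Longrightarrow> i \<in> Weq MW \<Longrightarrow> Fa i \<in> Weq MV"
begin

lemma Ga_Fib:
  assumes "p \<in> Fib MV"
  shows "Ga p \<in> Fib MW"
proof (rule W.FibI)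
  have p: "p \<in> hom V (Dom V p) (Cod V p)" using assms by (simp add: hom_def)
  then show "Ga p \<in> Arr W" using Ga_hom by (auto simp: hom_def)
  fix i assume "i \<in> Cof MW" "i \<in> Weq MW"
  then show "has_lift W i (Ga p)"
    using lift_adjoint [OF _ p V.lift_acyclic_Cof] assms Fa_Cof Fa_acyclic_Cof by (auto simp: hom_def)
qed

lemma Ga_acyclic_Fib:
  assumes "p \<in> Fib MV" "p \<in> Weq MV"
  shows "Ga p \<in> Weq MW"
proof (rule W.acyclic_FibI)
  have p: "p \<in> hom V (Dom V p) (Cod V p)" using assms by (simp add: hom_def)
  then show "Ga p \<in> Arr W" using Ga_hom by (auto simp: hom_def)
  fix i assume "i \<in> Cof MW"
  then show "has_lift W i (Ga p)"
    using lift_adjoint [OF _ p V.lift_acyclic_Fib] assms Fa_Cof by (auto simp: hom_def)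
qed

lemma Go_fibrant:
  assumes "fibrant V MV x"
  shows "fibrant W MW (Go x)"
proof (rule W.fibrantI)
  have x: "x \<in> Obj V" using assms by (rule V.fibrant_Obj)
  then show "Go x \<in> Obj W" by (rule Go_Obj)
  fix a b j f assume j: "j \<in> Cof MW" "j \<in> Weq MW" "j \<in> hom W a b" and f: "f \<in> hom W a (Go x)"
  obtain g where g: "g \<in> hom V (Fo b) x" "g \<cdot>\<^bsub>V\<^esub> Fa j = flat a x f"
    using V.fibrant_extend [OF assms Fa_Cof [OF j(1)] Fa_acyclic_Cof [OF j(1,2)] Fa_hom [OF j(3)] flat(1) [OF f x]]
    by blast
  have "sharp b g \<cdot>\<^bsub>W\<^esub> j = f"
    using sharp_right [OF j(3) g(1)] g(2) flat(2) [OF f x] by simp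
  then show "\<exists>g\<in>hom W b (Go x). g \<cdot>\<^bsub>W\<^esub> j = f"
    using sharp_hom [OF W.hom_Obj(2) [OF j(3)] g(1)] by blast
qed

lemma Fo_cofibrant:
  assumes "cofibrant W MW a"
  shows "cofibrant V MV (Fo a)"
  using assms initial_adjoint Fa_Cof Fa_hom Fo_Obj unfolding cofibrant_def by blast

text \<open>Ken Brown's lemma for the right adjoint: a weak equivalence between fibrant objects is an acyclic
  fibration after a section of an acyclic fibration, and \<open>G\<close> preserves both.\<close>

lemma Ga_Weq_fibrant:
  assumes x: "fibrant V MV x" and y: "fibrant V MV y" and w: "w \<in> hom V x y" "w \<in> Weq MV"
  shows "Ga w \<in> Weq MW"
proof -
  obtain e i p1 p2 where i: "i \<in> hom V x e" "i \<in> Weq MV"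
    and p1: "p1 \<in> hom V e x" "p1 \<in> Fib MV" "p1 \<in> Weq MV" and p2: "p2 \<in> hom V e y" "p2 \<in> Fib MV"
    and eq: "p1 \<cdot>\<^bsub>V\<^esub> i = idn V x" "p2 \<cdot>\<^bsub>V\<^esub> i = w"
    using V.graph_factorization [OF x y w(1)] by metis
  have "p2 \<in> Weq MV" using V.two_of_three_right [OF i(1) p2(1) i(2)] eq w by simp
  then have Gp: "Ga p1 \<in> Weq MW" "Ga p2 \<in> Weq MW" using Ga_acyclic_Fib p1 p2 by blast+
  have "Ga p1 \<cdot>\<^bsub>W\<^esub> Ga i = idn W (Go x)"
    using Ga_Comp [OF i(1) p1(1)] eq Ga_idn V.fibrant_Obj [OF x] by simp
  then have "Ga i \<in> Weq MW"
    using W.two_of_three_left [OF Ga_hom [OF i(1)] Ga_hom [OF p1(1)] Gp(1)] Go_Obj V.fibrant_Obj [OF x] by simp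
  moreover have "Ga w = Ga p2 \<cdot>\<^bsub>W\<^esub> Ga i" using Ga_Comp [OF i(1) p2(1)] eq by simp
  ultimately show ?thesis
    using W.model_Comp(1) [of "Ga i" "Ga p2"] Gp Ga_hom [OF i(1)] Ga_hom [OF p2(1)] by (simp add: hom_def)
qed

text \<open>The hom-set bijection respects homotopy in both directions: \<open>G\<close> preserves path objects of
  fibrant objects, and \<open>F\<close> preserves cylinders whose ends are acyclic cofibrations.\<close>

lemma sharp_ho_eq:
  assumes a: "cofibrant W MW a" and x: "fibrant V MV x"
    and f: "f \<in> hom V (Fo a) x" and g: "g \<in> hom V (Fo a) x"
  shows "W.ho_eq MW a (Go x) (sharp a f) (sharp a g) \<longleftrightarrow> V.ho_eq MV (Fo a) x f g"
proof -
  have a0: "a \<in> Obj W" and x0: "x \<in> Obj V" using a x W.cofibrant_Obj V.fibrant_Obj by blast+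
  note sf = sharp_hom [OF a0 f] and sg = sharp_hom [OF a0 g]
  have "W.homotopic (sharp a f) (sharp a g) \<longleftrightarrow> V.homotopic f g"
  proof
    assume "V.homotopic f g"
    from V.homotopic_path [OF x f this] obtain e i p1 p2 k where
      i: "i \<in> hom V x e" and p1: "p1 \<in> hom V e x" "p1 \<in> Fib MV" "p1 \<in> Weq MV" and p2: "p2 \<in> hom V e x"
      and eq: "p1 \<cdot>\<^bsub>V\<^esub> i = idn V x" "p2 \<cdot>\<^bsub>V\<^esub> i = idn V x"
      and k: "k \<in> hom V (Fo a) e" "p1 \<cdot>\<^bsub>V\<^esub> k = f" "p2 \<cdot>\<^bsub>V\<^esub> k = g" by metis
    have "Ga p1 \<cdot>\<^bsub>W\<^esub> Ga i = idn W (Go x)" "Ga p2 \<cdot>\<^bsub>W\<^esub> Ga i = idn W (Go x)"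
      using Ga_Comp [OF i p1(1)] Ga_Comp [OF i p2] eq Ga_idn [OF x0] by simp_all
    from W.path_homotopic [OF a sharp_hom [OF a0 k(1)] Ga_hom [OF i] Ga_hom [OF p1(1)] Ga_Fib [OF p1(2)]
        Ga_acyclic_Fib [OF p1(2,3)] Ga_hom [OF p2] this]
    show "W.homotopic (sharp a f) (sharp a g)"
      using sharp_left [OF a0 k(1) p1(1)] sharp_left [OF a0 k(1) p2] k by simp
  next
    assume "W.homotopic (sharp a f) (sharp a g)"
    from W.homotopicE [OF this sf] obtain z i0 i1 p h where
      *: "i0 \<in> hom W a z" "i0 \<in> Cof MW" "i0 \<in> Weq MW"
      "i1 \<in> hom W a z" "i1 \<in> Cof MW" "i1 \<in> Weq MW" "p \<in> hom W z a"
      "p \<cdot>\<^bsub>W\<^esub> i0 = idn W a" "p \<cdot>\<^bsub>W\<^esub> i1 = idn W a"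
      "h \<in> hom W z (Go x)" "h \<cdot>\<^bsub>W\<^esub> i0 = sharp a f" "h \<cdot>\<^bsub>W\<^esub> i1 = sharp a g" by metis
    have "Fa p \<cdot>\<^bsub>V\<^esub> Fa i0 = idn V (Fo a)" "Fa p \<cdot>\<^bsub>V\<^esub> Fa i1 = idn V (Fo a)"
      using Fa_Comp [OF *(1,7)] Fa_Comp [OF *(4,7)] * Fa_idn [OF a0] by simp_all
    moreover have "flat z x h \<cdot>\<^bsub>V\<^esub> Fa i0 = f" "flat z x h \<cdot>\<^bsub>V\<^esub> Fa i1 = g"
      using flat_right [OF *(1,10) x0] flat_right [OF *(4,10) x0] * flatI [OF a0 f] flatI [OF a0 g] by simp_all
    ultimately show "V.homotopic f g"
      unfolding V.homotopic_def using Fa_hom [OF *(1)] Fa_hom [OF *(4)] Fa_hom [OF *(7)] flat(1) [OF *(10) x0]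
        Fa_Cof Fa_acyclic_Cof * by metis
  qed
  then show ?thesis
    using W.ho_eq_iff_homotopic [OF a Go_fibrant [OF x] sf sg]
      V.ho_eq_iff_homotopic [OF Fo_cofibrant [OF a] x f g] by simp
qed

text \<open>Let \<open>q : Q \<rightarrow> I\<close> be a cofibrant replacement and \<open>r : F Q \<rightarrow> B\<close> a weak equivalence. Then
  \<open>[B, x] \<cong> [F Q, x] \<cong> [Q, G x] \<cong> [I, G x]\<close>, and this bijection is computed by any \<open>\<Phi>\<close> that is
  compatible with \<open>q\<close>, \<open>r\<close> and the adjunction.\<close>

context
  fixes Q I q B r x \<Phi>
  assumes Q: "cofibrant W MW Q" and q: "q \<in> hom W Q I" "q \<in> Weq MW"
    and r: "r \<in> hom V (Fo Q) B" "r \<in> Weq MV" and x: "fibrant V MV x"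
    and \<Phi>: "\<And>f. f \<in> hom V B x \<Longrightarrow> \<Phi> f \<in> hom W I (Go x)"
    and \<Phi>_q: "\<And>f. f \<in> hom V B x \<Longrightarrow> sharp Q (f \<cdot>\<^bsub>V\<^esub> r) = \<Phi> f \<cdot>\<^bsub>W\<^esub> q"
begin

lemma derived_hom_inj:
  assumes f: "f \<in> hom V B x" and g: "g \<in> hom V B x"
  shows "W.ho_eq MW I (Go x) (\<Phi> f) (\<Phi> g) \<longleftrightarrow> V.ho_eq MV B x f g"
proof -
  note fr = V.Comp_in_hom [OF r(1) f] and gr = V.Comp_in_hom [OF r(1) g]
  have "W.ho_eq MW I (Go x) (\<Phi> f) (\<Phi> g) \<longleftrightarrow> W.ho_eq MW Q (Go x) (\<Phi> f \<cdot>\<^bsub>W\<^esub> q) (\<Phi> g \<cdot>\<^bsub>W\<^esub> q)"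
    using W.ho_eq_cancel_right [OF q \<Phi> [OF f] \<Phi> [OF g]] W.ho_eq_right [OF \<Phi> [OF f] \<Phi> [OF g] _ q(1)] by blast
  also have "\<dots> \<longleftrightarrow> V.ho_eq MV (Fo Q) x (f \<cdot>\<^bsub>V\<^esub> r) (g \<cdot>\<^bsub>V\<^esub> r)"
    using sharp_ho_eq [OF Q x fr gr] \<Phi>_q f g by simp
  also have "\<dots> \<longleftrightarrow> V.ho_eq MV B x f g"
    using V.ho_eq_cancel_right [OF r f g] V.ho_eq_right [OF f g _ r(1)] by blast
  finally show ?thesis .
qed

lemma derived_hom_surj:
  assumes rep: "\<And>s. zigzag V MV B s x \<Longrightarrow> \<exists>f\<in>hom V B x. zz_equiv V MV B x s [Inl f]"
    and s: "zigzag W MW I s (Go x)"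
  shows "\<exists>f\<in>hom V B x. zz_equiv W MW I (Go x) s [Inl (\<Phi> f)]"
proof -
  have x0: "x \<in> Obj V" using x by (rule V.fibrant_Obj)
  have "zigzag W MW Q ([Inl q] @ s) (Go x)"
    by (rule zigzag_append [OF W.zigzag_fwd [OF q(1)] s])
  then obtain g where g: "g \<in> hom W Q (Go x)" "zz_equiv W MW Q (Go x) ([Inl q] @ s) [Inl g]"
    using W.zigzag_represented [OF Q Go_fibrant [OF x]] by metis
  note g' = flat [OF g(1) x0]
  have "zigzag V MV B [Inr r, Inl (flat Q x g)] x"
    using zigzag_append [OF V.zigzag_bwd [OF r] V.zigzag_fwd [OF g'(1)]] by simp
  then obtain f where f: "f \<in> hom V B x" "zz_equiv V MV B x [Inr r, Inl (flat Q x g)] [Inl f]"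
    using rep by metis
  have "zz_equiv V MV (Fo Q) x [Inl r, Inr r, Inl (flat Q x g)] [Inl r, Inl f]"
    using V.zze_left [OF V.zigzag_fwd [OF r(1)] f(2)] by simp
  moreover have "zz_equiv V MV (Fo Q) x [Inl r, Inr r, Inl (flat Q x g)] [Inl (flat Q x g)]"
    using V.zze_right [OF zze_inv_right [OF r] V.zigzag_fwd [OF g'(1)]] by simp
  ultimately have "V.ho_eq MV (Fo Q) x (f \<cdot>\<^bsub>V\<^esub> r) (flat Q x g)"
    using zze_Comp [OF r(1) f(1)] unfolding V.ho_eq_def by (blast intro: zze_trans zze_sym)
  then have "W.ho_eq MW Q (Go x) (\<Phi> f \<cdot>\<^bsub>W\<^esub> q) g"
    using sharp_ho_eq [OF Q x V.Comp_in_hom [OF r(1) f(1)] g'(1)] \<Phi>_q [OF f(1)] g'(2) by simp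
  then have "zz_equiv W MW Q (Go x) (Inl q # s) (Inl q # [Inl (\<Phi> f)])"
    using g(2) zze_Comp [OF q(1) \<Phi> [OF f(1)]] unfolding W.ho_eq_def by (simp) (metis zze_trans zze_sym)
  then have "zz_equiv W MW I (Go x) s [Inl (\<Phi> f)]"
    using W.zze_cancel_left [OF q s W.zigzag_fwd [OF \<Phi> [OF f(1)]]] by blast
  then show ?thesis using f by blast
qed

end

end

subsection \<open>Comparing sets of maps in two homotopy categories\<close>

text \<open>If every class in \<open>[x, y]\<close> is represented by an arrow, a map out of \<open>[x, y]\<close> amounts to a map
  \<open>\<Phi>\<close> on arrows that respects homotopy classes.\<close>

lemma ho_hom_bijection:
  assumes "category C" "category D"
    and rep: "\<forall>r. zigzag C MC x r y \<longrightarrow> (\<exists>f\<in>hom C x y. zz_equiv C MC x y r [Inl f])"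
    and "\<forall>f\<in>hom C x y. \<Phi> f \<in> hom D x' y'"
  shows "(\<exists>\<kappa>. (\<forall>f\<in>hom C x y. \<kappa> (ho_class C MC f) = ho_class D MD (\<Phi> f))
      \<and> bij_betw \<kappa> (ho_hom C MC x y) (ho_hom D MD x' y')) \<longleftrightarrow>
    (\<forall>f\<in>hom C x y. \<forall>g\<in>hom C x y. category.ho_eq D MD x' y' (\<Phi> f) (\<Phi> g) \<longleftrightarrow> category.ho_eq C MC x y f g)
    \<and> (\<forall>r. zigzag D MD x' r y' \<longrightarrow> (\<exists>f\<in>hom C x y. zz_equiv D MD x' y' r [Inl (\<Phi> f)]))"
    (is "(\<exists>\<kappa>. ?P \<kappa>) \<longleftrightarrow> ?inj \<and> ?surj")
proof -
  interpret C: category C by fact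
  interpret D: category D by fact
  have \<Phi>: "\<Phi> f \<in> hom D x' y'" if "f \<in> hom C x y" for f using assms(4) that by blast
  have C_hom: "ho_hom C MC x y = ho_class C MC ` hom C x y"
  proof (intro equalityI subsetI)
    fix X assume "X \<in> ho_hom C MC x y"
    then obtain r where r: "zigzag C MC x r y" "X = {s. zz_equiv C MC x y r s}" by (rule C.ho_homE)
    then obtain f where f: "f \<in> hom C x y" "zz_equiv C MC x y r [Inl f]" using rep by blast
    then have "X = ho_class C MC f"
      using r C.zz_class_eq [OF f(2)] by (simp add: ho_class_def hom_def)
    then show "X \<in> ho_class C MC ` hom C x y" using f by blast
  qed (auto intro: C.ho_class_hom)
  show ?thesis
  proof
    assume "\<exists>\<kappa>. ?P \<kappa>"
    then obtain \<kappa> where \<kappa>: "\<And>f. f \<in> hom C x y \<Longrightarrow> \<kappa> (ho_class C MC f) = ho_class D MD (\<Phi> f)"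
      and bij: "bij_betw \<kappa> (ho_hom C MC x y) (ho_hom D MD x' y')" by blast
    show "?inj \<and> ?surj"
    proof (intro conjI ballI allI impI)
      fix f g assume f: "f \<in> hom C x y" and g: "g \<in> hom C x y"
      have "ho_class D MD (\<Phi> f) = ho_class D MD (\<Phi> g) \<longleftrightarrow> ho_class C MC f = ho_class C MC g"
        using bij \<kappa> [OF f] \<kappa> [OF g] C.ho_class_hom [OF f] C.ho_class_hom [OF g] unfolding bij_betw_def
        by (metis inj_on_def)
      then show "D.ho_eq MD x' y' (\<Phi> f) (\<Phi> g) \<longleftrightarrow> C.ho_eq MC x y f g"
        by (simp add: D.ho_class_eq [OF \<Phi> [OF f] \<Phi> [OF g]] C.ho_class_eq [OF f g])
    next
      fix r assume r: "zigzag D MD x' r y'"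
      from D.ho_homI [OF this] obtain X where "X \<in> ho_hom C MC x y" "\<kappa> X = {s. zz_equiv D MD x' y' r s}"
        using bij unfolding bij_betw_def by (metis imageE)
      then obtain f where f: "f \<in> hom C x y" "ho_class D MD (\<Phi> f) = {s. zz_equiv D MD x' y' r s}"
        using C_hom \<kappa> by auto
      have "[Inl (\<Phi> f)] \<in> ho_class D MD (\<Phi> f)"
        using \<Phi> [OF f(1)] zze_refl [OF D.zigzag_fwd [OF \<Phi> [OF f(1)]]] by (simp add: ho_class_def hom_def)
      then show "\<exists>f\<in>hom C x y. zz_equiv D MD x' y' r [Inl (\<Phi> f)]" using f by auto
    qed
  next
    assume *: "?inj \<and> ?surj"
    have cls: "ho_class D MD (\<Phi> f) = ho_class D MD (\<Phi> g) \<longleftrightarrow> ho_class C MC f = ho_class C MC g"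
      if f: "f \<in> hom C x y" and g: "g \<in> hom C x y" for f g
      using * f g by (simp add: D.ho_class_eq [OF \<Phi> [OF f] \<Phi> [OF g]] C.ho_class_eq [OF f g])
    define \<kappa> where "\<kappa> X = ho_class D MD (\<Phi> (SOME f. f \<in> hom C x y \<and> ho_class C MC f = X))" for X
    have \<kappa>: "\<kappa> (ho_class C MC f) = ho_class D MD (\<Phi> f)" if f: "f \<in> hom C x y" for f
    proof -
      let ?g = "SOME g. g \<in> hom C x y \<and> ho_class C MC g = ho_class C MC f"
      have "?g \<in> hom C x y \<and> ho_class C MC ?g = ho_class C MC f"
        by (rule someI [of _ f]) (use f in blast)
      then show ?thesis unfolding \<kappa>_def using cls f by blast
    qed
    moreover have "bij_betw \<kappa> (ho_hom C MC x y) (ho_hom D MD x' y')"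
      unfolding bij_betw_def
    proof (intro conjI equalityI subsetI)
      show "inj_on \<kappa> (ho_hom C MC x y)"
        unfolding C_hom using \<kappa> cls by (auto simp: inj_on_def)
      show "X \<in> ho_hom D MD x' y'" if "X \<in> \<kappa> ` ho_hom C MC x y" for X
        using that \<kappa> \<Phi> D.ho_class_hom unfolding C_hom by auto
      show "X \<in> \<kappa> ` ho_hom C MC x y" if "X \<in> ho_hom D MD x' y'" for X
      proof -
        from that obtain r where r: "zigzag D MD x' r y'" "X = {s. zz_equiv D MD x' y' r s}"
          by (rule D.ho_homE)
        then obtain f where f: "f \<in> hom C x y" "zz_equiv D MD x' y' r [Inl (\<Phi> f)]" using * by blast
        then have "X = ho_class D MD (\<Phi> f)"
          using r D.zz_class_eq [OF f(2)] \<Phi> [OF f(1)] by (simp add: ho_class_def hom_def)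
        then show ?thesis using \<kappa> [OF f(1)] f unfolding C_hom by auto
      qed
    qed
    ultimately show "\<exists>\<kappa>. ?P \<kappa>" by blast
  qed
qed


lemma (in category) iso_epic_hom:
  assumes "iso C f" "f \<in> hom C x y" "g \<in> hom C y z" "h \<in> hom C y z" "g \<cdot>\<^bsub>C\<^esub> f = h \<cdot>\<^bsub>C\<^esub> f"
  shows "g = h"
  using iso_epic [OF assms(1,5)] assms(2-4) by (auto simp: hom_def)

section \<open>Symmetric monoidal closed categories\<close>

context symmetric_monoidal_closed
begin

declare munit_Obj [simp]

lemmas tens_Obj [simp] = bifunctorD(1) [OF tens_bifunctor]
lemmas tens_hom = bifunctorD(2) [OF tens_bifunctor]
lemmas tens_idn [simp] = bifunctorD(3) [OF tens_bifunctor]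
lemmas tens_simps [simp] = bifunctor_simps [OF tens_bifunctor]

lemma tens_Comp_extend [simp]:
  assumes "f \<in> Arr V" "g \<in> Arr V" "f' \<in> Arr V" "g' \<in> Arr V" "Dom V f' = Cod V f" "Dom V g' = Cod V g"
    "k \<in> Arr V" "Cod V k = Dom V f \<otimes>\<^bsub>V\<^esub> Dom V g"
  shows "(f' \<odot>\<^bsub>V\<^esub> g') \<cdot>\<^bsub>V\<^esub> (f \<odot>\<^bsub>V\<^esub> g) \<cdot>\<^bsub>V\<^esub> k = ((f' \<cdot>\<^bsub>V\<^esub> f) \<odot>\<^bsub>V\<^esub> (g' \<cdot>\<^bsub>V\<^esub> g)) \<cdot>\<^bsub>V\<^esub> k"
  by (rule Comp_extend) (use assms in auto)

lemma assoc_simps [simp]: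
  assumes "x \<in> Obj V" "y \<in> Obj V" "z \<in> Obj V"
  shows "assoc V x y z \<in> Arr V" "Dom V (assoc V x y z) = (x \<otimes>\<^bsub>V\<^esub> y) \<otimes>\<^bsub>V\<^esub> z"
    "Cod V (assoc V x y z) = x \<otimes>\<^bsub>V\<^esub> (y \<otimes>\<^bsub>V\<^esub> z)" "iso V (assoc V x y z)"
  using assoc_hom [OF assms] by (auto simp: hom_def)

lemma lunit_simps [simp]:
  assumes "x \<in> Obj V"
  shows "lunit V x \<in> Arr V" "Dom V (lunit V x) = \<one>\<^bsub>V\<^esub> \<otimes>\<^bsub>V\<^esub> x" "Cod V (lunit V x) = x" "iso V (lunit V x)"
  using lunit_hom [OF assms] by (auto simp: hom_def)

lemma runit_simps [simp]:
  assumes "x \<in> Obj V"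
  shows "runit V x \<in> Arr V" "Dom V (runit V x) = x \<otimes>\<^bsub>V\<^esub> \<one>\<^bsub>V\<^esub>" "Cod V (runit V x) = x" "iso V (runit V x)"
  using runit_hom [OF assms] by (auto simp: hom_def)

lemma braid_simps [simp]:
  assumes "x \<in> Obj V" "y \<in> Obj V"
  shows "braid V x y \<in> Arr V" "Dom V (braid V x y) = x \<otimes>\<^bsub>V\<^esub> y" "Cod V (braid V x y) = y \<otimes>\<^bsub>V\<^esub> x"
  using braid_hom [OF assms] by (auto simp: hom_def)

lemma ev_simps [simp]:
  assumes "x \<in> Obj V" "z \<in> Obj V"
  shows "ihom V x z \<in> Obj V" "ev V x z \<in> Arr V" "Dom V (ev V x z) = ihom V x z \<otimes>\<^bsub>V\<^esub> x" "Cod V (ev V x z) = z"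
  using ev_hom [OF assms] by (auto simp: hom_def)

lemma iso_tens:
  assumes "iso V f" "iso V g"
  shows "iso V (f \<odot>\<^bsub>V\<^esub> g)"
  by (rule isoI [of _ "Dom V f \<otimes>\<^bsub>V\<^esub> Dom V g" "Cod V f \<otimes>\<^bsub>V\<^esub> Cod V g" "inv_arr V f \<odot>\<^bsub>V\<^esub> inv_arr V g"])
    (use assms in \<open>auto simp: hom_def\<close>)

lemma unit_tens_faithful:
  assumes "f \<in> hom V x y" "g \<in> hom V x y" "idn V \<one>\<^bsub>V\<^esub> \<odot>\<^bsub>V\<^esub> f = idn V \<one>\<^bsub>V\<^esub> \<odot>\<^bsub>V\<^esub> g"
  shows "f = g"
proof -
  have "f \<cdot>\<^bsub>V\<^esub> lunit V x = g \<cdot>\<^bsub>V\<^esub> lunit V x"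
    using lunit_natural [OF assms(1)] lunit_natural [OF assms(2)] assms(3) by simp
  then show ?thesis
    using iso_epic [of "lunit V x" f g] assms hom_Obj [OF assms(1)] by (auto simp: hom_def)
qed

lemma tens_unit_faithful:
  assumes "f \<in> hom V x y" "g \<in> hom V x y" "f \<odot>\<^bsub>V\<^esub> idn V \<one>\<^bsub>V\<^esub> = g \<odot>\<^bsub>V\<^esub> idn V \<one>\<^bsub>V\<^esub>"
  shows "f = g"
proof -
  have "f \<cdot>\<^bsub>V\<^esub> runit V x = g \<cdot>\<^bsub>V\<^esub> runit V x"
    using runit_natural [OF assms(1)] runit_natural [OF assms(2)] assms(3) by simp
  then show ?thesis
    using iso_epic [of "runit V x" f g] assms hom_Obj [OF assms(1)] by (auto simp: hom_def)
qed

text \<open>Kelly's redundancy: the pentagon and the triangle determine the left unit constraint on a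
  tensor product, and hence identify the two unit constraints on the unit object.\<close>

lemma lunit_tens:
  assumes x: "x \<in> Obj V" and y: "y \<in> Obj V"
  shows "lunit V (x \<otimes>\<^bsub>V\<^esub> y) \<cdot>\<^bsub>V\<^esub> assoc V \<one>\<^bsub>V\<^esub> x y = lunit V x \<odot>\<^bsub>V\<^esub> idn V y"
proof (rule unit_tens_faithful)
  show "lunit V (x \<otimes>\<^bsub>V\<^esub> y) \<cdot>\<^bsub>V\<^esub> assoc V \<one>\<^bsub>V\<^esub> x y \<in> hom V ((\<one>\<^bsub>V\<^esub> \<otimes>\<^bsub>V\<^esub> x) \<otimes>\<^bsub>V\<^esub> y) (x \<otimes>\<^bsub>V\<^esub> y)"
    "lunit V x \<odot>\<^bsub>V\<^esub> idn V y \<in> hom V ((\<one>\<^bsub>V\<^esub> \<otimes>\<^bsub>V\<^esub> x) \<otimes>\<^bsub>V\<^esub> y) (x \<otimes>\<^bsub>V\<^esub> y)"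
    using x y by (auto simp: hom_def)
  let ?I = "\<one>\<^bsub>V\<^esub>"
  define b where "b = assoc V ?I (?I \<otimes>\<^bsub>V\<^esub> x) y \<cdot>\<^bsub>V\<^esub> (assoc V ?I ?I x \<odot>\<^bsub>V\<^esub> idn V y)"
  have b: "iso V b" "b \<in> Arr V" "Cod V b = ?I \<otimes>\<^bsub>V\<^esub> ((?I \<otimes>\<^bsub>V\<^esub> x) \<otimes>\<^bsub>V\<^esub> y)"
    "Dom V b = ((?I \<otimes>\<^bsub>V\<^esub> ?I) \<otimes>\<^bsub>V\<^esub> x) \<otimes>\<^bsub>V\<^esub> y"
    unfolding b_def using x y by (auto intro!: iso_Comp iso_tens)
  have "(idn V ?I \<odot>\<^bsub>V\<^esub> lunit V (x \<otimes>\<^bsub>V\<^esub> y)) \<cdot>\<^bsub>V\<^esub> ((idn V ?I \<odot>\<^bsub>V\<^esub> assoc V ?I x y) \<cdot>\<^bsub>V\<^esub> b)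
      = (idn V ?I \<odot>\<^bsub>V\<^esub> lunit V (x \<otimes>\<^bsub>V\<^esub> y)) \<cdot>\<^bsub>V\<^esub> (assoc V ?I ?I (x \<otimes>\<^bsub>V\<^esub> y) \<cdot>\<^bsub>V\<^esub> assoc V (?I \<otimes>\<^bsub>V\<^esub> ?I) x y)"
    unfolding b_def using pentagon [of ?I ?I x y] x y by simp
  also have "\<dots> = (runit V ?I \<odot>\<^bsub>V\<^esub> idn V (x \<otimes>\<^bsub>V\<^esub> y)) \<cdot>\<^bsub>V\<^esub> assoc V (?I \<otimes>\<^bsub>V\<^esub> ?I) x y"
    using Comp_extend [OF triangle [of ?I "x \<otimes>\<^bsub>V\<^esub> y"], of "assoc V (?I \<otimes>\<^bsub>V\<^esub> ?I) x y"] x y by simp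
  also have "\<dots> = assoc V ?I x y \<cdot>\<^bsub>V\<^esub> ((runit V ?I \<odot>\<^bsub>V\<^esub> idn V x) \<odot>\<^bsub>V\<^esub> idn V y)"
    using assoc_natural [of "runit V ?I" "?I \<otimes>\<^bsub>V\<^esub> ?I" ?I "idn V x" x x "idn V y" y y] x y by (simp add: hom_def)
  also have "\<dots> = assoc V ?I x y \<cdot>\<^bsub>V\<^esub> ((idn V ?I \<odot>\<^bsub>V\<^esub> lunit V x) \<odot>\<^bsub>V\<^esub> idn V y) \<cdot>\<^bsub>V\<^esub> (assoc V ?I ?I x \<odot>\<^bsub>V\<^esub> idn V y)"
    using triangle [of ?I x] x y by simp
  also have "\<dots> = (idn V ?I \<odot>\<^bsub>V\<^esub> (lunit V x \<odot>\<^bsub>V\<^esub> idn V y)) \<cdot>\<^bsub>V\<^esub> b"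
    unfolding b_def
    using Comp_extend [OF assoc_natural [of "idn V ?I" ?I ?I "lunit V x" "?I \<otimes>\<^bsub>V\<^esub> x" x "idn V y" y y],
        of "assoc V ?I ?I x \<odot>\<^bsub>V\<^esub> idn V y"] x y by (simp add: hom_def)
  finally have "(idn V ?I \<odot>\<^bsub>V\<^esub> (lunit V (x \<otimes>\<^bsub>V\<^esub> y) \<cdot>\<^bsub>V\<^esub> assoc V ?I x y)) \<cdot>\<^bsub>V\<^esub> b
      = (idn V ?I \<odot>\<^bsub>V\<^esub> (lunit V x \<odot>\<^bsub>V\<^esub> idn V y)) \<cdot>\<^bsub>V\<^esub> b"
    using x y b by simp
  then show "idn V ?I \<odot>\<^bsub>V\<^esub> (lunit V (x \<otimes>\<^bsub>V\<^esub> y) \<cdot>\<^bsub>V\<^esub> assoc V ?I x y)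
      = idn V ?I \<odot>\<^bsub>V\<^esub> (lunit V x \<odot>\<^bsub>V\<^esub> idn V y)"
    by (rule iso_epic [OF b(1)]) (use x y b in auto)
qed

lemma lunit_unit_eq_runit_unit: "lunit V \<one>\<^bsub>V\<^esub> = runit V \<one>\<^bsub>V\<^esub>"
proof (rule tens_unit_faithful)
  let ?I = "\<one>\<^bsub>V\<^esub>"
  show "lunit V ?I \<in> hom V (?I \<otimes>\<^bsub>V\<^esub> ?I) ?I" "runit V ?I \<in> hom V (?I \<otimes>\<^bsub>V\<^esub> ?I) ?I"
    by (auto simp: hom_def)
  have "lunit V ?I \<cdot>\<^bsub>V\<^esub> (idn V ?I \<odot>\<^bsub>V\<^esub> lunit V ?I) = lunit V ?I \<cdot>\<^bsub>V\<^esub> lunit V (?I \<otimes>\<^bsub>V\<^esub> ?I)"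
    by (rule lunit_natural) (simp add: hom_def)
  then have "idn V ?I \<odot>\<^bsub>V\<^esub> lunit V ?I = lunit V (?I \<otimes>\<^bsub>V\<^esub> ?I)"
    by (rule iso_monic [rotated]) auto
  then show "lunit V ?I \<odot>\<^bsub>V\<^esub> idn V ?I = runit V ?I \<odot>\<^bsub>V\<^esub> idn V ?I"
    using lunit_tens [of ?I ?I] triangle [of ?I ?I] by simp
qed

subsection \<open>Internal homs\<close>

lemma curry:
  assumes "a \<in> Obj V" "x \<in> Obj V" "z \<in> Obj V" "h \<in> hom V (a \<otimes>\<^bsub>V\<^esub> x) z"
  shows "curry_arr V a x z h \<in> hom V a (ihom V x z)"
    "ev V x z \<cdot>\<^bsub>V\<^esub> (curry_arr V a x z h \<odot>\<^bsub>V\<^esub> idn V x) = h"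
  using theI' [OF ev_universal [OF assms]] unfolding curry_arr_def by blast+

lemma ev_tens_hom:
  "k \<in> hom V a (ihom V x z) \<Longrightarrow> x \<in> Obj V \<Longrightarrow> z \<in> Obj V \<Longrightarrow> ev V x z \<cdot>\<^bsub>V\<^esub> (k \<odot>\<^bsub>V\<^esub> idn V x) \<in> hom V (a \<otimes>\<^bsub>V\<^esub> x) z"
  by (auto simp: hom_def)

lemma curryI:
  assumes "k \<in> hom V a (ihom V x z)" "x \<in> Obj V" "z \<in> Obj V" "ev V x z \<cdot>\<^bsub>V\<^esub> (k \<odot>\<^bsub>V\<^esub> idn V x) = h"
  shows "curry_arr V a x z h = k"
  using ev_universal [OF hom_Obj(1) [OF assms(1)] assms(2,3) ev_tens_hom [OF assms(1-3)]]
    curry [OF hom_Obj(1) [OF assms(1)] assms(2,3) ev_tens_hom [OF assms(1-3)]] assms by blast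

lemma ihom_ext:
  assumes "k \<in> hom V a (ihom V x z)" "k' \<in> hom V a (ihom V x z)" "x \<in> Obj V" "z \<in> Obj V"
    "ev V x z \<cdot>\<^bsub>V\<^esub> (k \<odot>\<^bsub>V\<^esub> idn V x) = ev V x z \<cdot>\<^bsub>V\<^esub> (k' \<odot>\<^bsub>V\<^esub> idn V x)"
  shows "k = k'"
  using curryI assms by metis

lemma ihom_arr:
  assumes f: "f \<in> hom V x' x" and g: "g \<in> hom V z z'"
  shows "ihom_arr V f g \<in> hom V (ihom V x z) (ihom V x' z')"
    "k \<in> hom V a (ihom V x z) \<Longrightarrow> ev V x' z' \<cdot>\<^bsub>V\<^esub> ((ihom_arr V f g \<cdot>\<^bsub>V\<^esub> k) \<odot>\<^bsub>V\<^esub> idn V x') = g \<cdot>\<^bsub>V\<^esub> ev V x z \<cdot>\<^bsub>V\<^esub> (k \<odot>\<^bsub>V\<^esub> f)"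
proof -
  note ob = hom_Obj [OF f] hom_Obj [OF g]
  have D: "Dom V f = x'" "Cod V f = x" "Dom V g = z" "Cod V g = z'" "f \<in> Arr V" "g \<in> Arr V"
    using f g by (auto simp: hom_def)
  have e: "ihom_arr V f g = curry_arr V (ihom V x z) x' z' (g \<cdot>\<^bsub>V\<^esub> ev V x z \<cdot>\<^bsub>V\<^esub> (idn V (ihom V x z) \<odot>\<^bsub>V\<^esub> f))"
    by (simp add: ihom_arr_def D Let_def)
  have h: "g \<cdot>\<^bsub>V\<^esub> ev V x z \<cdot>\<^bsub>V\<^esub> (idn V (ihom V x z) \<odot>\<^bsub>V\<^esub> f) \<in> hom V (ihom V x z \<otimes>\<^bsub>V\<^esub> x') z'"
    using D ob by (auto simp: hom_def)
  have "ihom V x z \<in> Obj V" using ob by simp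
  note c = curry [OF this ob(1,4) h, folded e]
  show i: "ihom_arr V f g \<in> hom V (ihom V x z) (ihom V x' z')" by (rule c(1))
  assume k: "k \<in> hom V a (ihom V x z)"
  note a = hom_Obj(1) [OF k]
  have "(ihom_arr V f g \<cdot>\<^bsub>V\<^esub> k) \<odot>\<^bsub>V\<^esub> idn V x' = (ihom_arr V f g \<odot>\<^bsub>V\<^esub> idn V x') \<cdot>\<^bsub>V\<^esub> (k \<odot>\<^bsub>V\<^esub> idn V x')"
    using i k ob a by (simp add: hom_def)
  then have "ev V x' z' \<cdot>\<^bsub>V\<^esub> ((ihom_arr V f g \<cdot>\<^bsub>V\<^esub> k) \<odot>\<^bsub>V\<^esub> idn V x')
      = (g \<cdot>\<^bsub>V\<^esub> ev V x z \<cdot>\<^bsub>V\<^esub> (idn V (ihom V x z) \<odot>\<^bsub>V\<^esub> f)) \<cdot>\<^bsub>V\<^esub> (k \<odot>\<^bsub>V\<^esub> idn V x')"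
    using Comp_extend [OF c(2), of "k \<odot>\<^bsub>V\<^esub> idn V x'"] i k ob a by (simp add: hom_def)
  also have "\<dots> = g \<cdot>\<^bsub>V\<^esub> ev V x z \<cdot>\<^bsub>V\<^esub> (k \<odot>\<^bsub>V\<^esub> f)"
    using D ob k a by (simp add: hom_def)
  finally show "ev V x' z' \<cdot>\<^bsub>V\<^esub> ((ihom_arr V f g \<cdot>\<^bsub>V\<^esub> k) \<odot>\<^bsub>V\<^esub> idn V x') = g \<cdot>\<^bsub>V\<^esub> ev V x z \<cdot>\<^bsub>V\<^esub> (k \<odot>\<^bsub>V\<^esub> f)" .
qed

lemma unit_ihom:
  assumes z: "z \<in> Obj V"
  shows "unit_ihom V z \<in> hom V z (ihom V \<one>\<^bsub>V\<^esub> z)"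
    "ev V \<one>\<^bsub>V\<^esub> z \<cdot>\<^bsub>V\<^esub> (unit_ihom V z \<odot>\<^bsub>V\<^esub> idn V \<one>\<^bsub>V\<^esub>) = runit V z"
  unfolding unit_ihom_def using curry [OF z munit_Obj z, of "runit V z"] z by (auto simp: hom_def)

text \<open>The codomain of \<open>h\<close> is not determined by \<open>a\<close> and \<open>x\<close>, so currying reads it off from \<open>h\<close>.\<close>

lemma tensor_hom_adjunction:
  assumes x: "x \<in> Obj V"
  shows "hom_adjunction V V (\<lambda>a. a \<otimes>\<^bsub>V\<^esub> x) (\<lambda>f. f \<odot>\<^bsub>V\<^esub> idn V x) (ihom V x) (ihom_arr V (idn V x))
    (\<lambda>a h. curry_arr V a x (Cod V h) h)"
proof
  have c: "curry_arr V a x (Cod V h) h \<in> hom V a (ihom V x z)"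
    "ev V x z \<cdot>\<^bsub>V\<^esub> (curry_arr V a x (Cod V h) h \<odot>\<^bsub>V\<^esub> idn V x) = h"
    if "a \<in> Obj V" "h \<in> hom V (a \<otimes>\<^bsub>V\<^esub> x) z" for a h z
  proof -
    have "Cod V h = z" using that by (simp add: hom_def)
    then show "curry_arr V a x (Cod V h) h \<in> hom V a (ihom V x z)"
      "ev V x z \<cdot>\<^bsub>V\<^esub> (curry_arr V a x (Cod V h) h \<odot>\<^bsub>V\<^esub> idn V x) = h"
      using curry [OF that(1) x hom_Obj(2) [OF that(2)] that(2)] by simp_all
  qed
  show "is_functor V V (\<lambda>a. a \<otimes>\<^bsub>V\<^esub> x) (\<lambda>f. f \<odot>\<^bsub>V\<^esub> idn V x)"
    using x by (auto simp: is_functor_def hom_def)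
  show "v \<in> Obj V \<Longrightarrow> ihom V x v \<in> Obj V" for v using x by simp
  show "g \<in> hom V v v' \<Longrightarrow> ihom_arr V (idn V x) g \<in> hom V (ihom V x v) (ihom V x v')" for g v v'
    using ihom_arr(1) [OF idn_in_hom [OF x]] .
  show "bij_betw (\<lambda>h. curry_arr V w x (Cod V h) h) (hom V (w \<otimes>\<^bsub>V\<^esub> x) v) (hom V w (ihom V x v))"
    if w: "w \<in> Obj V" and v: "v \<in> Obj V" for w v
  proof (rule bij_betw_byWitness [where f' = "\<lambda>k. ev V x v \<cdot>\<^bsub>V\<^esub> (k \<odot>\<^bsub>V\<^esub> idn V x)"])
    show "\<forall>h\<in>hom V (w \<otimes>\<^bsub>V\<^esub> x) v. ev V x v \<cdot>\<^bsub>V\<^esub> (curry_arr V w x (Cod V h) h \<odot>\<^bsub>V\<^esub> idn V x) = h"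
      using c w by blast
    show "\<forall>k\<in>hom V w (ihom V x v). curry_arr V w x (Cod V (ev V x v \<cdot>\<^bsub>V\<^esub> (k \<odot>\<^bsub>V\<^esub> idn V x))) (ev V x v \<cdot>\<^bsub>V\<^esub> (k \<odot>\<^bsub>V\<^esub> idn V x)) = k"
    proof
      fix k assume k: "k \<in> hom V w (ihom V x v)"
      have "Cod V (ev V x v \<cdot>\<^bsub>V\<^esub> (k \<odot>\<^bsub>V\<^esub> idn V x)) = v"
        using ev_tens_hom [OF k x v] by (simp add: hom_def)
      then show "curry_arr V w x (Cod V (ev V x v \<cdot>\<^bsub>V\<^esub> (k \<odot>\<^bsub>V\<^esub> idn V x))) (ev V x v \<cdot>\<^bsub>V\<^esub> (k \<odot>\<^bsub>V\<^esub> idn V x)) = k"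
        using curryI [OF k x v refl] by simp
    qed
    show "(\<lambda>h. curry_arr V w x (Cod V h) h) ` hom V (w \<otimes>\<^bsub>V\<^esub> x) v \<subseteq> hom V w (ihom V x v)"
      using c w by blast
    show "(\<lambda>k. ev V x v \<cdot>\<^bsub>V\<^esub> (k \<odot>\<^bsub>V\<^esub> idn V x)) ` hom V w (ihom V x v) \<subseteq> hom V (w \<otimes>\<^bsub>V\<^esub> x) v"
      using ev_tens_hom x v by blast
  qed
  show "curry_arr V w x (Cod V (g \<cdot>\<^bsub>V\<^esub> f)) (g \<cdot>\<^bsub>V\<^esub> f) = ihom_arr V (idn V x) g \<cdot>\<^bsub>V\<^esub> curry_arr V w x (Cod V f) f"
    if w: "w \<in> Obj V" and f: "f \<in> hom V (w \<otimes>\<^bsub>V\<^esub> x) v" and g: "g \<in> hom V v v'" for w f g v v'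
  proof -
    note i = ihom_arr [OF idn_in_hom [OF x] g]
    have "Cod V (g \<cdot>\<^bsub>V\<^esub> f) = v'" using f g by (simp add: hom_def)
    then show ?thesis
      using curryI [OF Comp_in_hom [OF c(1) [OF w f] i(1)] x hom_Obj(2) [OF g]] i(2) [OF c(1) [OF w f]] c(2) [OF w f]
      by simp
  qed
  show "curry_arr V w' x (Cod V (f \<cdot>\<^bsub>V\<^esub> (h \<odot>\<^bsub>V\<^esub> idn V x))) (f \<cdot>\<^bsub>V\<^esub> (h \<odot>\<^bsub>V\<^esub> idn V x)) = curry_arr V w x (Cod V f) f \<cdot>\<^bsub>V\<^esub> h"
    if h: "h \<in> hom V w' w" and f: "f \<in> hom V (w \<otimes>\<^bsub>V\<^esub> x) v" for h w w' f v
  proof -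
    note w = hom_Obj [OF h] and v = hom_Obj(2) [OF f]
    note cf = c [OF w(2) f]
    have "ev V x v \<cdot>\<^bsub>V\<^esub> ((curry_arr V w x (Cod V f) f \<cdot>\<^bsub>V\<^esub> h) \<odot>\<^bsub>V\<^esub> idn V x)
        = ev V x v \<cdot>\<^bsub>V\<^esub> (curry_arr V w x (Cod V f) f \<odot>\<^bsub>V\<^esub> idn V x) \<cdot>\<^bsub>V\<^esub> (h \<odot>\<^bsub>V\<^esub> idn V x)"
      using cf(1) h x w by (simp add: hom_def)
    also have "\<dots> = f \<cdot>\<^bsub>V\<^esub> (h \<odot>\<^bsub>V\<^esub> idn V x)"
      using Comp_extend [OF cf(2), of "h \<odot>\<^bsub>V\<^esub> idn V x"] cf(1) h x w v by (simp add: hom_def)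
    moreover have "Cod V (f \<cdot>\<^bsub>V\<^esub> (h \<odot>\<^bsub>V\<^esub> idn V x)) = v" using f h x w by (simp add: hom_def)
    ultimately show ?thesis
      using curryI [OF Comp_in_hom [OF h cf(1)] x v] by simp
  qed
qed

lemma initial_tens:
  assumes "is_initial V z" "x \<in> Obj V"
  shows "is_initial V (z \<otimes>\<^bsub>V\<^esub> x)" "is_initial V (x \<otimes>\<^bsub>V\<^esub> z)"
proof -
  have z: "z \<in> Obj V" using assms(1) by (simp add: is_initial_def)
  show zx: "is_initial V (z \<otimes>\<^bsub>V\<^esub> x)"
    using hom_adjunction.initial_adjoint [OF tensor_hom_adjunction [OF assms(2)] assms(1)] .
  show "is_initial V (x \<otimes>\<^bsub>V\<^esub> z)"
    unfolding is_initial_def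
  proof (intro conjI ballI)
    show "x \<otimes>\<^bsub>V\<^esub> z \<in> Obj V" using assms z by simp
    fix y assume "y \<in> Obj V"
    then obtain f where f: "f \<in> hom V (z \<otimes>\<^bsub>V\<^esub> x) y" "\<And>g. g \<in> hom V (z \<otimes>\<^bsub>V\<^esub> x) y \<Longrightarrow> g = f"
      using zx unfolding is_initial_def by blast
    show "\<exists>!f. f \<in> hom V (x \<otimes>\<^bsub>V\<^esub> z) y"
    proof (rule ex1I [of _ "f \<cdot>\<^bsub>V\<^esub> braid V x z"])
      show "f \<cdot>\<^bsub>V\<^esub> braid V x z \<in> hom V (x \<otimes>\<^bsub>V\<^esub> z) y" using f(1) z assms(2) by (auto simp: hom_def)
      fix g assume g: "g \<in> hom V (x \<otimes>\<^bsub>V\<^esub> z) y"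
      have "g \<cdot>\<^bsub>V\<^esub> braid V z x = f" using f(2) [of "g \<cdot>\<^bsub>V\<^esub> braid V z x"] g z assms(2) by (auto simp: hom_def)
      then have "f \<cdot>\<^bsub>V\<^esub> braid V x z = g \<cdot>\<^bsub>V\<^esub> (braid V z x \<cdot>\<^bsub>V\<^esub> braid V x z)"
        using g z assms(2) by (auto simp: hom_def)
      also have "\<dots> = g" using g z assms(2) braid_symmetric [of x z] by (simp add: hom_def)
      finally show "g = f \<cdot>\<^bsub>V\<^esub> braid V x z" by simp
    qed
  qed
qed

end

subsection \<open>Tensoring with a cofibrant object\<close>

text \<open>The corner map of \<open>i\<close> and \<open>\<emptyset> \<rightarrow> v\<close> is \<open>i \<otimes> v\<close> as soon as tensoring with \<open>\<emptyset>\<close> gives \<open>\<emptyset>\<close>.\<close>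

lemma pushout_product_cofibrant:
  assumes "category A" "category B" "category D" and To: "is_bifunctor A B D To Ta"
    and pp: "pushout_product_axiom A MA B MB D MD To Ta"
    and i: "i \<in> Cof MA" "i \<in> Arr A" and v: "cofibrant B MB v"
    and init: "\<And>a z. a \<in> Obj A \<Longrightarrow> is_initial B z \<Longrightarrow> is_initial D (To a z)"
  shows "Ta i (idn B v) \<in> Cof MD" "i \<in> Weq MA \<Longrightarrow> Ta i (idn B v) \<in> Weq MD"
proof -
  interpret A: category A by fact
  interpret B: category B by fact
  interpret D: category D by fact
  obtain z k where z: "is_initial B z" and k: "k \<in> hom B z v" "k \<in> Cof MB"
    using v unfolding cofibrant_def by blast
  define a b where "a = Dom A i" and "b = Cod A i"
  have ih: "i \<in> hom A a b" using i by (simp add: hom_def a_def b_def)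
  note ab = A.hom_Obj [OF ih] and zv = B.hom_Obj [OF k(1)]
  note T = bifunctorD [OF To]
  have az: "is_initial D (To a z)" and bz: "is_initial D (To b z)" using init ab z by blast+
  have uniq: "f = g" if "is_initial D w" "f \<in> hom D w y" "g \<in> hom D w y" for f g w y
    using that D.hom_Obj(2) unfolding is_initial_def by blast
  obtain s where s: "s \<in> hom D (To b z) (To a v)" using bz T(1) [OF ab(1) zv(2)] unfolding is_initial_def by blast
  have iz: "Ta i (idn B z) \<in> hom D (To a z) (To b z)" using T(2) [OF ih B.idn_in_hom [OF zv(1)]] .
  have ak: "Ta (idn A a) k \<in> hom D (To a z) (To a v)" using T(2) [OF A.idn_in_hom [OF ab(1)] k(1)] .
  have bk: "Ta (idn A b) k \<in> hom D (To b z) (To b v)" using T(2) [OF A.idn_in_hom [OF ab(2)] k(1)] .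
  have iv: "Ta i (idn B v) \<in> hom D (To a v) (To b v)" using T(2) [OF ih B.idn_in_hom [OF zv(2)]] .
  have av: "To a v \<in> Obj D" using T(1) ab zv by blast
  have D: "Cod A i = b" "Dom A i = a" "Dom B k = z" "Cod B k = v"
    using k by (auto simp: hom_def a_def b_def)
  have E: "Dom D (Ta i (idn B z)) = To a z" "Cod D (Ta i (idn B z)) = To b z"
    "Dom D (Ta (idn A a) k) = To a z" "Cod D (Ta (idn A a) k) = To a v"
    using iz ak by (auto simp: hom_def)
  have "is_pushout D (Ta i (idn B (Dom B k))) (Ta (idn A (Dom A i)) k) (To a v) s (idn D (To a v))"
    unfolding is_pushout_def D E
  proof (intro conjI allI ballI impI)
    show "s \<cdot>\<^bsub>D\<^esub> Ta i (idn B z) = idn D (To a v) \<cdot>\<^bsub>D\<^esub> Ta (idn A a) k"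
      using uniq [OF az] D.Comp_in_hom [OF iz s] D.Comp_in_hom [OF ak D.idn_in_hom [OF av]] by blast
    fix c s' t' assume s': "s' \<in> hom D (To b z) c" and t': "t' \<in> hom D (To a v) c"
    show "\<exists>!h. h \<in> hom D (To a v) c \<and> h \<cdot>\<^bsub>D\<^esub> s = s' \<and> h \<cdot>\<^bsub>D\<^esub> idn D (To a v) = t'"
    proof (rule ex1I [of _ t'])
      show "t' \<in> hom D (To a v) c \<and> t' \<cdot>\<^bsub>D\<^esub> s = s' \<and> t' \<cdot>\<^bsub>D\<^esub> idn D (To a v) = t'"
        using t' uniq [OF bz D.Comp_in_hom [OF s t'] s'] D.Comp_idn_right [OF t'] by blast
    qed (use D.Comp_idn_right in auto)
  qed (use iz ak s av in \<open>auto simp: hom_def\<close>)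
  moreover have "Ta i (idn B v) \<cdot>\<^bsub>D\<^esub> s = Ta (idn A b) k"
    using uniq [OF bz D.Comp_in_hom [OF s iv] bk] .
  moreover have "Ta i (idn B v) \<cdot>\<^bsub>D\<^esub> idn D (To a v) = Ta i (idn B v)"
    using D.Comp_idn_right [OF iv] .
  ultimately show "Ta i (idn B v) \<in> Cof MD" "i \<in> Weq MA \<Longrightarrow> Ta i (idn B v) \<in> Weq MD"
    using pp i(1) k(2) iv unfolding pushout_product_axiom_def D by (metis D)+
qed

lemma pushout_product_swap:
  assumes "pushout_product_axiom A MA B MB D MD To Ta"
  shows "pushout_product_axiom B MB A MA D MD (\<lambda>b a. To a b) (\<lambda>k i. Ta i k)"
  unfolding pushout_product_axiom_def
proof (intro ballI allI impI, elim conjE)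
  fix i k p s t h
  assume "i \<in> Cof MB" "k \<in> Cof MA" "h \<in> hom D p (To (Cod A k) (Cod B i))"
    and po: "is_pushout D (Ta (idn A (Dom A k)) i) (Ta k (idn B (Dom B i))) p s t"
    and "h \<cdot>\<^bsub>D\<^esub> s = Ta k (idn B (Cod B i))" "h \<cdot>\<^bsub>D\<^esub> t = Ta (idn A (Cod A k)) i"
  then show "h \<in> Cof MD \<and> (i \<in> Weq MB \<or> k \<in> Weq MA \<longrightarrow> h \<in> Weq MD)"
    using assms pushout_swap [OF po] unfolding pushout_product_axiom_def by meson
qed

locale complete_monoidal_model_category =
  symmetric_monoidal_model_category U V M + complete_model_category U V M
  for U :: "'u itself" and V :: "('o, 'm, 'x) smc_scheme" (structure) and M :: "'m model_structure"
begin

lemma tensor_hom_quillen: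
  assumes w: "cofibrant V M w"
  shows "quillen_adjunction U V M V M (\<lambda>a. a \<otimes> w) (\<lambda>f. f \<odot> idn V w) (ihom V w) (ihom_arr V (idn V w))
    (\<lambda>a h. curry_arr V a w (Cod V h) h)"
proof -
  interpret hom_adjunction V V "\<lambda>a. a \<otimes> w" "\<lambda>f. f \<odot> idn V w" "ihom V w" "ihom_arr V (idn V w)"
    "\<lambda>a h. curry_arr V a w (Cod V h) h"
    using tensor_hom_adjunction [OF cofibrant_Obj [OF w]] .
  show ?thesis
    by unfold_locales
      (use pushout_product_cofibrant [OF category_axioms category_axioms category_axioms tens_bifunctor
          pushout_product _ _ w initial_tens(2)] in auto)
qed

end

section \<open>Lax monoidal right adjoints\<close>

locale lax_monoidal_adjunction = W: symmetric_monoidal_closed W + V: symmetric_monoidal_closed V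
  for W :: "('wo, 'wm, 'x) smc_scheme" and V :: "('vo, 'vm, 'y) smc_scheme" +
  fixes A :: "('wo, 'wm, 'vo, 'vm) lax_adjunction"
  assumes adjunction: "is_adjunction W V A" and lax: "is_lax_monoidal W V A"
begin

abbreviation sharp where "sharp \<equiv> \<lambda>w f. GA A f \<cdot>\<^bsub>W\<^esub> adj_unit A w"
abbreviation delta where "delta \<equiv> oplax_mult W V A"
abbreviation eps where "eps \<equiv> oplax_counit V A"

lemma F_functor: "is_functor W V (FO A) (FA A)" and G_functor: "is_functor V W (GO A) (GA A)"
  using adjunction unfolding is_adjunction_def by blast+

lemmas F_simps [simp] = functorD(1,3) [OF F_functor] functor_simps(1-3) [OF F_functor]
lemmas G_simps [simp] = functorD(1,3) [OF G_functor] functor_simps(1-3) [OF G_functor]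
lemmas F_Comp = functorD(4) [OF F_functor] and F_hom = functorD(2) [OF F_functor]
lemmas G_Comp = functorD(4) [OF G_functor] and G_hom = functorD(2) [OF G_functor]

lemma G_Comp_Arr: "f \<in> Arr V \<Longrightarrow> g \<in> Arr V \<Longrightarrow> Cod V f = Dom V g \<Longrightarrow> GA A (g \<cdot>\<^bsub>V\<^esub> f) = GA A g \<cdot>\<^bsub>W\<^esub> GA A f"
  by (rule functor_simps(4) [OF G_functor])

lemma F_Comp_Arr: "f \<in> Arr W \<Longrightarrow> g \<in> Arr W \<Longrightarrow> Cod W f = Dom W g \<Longrightarrow> FA A (g \<cdot>\<^bsub>W\<^esub> f) = FA A g \<cdot>\<^bsub>V\<^esub> FA A f"
  by (rule functor_simps(4) [OF F_functor])

lemma unit_simps [simp]: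
  assumes "w \<in> Obj W"
  shows "adj_unit A w \<in> Arr W" "Dom W (adj_unit A w) = w" "Cod W (adj_unit A w) = GO A (FO A w)"
  using adjunction assms unfolding is_adjunction_def by (auto simp: hom_def)

lemma counit_simps [simp]:
  assumes "v \<in> Obj V"
  shows "adj_counit A v \<in> Arr V" "Dom V (adj_counit A v) = FO A (GO A v)" "Cod V (adj_counit A v) = v"
  using adjunction assms unfolding is_adjunction_def by (auto simp: hom_def)

lemma unit_natural: "f \<in> hom W w w' \<Longrightarrow> adj_unit A w' \<cdot>\<^bsub>W\<^esub> f = GA A (FA A f) \<cdot>\<^bsub>W\<^esub> adj_unit A w"
  and counit_natural: "g \<in> hom V v v' \<Longrightarrow> adj_counit A v' \<cdot>\<^bsub>V\<^esub> FA A (GA A g) = g \<cdot>\<^bsub>V\<^esub> adj_counit A v"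
  and zigzag_left: "w \<in> Obj W \<Longrightarrow> adj_counit A (FO A w) \<cdot>\<^bsub>V\<^esub> FA A (adj_unit A w) = idn V (FO A w)"
  and zigzag_right: "v \<in> Obj V \<Longrightarrow> GA A (adj_counit A v) \<cdot>\<^bsub>W\<^esub> adj_unit A (GO A v) = idn W (GO A v)"
  using adjunction unfolding is_adjunction_def by blast+

text \<open>The bijection \<open>f \<mapsto> G f \<cdot> \<eta>\<close> has the inverse \<open>g \<mapsto> c \<cdot> F g\<close> by the triangle identities, where \<open>\<eta>\<close>
  is the unit and \<open>c\<close> the counit of the adjunction.\<close>

lemma sharp_counit:
  assumes g: "g \<in> hom W w (GO A v)" and v: "v \<in> Obj V"
  shows "sharp w (adj_counit A v \<cdot>\<^bsub>V\<^esub> FA A g) = g"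
proof -
  note w = W.hom_Obj [OF g]
  have "sharp w (adj_counit A v \<cdot>\<^bsub>V\<^esub> FA A g) = GA A (adj_counit A v) \<cdot>\<^bsub>W\<^esub> (GA A (FA A g) \<cdot>\<^bsub>W\<^esub> adj_unit A w)"
    using g v w by (simp add: G_Comp_Arr hom_def)
  also have "\<dots> = GA A (adj_counit A v) \<cdot>\<^bsub>W\<^esub> (adj_unit A (GO A v) \<cdot>\<^bsub>W\<^esub> g)"
    by (simp add: unit_natural [OF g])
  also have "\<dots> = idn W (GO A v) \<cdot>\<^bsub>W\<^esub> g"
    using W.Comp_extend [OF zigzag_right [OF v], of g] g v w by (simp add: hom_def)
  finally show ?thesis using g by (simp add: hom_def)
qed

sublocale hom_adjunction W V "FO A" "FA A" "GO A" "GA A" sharp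
proof unfold_locales
  show "is_functor W V (FO A) (FA A)" by (rule F_functor)
  show "v \<in> Obj V \<Longrightarrow> GO A v \<in> Obj W" for v by simp
  show "g \<in> hom V v v' \<Longrightarrow> GA A g \<in> hom W (GO A v) (GO A v')" for g v v' by (rule G_hom)
  show "GA A (g \<cdot>\<^bsub>V\<^esub> f) \<cdot>\<^bsub>W\<^esub> adj_unit A w = GA A g \<cdot>\<^bsub>W\<^esub> GA A f \<cdot>\<^bsub>W\<^esub> adj_unit A w"
    if "w \<in> Obj W" "f \<in> hom V (FO A w) v" "g \<in> hom V v v'" for w f g v v'
    using that by (simp add: G_Comp_Arr hom_def)
  show "GA A (f \<cdot>\<^bsub>V\<^esub> FA A h) \<cdot>\<^bsub>W\<^esub> adj_unit A w' = (GA A f \<cdot>\<^bsub>W\<^esub> adj_unit A w) \<cdot>\<^bsub>W\<^esub> h"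
    if h: "h \<in> hom W w' w" and f: "f \<in> hom V (FO A w) v" for h w' w f v
    using unit_natural [OF h] h f W.hom_Obj [OF h] by (simp add: G_Comp_Arr hom_def)
  show "bij_betw (\<lambda>f. GA A f \<cdot>\<^bsub>W\<^esub> adj_unit A w) (hom V (FO A w) v) (hom W w (GO A v))"
    if w: "w \<in> Obj W" and v: "v \<in> Obj V" for w v
  proof (rule bij_betw_byWitness [where f' = "\<lambda>g. adj_counit A v \<cdot>\<^bsub>V\<^esub> FA A g"])
    show "\<forall>g\<in>hom W w (GO A v). GA A (adj_counit A v \<cdot>\<^bsub>V\<^esub> FA A g) \<cdot>\<^bsub>W\<^esub> adj_unit A w = g"
      using sharp_counit v by blast
    show "\<forall>f\<in>hom V (FO A w) v. adj_counit A v \<cdot>\<^bsub>V\<^esub> FA A (GA A f \<cdot>\<^bsub>W\<^esub> adj_unit A w) = f"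
    proof
      fix f assume f: "f \<in> hom V (FO A w) v"
      have "adj_counit A v \<cdot>\<^bsub>V\<^esub> FA A (GA A f \<cdot>\<^bsub>W\<^esub> adj_unit A w)
          = adj_counit A v \<cdot>\<^bsub>V\<^esub> FA A (GA A f) \<cdot>\<^bsub>V\<^esub> FA A (adj_unit A w)"
        using f w by (simp add: F_Comp_Arr hom_def)
      also have "\<dots> = f \<cdot>\<^bsub>V\<^esub> adj_counit A (FO A w) \<cdot>\<^bsub>V\<^esub> FA A (adj_unit A w)"
        using V.Comp_extend [OF counit_natural [OF f], of "FA A (adj_unit A w)"] f w v by (simp add: hom_def)
      also have "\<dots> = f" using zigzag_left [OF w] f by (simp add: hom_def)
      finally show "adj_counit A v \<cdot>\<^bsub>V\<^esub> FA A (GA A f \<cdot>\<^bsub>W\<^esub> adj_unit A w) = f" .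
    qed
  qed (use w v in \<open>auto simp: hom_def\<close>)
qed

lemma flat_eq: "g \<in> hom W w (GO A v) \<Longrightarrow> v \<in> Obj V \<Longrightarrow> flat w v g = adj_counit A v \<cdot>\<^bsub>V\<^esub> FA A g"
  by (rule flatI [OF _ _ sharp_counit]) (auto simp: hom_def W.hom_Obj dest: W.hom_Obj)

lemma lax_mult_simps [simp]:
  assumes "x \<in> Obj V" "y \<in> Obj V"
  shows "lax_mult A x y \<in> Arr W" "Dom W (lax_mult A x y) = GO A x \<otimes>\<^bsub>W\<^esub> GO A y"
    "Cod W (lax_mult A x y) = GO A (x \<otimes>\<^bsub>V\<^esub> y)"
  using lax assms unfolding is_lax_monoidal_def by (auto simp: hom_def)

lemma lax_unit_simps [simp]:
  "lax_unit A \<in> Arr W" "Dom W (lax_unit A) = \<one>\<^bsub>W\<^esub>" "Cod W (lax_unit A) = GO A \<one>\<^bsub>V\<^esub>"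
  using lax unfolding is_lax_monoidal_def by (auto simp: hom_def)

lemma lax_natural:
  assumes "f \<in> Arr V" "g \<in> Arr V"
  shows "lax_mult A (Cod V f) (Cod V g) \<cdot>\<^bsub>W\<^esub> (GA A f \<odot>\<^bsub>W\<^esub> GA A g) = GA A (f \<odot>\<^bsub>V\<^esub> g) \<cdot>\<^bsub>W\<^esub> lax_mult A (Dom V f) (Dom V g)"
proof -
  have "f \<in> hom V (Dom V f) (Cod V f)" "g \<in> hom V (Dom V g) (Cod V g)" using assms by (auto simp: hom_def)
  then show ?thesis using lax unfolding is_lax_monoidal_def by blast
qed

lemma lax_assoc: "x \<in> Obj V \<Longrightarrow> y \<in> Obj V \<Longrightarrow> z \<in> Obj V \<Longrightarrow>
         GA A (assoc V x y z) \<cdot>\<^bsub>W\<^esub> lax_mult A (x \<otimes>\<^bsub>V\<^esub> y) z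
             \<cdot>\<^bsub>W\<^esub> (lax_mult A x y \<odot>\<^bsub>W\<^esub> idn W (GO A z)) =
         lax_mult A x (y \<otimes>\<^bsub>V\<^esub> z) \<cdot>\<^bsub>W\<^esub> (idn W (GO A x) \<odot>\<^bsub>W\<^esub> lax_mult A y z)
             \<cdot>\<^bsub>W\<^esub> assoc W (GO A x) (GO A y) (GO A z)"
  and lax_lunit: "x \<in> Obj V \<Longrightarrow> GA A (lunit V x) \<cdot>\<^bsub>W\<^esub> lax_mult A \<one>\<^bsub>V\<^esub> x
             \<cdot>\<^bsub>W\<^esub> (lax_unit A \<odot>\<^bsub>W\<^esub> idn W (GO A x)) = lunit W (GO A x)"
  and lax_runit: "x \<in> Obj V \<Longrightarrow> GA A (runit V x) \<cdot>\<^bsub>W\<^esub> lax_mult A x \<one>\<^bsub>V\<^esub>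
             \<cdot>\<^bsub>W\<^esub> (idn W (GO A x) \<odot>\<^bsub>W\<^esub> lax_unit A) = runit W (GO A x)"
  using lax unfolding is_lax_monoidal_def by blast+

lemma delta:
  assumes "a \<in> Obj W" "b \<in> Obj W"
  shows "delta a b \<in> hom V (FO A (a \<otimes>\<^bsub>W\<^esub> b)) (FO A a \<otimes>\<^bsub>V\<^esub> FO A b)"
    "sharp (a \<otimes>\<^bsub>W\<^esub> b) (delta a b) = lax_mult A (FO A a) (FO A b) \<cdot>\<^bsub>W\<^esub> (adj_unit A a \<odot>\<^bsub>W\<^esub> adj_unit A b)"
proof -
  show "delta a b \<in> hom V (FO A (a \<otimes>\<^bsub>W\<^esub> b)) (FO A a \<otimes>\<^bsub>V\<^esub> FO A b)"
    using assms unfolding oplax_mult_def by (auto simp: hom_def)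
  show "sharp (a \<otimes>\<^bsub>W\<^esub> b) (delta a b) = lax_mult A (FO A a) (FO A b) \<cdot>\<^bsub>W\<^esub> (adj_unit A a \<odot>\<^bsub>W\<^esub> adj_unit A b)"
    unfolding oplax_mult_def by (rule sharp_counit) (use assms in \<open>auto simp: hom_def\<close>)
qed

lemma delta_simps [simp]:
  assumes "a \<in> Obj W" "b \<in> Obj W"
  shows "delta a b \<in> Arr V" "Dom V (delta a b) = FO A (a \<otimes>\<^bsub>W\<^esub> b)" "Cod V (delta a b) = FO A a \<otimes>\<^bsub>V\<^esub> FO A b"
  using delta(1) [OF assms] by (auto simp: hom_def)

lemma eps:
  shows "eps \<in> hom V (FO A \<one>\<^bsub>W\<^esub>) \<one>\<^bsub>V\<^esub>" "sharp \<one>\<^bsub>W\<^esub> eps = lax_unit A"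
proof -
  show "eps \<in> hom V (FO A \<one>\<^bsub>W\<^esub>) \<one>\<^bsub>V\<^esub>" unfolding oplax_counit_def by (auto simp: hom_def)
  show "sharp \<one>\<^bsub>W\<^esub> eps = lax_unit A" unfolding oplax_counit_def by (rule sharp_counit) (auto simp: hom_def)
qed

lemma eps_simps [simp]: "eps \<in> Arr V" "Dom V eps = FO A \<one>\<^bsub>W\<^esub>" "Cod V eps = \<one>\<^bsub>V\<^esub>"
  using eps(1) by (auto simp: hom_def)

text \<open>Equations between maps out of \<open>F (a \<otimes> b)\<close> involving \<open>\<delta>\<close> are checked on adjuncts, where \<open>\<delta>\<close>
  becomes the lax structure map.\<close>

lemma sharp_tens_delta:
  assumes "a \<in> Obj W" "b \<in> Obj W" and f: "f \<in> hom V (FO A a) x" and g: "g \<in> hom V (FO A b) y"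
  shows "sharp (a \<otimes>\<^bsub>W\<^esub> b) ((f \<odot>\<^bsub>V\<^esub> g) \<cdot>\<^bsub>V\<^esub> delta a b) = lax_mult A x y \<cdot>\<^bsub>W\<^esub> (sharp a f \<odot>\<^bsub>W\<^esub> sharp b g)"
proof -
  have fg: "f \<in> Arr V" "Dom V f = FO A a" "Cod V f = x" "g \<in> Arr V" "Dom V g = FO A b" "Cod V g = y"
    using f g by (auto simp: hom_def)
  have xy: "x \<in> Obj V" "y \<in> Obj V" using V.hom_Obj f g by blast+
  have "sharp (a \<otimes>\<^bsub>W\<^esub> b) ((f \<odot>\<^bsub>V\<^esub> g) \<cdot>\<^bsub>V\<^esub> delta a b) = GA A (f \<odot>\<^bsub>V\<^esub> g) \<cdot>\<^bsub>W\<^esub> sharp (a \<otimes>\<^bsub>W\<^esub> b) (delta a b)"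
    using fg assms(1,2) by (simp add: G_Comp_Arr)
  also have "\<dots> = GA A (f \<odot>\<^bsub>V\<^esub> g) \<cdot>\<^bsub>W\<^esub> lax_mult A (FO A a) (FO A b) \<cdot>\<^bsub>W\<^esub> (adj_unit A a \<odot>\<^bsub>W\<^esub> adj_unit A b)"
    using delta(2) [OF assms(1,2)] by simp
  also have "\<dots> = lax_mult A x y \<cdot>\<^bsub>W\<^esub> (GA A f \<odot>\<^bsub>W\<^esub> GA A g) \<cdot>\<^bsub>W\<^esub> (adj_unit A a \<odot>\<^bsub>W\<^esub> adj_unit A b)"
    using W.Comp_extend [OF lax_natural [OF fg(1,4), symmetric], of "adj_unit A a \<odot>\<^bsub>W\<^esub> adj_unit A b"] fg assms(1,2) xy
    by simp
  also have "\<dots> = lax_mult A x y \<cdot>\<^bsub>W\<^esub> (sharp a f \<odot>\<^bsub>W\<^esub> sharp b g)"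
    using fg assms(1,2) xy by simp
  finally show ?thesis .
qed

lemma delta_natural:
  assumes f: "f \<in> hom W a a'" and g: "g \<in> hom W b b'"
  shows "delta a' b' \<cdot>\<^bsub>V\<^esub> FA A (f \<odot>\<^bsub>W\<^esub> g) = (FA A f \<odot>\<^bsub>V\<^esub> FA A g) \<cdot>\<^bsub>V\<^esub> delta a b"
proof -
  have fg: "f \<in> Arr W" "Dom W f = a" "Cod W f = a'" "g \<in> Arr W" "Dom W g = b" "Cod W g = b'"
    using f g by (auto simp: hom_def)
  note ob = W.hom_Obj [OF f] W.hom_Obj [OF g]
  have "sharp (a \<otimes>\<^bsub>W\<^esub> b) (delta a' b' \<cdot>\<^bsub>V\<^esub> FA A (f \<odot>\<^bsub>W\<^esub> g)) = sharp (a' \<otimes>\<^bsub>W\<^esub> b') (delta a' b') \<cdot>\<^bsub>W\<^esub> (f \<odot>\<^bsub>W\<^esub> g)"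
    by (rule sharp_right [OF W.tens_hom [OF f g] delta(1) [OF ob(2,4)]])
  also have "\<dots> = lax_mult A (FO A a') (FO A b') \<cdot>\<^bsub>W\<^esub> ((adj_unit A a' \<cdot>\<^bsub>W\<^esub> f) \<odot>\<^bsub>W\<^esub> (adj_unit A b' \<cdot>\<^bsub>W\<^esub> g))"
    unfolding delta(2) [OF ob(2,4)] using fg ob by simp
  also have "\<dots> = sharp (a \<otimes>\<^bsub>W\<^esub> b) ((FA A f \<odot>\<^bsub>V\<^esub> FA A g) \<cdot>\<^bsub>V\<^esub> delta a b)"
    unfolding unit_natural [OF f] unit_natural [OF g]
    by (rule sharp_tens_delta [OF ob(1,3) F_hom [OF f] F_hom [OF g], symmetric])
  finally show ?thesis
    using sharp_inject [of "a \<otimes>\<^bsub>W\<^esub> b" "delta a' b' \<cdot>\<^bsub>V\<^esub> FA A (f \<odot>\<^bsub>W\<^esub> g)" "FO A a' \<otimes>\<^bsub>V\<^esub> FO A b'"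
        "(FA A f \<odot>\<^bsub>V\<^esub> FA A g) \<cdot>\<^bsub>V\<^esub> delta a b"] fg ob by (simp add: hom_def)
qed

text \<open>The oplax structure on \<open>F\<close> is compatible with the unit constraints because the lax structure on \<open>G\<close> is,
  as one sees on adjuncts.\<close>

lemma oplax_runit:
  assumes a: "a \<in> Obj W"
  shows "runit V (FO A a) \<cdot>\<^bsub>V\<^esub> (idn V (FO A a) \<odot>\<^bsub>V\<^esub> eps) \<cdot>\<^bsub>V\<^esub> delta a \<one>\<^bsub>W\<^esub> = FA A (runit W a)"
proof -
  let ?d = "(idn V (FO A a) \<odot>\<^bsub>V\<^esub> eps) \<cdot>\<^bsub>V\<^esub> delta a \<one>\<^bsub>W\<^esub>"
  have d: "?d \<in> hom V (FO A (a \<otimes>\<^bsub>W\<^esub> \<one>\<^bsub>W\<^esub>)) (FO A a \<otimes>\<^bsub>V\<^esub> \<one>\<^bsub>V\<^esub>)" using a by (auto simp: hom_def)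
  have r: "runit V (FO A a) \<in> hom V (FO A a \<otimes>\<^bsub>V\<^esub> \<one>\<^bsub>V\<^esub>) (FO A a)" using a by (auto simp: hom_def)
  have "sharp (a \<otimes>\<^bsub>W\<^esub> \<one>\<^bsub>W\<^esub>) (runit V (FO A a) \<cdot>\<^bsub>V\<^esub> ?d) = GA A (runit V (FO A a)) \<cdot>\<^bsub>W\<^esub> sharp (a \<otimes>\<^bsub>W\<^esub> \<one>\<^bsub>W\<^esub>) ?d"
    by (rule sharp_left [OF _ d r]) (simp add: a)
  also have "sharp (a \<otimes>\<^bsub>W\<^esub> \<one>\<^bsub>W\<^esub>) ?d = lax_mult A (FO A a) \<one>\<^bsub>V\<^esub> \<cdot>\<^bsub>W\<^esub> (adj_unit A a \<odot>\<^bsub>W\<^esub> lax_unit A)"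
    using sharp_tens_delta [OF a W.munit_Obj V.idn_in_hom eps(1)] a eps(2) by simp
  also have "adj_unit A a \<odot>\<^bsub>W\<^esub> lax_unit A = (idn W (GO A (FO A a)) \<odot>\<^bsub>W\<^esub> lax_unit A) \<cdot>\<^bsub>W\<^esub> (adj_unit A a \<odot>\<^bsub>W\<^esub> idn W \<one>\<^bsub>W\<^esub>)"
    using a by simp
  also have "GA A (runit V (FO A a)) \<cdot>\<^bsub>W\<^esub> lax_mult A (FO A a) \<one>\<^bsub>V\<^esub> \<cdot>\<^bsub>W\<^esub> \<dots>
      = (GA A (runit V (FO A a)) \<cdot>\<^bsub>W\<^esub> lax_mult A (FO A a) \<one>\<^bsub>V\<^esub> \<cdot>\<^bsub>W\<^esub> (idn W (GO A (FO A a)) \<odot>\<^bsub>W\<^esub> lax_unit A))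
          \<cdot>\<^bsub>W\<^esub> (adj_unit A a \<odot>\<^bsub>W\<^esub> idn W \<one>\<^bsub>W\<^esub>)"
    using a by simp
  also have "\<dots> = runit W (GO A (FO A a)) \<cdot>\<^bsub>W\<^esub> (adj_unit A a \<odot>\<^bsub>W\<^esub> idn W \<one>\<^bsub>W\<^esub>)"
    using lax_runit [of "FO A a"] a by simp
  also have "\<dots> = adj_unit A a \<cdot>\<^bsub>W\<^esub> runit W a"
    by (rule W.runit_natural) (use a in \<open>simp add: hom_def\<close>)
  also have "\<dots> = sharp (a \<otimes>\<^bsub>W\<^esub> \<one>\<^bsub>W\<^esub>) (FA A (runit W a))"
    by (rule unit_natural) (use a in \<open>simp add: hom_def\<close>)
  finally show ?thesis
    using sharp_inject [of "a \<otimes>\<^bsub>W\<^esub> \<one>\<^bsub>W\<^esub>" "runit V (FO A a) \<cdot>\<^bsub>V\<^esub> ?d" "FO A a" "FA A (runit W a)"] a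
    by (simp add: hom_def)
qed

lemma oplax_lunit:
  assumes a: "a \<in> Obj W"
  shows "lunit V (FO A a) \<cdot>\<^bsub>V\<^esub> (eps \<odot>\<^bsub>V\<^esub> idn V (FO A a)) \<cdot>\<^bsub>V\<^esub> delta \<one>\<^bsub>W\<^esub> a = FA A (lunit W a)"
proof -
  let ?d = "(eps \<odot>\<^bsub>V\<^esub> idn V (FO A a)) \<cdot>\<^bsub>V\<^esub> delta \<one>\<^bsub>W\<^esub> a"
  have d: "?d \<in> hom V (FO A (\<one>\<^bsub>W\<^esub> \<otimes>\<^bsub>W\<^esub> a)) (\<one>\<^bsub>V\<^esub> \<otimes>\<^bsub>V\<^esub> FO A a)" using a by (auto simp: hom_def)
  have r: "lunit V (FO A a) \<in> hom V (\<one>\<^bsub>V\<^esub> \<otimes>\<^bsub>V\<^esub> FO A a) (FO A a)" using a by (auto simp: hom_def)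
  have "sharp (\<one>\<^bsub>W\<^esub> \<otimes>\<^bsub>W\<^esub> a) (lunit V (FO A a) \<cdot>\<^bsub>V\<^esub> ?d) = GA A (lunit V (FO A a)) \<cdot>\<^bsub>W\<^esub> sharp (\<one>\<^bsub>W\<^esub> \<otimes>\<^bsub>W\<^esub> a) ?d"
    by (rule sharp_left [OF _ d r]) (simp add: a)
  also have "sharp (\<one>\<^bsub>W\<^esub> \<otimes>\<^bsub>W\<^esub> a) ?d = lax_mult A \<one>\<^bsub>V\<^esub> (FO A a) \<cdot>\<^bsub>W\<^esub> (lax_unit A \<odot>\<^bsub>W\<^esub> adj_unit A a)"
    using sharp_tens_delta [OF W.munit_Obj a eps(1) V.idn_in_hom] a eps(2) by simp
  also have "lax_unit A \<odot>\<^bsub>W\<^esub> adj_unit A a = (lax_unit A \<odot>\<^bsub>W\<^esub> idn W (GO A (FO A a))) \<cdot>\<^bsub>W\<^esub> (idn W \<one>\<^bsub>W\<^esub> \<odot>\<^bsub>W\<^esub> adj_unit A a)"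
    using a by simp
  also have "GA A (lunit V (FO A a)) \<cdot>\<^bsub>W\<^esub> lax_mult A \<one>\<^bsub>V\<^esub> (FO A a) \<cdot>\<^bsub>W\<^esub> \<dots>
      = (GA A (lunit V (FO A a)) \<cdot>\<^bsub>W\<^esub> lax_mult A \<one>\<^bsub>V\<^esub> (FO A a) \<cdot>\<^bsub>W\<^esub> (lax_unit A \<odot>\<^bsub>W\<^esub> idn W (GO A (FO A a))))
          \<cdot>\<^bsub>W\<^esub> (idn W \<one>\<^bsub>W\<^esub> \<odot>\<^bsub>W\<^esub> adj_unit A a)"
    using a by simp
  also have "\<dots> = lunit W (GO A (FO A a)) \<cdot>\<^bsub>W\<^esub> (idn W \<one>\<^bsub>W\<^esub> \<odot>\<^bsub>W\<^esub> adj_unit A a)"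
    using lax_lunit [of "FO A a"] a by simp
  also have "\<dots> = adj_unit A a \<cdot>\<^bsub>W\<^esub> lunit W a"
    by (rule W.lunit_natural) (use a in \<open>simp add: hom_def\<close>)
  also have "\<dots> = sharp (\<one>\<^bsub>W\<^esub> \<otimes>\<^bsub>W\<^esub> a) (FA A (lunit W a))"
    by (rule unit_natural) (use a in \<open>simp add: hom_def\<close>)
  finally show ?thesis
    using sharp_inject [of "\<one>\<^bsub>W\<^esub> \<otimes>\<^bsub>W\<^esub> a" "lunit V (FO A a) \<cdot>\<^bsub>V\<^esub> ?d" "FO A a" "FA A (lunit W a)"] a
    by (simp add: hom_def)
qed

text \<open>The compatibility of \<open>\<delta>\<close> with the left unit constraints exhibits \<open>\<delta>\<close> as a composite of isomorphisms.\<close>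

lemma delta_unit_iso:
  assumes eps: "iso V eps" and a: "a \<in> Obj W"
  shows "iso V (delta \<one>\<^bsub>W\<^esub> a)"
proof -
  let ?l = "lunit V (FO A a) \<cdot>\<^bsub>V\<^esub> (eps \<odot>\<^bsub>V\<^esub> idn V (FO A a))"
  have l: "iso V ?l" "Dom V ?l = FO A \<one>\<^bsub>W\<^esub> \<otimes>\<^bsub>V\<^esub> FO A a" "Cod V ?l = FO A a"
    using eps a by (auto intro!: V.iso_Comp V.iso_tens)
  have "?l \<cdot>\<^bsub>V\<^esub> delta \<one>\<^bsub>W\<^esub> a = FA A (lunit W a)" using oplax_lunit [OF a] a by simp
  moreover have "delta \<one>\<^bsub>W\<^esub> a = inv_arr V ?l \<cdot>\<^bsub>V\<^esub> (?l \<cdot>\<^bsub>V\<^esub> delta \<one>\<^bsub>W\<^esub> a)"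
    using V.inv_cancel(1) [OF l(1), of "delta \<one>\<^bsub>W\<^esub> a"] l a by simp
  ultimately have "delta \<one>\<^bsub>W\<^esub> a = inv_arr V ?l \<cdot>\<^bsub>V\<^esub> FA A (lunit W a)" by simp
  moreover have "iso V (FA A (lunit W a))"
    using functor_iso [OF W.category_axioms V.category_axioms F_functor] a by simp
  ultimately show ?thesis
    using V.iso_Comp [OF _ V.iso_inv [OF l(1)]] l a by simp
qed

subsection \<open>The comparison of internal homs\<close>

abbreviation th where "th \<equiv> theta W V A"

text \<open>The defining property of \<open>\<theta>\<close>, generalised from the identity of \<open>G (ihom (F w) v)\<close> to an arbitrary
  \<open>g : a \<rightarrow> G (ihom (F w) v)\<close>: the map \<open>a \<otimes> w \<rightarrow> G v\<close> named by \<open>\<theta> \<cdot> g\<close> is the adjunct of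
  \<open>F (a \<otimes> w) \<rightarrow> F a \<otimes> F w \<rightarrow> v\<close>, where the first map is \<open>\<delta>\<close> and the second is named by the adjunct of \<open>g\<close>.
  In this form \<open>\<theta>\<close> is visibly a composite of adjunction bijections and of precomposition with \<open>\<delta>\<close>.\<close>

lemma theta:
  assumes w: "w \<in> Obj W" and v: "v \<in> Obj V"
  shows "th w v \<in> hom W (GO A (ihom V (FO A w) v)) (ihom W w (GO A v))"
    "g \<in> hom W a (GO A (ihom V (FO A w) v)) \<Longrightarrow>
      ev W w (GO A v) \<cdot>\<^bsub>W\<^esub> ((th w v \<cdot>\<^bsub>W\<^esub> g) \<odot>\<^bsub>W\<^esub> idn W w) =
      sharp (a \<otimes>\<^bsub>W\<^esub> w) ((ev V (FO A w) v \<cdot>\<^bsub>V\<^esub> (flat a (ihom V (FO A w) v) g \<odot>\<^bsub>V\<^esub> idn V (FO A w))) \<cdot>\<^bsub>V\<^esub> delta a w)"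
proof -
  let ?h = "ihom V (FO A w) v"
  let ?a = "GO A ?h"
  let ?m = "ev V (FO A w) v \<cdot>\<^bsub>V\<^esub> (adj_counit A ?h \<odot>\<^bsub>V\<^esub> idn V (FO A w)) \<cdot>\<^bsub>V\<^esub> delta ?a w"
  have m: "?m \<in> hom V (FO A (?a \<otimes>\<^bsub>W\<^esub> w)) v" using w v by (auto simp: hom_def)
  have sm: "sharp (?a \<otimes>\<^bsub>W\<^esub> w) ?m \<in> hom W (?a \<otimes>\<^bsub>W\<^esub> w) (GO A v)" by (rule sharp_hom [OF _ m]) (use w v in simp)
  have e: "th w v = curry_arr W ?a w (GO A v) (sharp (?a \<otimes>\<^bsub>W\<^esub> w) ?m)"
    by (simp add: theta_def Let_def)
  have "?a \<in> Obj W" "GO A v \<in> Obj W" using w v by simp_all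
  note c = W.curry [OF this(1) w this(2) sm, folded e]
  show "th w v \<in> hom W (GO A ?h) (ihom W w (GO A v))" by (rule c(1))
  assume g: "g \<in> hom W a ?a"
  note a = W.hom_Obj(1) [OF g]
  have th: "th w v \<in> Arr W" "Dom W (th w v) = ?a" "Cod W (th w v) = ihom W w (GO A v)"
    and g': "g \<in> Arr W" "Dom W g = a" "Cod W g = ?a" using c(1) g by (auto simp: hom_def)
  have gw: "g \<odot>\<^bsub>W\<^esub> idn W w \<in> hom W (a \<otimes>\<^bsub>W\<^esub> w) (?a \<otimes>\<^bsub>W\<^esub> w)" using g' w a by (auto simp: hom_def)
  have "ev W w (GO A v) \<cdot>\<^bsub>W\<^esub> ((th w v \<cdot>\<^bsub>W\<^esub> g) \<odot>\<^bsub>W\<^esub> idn W w)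
      = ev W w (GO A v) \<cdot>\<^bsub>W\<^esub> (th w v \<odot>\<^bsub>W\<^esub> idn W w) \<cdot>\<^bsub>W\<^esub> (g \<odot>\<^bsub>W\<^esub> idn W w)"
    using th g' w v a by simp
  also have "\<dots> = sharp (?a \<otimes>\<^bsub>W\<^esub> w) ?m \<cdot>\<^bsub>W\<^esub> (g \<odot>\<^bsub>W\<^esub> idn W w)"
    by (rule W.Comp_extend [OF c(2)]) (use th g' w v a in auto)
  also have "\<dots> = sharp (a \<otimes>\<^bsub>W\<^esub> w) (?m \<cdot>\<^bsub>V\<^esub> FA A (g \<odot>\<^bsub>W\<^esub> idn W w))"
    by (rule sharp_right [OF gw m, symmetric])
  also have "?m \<cdot>\<^bsub>V\<^esub> FA A (g \<odot>\<^bsub>W\<^esub> idn W w) = ev V (FO A w) v \<cdot>\<^bsub>V\<^esub> (adj_counit A ?h \<odot>\<^bsub>V\<^esub> idn V (FO A w))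
      \<cdot>\<^bsub>V\<^esub> (delta ?a w \<cdot>\<^bsub>V\<^esub> FA A (g \<odot>\<^bsub>W\<^esub> idn W w))"
    using g' w v a by simp
  also have "\<dots> = ev V (FO A w) v \<cdot>\<^bsub>V\<^esub> (adj_counit A ?h \<odot>\<^bsub>V\<^esub> idn V (FO A w))
      \<cdot>\<^bsub>V\<^esub> ((FA A g \<odot>\<^bsub>V\<^esub> idn V (FO A w)) \<cdot>\<^bsub>V\<^esub> delta a w)"
    using delta_natural [OF g W.idn_in_hom [OF w]] w by simp
  also have "\<dots> = (ev V (FO A w) v \<cdot>\<^bsub>V\<^esub> (flat a ?h g \<odot>\<^bsub>V\<^esub> idn V (FO A w))) \<cdot>\<^bsub>V\<^esub> delta a w"
    using flat_eq [OF g] g' w v a by simp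
  finally show "ev W w (GO A v) \<cdot>\<^bsub>W\<^esub> ((th w v \<cdot>\<^bsub>W\<^esub> g) \<odot>\<^bsub>W\<^esub> idn W w) =
      sharp (a \<otimes>\<^bsub>W\<^esub> w) ((ev V (FO A w) v \<cdot>\<^bsub>V\<^esub> (flat a ?h g \<odot>\<^bsub>V\<^esub> idn V (FO A w))) \<cdot>\<^bsub>V\<^esub> delta a w)" .
qed

lemma theta_GA:
  assumes w: "w \<in> Obj W" and v: "v \<in> Obj V" and j: "j \<in> hom V x (ihom V (FO A w) v)"
  shows "ev W w (GO A v) \<cdot>\<^bsub>W\<^esub> ((th w v \<cdot>\<^bsub>W\<^esub> GA A j) \<odot>\<^bsub>W\<^esub> idn W w) =
      sharp (GO A x \<otimes>\<^bsub>W\<^esub> w) ((ev V (FO A w) v \<cdot>\<^bsub>V\<^esub> (j \<odot>\<^bsub>V\<^esub> idn V (FO A w)))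
        \<cdot>\<^bsub>V\<^esub> (adj_counit A x \<odot>\<^bsub>V\<^esub> idn V (FO A w)) \<cdot>\<^bsub>V\<^esub> delta (GO A x) w)"
proof -
  note x = V.hom_Obj(1) [OF j]
  have "flat (GO A x) (ihom V (FO A w) v) (GA A j) = j \<cdot>\<^bsub>V\<^esub> adj_counit A x"
    using flat_eq [OF G_hom [OF j]] counit_natural [OF j] w v by simp
  then show ?thesis
    using theta(2) [OF w v G_hom [OF j]] j w v x by (simp add: hom_def)
qed

text \<open>Both sides are compared after evaluation, where they become adjuncts of maps out of
  \<open>F (G (ihom (F w) v) \<otimes> w')\<close>; these agree by naturality of \<open>\<delta>\<close>.\<close>

lemma theta_natural:
  assumes k: "k \<in> hom W w' w" and g: "g \<in> hom V v v'"
  shows "th w' v' \<cdot>\<^bsub>W\<^esub> GA A (ihom_arr V (FA A k) g) = ihom_arr W k (GA A g) \<cdot>\<^bsub>W\<^esub> th w v"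
proof -
  note w = W.hom_Obj [OF k] and v = V.hom_Obj [OF g]
  have k': "k \<in> Arr W" "Dom W k = w'" "Cod W k = w" and g': "g \<in> Arr V" "Dom V g = v" "Cod V g = v'"
    using k g by (auto simp: hom_def)
  let ?h = "ihom V (FO A w) v"
  have h: "?h \<in> Obj V" and Gh: "GO A ?h \<in> Obj W" using w v by simp_all
  note i = V.ihom_arr [OF F_hom [OF k] g]
  note t = theta(1) [OF w(2) v(1)] and t' = theta(1) [OF w(1) v(2)]
  have th: "th w v \<in> Arr W" "Dom W (th w v) = GO A ?h" "Cod W (th w v) = ihom W w (GO A v)"
    using t by (auto simp: hom_def)
  let ?c = "(adj_counit A ?h \<odot>\<^bsub>V\<^esub> FA A k) \<cdot>\<^bsub>V\<^esub> delta (GO A ?h) w'"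
  have "ev V (FO A w') v' \<cdot>\<^bsub>V\<^esub> (ihom_arr V (FA A k) g \<odot>\<^bsub>V\<^esub> idn V (FO A w')) = g \<cdot>\<^bsub>V\<^esub> ev V (FO A w) v \<cdot>\<^bsub>V\<^esub> (idn V ?h \<odot>\<^bsub>V\<^esub> FA A k)"
    using i(2) [OF V.idn_in_hom [OF h]] i(1) by (simp add: hom_def)
  then have "ev W w' (GO A v') \<cdot>\<^bsub>W\<^esub> ((th w' v' \<cdot>\<^bsub>W\<^esub> GA A (ihom_arr V (FA A k) g)) \<odot>\<^bsub>W\<^esub> idn W w')
      = sharp (GO A ?h \<otimes>\<^bsub>W\<^esub> w') ((g \<cdot>\<^bsub>V\<^esub> ev V (FO A w) v \<cdot>\<^bsub>V\<^esub> (idn V ?h \<odot>\<^bsub>V\<^esub> FA A k))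
        \<cdot>\<^bsub>V\<^esub> (adj_counit A ?h \<odot>\<^bsub>V\<^esub> idn V (FO A w')) \<cdot>\<^bsub>V\<^esub> delta (GO A ?h) w')"
    using theta_GA [OF w(1) v(2) i(1)] by simp
  also have "(g \<cdot>\<^bsub>V\<^esub> ev V (FO A w) v \<cdot>\<^bsub>V\<^esub> (idn V ?h \<odot>\<^bsub>V\<^esub> FA A k))
        \<cdot>\<^bsub>V\<^esub> (adj_counit A ?h \<odot>\<^bsub>V\<^esub> idn V (FO A w')) \<cdot>\<^bsub>V\<^esub> delta (GO A ?h) w' = g \<cdot>\<^bsub>V\<^esub> ev V (FO A w) v \<cdot>\<^bsub>V\<^esub> ?c"
    using g' k' w v by simp
  finally have L: "ev W w' (GO A v') \<cdot>\<^bsub>W\<^esub> ((th w' v' \<cdot>\<^bsub>W\<^esub> GA A (ihom_arr V (FA A k) g)) \<odot>\<^bsub>W\<^esub> idn W w')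
      = sharp (GO A ?h \<otimes>\<^bsub>W\<^esub> w') (g \<cdot>\<^bsub>V\<^esub> ev V (FO A w) v \<cdot>\<^bsub>V\<^esub> ?c)" .
  have e0: "ev W w (GO A v) \<cdot>\<^bsub>W\<^esub> (th w v \<odot>\<^bsub>W\<^esub> idn W w)
      = sharp (GO A ?h \<otimes>\<^bsub>W\<^esub> w) (ev V (FO A w) v \<cdot>\<^bsub>V\<^esub> (adj_counit A ?h \<odot>\<^bsub>V\<^esub> idn V (FO A w)) \<cdot>\<^bsub>V\<^esub> delta (GO A ?h) w)"
    using theta_GA [OF w(2) v(1) V.idn_in_hom [OF h]] th w v by simp
  have hk: "idn W (GO A ?h) \<odot>\<^bsub>W\<^esub> k \<in> hom W (GO A ?h \<otimes>\<^bsub>W\<^esub> w') (GO A ?h \<otimes>\<^bsub>W\<^esub> w)"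
    using k' w v by (auto simp: hom_def)
  have "ev W w' (GO A v') \<cdot>\<^bsub>W\<^esub> ((ihom_arr W k (GA A g) \<cdot>\<^bsub>W\<^esub> th w v) \<odot>\<^bsub>W\<^esub> idn W w')
      = GA A g \<cdot>\<^bsub>W\<^esub> ev W w (GO A v) \<cdot>\<^bsub>W\<^esub> (th w v \<odot>\<^bsub>W\<^esub> k)"
    by (rule W.ihom_arr(2) [OF k G_hom [OF g] t])
  also have "\<dots> = GA A g \<cdot>\<^bsub>W\<^esub> (ev W w (GO A v) \<cdot>\<^bsub>W\<^esub> (th w v \<odot>\<^bsub>W\<^esub> idn W w)) \<cdot>\<^bsub>W\<^esub> (idn W (GO A ?h) \<odot>\<^bsub>W\<^esub> k)"
    using th g' k' w v by simp
  also have "\<dots> = GA A g \<cdot>\<^bsub>W\<^esub> sharp (GO A ?h \<otimes>\<^bsub>W\<^esub> w') ((ev V (FO A w) v \<cdot>\<^bsub>V\<^esub> (adj_counit A ?h \<odot>\<^bsub>V\<^esub> idn V (FO A w)) \<cdot>\<^bsub>V\<^esub> delta (GO A ?h) w)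
      \<cdot>\<^bsub>V\<^esub> FA A (idn W (GO A ?h) \<odot>\<^bsub>W\<^esub> k))"
    unfolding e0 by (subst sharp_right [OF hk]) (use w v in \<open>auto simp: hom_def\<close>)
  also have "(ev V (FO A w) v \<cdot>\<^bsub>V\<^esub> (adj_counit A ?h \<odot>\<^bsub>V\<^esub> idn V (FO A w)) \<cdot>\<^bsub>V\<^esub> delta (GO A ?h) w)
      \<cdot>\<^bsub>V\<^esub> FA A (idn W (GO A ?h) \<odot>\<^bsub>W\<^esub> k) = ev V (FO A w) v \<cdot>\<^bsub>V\<^esub> (adj_counit A ?h \<odot>\<^bsub>V\<^esub> idn V (FO A w))
      \<cdot>\<^bsub>V\<^esub> (delta (GO A ?h) w \<cdot>\<^bsub>V\<^esub> FA A (idn W (GO A ?h) \<odot>\<^bsub>W\<^esub> k))"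
    using k' w v by simp
  also have "\<dots> = ev V (FO A w) v \<cdot>\<^bsub>V\<^esub> ?c"
    unfolding delta_natural [OF W.idn_in_hom [OF Gh] k] using k' w v by simp
  also have "GA A g \<cdot>\<^bsub>W\<^esub> sharp (GO A ?h \<otimes>\<^bsub>W\<^esub> w') (ev V (FO A w) v \<cdot>\<^bsub>V\<^esub> ?c)
      = sharp (GO A ?h \<otimes>\<^bsub>W\<^esub> w') (g \<cdot>\<^bsub>V\<^esub> ev V (FO A w) v \<cdot>\<^bsub>V\<^esub> ?c)"
    by (rule sharp_left [OF _ _ g, symmetric]) (use k' w v in \<open>auto simp: hom_def\<close>)
  finally have R: "ev W w' (GO A v') \<cdot>\<^bsub>W\<^esub> ((ihom_arr W k (GA A g) \<cdot>\<^bsub>W\<^esub> th w v) \<odot>\<^bsub>W\<^esub> idn W w')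
      = sharp (GO A ?h \<otimes>\<^bsub>W\<^esub> w') (g \<cdot>\<^bsub>V\<^esub> ev V (FO A w) v \<cdot>\<^bsub>V\<^esub> ?c)" .
  show ?thesis
    by (rule W.ihom_ext [OF W.Comp_in_hom [OF G_hom [OF i(1)] t'] W.Comp_in_hom [OF t W.ihom_arr(1) [OF k G_hom [OF g]]]])
      (use w v L R in simp_all)
qed

text \<open>After evaluation this becomes the compatibility of the oplax structure with the right unit
  constraints.\<close>

lemma theta_unit:
  assumes v: "v \<in> Obj V"
  shows "th \<one>\<^bsub>W\<^esub> v \<cdot>\<^bsub>W\<^esub> GA A (ihom_arr V eps (idn V v) \<cdot>\<^bsub>V\<^esub> unit_ihom V v) = unit_ihom W (GO A v)"
proof -
  note i = V.ihom_arr [OF eps(1) V.idn_in_hom [OF v]] and u = V.unit_ihom [OF v]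
  let ?j = "ihom_arr V eps (idn V v) \<cdot>\<^bsub>V\<^esub> unit_ihom V v"
  let ?I = "FO A \<one>\<^bsub>W\<^esub>"
  have j: "?j \<in> hom V v (ihom V ?I v)" by (rule V.Comp_in_hom [OF u(1) i(1)])
  have u': "unit_ihom V v \<in> Arr V" "Dom V (unit_ihom V v) = v" "Cod V (unit_ihom V v) = ihom V \<one>\<^bsub>V\<^esub> v"
    using u(1) by (auto simp: hom_def)
  have "ev V ?I v \<cdot>\<^bsub>V\<^esub> (?j \<odot>\<^bsub>V\<^esub> idn V ?I) = (ev V \<one>\<^bsub>V\<^esub> v \<cdot>\<^bsub>V\<^esub> (unit_ihom V v \<odot>\<^bsub>V\<^esub> idn V \<one>\<^bsub>V\<^esub>)) \<cdot>\<^bsub>V\<^esub> (idn V v \<odot>\<^bsub>V\<^esub> eps)"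
    using i(2) [OF u(1)] u' v by simp
  then have ej: "ev V ?I v \<cdot>\<^bsub>V\<^esub> (?j \<odot>\<^bsub>V\<^esub> idn V ?I) = runit V v \<cdot>\<^bsub>V\<^esub> (idn V v \<odot>\<^bsub>V\<^esub> eps)"
    unfolding u(2) .
  have "ev W \<one>\<^bsub>W\<^esub> (GO A v) \<cdot>\<^bsub>W\<^esub> ((th \<one>\<^bsub>W\<^esub> v \<cdot>\<^bsub>W\<^esub> GA A ?j) \<odot>\<^bsub>W\<^esub> idn W \<one>\<^bsub>W\<^esub>)
      = sharp (GO A v \<otimes>\<^bsub>W\<^esub> \<one>\<^bsub>W\<^esub>) ((runit V v \<cdot>\<^bsub>V\<^esub> (idn V v \<odot>\<^bsub>V\<^esub> eps))
        \<cdot>\<^bsub>V\<^esub> (adj_counit A v \<odot>\<^bsub>V\<^esub> idn V ?I) \<cdot>\<^bsub>V\<^esub> delta (GO A v) \<one>\<^bsub>W\<^esub>)"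
    using theta_GA [OF W.munit_Obj v j] ej by simp
  also have "(runit V v \<cdot>\<^bsub>V\<^esub> (idn V v \<odot>\<^bsub>V\<^esub> eps)) \<cdot>\<^bsub>V\<^esub> (adj_counit A v \<odot>\<^bsub>V\<^esub> idn V ?I) \<cdot>\<^bsub>V\<^esub> delta (GO A v) \<one>\<^bsub>W\<^esub>
      = runit V v \<cdot>\<^bsub>V\<^esub> (adj_counit A v \<odot>\<^bsub>V\<^esub> idn V \<one>\<^bsub>V\<^esub>) \<cdot>\<^bsub>V\<^esub> (idn V (FO A (GO A v)) \<odot>\<^bsub>V\<^esub> eps) \<cdot>\<^bsub>V\<^esub> delta (GO A v) \<one>\<^bsub>W\<^esub>"
    using v by simp
  also have "\<dots> = adj_counit A v \<cdot>\<^bsub>V\<^esub> runit V (FO A (GO A v)) \<cdot>\<^bsub>V\<^esub> (idn V (FO A (GO A v)) \<odot>\<^bsub>V\<^esub> eps) \<cdot>\<^bsub>V\<^esub> delta (GO A v) \<one>\<^bsub>W\<^esub>"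
    using V.Comp_extend [OF V.runit_natural [of "adj_counit A v" "FO A (GO A v)" v],
        of "(idn V (FO A (GO A v)) \<odot>\<^bsub>V\<^esub> eps) \<cdot>\<^bsub>V\<^esub> delta (GO A v) \<one>\<^bsub>W\<^esub>"] v by (simp add: hom_def)
  also have "\<dots> = adj_counit A v \<cdot>\<^bsub>V\<^esub> FA A (runit W (GO A v))"
    using oplax_runit [of "GO A v"] v by simp
  also have "sharp (GO A v \<otimes>\<^bsub>W\<^esub> \<one>\<^bsub>W\<^esub>) (adj_counit A v \<cdot>\<^bsub>V\<^esub> FA A (runit W (GO A v))) = runit W (GO A v)"
    by (rule sharp_counit) (use v in \<open>auto simp: hom_def\<close>)
  finally have L: "ev W \<one>\<^bsub>W\<^esub> (GO A v) \<cdot>\<^bsub>W\<^esub> ((th \<one>\<^bsub>W\<^esub> v \<cdot>\<^bsub>W\<^esub> GA A ?j) \<odot>\<^bsub>W\<^esub> idn W \<one>\<^bsub>W\<^esub>) = runit W (GO A v)" .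
  show ?thesis
    by (rule W.ihom_ext [OF W.Comp_in_hom [OF G_hom [OF j] theta(1) [OF W.munit_Obj v]] W.unit_ihom(1)])
      (use v L W.unit_ihom(2) in simp_all)
qed

text \<open>Naturality of the structure map \<open>\<theta> \<cdot> G p\<close> of an induced weak tensoring or cotensoring, and in the next
  lemma its compatibility with the units, given the same for \<open>p\<close>.\<close>

lemma theta_comp_natural:
  assumes k: "k \<in> hom W w' w" and p: "p \<in> hom V a (ihom V (FO A w) b)" and p': "p' \<in> hom V a' (ihom V (FO A w') b')"
    and e: "e \<in> hom V a a'" and g: "g \<in> hom V b b'" and eq: "p' \<cdot>\<^bsub>V\<^esub> e = ihom_arr V (FA A k) g \<cdot>\<^bsub>V\<^esub> p"
  shows "(th w' b' \<cdot>\<^bsub>W\<^esub> GA A p') \<cdot>\<^bsub>W\<^esub> GA A e = ihom_arr W k (GA A g) \<cdot>\<^bsub>W\<^esub> (th w b \<cdot>\<^bsub>W\<^esub> GA A p)"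
proof -
  note w = W.hom_Obj [OF k] and b = V.hom_Obj [OF g]
  note t = theta(1) [OF w(2) b(1)] and t' = theta(1) [OF w(1) b(2)]
  note i = V.ihom_arr(1) [OF F_hom [OF k] g]
  have "(th w' b' \<cdot>\<^bsub>W\<^esub> GA A p') \<cdot>\<^bsub>W\<^esub> GA A e = th w' b' \<cdot>\<^bsub>W\<^esub> GA A (p' \<cdot>\<^bsub>V\<^esub> e)"
    unfolding G_Comp [OF e p'] by (rule W.Comp_assoc [OF G_hom [OF e] G_hom [OF p'] t', symmetric])
  also have "\<dots> = (th w' b' \<cdot>\<^bsub>W\<^esub> GA A (ihom_arr V (FA A k) g)) \<cdot>\<^bsub>W\<^esub> GA A p"
    unfolding eq G_Comp [OF p i] by (rule W.Comp_assoc [OF G_hom [OF p] G_hom [OF i] t'])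
  also have "\<dots> = ihom_arr W k (GA A g) \<cdot>\<^bsub>W\<^esub> (th w b \<cdot>\<^bsub>W\<^esub> GA A p)"
    unfolding theta_natural [OF k g] by (rule W.Comp_assoc [OF G_hom [OF p] t W.ihom_arr(1) [OF k G_hom [OF g]], symmetric])
  finally show ?thesis .
qed

lemma theta_comp_unit:
  assumes p: "p \<in> hom V a (ihom V (FO A \<one>\<^bsub>W\<^esub>) b)" and e: "e \<in> hom V b a"
    and eq: "p \<cdot>\<^bsub>V\<^esub> e = ihom_arr V eps (idn V b) \<cdot>\<^bsub>V\<^esub> unit_ihom V b"
  shows "(th \<one>\<^bsub>W\<^esub> b \<cdot>\<^bsub>W\<^esub> GA A p) \<cdot>\<^bsub>W\<^esub> GA A e = unit_ihom W (GO A b)"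
  unfolding theta_unit [OF V.hom_Obj(1) [OF e], symmetric] eq [symmetric] G_Comp [OF e p]
  by (rule W.Comp_assoc [OF G_hom [OF e] G_hom [OF p] theta(1) [OF W.munit_Obj V.hom_Obj(1) [OF e]], symmetric])

text \<open>On elements \<open>\<theta>\<close> is the composite
  \<open>W(\<one>, G (ihom (F w) v)) \<cong> V(F \<one> \<otimes> F w, v) \<cong> V(F (\<one> \<otimes> w), v) \<cong> W(\<one>, ihom w (G v))\<close>, whose middle map is
  precomposition with the isomorphism \<open>\<delta>\<close>.\<close>

lemma theta_set_bijective:
  assumes eps: "iso V eps" and w: "w \<in> Obj W" and v: "v \<in> Obj V"
  shows "bij_betw (\<lambda>g. th w v \<cdot>\<^bsub>W\<^esub> g) (hom W \<one>\<^bsub>W\<^esub> (GO A (ihom V (FO A w) v))) (hom W \<one>\<^bsub>W\<^esub> (ihom W w (GO A v)))"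
proof -
  let ?h = "ihom V (FO A w) v" and ?I = "\<one>\<^bsub>W\<^esub>"
  have h: "?h \<in> Obj V" and Gv: "GO A v \<in> Obj W" and Fw: "FO A w \<in> Obj V" and Iw: "?I \<otimes>\<^bsub>W\<^esub> w \<in> Obj W"
    and FI: "FO A ?I \<in> Obj V" using w v by simp_all
  note t = theta [OF w v]
  have d: "iso V (delta ?I w)" using delta_unit_iso [OF eps w] .
  have n: "(ev V (FO A w) v \<cdot>\<^bsub>V\<^esub> (flat ?I ?h g \<odot>\<^bsub>V\<^esub> idn V (FO A w))) \<cdot>\<^bsub>V\<^esub> delta ?I w \<in> hom V (FO A (?I \<otimes>\<^bsub>W\<^esub> w)) v"
    and n': "ev V (FO A w) v \<cdot>\<^bsub>V\<^esub> (flat ?I ?h g \<odot>\<^bsub>V\<^esub> idn V (FO A w)) \<in> hom V (FO A ?I \<otimes>\<^bsub>V\<^esub> FO A w) v"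
    if "g \<in> hom W ?I (GO A ?h)" for g
    using V.ev_tens_hom [OF flat(1) [OF that h] Fw v] V.Comp_in_hom [OF delta(1) [OF W.munit_Obj w]] by blast+
  show ?thesis
    unfolding bij_betw_def
  proof (intro conjI equalityI subsetI)
    show "inj_on (\<lambda>g. th w v \<cdot>\<^bsub>W\<^esub> g) (hom W ?I (GO A ?h))"
    proof (rule inj_onI)
      fix g g' assume g: "g \<in> hom W ?I (GO A ?h)" and g': "g' \<in> hom W ?I (GO A ?h)"
        and eq: "th w v \<cdot>\<^bsub>W\<^esub> g = th w v \<cdot>\<^bsub>W\<^esub> g'"
      have "(ev V (FO A w) v \<cdot>\<^bsub>V\<^esub> (flat ?I ?h g \<odot>\<^bsub>V\<^esub> idn V (FO A w))) \<cdot>\<^bsub>V\<^esub> delta ?I w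
          = (ev V (FO A w) v \<cdot>\<^bsub>V\<^esub> (flat ?I ?h g' \<odot>\<^bsub>V\<^esub> idn V (FO A w))) \<cdot>\<^bsub>V\<^esub> delta ?I w"
        using sharp_inject [OF Iw n [OF g] n [OF g']] t(2) [OF g] t(2) [OF g'] eq by simp
      then have "ev V (FO A w) v \<cdot>\<^bsub>V\<^esub> (flat ?I ?h g \<odot>\<^bsub>V\<^esub> idn V (FO A w)) = ev V (FO A w) v \<cdot>\<^bsub>V\<^esub> (flat ?I ?h g' \<odot>\<^bsub>V\<^esub> idn V (FO A w))"
        by (rule V.iso_epic_hom [OF d delta(1) [OF W.munit_Obj w] n' [OF g] n' [OF g']])
      then have "flat ?I ?h g = flat ?I ?h g'"
        by (rule V.ihom_ext [OF flat(1) [OF g h] flat(1) [OF g' h] Fw v])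
      then have "sharp ?I (flat ?I ?h g) = sharp ?I (flat ?I ?h g')" by (rule arg_cong)
      then show "g = g'" by (simp only: flat(2) [OF g h] flat(2) [OF g' h])
    qed
    show "k \<in> hom W ?I (ihom W w (GO A v))" if "k \<in> (\<lambda>g. th w v \<cdot>\<^bsub>W\<^esub> g) ` hom W ?I (GO A ?h)" for k
      using that t(1) W.Comp_in_hom by blast
    show "k \<in> (\<lambda>g. th w v \<cdot>\<^bsub>W\<^esub> g) ` hom W ?I (GO A ?h)" if k: "k \<in> hom W ?I (ihom W w (GO A v))" for k
    proof -
      define u where "u = ev W w (GO A v) \<cdot>\<^bsub>W\<^esub> (k \<odot>\<^bsub>W\<^esub> idn W w)"
      have u: "u \<in> hom W (?I \<otimes>\<^bsub>W\<^esub> w) (GO A v)" unfolding u_def by (rule W.ev_tens_hom [OF k w Gv])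
      define l where "l = flat (?I \<otimes>\<^bsub>W\<^esub> w) v u \<cdot>\<^bsub>V\<^esub> inv_arr V (delta ?I w)"
      have l: "l \<in> hom V (FO A ?I \<otimes>\<^bsub>V\<^esub> FO A w) v" "l \<cdot>\<^bsub>V\<^esub> delta ?I w = flat (?I \<otimes>\<^bsub>W\<^esub> w) v u"
        unfolding l_def using flat(1) [OF u v] d w by (auto simp: hom_def)
      note c = V.curry [OF FI Fw v l(1)]
      define g where "g = sharp ?I (curry_arr V (FO A ?I) (FO A w) v l)"
      have g: "g \<in> hom W ?I (GO A ?h)" unfolding g_def by (rule sharp_hom [OF W.munit_Obj c(1)])
      have fg: "flat ?I ?h g = curry_arr V (FO A ?I) (FO A w) v l"
        by (rule flatI [OF W.munit_Obj c(1)]) (simp add: g_def)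
      have "ev W w (GO A v) \<cdot>\<^bsub>W\<^esub> ((th w v \<cdot>\<^bsub>W\<^esub> g) \<odot>\<^bsub>W\<^esub> idn W w) = u"
        using t(2) [OF g] flat(2) [OF u v] unfolding fg c(2) l(2) by simp
      then have "th w v \<cdot>\<^bsub>W\<^esub> g = k"
        using W.ihom_ext [OF W.Comp_in_hom [OF g t(1)] k w Gv] u_def by simp
      then show ?thesis using g by blast
    qed
  qed
qed

end


text \<open>If \<open>w\<close> is cofibrant and \<open>v\<close> is fibrant, then for cofibrant \<open>a\<close> the map induced by \<open>\<theta>\<close> is the
  composite of the bijections
  \<open>[a, G (ihom (F w) v)] \<cong> [F a, ihom (F w) v] \<cong> [F a \<otimes> F w, v] \<cong> [F (a \<otimes> w), v] \<cong> [a \<otimes> w, G v]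
  \<cong> [a, ihom w (G v)]\<close>, of which the middle one is precomposition with \<open>\<delta>\<close>.\<close>

locale weak_monoidal_quillen_adjunction =
  lax_monoidal_adjunction W V A + W: complete_monoidal_model_category U W MW
  + V: complete_monoidal_model_category U V MV
  for U :: "'u itself" and W :: "('wo, 'wm, 'x) smc_scheme" and MW
    and V :: "('vo, 'vm, 'y) smc_scheme" and MV and A +
  assumes F_Cof: "i \<in> Cof MW \<Longrightarrow> FA A i \<in> Cof MV"
    and F_acyclic_Cof: "i \<in> Cof MW \<Longrightarrow> i \<in> Weq MW \<Longrightarrow> FA A i \<in> Weq MV"
    and delta_Weq: "cofibrant W MW a \<Longrightarrow> cofibrant W MW b \<Longrightarrow> delta a b \<in> Weq MV"
    and unit_replacement: "\<exists>q. cofibrant_replacement W MW \<one>\<^bsub>W\<^esub> q \<and> eps \<cdot>\<^bsub>V\<^esub> FA A q \<in> Weq MV"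
begin

sublocale quillen_adjunction U W MW V MV "FO A" "FA A" "GO A" "GA A" sharp
  by unfold_locales (auto intro: F_Cof F_acyclic_Cof)

theorem theta_Weq:
  assumes w: "cofibrant W MW w" and v: "fibrant V MV v"
  shows "th w v \<in> Weq MW"
proof -
  have Fw: "cofibrant V MV (FO A w)" using w by (rule Fo_cofibrant)
  interpret VQ: quillen_adjunction U V MV V MV "\<lambda>a. a \<otimes>\<^bsub>V\<^esub> FO A w" "\<lambda>f. f \<odot>\<^bsub>V\<^esub> idn V (FO A w)"
    "ihom V (FO A w)" "ihom_arr V (idn V (FO A w))" "\<lambda>a h. curry_arr V a (FO A w) (Cod V h) h"
    using V.tensor_hom_quillen [OF Fw] .
  interpret WQ: quillen_adjunction U W MW W MW "\<lambda>a. a \<otimes>\<^bsub>W\<^esub> w" "\<lambda>f. f \<odot>\<^bsub>W\<^esub> idn W w"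
    "ihom W w" "ihom_arr W (idn W w)" "\<lambda>a h. curry_arr W a w (Cod W h) h"
    using W.tensor_hom_quillen [OF w] .
  let ?h = "ihom V (FO A w) v"
  have ob: "w \<in> Obj W" "FO A w \<in> Obj V" "v \<in> Obj V" "GO A v \<in> Obj W"
    using w v W.cofibrant_Obj V.fibrant_Obj by simp_all
  then have h0: "?h \<in> Obj V" by simp
  have h: "fibrant V MV ?h" using VQ.Go_fibrant [OF v] .
  have Gv: "fibrant W MW (GO A v)" using Go_fibrant [OF v] .
  note t = theta [OF ob(1,3)]
  \<comment> \<open>the map \<open>F a \<otimes> F w \<rightarrow> v\<close> named by the adjunct of \<open>g\<close>\<close>
  let ?n = "\<lambda>a g. ev V (FO A w) v \<cdot>\<^bsub>V\<^esub> (flat a ?h g \<odot>\<^bsub>V\<^esub> idn V (FO A w))"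
  have n: "?n a g \<in> hom V (FO A a \<otimes>\<^bsub>V\<^esub> FO A w) v"
    "curry_arr V (FO A a) (FO A w) v (?n a g) = flat a ?h g"
    if "g \<in> hom W a (GO A ?h)" for a g
    using V.ev_tens_hom [OF flat(1) [OF that h0] ob(2,3)] V.curryI [OF flat(1) [OF that h0] ob(2,3) refl] by auto
  have tg: "th w v \<cdot>\<^bsub>W\<^esub> g = curry_arr W a w (GO A v) (sharp (a \<otimes>\<^bsub>W\<^esub> w) (?n a g \<cdot>\<^bsub>V\<^esub> delta a w))"
    if g: "g \<in> hom W a (GO A ?h)" for a g
    using W.curryI [OF W.Comp_in_hom [OF g t(1)] ob(1,4) t(2) [OF g]] by simp
  have curryW: "W.ho_eq MW a (ihom W w (GO A v)) (curry_arr W a w (GO A v) f) (curry_arr W a w (GO A v) f')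
      \<longleftrightarrow> W.ho_eq MW (a \<otimes>\<^bsub>W\<^esub> w) (GO A v) f f'"
    if "cofibrant W MW a" "f \<in> hom W (a \<otimes>\<^bsub>W\<^esub> w) (GO A v)" "f' \<in> hom W (a \<otimes>\<^bsub>W\<^esub> w) (GO A v)" for a f f'
    using WQ.sharp_ho_eq [OF that(1) Gv that(2,3)] that(2,3) by (simp add: hom_def)
  have curryV: "V.ho_eq MV b ?h (curry_arr V b (FO A w) v f) (curry_arr V b (FO A w) v f')
      \<longleftrightarrow> V.ho_eq MV (b \<otimes>\<^bsub>V\<^esub> FO A w) v f f'"
    if "cofibrant V MV b" "f \<in> hom V (b \<otimes>\<^bsub>V\<^esub> FO A w) v" "f' \<in> hom V (b \<otimes>\<^bsub>V\<^esub> FO A w) v" for b f f'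
    using VQ.sharp_ho_eq [OF that(1) v that(2,3)] that(2,3) by (simp add: hom_def)
  have d: "delta a w \<in> hom V (FO A (a \<otimes>\<^bsub>W\<^esub> w)) (FO A a \<otimes>\<^bsub>V\<^esub> FO A w)" "delta a w \<in> Weq MV"
    if "cofibrant W MW a" for a
    using delta(1) [OF W.cofibrant_Obj [OF that] ob(1)] delta_Weq [OF that w] by auto
  have aw: "cofibrant W MW (a \<otimes>\<^bsub>W\<^esub> w)" if "cofibrant W MW a" for a
    using WQ.Fo_cofibrant [OF that] .
  show ?thesis
  proof (rule W.Weq_if_ho_bijective [OF Go_fibrant [OF h] WQ.Go_fibrant [OF Gv] t(1)])
    fix a g g'
    assume a: "cofibrant W MW a" and g: "g \<in> hom W a (GO A ?h)" and g': "g' \<in> hom W a (GO A ?h)"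
      and eq: "W.ho_eq MW a (ihom W w (GO A v)) (th w v \<cdot>\<^bsub>W\<^esub> g) (th w v \<cdot>\<^bsub>W\<^esub> g')"
    note nd = V.Comp_in_hom [OF d(1) [OF a] n(1) [OF g]] V.Comp_in_hom [OF d(1) [OF a] n(1) [OF g']]
    note Fa = Fo_cofibrant [OF a]
    have "W.ho_eq MW (a \<otimes>\<^bsub>W\<^esub> w) (GO A v) (sharp (a \<otimes>\<^bsub>W\<^esub> w) (?n a g \<cdot>\<^bsub>V\<^esub> delta a w)) (sharp (a \<otimes>\<^bsub>W\<^esub> w) (?n a g' \<cdot>\<^bsub>V\<^esub> delta a w))"
      using eq curryW [OF a] sharp_hom [OF W.cofibrant_Obj [OF aw [OF a]] nd(1)]
        sharp_hom [OF W.cofibrant_Obj [OF aw [OF a]] nd(2)] unfolding tg [OF g] tg [OF g'] by blast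
    then have "V.ho_eq MV (FO A (a \<otimes>\<^bsub>W\<^esub> w)) v (?n a g \<cdot>\<^bsub>V\<^esub> delta a w) (?n a g' \<cdot>\<^bsub>V\<^esub> delta a w)"
      using sharp_ho_eq [OF aw [OF a] v nd] by blast
    then have "V.ho_eq MV (FO A a \<otimes>\<^bsub>V\<^esub> FO A w) v (?n a g) (?n a g')"
      by (rule V.ho_eq_cancel_right [OF d [OF a] n(1) [OF g] n(1) [OF g']])
    then have "V.ho_eq MV (FO A a) ?h (flat a ?h g) (flat a ?h g')"
      using curryV [OF Fa n(1) [OF g] n(1) [OF g']] n(2) [OF g] n(2) [OF g'] by simp
    then show "W.ho_eq MW a (GO A ?h) g g'"
      using sharp_ho_eq [OF a h flat(1) [OF g h0] flat(1) [OF g' h0]] flat(2) [OF g h0] flat(2) [OF g' h0] by simp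
  next
    fix a k
    assume a: "cofibrant W MW a" and k: "k \<in> hom W a (ihom W w (GO A v))"
    note Fa = Fo_cofibrant [OF a] and a0 = W.cofibrant_Obj [OF a] and aw0 = W.cofibrant_Obj [OF aw [OF a]]
    define u where "u = ev W w (GO A v) \<cdot>\<^bsub>W\<^esub> (k \<odot>\<^bsub>W\<^esub> idn W w)"
    have u: "u \<in> hom W (a \<otimes>\<^bsub>W\<^esub> w) (GO A v)" unfolding u_def by (rule W.ev_tens_hom [OF k ob(1,4)])
    have ku: "curry_arr W a w (GO A v) u = k" by (rule W.curryI [OF k ob(1,4)]) (simp add: u_def)
    note fu = flat [OF u ob(3)]
    have faw: "cofibrant V MV (FO A a \<otimes>\<^bsub>V\<^esub> FO A w)" using VQ.Fo_cofibrant [OF Fa] .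
    obtain l where l: "l \<in> hom V (FO A a \<otimes>\<^bsub>V\<^esub> FO A w) v"
      and ll: "V.ho_eq MV (FO A (a \<otimes>\<^bsub>W\<^esub> w)) v (l \<cdot>\<^bsub>V\<^esub> delta a w) (flat (a \<otimes>\<^bsub>W\<^esub> w) v u)"
      using V.ho_eq_precomp_surj [OF faw v d [OF a] fu(1)] by blast
    note c = V.curry [OF V.cofibrant_Obj [OF Fa] ob(2,3) l]
    define g where "g = sharp a (curry_arr V (FO A a) (FO A w) v l)"
    have g: "g \<in> hom W a (GO A ?h)" unfolding g_def by (rule sharp_hom [OF a0 c(1)])
    have fg: "flat a ?h g = curry_arr V (FO A a) (FO A w) v l"
      by (rule flatI [OF a0 c(1)]) (simp add: g_def)
    have tgl: "th w v \<cdot>\<^bsub>W\<^esub> g = curry_arr W a w (GO A v) (sharp (a \<otimes>\<^bsub>W\<^esub> w) (l \<cdot>\<^bsub>V\<^esub> delta a w))"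
      unfolding tg [OF g] fg c(2) ..
    note ld = V.Comp_in_hom [OF d(1) [OF a] l]
    have "W.ho_eq MW (a \<otimes>\<^bsub>W\<^esub> w) (GO A v) (sharp (a \<otimes>\<^bsub>W\<^esub> w) (l \<cdot>\<^bsub>V\<^esub> delta a w)) u"
      using sharp_ho_eq [OF aw [OF a] v ld fu(1)] ll fu(2) by simp
    then have "W.ho_eq MW a (ihom W w (GO A v)) (th w v \<cdot>\<^bsub>W\<^esub> g) k"
      using curryW [OF a sharp_hom [OF aw0 ld] u] unfolding tgl ku by simp
    then show "\<exists>g\<in>hom W a (GO A ?h). W.ho_eq MW a (ihom W w (GO A v)) (th w v \<cdot>\<^bsub>W\<^esub> g) k"
      using g by blast
  qed
qed

end


section \<open>Enriched categories\<close>

locale enriched = symmetric_monoidal_closed V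
  for V :: "('o, 'm, 'x) smc_scheme" (structure) and C :: "('c, 'o, 'm) vcat" +
  assumes enriched: "enriched_category V C"
begin

abbreviation C0 where "C0 \<equiv> underlying V C"

lemma EHom_Obj [simp]: "x \<in> EObj C \<Longrightarrow> y \<in> EObj C \<Longrightarrow> EHom C x y \<in> Obj V"
  using enriched by (simp add: enriched_category_def)

lemma EId_simps [simp]:
  assumes "x \<in> EObj C"
  shows "EId C x \<in> Arr V" "Dom V (EId C x) = \<one>" "Cod V (EId C x) = EHom C x x"
  using enriched assms by (auto simp: enriched_category_def hom_def)

lemma EComp_simps [simp]:
  assumes "x \<in> EObj C" "y \<in> EObj C" "z \<in> EObj C"
  shows "EComp C x y z \<in> Arr V" "Dom V (EComp C x y z) = EHom C y z \<otimes> EHom C x y"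
    "Cod V (EComp C x y z) = EHom C x z"
  using enriched assms by (auto simp: enriched_category_def hom_def)

lemma EComp_assoc:
  "w \<in> EObj C \<Longrightarrow> x \<in> EObj C \<Longrightarrow> y \<in> EObj C \<Longrightarrow> z \<in> EObj C \<Longrightarrow>
     EComp C w x z \<cdot> (EComp C x y z \<odot> idn V (EHom C w x)) =
     EComp C w y z \<cdot> (idn V (EHom C y z) \<odot> EComp C w x y)
       \<cdot> assoc V (EHom C y z) (EHom C x y) (EHom C w x)"
  and EComp_left: "x \<in> EObj C \<Longrightarrow> y \<in> EObj C \<Longrightarrow>
     EComp C x y y \<cdot> (EId C y \<odot> idn V (EHom C x y)) = lunit V (EHom C x y)"
  and EComp_right: "x \<in> EObj C \<Longrightarrow> y \<in> EObj C \<Longrightarrow>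
     EComp C x x y \<cdot> (idn V (EHom C x y) \<odot> EId C x) = runit V (EHom C x y)"
  using enriched unfolding enriched_category_def by blast+

lemma underlying_simps [simp]:
  "Obj C0 = EObj C" "idn C0 x = (x, x, EId C x)" "Dom C0 (x, y, f) = x" "Cod C0 (x, y, f) = y"
  "(x, y, f) \<in> Arr C0 \<longleftrightarrow> x \<in> EObj C \<and> y \<in> EObj C \<and> f \<in> hom V \<one> (EHom C x y)"
  by (simp_all add: underlying_def)

lemma hom_underlying:
  "h \<in> hom C0 x y \<longleftrightarrow> x \<in> EObj C \<and> y \<in> EObj C \<and> (\<exists>f\<in>hom V \<one> (EHom C x y). h = (x, y, f))"
  by (cases h) (auto simp: hom_def [of C0])

text \<open>Postcomposition with an element \<open>g\<close> of \<open>EHom C y y'\<close> and, below, precomposition with an element \<open>f\<close> of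
  \<open>EHom C x' x\<close>. The two commute, and \<open>EHom C f g\<close> is their composite.\<close>

definition post :: "'c \<Rightarrow> 'c \<Rightarrow> 'c \<Rightarrow> 'm \<Rightarrow> 'm" where
  "post x y y' g = EComp C x y y' \<cdot> (g \<odot> idn V (EHom C x y)) \<cdot> inv_arr V (lunit V (EHom C x y))"

definition pre :: "'c \<Rightarrow> 'c \<Rightarrow> 'c \<Rightarrow> 'm \<Rightarrow> 'm" where
  "pre x' x y f = EComp C x' x y \<cdot> (idn V (EHom C x y) \<odot> f) \<cdot> inv_arr V (runit V (EHom C x y))"

lemma ehom_arr_eq: "ehom_arr V C (x', x, f) (y, y', g) = pre x' x y' f \<cdot> post x y y' g"
  by (simp add: ehom_arr_def pre_def post_def)

lemma post_simps [simp]: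
  assumes "x \<in> EObj C" "y \<in> EObj C" "y' \<in> EObj C" "g \<in> hom V \<one> (EHom C y y')"
  shows "post x y y' g \<in> Arr V" "Dom V (post x y y' g) = EHom C x y" "Cod V (post x y y' g) = EHom C x y'"
  using assms unfolding post_def by (auto simp: hom_def)

lemma pre_simps [simp]:
  assumes "x' \<in> EObj C" "x \<in> EObj C" "y \<in> EObj C" "f \<in> hom V \<one> (EHom C x' x)"
  shows "pre x' x y f \<in> Arr V" "Dom V (pre x' x y f) = EHom C x y" "Cod V (pre x' x y f) = EHom C x' y"
  using assms unfolding pre_def by (auto simp: hom_def)

lemma inv_lunit_natural:
  assumes "f \<in> Arr V"
  shows "inv_arr V (lunit V (Cod V f)) \<cdot> f = (idn V \<one> \<odot> f) \<cdot> inv_arr V (lunit V (Dom V f))"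
proof (rule iso_monic [of "lunit V (Cod V f)"])
  have "f \<in> hom V (Dom V f) (Cod V f)" using assms by (simp add: hom_def)
  from Comp_extend [OF lunit_natural [OF this], of "inv_arr V (lunit V (Dom V f))"]
  show "lunit V (Cod V f) \<cdot> inv_arr V (lunit V (Cod V f)) \<cdot> f
      = lunit V (Cod V f) \<cdot> (idn V \<one> \<odot> f) \<cdot> inv_arr V (lunit V (Dom V f))"
    using assms by simp
qed (use assms in auto)

lemma inv_runit_natural:
  assumes "f \<in> Arr V"
  shows "inv_arr V (runit V (Cod V f)) \<cdot> f = (f \<odot> idn V \<one>) \<cdot> inv_arr V (runit V (Dom V f))"
proof (rule iso_monic [of "runit V (Cod V f)"])
  have "f \<in> hom V (Dom V f) (Cod V f)" using assms by (simp add: hom_def)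
  from Comp_extend [OF runit_natural [OF this], of "inv_arr V (runit V (Dom V f))"]
  show "runit V (Cod V f) \<cdot> inv_arr V (runit V (Cod V f)) \<cdot> f
      = runit V (Cod V f) \<cdot> (f \<odot> idn V \<one>) \<cdot> inv_arr V (runit V (Dom V f))"
    using assms by simp
qed (use assms in auto)

lemma post_Comp:
  assumes "x \<in> EObj C" "y \<in> EObj C" "z \<in> EObj C" "g \<in> hom V \<one> (EHom C y z)" "f \<in> hom V a (EHom C x y)"
  shows "post x y z g \<cdot> f = EComp C x y z \<cdot> (g \<odot> f) \<cdot> inv_arr V (lunit V a)"
proof -
  have gf: "g \<in> Arr V" "Dom V g = \<one>" "Cod V g = EHom C y z" "f \<in> Arr V" "Dom V f = a" "Cod V f = EHom C x y"
    using assms by (auto simp: hom_def)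
  have a: "a \<in> Obj V" using gf(4,5) Dom_in_Obj by blast
  show ?thesis
    unfolding post_def using gf a assms(1-3) inv_lunit_natural [OF gf(4)] by simp
qed

lemma pre_Comp:
  assumes "x \<in> EObj C" "y \<in> EObj C" "z \<in> EObj C" "f \<in> hom V \<one> (EHom C x y)" "g \<in> hom V a (EHom C y z)"
  shows "pre x y z f \<cdot> g = EComp C x y z \<cdot> (g \<odot> f) \<cdot> inv_arr V (runit V a)"
proof -
  have gf: "f \<in> Arr V" "Dom V f = \<one>" "Cod V f = EHom C x y" "g \<in> Arr V" "Dom V g = a" "Cod V g = EHom C y z"
    using assms by (auto simp: hom_def)
  have a: "a \<in> Obj V" using gf(4,5) Dom_in_Obj by blast
  show ?thesis
    unfolding pre_def using gf a assms(1-3) inv_runit_natural [OF gf(4)] by simp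
qed

text \<open>Composition in the underlying category is postcomposition and, since the two unit
  constraints agree on the unit object, also precomposition.\<close>

lemma Comp_underlying:
  "(y, z, g) \<cdot>\<^bsub>C0\<^esub> (x, y', f) = (x, z, EComp C x y z \<cdot> (g \<odot> f) \<cdot> inv_arr V (lunit V \<one>))"
  by (simp add: underlying_def)

lemma Comp_underlying_post:
  assumes "x \<in> EObj C" "y \<in> EObj C" "z \<in> EObj C" "g \<in> hom V \<one> (EHom C y z)" "f \<in> hom V \<one> (EHom C x y)"
  shows "(y, z, g) \<cdot>\<^bsub>C0\<^esub> (x, y, f) = (x, z, post x y z g \<cdot> f)"
  by (simp add: Comp_underlying post_Comp [OF assms])

lemma Comp_underlying_pre:
  assumes "x \<in> EObj C" "y \<in> EObj C" "z \<in> EObj C" "g \<in> hom V \<one> (EHom C y z)" "f \<in> hom V \<one> (EHom C x y)"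
  shows "(y, z, g) \<cdot>\<^bsub>C0\<^esub> (x, y, f) = (x, z, pre x y z f \<cdot> g)"
  by (simp add: Comp_underlying pre_Comp [OF assms(1-3,5,4)] lunit_unit_eq_runit_unit)

lemma post_EId:
  assumes "x \<in> EObj C" "y \<in> EObj C"
  shows "post x y y (EId C y) = idn V (EHom C x y)"
  unfolding post_def
  using Comp_extend [OF EComp_left [OF assms], of "inv_arr V (lunit V (EHom C x y))"] assms by simp

lemma pre_EId:
  assumes "x \<in> EObj C" "y \<in> EObj C"
  shows "pre x x y (EId C x) = idn V (EHom C x y)"
  unfolding pre_def
  using Comp_extend [OF EComp_right [OF assms], of "inv_arr V (runit V (EHom C x y))"] assms by simp

text \<open>Three associativity laws for an element acting on a hom-object; they are associativity
  of \<open>EComp\<close> up to the coherence isomorphisms of a tensor product with one or two unit factors.\<close>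

lemma inv_tens_unit:
  assumes "a \<in> Obj V"
  shows "assoc V a \<one> \<one> \<cdot> (inv_arr V (runit V a) \<odot> idn V \<one>) = idn V a \<odot> inv_arr V (lunit V \<one>)"
    (is "?L = ?R")
    and "assoc V \<one> \<one> a \<cdot> (inv_arr V (lunit V \<one>) \<odot> idn V a) = idn V \<one> \<odot> inv_arr V (lunit V a)"
    (is "?L' = ?R'")
    and "assoc V \<one> a \<one> \<cdot> (inv_arr V (lunit V a) \<odot> idn V \<one>) = inv_arr V (lunit V (a \<otimes> \<one>))"
    (is "?L'' = ?R''")
proof -
  let ?I = "\<one>"
  show "?L = ?R"
  proof (rule iso_monic [of "idn V a \<odot> lunit V ?I"])
    show "(idn V a \<odot> lunit V ?I) \<cdot> ?L = (idn V a \<odot> lunit V ?I) \<cdot> ?R"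
      using Comp_extend [OF triangle [OF assms munit_Obj], of "inv_arr V (runit V a) \<odot> idn V ?I"] assms by simp
  qed (use assms iso_tens in auto)
  show "?L' = ?R'"
  proof (rule iso_monic [of "idn V ?I \<odot> lunit V a"])
    show "(idn V ?I \<odot> lunit V a) \<cdot> ?L' = (idn V ?I \<odot> lunit V a) \<cdot> ?R'"
      using Comp_extend [OF triangle [OF munit_Obj assms], of "inv_arr V (lunit V ?I) \<odot> idn V a"] assms
      by (simp add: lunit_unit_eq_runit_unit)
  qed (use assms iso_tens in auto)
  show "?L'' = ?R''"
  proof (rule iso_monic [of "lunit V (a \<otimes> ?I)"])
    show "lunit V (a \<otimes> ?I) \<cdot> ?L'' = lunit V (a \<otimes> ?I) \<cdot> ?R''"
      using Comp_extend [OF lunit_tens [OF assms munit_Obj], of "inv_arr V (lunit V a) \<odot> idn V ?I"] assms by simp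
  qed (use assms in auto)
qed

lemma EComp_assoc_elements:
  assumes ob: "w \<in> EObj C" "x \<in> EObj C" "y \<in> EObj C" "z \<in> EObj C"
    and "h \<in> hom V a (EHom C y z)" "g \<in> hom V b (EHom C x y)" "f \<in> hom V c (EHom C w x)"
  shows "EComp C w x z \<cdot> ((EComp C x y z \<cdot> (h \<odot> g)) \<odot> f) =
    EComp C w y z \<cdot> (h \<odot> (EComp C w x y \<cdot> (g \<odot> f))) \<cdot> assoc V a b c"
proof -
  have D: "h \<in> Arr V" "Dom V h = a" "Cod V h = EHom C y z" "g \<in> Arr V" "Dom V g = b" "Cod V g = EHom C x y"
    "f \<in> Arr V" "Dom V f = c" "Cod V f = EHom C w x"
    using assms by (auto simp: hom_def)
  have abc: "a \<in> Obj V" "b \<in> Obj V" "c \<in> Obj V" using hom_Obj(1) assms by blast+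
  have "EComp C w x z \<cdot> ((EComp C x y z \<cdot> (h \<odot> g)) \<odot> f)
      = (EComp C w x z \<cdot> (EComp C x y z \<odot> idn V (EHom C w x))) \<cdot> ((h \<odot> g) \<odot> f)"
    using D ob abc by simp
  also have "\<dots> = EComp C w y z \<cdot> (idn V (EHom C y z) \<odot> EComp C w x y)
       \<cdot> (assoc V (EHom C y z) (EHom C x y) (EHom C w x) \<cdot> ((h \<odot> g) \<odot> f))"
    unfolding EComp_assoc [OF ob] using D ob abc by simp
  also have "\<dots> = EComp C w y z \<cdot> (h \<odot> (EComp C w x y \<cdot> (g \<odot> f))) \<cdot> assoc V a b c"
    unfolding assoc_natural [OF assms(5-7)] using D ob abc by simp
  finally show ?thesis .
qed

lemma post_post:
  assumes ob: "x \<in> EObj C" "y \<in> EObj C" "y' \<in> EObj C" "y'' \<in> EObj C"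
    and g: "g \<in> hom V \<one> (EHom C y y')" and g': "g' \<in> hom V \<one> (EHom C y' y'')"
  shows "post x y y'' (post y y' y'' g' \<cdot> g) = post x y' y'' g' \<cdot> post x y y' g"
proof -
  let ?E = "EHom C x y" and ?I = "\<one>"
  have D: "g \<in> Arr V" "Dom V g = ?I" "Cod V g = EHom C y y'" "g' \<in> Arr V" "Dom V g' = ?I" "Cod V g' = EHom C y' y''"
    using g g' by (auto simp: hom_def)
  have E: "?E \<in> Obj V" using ob by simp
  have "post x y y'' (post y y' y'' g' \<cdot> g) = (EComp C x y y'' \<cdot> ((EComp C y y' y'' \<cdot> (g' \<odot> g)) \<odot> idn V ?E))
      \<cdot> (inv_arr V (lunit V ?I) \<odot> idn V ?E) \<cdot> inv_arr V (lunit V ?E)"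
    unfolding post_Comp [OF ob(2-4) g' g] unfolding post_def using D E ob by simp
  also have "\<dots> = EComp C x y' y'' \<cdot> (g' \<odot> (EComp C x y y' \<cdot> (g \<odot> idn V ?E)))
      \<cdot> (assoc V ?I ?I ?E \<cdot> (inv_arr V (lunit V ?I) \<odot> idn V ?E)) \<cdot> inv_arr V (lunit V ?E)"
    unfolding EComp_assoc_elements [OF ob(1,2,3,4) g' g idn_in_hom [OF E]] using D E ob by simp
  also have "\<dots> = EComp C x y' y'' \<cdot> (g' \<odot> post x y y' g) \<cdot> inv_arr V (lunit V ?E)"
    unfolding inv_tens_unit(2) [OF E] unfolding post_def using D E ob by simp
  also have "\<dots> = post x y' y'' g' \<cdot> post x y y' g"
    by (rule post_Comp [OF ob(1,3,4) g', symmetric]) (use ob g in \<open>simp add: hom_def [of V "EHom C x y"]\<close>)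
  finally show ?thesis .
qed

lemma pre_pre:
  assumes ob: "x'' \<in> EObj C" "x' \<in> EObj C" "x \<in> EObj C" "y \<in> EObj C"
    and f: "f \<in> hom V \<one> (EHom C x' x)" and f': "f' \<in> hom V \<one> (EHom C x'' x')"
  shows "pre x'' x y (post x'' x' x f \<cdot> f') = pre x'' x' y f' \<cdot> pre x' x y f"
proof -
  let ?E = "EHom C x y" and ?I = "\<one>"
  have D: "f \<in> Arr V" "Dom V f = ?I" "Cod V f = EHom C x' x" "f' \<in> Arr V" "Dom V f' = ?I" "Cod V f' = EHom C x'' x'"
    using f f' by (auto simp: hom_def)
  have E: "?E \<in> Obj V" using ob by simp
  have "pre x'' x' y f' \<cdot> pre x' x y f = EComp C x'' x' y \<cdot> (pre x' x y f \<odot> f') \<cdot> inv_arr V (runit V ?E)"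
    by (rule pre_Comp [OF ob(1,2,4) f']) (use ob f in \<open>simp add: hom_def [of V "EHom C x y"]\<close>)
  also have "\<dots> = (EComp C x'' x' y \<cdot> ((EComp C x' x y \<cdot> (idn V ?E \<odot> f)) \<odot> f'))
      \<cdot> (inv_arr V (runit V ?E) \<odot> idn V ?I) \<cdot> inv_arr V (runit V ?E)"
    unfolding pre_def using D E ob by simp
  also have "\<dots> = EComp C x'' x y \<cdot> (idn V ?E \<odot> (EComp C x'' x' x \<cdot> (f \<odot> f')))
      \<cdot> (assoc V ?E ?I ?I \<cdot> (inv_arr V (runit V ?E) \<odot> idn V ?I)) \<cdot> inv_arr V (runit V ?E)"
    unfolding EComp_assoc_elements [OF ob(1,2,3,4) idn_in_hom [OF E] f f'] using D E ob by simp
  also have "\<dots> = pre x'' x y (post x'' x' x f \<cdot> f')"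
    unfolding inv_tens_unit(1) [OF E] post_Comp [OF ob(1-3) f f'] unfolding pre_def using D E ob by simp
  finally show ?thesis by simp
qed

lemma post_pre:
  assumes ob: "x' \<in> EObj C" "x \<in> EObj C" "y \<in> EObj C" "y' \<in> EObj C"
    and f: "f \<in> hom V \<one> (EHom C x' x)" and g: "g \<in> hom V \<one> (EHom C y y')"
  shows "post x' y y' g \<cdot> pre x' x y f = pre x' x y' f \<cdot> post x y y' g"
proof -
  let ?E = "EHom C x y" and ?I = "\<one>"
  have D: "f \<in> Arr V" "Dom V f = ?I" "Cod V f = EHom C x' x" "g \<in> Arr V" "Dom V g = ?I" "Cod V g = EHom C y y'"
    using f g by (auto simp: hom_def)
  have E: "?E \<in> Obj V" using ob by simp
  have EI: "EComp C x' x y \<cdot> (idn V ?E \<odot> f) \<in> hom V (?E \<otimes> ?I) (EHom C x' y)"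
    using D E ob by (auto simp: hom_def)
  have "pre x' x y' f \<cdot> post x y y' g = EComp C x' x y' \<cdot> (post x y y' g \<odot> f) \<cdot> inv_arr V (runit V ?E)"
    by (rule pre_Comp [OF ob(1,2,4) f]) (use ob g in \<open>simp add: hom_def [of V "EHom C x y"]\<close>)
  also have "\<dots> = (EComp C x' x y' \<cdot> ((EComp C x y y' \<cdot> (g \<odot> idn V ?E)) \<odot> f))
      \<cdot> (inv_arr V (lunit V ?E) \<odot> idn V ?I) \<cdot> inv_arr V (runit V ?E)"
    unfolding post_def using D E ob by simp
  also have "\<dots> = EComp C x' y y' \<cdot> (g \<odot> (EComp C x' x y \<cdot> (idn V ?E \<odot> f)))
      \<cdot> (assoc V ?I ?E ?I \<cdot> (inv_arr V (lunit V ?E) \<odot> idn V ?I)) \<cdot> inv_arr V (runit V ?E)"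
    unfolding EComp_assoc_elements [OF ob(1,2,3,4) g idn_in_hom [OF E] f] using D E ob by simp
  also have "\<dots> = (EComp C x' y y' \<cdot> (g \<odot> (EComp C x' x y \<cdot> (idn V ?E \<odot> f)))
      \<cdot> inv_arr V (lunit V (?E \<otimes> ?I))) \<cdot> inv_arr V (runit V ?E)"
    unfolding inv_tens_unit(3) [OF E] using D E ob by simp
  also have "\<dots> = (post x' y y' g \<cdot> (EComp C x' x y \<cdot> (idn V ?E \<odot> f))) \<cdot> inv_arr V (runit V ?E)"
    unfolding post_Comp [OF ob(1,3,4) g EI] ..
  also have "\<dots> = post x' y y' g \<cdot> pre x' x y f"
    unfolding pre_def using D E ob g by simp
  finally show ?thesis by simp
qed

lemma ehom_arr_hom:
  assumes "f \<in> hom C0 x' x" "g \<in> hom C0 y y'"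
  shows "ehom_arr V C f g \<in> hom V (EHom C x y) (EHom C x' y')"
  using assms by (auto simp: hom_underlying ehom_arr_eq) (auto simp: hom_def [of V "EHom C x y"])

lemma ehom_arr_idn_left: "x \<in> EObj C \<Longrightarrow> y \<in> EObj C \<Longrightarrow> y' \<in> EObj C \<Longrightarrow> g \<in> hom V \<one> (EHom C y y') \<Longrightarrow>
  ehom_arr V C (x, x, EId C x) (y, y', g) = post x y y' g"
  by (simp add: ehom_arr_eq pre_EId)

lemma ehom_arr_idn_right: "x' \<in> EObj C \<Longrightarrow> x \<in> EObj C \<Longrightarrow> y \<in> EObj C \<Longrightarrow> f \<in> hom V \<one> (EHom C x' x) \<Longrightarrow>
  ehom_arr V C (x', x, f) (y, y, EId C y) = pre x' x y f"
  by (simp add: ehom_arr_eq post_EId)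

lemma ehom_arr_interchange:
  assumes "f \<in> hom C0 x' x" "g \<in> hom C0 y y'"
  shows "ehom_arr V C (idn C0 x') g \<cdot> ehom_arr V C f (idn C0 y) = ehom_arr V C f (idn C0 y') \<cdot> ehom_arr V C (idn C0 x) g"
  using assms by (auto simp: hom_underlying ehom_arr_idn_left ehom_arr_idn_right post_pre)

lemma ehom_arr_Comp_left:
  assumes "f \<in> hom C0 x' x" "f' \<in> hom C0 x'' x'" "y \<in> EObj C"
  shows "ehom_arr V C (f \<cdot>\<^bsub>C0\<^esub> f') (idn C0 y) = ehom_arr V C f' (idn C0 y) \<cdot> ehom_arr V C f (idn C0 y)"
  using assms by (auto simp: hom_underlying Comp_underlying_post ehom_arr_idn_right pre_pre hom_def [of V])

lemma ehom_arr_Comp_right: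
  assumes "g \<in> hom C0 y y'" "g' \<in> hom C0 y' y''" "x \<in> EObj C"
  shows "ehom_arr V C (idn C0 x) (g' \<cdot>\<^bsub>C0\<^esub> g) = ehom_arr V C (idn C0 x) g' \<cdot> ehom_arr V C (idn C0 x) g"
  using assms by (auto simp: hom_underlying Comp_underlying_post ehom_arr_idn_left post_post hom_def [of V])

lemma ehom_arr_element:
  assumes "category C0" "f \<in> hom C0 x' x" "g \<in> hom C0 y y'" "(x, y, h) \<in> hom C0 x y"
  shows "(x', y', ehom_arr V C f g \<cdot> h) = g \<cdot>\<^bsub>C0\<^esub> (x, y, h) \<cdot>\<^bsub>C0\<^esub> f"
proof -
  interpret C0: category C0 by fact
  obtain f0 g0 where f: "f = (x', x, f0)" "f0 \<in> hom V \<one> (EHom C x' x)"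
    and g: "g = (y, y', g0)" "g0 \<in> hom V \<one> (EHom C y y')" and h: "h \<in> hom V \<one> (EHom C x y)"
    and ob: "x' \<in> EObj C" "x \<in> EObj C" "y \<in> EObj C" "y' \<in> EObj C"
    using assms(2-) by (auto simp: hom_underlying)
  have ph: "post x y y' g0 \<cdot> h \<in> hom V \<one> (EHom C x y')" using ob g h by (auto simp: hom_def [of V])
  have "g \<cdot>\<^bsub>C0\<^esub> (x, y, h) \<cdot>\<^bsub>C0\<^esub> f = (g \<cdot>\<^bsub>C0\<^esub> (x, y, h)) \<cdot>\<^bsub>C0\<^esub> f"
    using C0.Comp_assoc [OF assms(2,4,3)] .
  also have "\<dots> = (x', y', pre x' x y' f0 \<cdot> post x y y' g0 \<cdot> h)"
    unfolding f(1) g(1) Comp_underlying_post [OF ob(2-4) g(2) h] Comp_underlying_pre [OF ob(1,2,4) ph f(2)] ..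
  also have "pre x' x y' f0 \<cdot> post x y y' g0 \<cdot> h = ehom_arr V C f g \<cdot> h"
    using f g h ob by (simp add: ehom_arr_eq) (auto simp: hom_def [of V \<open>\<one>\<close> \<open>EHom C x y\<close>])
  finally show ?thesis by simp
qed

end

section \<open>Change of enrichment\<close>

lemma change_base_simps [simp]:
  "EObj (change_base W A C) = EObj C" "EHom (change_base W A C) x y = GO A (EHom C x y)"
  "EId (change_base W A C) x = GA A (EId C x) \<cdot>\<^bsub>W\<^esub> lax_unit A"
  "EComp (change_base W A C) x y z = GA A (EComp C x y z) \<cdot>\<^bsub>W\<^esub> lax_mult A (EHom C y z) (EHom C x y)"
  by (simp_all add: change_base_def)

locale change_of_base = lax_monoidal_adjunction W V A + E: enriched V C
  for W :: "('wo, 'wm, 'x) smc_scheme" and V :: "('vo, 'vm, 'y) smc_scheme"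
    and A :: "('wo, 'wm, 'vo, 'vm) lax_adjunction" and C :: "('c, 'vo, 'vm) vcat"
begin

abbreviation C' where "C' \<equiv> change_base W A C"

lemma lax_natural_left:
  assumes "f \<in> Arr V" "y \<in> Obj V"
  shows "lax_mult A (Cod V f) y \<cdot>\<^bsub>W\<^esub> (GA A f \<odot>\<^bsub>W\<^esub> idn W (GO A y)) = GA A (f \<odot>\<^bsub>V\<^esub> idn V y) \<cdot>\<^bsub>W\<^esub> lax_mult A (Dom V f) y"
  using lax_natural [OF assms(1) V.idn_simps(1) [OF assms(2)]] assms by simp

lemma lax_natural_right:
  assumes "f \<in> Arr V" "y \<in> Obj V"
  shows "lax_mult A y (Cod V f) \<cdot>\<^bsub>W\<^esub> (idn W (GO A y) \<odot>\<^bsub>W\<^esub> GA A f) = GA A (idn V y \<odot>\<^bsub>V\<^esub> f) \<cdot>\<^bsub>W\<^esub> lax_mult A y (Dom V f)"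
  using lax_natural [OF V.idn_simps(1) [OF assms(2)] assms(1)] assms by simp

text \<open>The axioms for \<open>C\<close> are carried over by naturality, associativity and unitality of the lax structure.\<close>

lemma enriched_change_base: "enriched_category W C'"
  unfolding enriched_category_def change_base_simps
proof (intro conjI ballI)
  fix w x y z assume ob: "w \<in> EObj C" "x \<in> EObj C" "y \<in> EObj C" "z \<in> EObj C"
  let ?G = "GO A" and ?m = "lax_mult A"
  let ?a = "EHom C y z" and ?b = "EHom C x y" and ?c = "EHom C w x"
  have abc: "?a \<in> Obj V" "?b \<in> Obj V" "?c \<in> Obj V" using ob by simp_all
  have n1: "?m (EHom C x z) ?c \<cdot>\<^bsub>W\<^esub> (GA A (EComp C x y z) \<odot>\<^bsub>W\<^esub> idn W (?G ?c))
      = GA A (EComp C x y z \<odot>\<^bsub>V\<^esub> idn V ?c) \<cdot>\<^bsub>W\<^esub> ?m (?a \<otimes>\<^bsub>V\<^esub> ?b) ?c"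
    using lax_natural_left [of "EComp C x y z" ?c] ob by simp
  have n2: "?m ?a (EHom C w y) \<cdot>\<^bsub>W\<^esub> (idn W (?G ?a) \<odot>\<^bsub>W\<^esub> GA A (EComp C w x y))
      = GA A (idn V ?a \<odot>\<^bsub>V\<^esub> EComp C w x y) \<cdot>\<^bsub>W\<^esub> ?m ?a (?b \<otimes>\<^bsub>V\<^esub> ?c)"
    using lax_natural_right [of "EComp C w x y" ?a] ob by simp
  have "(GA A (EComp C w x z) \<cdot>\<^bsub>W\<^esub> ?m (EHom C x z) ?c) \<cdot>\<^bsub>W\<^esub> ((GA A (EComp C x y z) \<cdot>\<^bsub>W\<^esub> ?m ?a ?b) \<odot>\<^bsub>W\<^esub> idn W (?G ?c))
      = GA A (EComp C w x z) \<cdot>\<^bsub>W\<^esub> (?m (EHom C x z) ?c \<cdot>\<^bsub>W\<^esub> (GA A (EComp C x y z) \<odot>\<^bsub>W\<^esub> idn W (?G ?c))) \<cdot>\<^bsub>W\<^esub> (?m ?a ?b \<odot>\<^bsub>W\<^esub> idn W (?G ?c))"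
    using ob abc by simp
  also have "\<dots> = (GA A (EComp C w x z) \<cdot>\<^bsub>W\<^esub> GA A (EComp C x y z \<odot>\<^bsub>V\<^esub> idn V ?c)) \<cdot>\<^bsub>W\<^esub> ?m (?a \<otimes>\<^bsub>V\<^esub> ?b) ?c \<cdot>\<^bsub>W\<^esub> (?m ?a ?b \<odot>\<^bsub>W\<^esub> idn W (?G ?c))"
    unfolding n1 using ob abc by simp
  also have "GA A (EComp C w x z) \<cdot>\<^bsub>W\<^esub> GA A (EComp C x y z \<odot>\<^bsub>V\<^esub> idn V ?c)
      = GA A (EComp C w y z \<cdot>\<^bsub>V\<^esub> (idn V ?a \<odot>\<^bsub>V\<^esub> EComp C w x y) \<cdot>\<^bsub>V\<^esub> assoc V ?a ?b ?c)"
    unfolding E.EComp_assoc [OF ob, symmetric] using ob abc by (subst G_Comp_Arr) auto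
  also have "\<dots> = GA A (EComp C w y z) \<cdot>\<^bsub>W\<^esub> GA A (idn V ?a \<odot>\<^bsub>V\<^esub> EComp C w x y) \<cdot>\<^bsub>W\<^esub> GA A (assoc V ?a ?b ?c)"
    using ob abc by (simp add: G_Comp_Arr)
  also have "\<dots> \<cdot>\<^bsub>W\<^esub> ?m (?a \<otimes>\<^bsub>V\<^esub> ?b) ?c \<cdot>\<^bsub>W\<^esub> (?m ?a ?b \<odot>\<^bsub>W\<^esub> idn W (?G ?c))
      = GA A (EComp C w y z) \<cdot>\<^bsub>W\<^esub> GA A (idn V ?a \<odot>\<^bsub>V\<^esub> EComp C w x y) \<cdot>\<^bsub>W\<^esub>
        (GA A (assoc V ?a ?b ?c) \<cdot>\<^bsub>W\<^esub> ?m (?a \<otimes>\<^bsub>V\<^esub> ?b) ?c \<cdot>\<^bsub>W\<^esub> (?m ?a ?b \<odot>\<^bsub>W\<^esub> idn W (?G ?c)))"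
    using ob abc by simp
  also have "\<dots> = GA A (EComp C w y z) \<cdot>\<^bsub>W\<^esub> (GA A (idn V ?a \<odot>\<^bsub>V\<^esub> EComp C w x y) \<cdot>\<^bsub>W\<^esub> ?m ?a (?b \<otimes>\<^bsub>V\<^esub> ?c))
      \<cdot>\<^bsub>W\<^esub> (idn W (?G ?a) \<odot>\<^bsub>W\<^esub> ?m ?b ?c) \<cdot>\<^bsub>W\<^esub> assoc W (?G ?a) (?G ?b) (?G ?c)"
    unfolding lax_assoc [OF abc] using ob abc by simp
  also have "\<dots> = (GA A (EComp C w y z) \<cdot>\<^bsub>W\<^esub> ?m ?a (EHom C w y)) \<cdot>\<^bsub>W\<^esub> (idn W (?G ?a) \<odot>\<^bsub>W\<^esub> (GA A (EComp C w x y) \<cdot>\<^bsub>W\<^esub> ?m ?b ?c))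
      \<cdot>\<^bsub>W\<^esub> assoc W (?G ?a) (?G ?b) (?G ?c)"
    unfolding n2 [symmetric] using ob abc by simp
  finally show "(GA A (EComp C w x z) \<cdot>\<^bsub>W\<^esub> ?m (EHom C x z) ?c) \<cdot>\<^bsub>W\<^esub> ((GA A (EComp C x y z) \<cdot>\<^bsub>W\<^esub> ?m ?a ?b) \<odot>\<^bsub>W\<^esub> idn W (?G ?c))
      = (GA A (EComp C w y z) \<cdot>\<^bsub>W\<^esub> ?m ?a (EHom C w y)) \<cdot>\<^bsub>W\<^esub> (idn W (?G ?a) \<odot>\<^bsub>W\<^esub> (GA A (EComp C w x y) \<cdot>\<^bsub>W\<^esub> ?m ?b ?c))
      \<cdot>\<^bsub>W\<^esub> assoc W (?G ?a) (?G ?b) (?G ?c)" .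
next
  fix x y assume ob: "x \<in> EObj C" "y \<in> EObj C"
  let ?h = "EHom C x y"
  have h: "?h \<in> Obj V" using ob by simp
  have "(GA A (EComp C x y y) \<cdot>\<^bsub>W\<^esub> lax_mult A (EHom C y y) ?h) \<cdot>\<^bsub>W\<^esub> ((GA A (EId C y) \<cdot>\<^bsub>W\<^esub> lax_unit A) \<odot>\<^bsub>W\<^esub> idn W (GO A ?h))
      = GA A (EComp C x y y) \<cdot>\<^bsub>W\<^esub> (lax_mult A (EHom C y y) ?h \<cdot>\<^bsub>W\<^esub> (GA A (EId C y) \<odot>\<^bsub>W\<^esub> idn W (GO A ?h))) \<cdot>\<^bsub>W\<^esub> (lax_unit A \<odot>\<^bsub>W\<^esub> idn W (GO A ?h))"
    using ob h by simp
  also have "lax_mult A (EHom C y y) ?h \<cdot>\<^bsub>W\<^esub> (GA A (EId C y) \<odot>\<^bsub>W\<^esub> idn W (GO A ?h)) = GA A (EId C y \<odot>\<^bsub>V\<^esub> idn V ?h) \<cdot>\<^bsub>W\<^esub> lax_mult A \<one>\<^bsub>V\<^esub> ?h"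
    using lax_natural_left [of "EId C y" ?h] ob by simp
  also have "GA A (EComp C x y y) \<cdot>\<^bsub>W\<^esub> \<dots> \<cdot>\<^bsub>W\<^esub> (lax_unit A \<odot>\<^bsub>W\<^esub> idn W (GO A ?h))
      = GA A (EComp C x y y \<cdot>\<^bsub>V\<^esub> (EId C y \<odot>\<^bsub>V\<^esub> idn V ?h)) \<cdot>\<^bsub>W\<^esub> lax_mult A \<one>\<^bsub>V\<^esub> ?h \<cdot>\<^bsub>W\<^esub> (lax_unit A \<odot>\<^bsub>W\<^esub> idn W (GO A ?h))"
    using ob h by (simp add: G_Comp_Arr)
  also have "\<dots> = lunit W (GO A ?h)"
    unfolding E.EComp_left [OF ob] by (rule lax_lunit [OF h])
  finally show "(GA A (EComp C x y y) \<cdot>\<^bsub>W\<^esub> lax_mult A (EHom C y y) ?h) \<cdot>\<^bsub>W\<^esub> ((GA A (EId C y) \<cdot>\<^bsub>W\<^esub> lax_unit A) \<odot>\<^bsub>W\<^esub> idn W (GO A ?h))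
      = lunit W (GO A ?h)" .
next
  fix x y assume ob: "x \<in> EObj C" "y \<in> EObj C"
  let ?h = "EHom C x y"
  have h: "?h \<in> Obj V" using ob by simp
  have "(GA A (EComp C x x y) \<cdot>\<^bsub>W\<^esub> lax_mult A ?h (EHom C x x)) \<cdot>\<^bsub>W\<^esub> (idn W (GO A ?h) \<odot>\<^bsub>W\<^esub> (GA A (EId C x) \<cdot>\<^bsub>W\<^esub> lax_unit A))
      = GA A (EComp C x x y) \<cdot>\<^bsub>W\<^esub> (lax_mult A ?h (EHom C x x) \<cdot>\<^bsub>W\<^esub> (idn W (GO A ?h) \<odot>\<^bsub>W\<^esub> GA A (EId C x))) \<cdot>\<^bsub>W\<^esub> (idn W (GO A ?h) \<odot>\<^bsub>W\<^esub> lax_unit A)"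
    using ob h by simp
  also have "lax_mult A ?h (EHom C x x) \<cdot>\<^bsub>W\<^esub> (idn W (GO A ?h) \<odot>\<^bsub>W\<^esub> GA A (EId C x)) = GA A (idn V ?h \<odot>\<^bsub>V\<^esub> EId C x) \<cdot>\<^bsub>W\<^esub> lax_mult A ?h \<one>\<^bsub>V\<^esub>"
    using lax_natural_right [of "EId C x" ?h] ob by simp
  also have "GA A (EComp C x x y) \<cdot>\<^bsub>W\<^esub> \<dots> \<cdot>\<^bsub>W\<^esub> (idn W (GO A ?h) \<odot>\<^bsub>W\<^esub> lax_unit A)
      = GA A (EComp C x x y \<cdot>\<^bsub>V\<^esub> (idn V ?h \<odot>\<^bsub>V\<^esub> EId C x)) \<cdot>\<^bsub>W\<^esub> lax_mult A ?h \<one>\<^bsub>V\<^esub> \<cdot>\<^bsub>W\<^esub> (idn W (GO A ?h) \<odot>\<^bsub>W\<^esub> lax_unit A)"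
    using ob h by (simp add: G_Comp_Arr)
  also have "\<dots> = runit W (GO A ?h)"
    unfolding E.EComp_right [OF ob] by (rule lax_runit [OF h])
  finally show "(GA A (EComp C x x y) \<cdot>\<^bsub>W\<^esub> lax_mult A ?h (EHom C x x)) \<cdot>\<^bsub>W\<^esub> (idn W (GO A ?h) \<odot>\<^bsub>W\<^esub> (GA A (EId C x) \<cdot>\<^bsub>W\<^esub> lax_unit A))
      = runit W (GO A ?h)" .
qed (auto simp: hom_def)

sublocale E': enriched W C'
  by unfold_locales (rule enriched_change_base)

text \<open>An element \<open>f : \<one> \<rightarrow> x\<close> of \<open>x\<close> gives the element of \<open>G x\<close> adjunct to \<open>f \<cdot> \<epsilon>\<close>.\<close>

definition elt :: "'vm \<Rightarrow> 'wm" where "elt f = GA A f \<cdot>\<^bsub>W\<^esub> lax_unit A"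

lemma elt_sharp: "f \<in> hom V \<one>\<^bsub>V\<^esub> x \<Longrightarrow> elt f = sharp \<one>\<^bsub>W\<^esub> (f \<cdot>\<^bsub>V\<^esub> eps)"
  using eps(2) by (simp add: elt_def G_Comp_Arr hom_def)

lemma elt_hom: "f \<in> hom V \<one>\<^bsub>V\<^esub> x \<Longrightarrow> elt f \<in> hom W \<one>\<^bsub>W\<^esub> (GO A x)"
  by (auto simp: elt_def hom_def)

lemma elt_Comp: "f \<in> hom V \<one>\<^bsub>V\<^esub> x \<Longrightarrow> g \<in> hom V x y \<Longrightarrow> elt (g \<cdot>\<^bsub>V\<^esub> f) = GA A g \<cdot>\<^bsub>W\<^esub> elt f"
  by (auto simp: elt_def hom_def G_Comp_Arr)

lemma elt_bij:
  assumes eps: "iso V eps" and x: "x \<in> Obj V"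
  shows "bij_betw elt (hom V \<one>\<^bsub>V\<^esub> x) (hom W \<one>\<^bsub>W\<^esub> (GO A x))"
proof -
  have "bij_betw (\<lambda>f. f \<cdot>\<^bsub>V\<^esub> eps) (hom V \<one>\<^bsub>V\<^esub> x) (hom V (FO A \<one>\<^bsub>W\<^esub>) x)"
    by (rule bij_betw_byWitness [where f' = "\<lambda>g. g \<cdot>\<^bsub>V\<^esub> inv_arr V eps"]) (use eps in \<open>auto simp: hom_def\<close>)
  from bij_betw_trans [OF this sharp_bij [OF W.munit_Obj x]]
  show ?thesis
    by (rule bij_betw_cong [THEN iffD1, rotated]) (simp add: elt_sharp)
qed

lemma base_arr_eq: "base_arr W A (x, y, f) = (x, y, elt f)"
  by (simp add: base_arr_def elt_def)

lemma inv_lunit_change_base: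
  assumes "x \<in> Obj V"
  shows "lax_mult A \<one>\<^bsub>V\<^esub> x \<cdot>\<^bsub>W\<^esub> (lax_unit A \<odot>\<^bsub>W\<^esub> idn W (GO A x)) \<cdot>\<^bsub>W\<^esub> inv_arr W (lunit W (GO A x)) = GA A (inv_arr V (lunit V x))"
proof (rule W.iso_monic [of "GA A (lunit V x)"])
  show "iso W (GA A (lunit V x))"
    using functor_iso [OF V.category_axioms W.category_axioms G_functor] assms by simp
  have "GA A (lunit V x) \<cdot>\<^bsub>W\<^esub> lax_mult A \<one>\<^bsub>V\<^esub> x \<cdot>\<^bsub>W\<^esub> (lax_unit A \<odot>\<^bsub>W\<^esub> idn W (GO A x)) \<cdot>\<^bsub>W\<^esub> inv_arr W (lunit W (GO A x))
      = (GA A (lunit V x) \<cdot>\<^bsub>W\<^esub> lax_mult A \<one>\<^bsub>V\<^esub> x \<cdot>\<^bsub>W\<^esub> (lax_unit A \<odot>\<^bsub>W\<^esub> idn W (GO A x))) \<cdot>\<^bsub>W\<^esub> inv_arr W (lunit W (GO A x))"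
    using assms by simp
  also have "\<dots> = GA A (lunit V x \<cdot>\<^bsub>V\<^esub> inv_arr V (lunit V x))"
    unfolding lax_lunit [OF assms] using assms by simp
  also have "\<dots> = GA A (lunit V x) \<cdot>\<^bsub>W\<^esub> GA A (inv_arr V (lunit V x))"
    by (rule G_Comp_Arr) (use assms in auto)
  finally show "GA A (lunit V x) \<cdot>\<^bsub>W\<^esub> lax_mult A \<one>\<^bsub>V\<^esub> x \<cdot>\<^bsub>W\<^esub> (lax_unit A \<odot>\<^bsub>W\<^esub> idn W (GO A x)) \<cdot>\<^bsub>W\<^esub> inv_arr W (lunit W (GO A x))
      = GA A (lunit V x) \<cdot>\<^bsub>W\<^esub> GA A (inv_arr V (lunit V x))" .
qed (use assms in auto)

lemma inv_runit_change_base: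
  assumes "x \<in> Obj V"
  shows "lax_mult A x \<one>\<^bsub>V\<^esub> \<cdot>\<^bsub>W\<^esub> (idn W (GO A x) \<odot>\<^bsub>W\<^esub> lax_unit A) \<cdot>\<^bsub>W\<^esub> inv_arr W (runit W (GO A x)) = GA A (inv_arr V (runit V x))"
proof (rule W.iso_monic [of "GA A (runit V x)"])
  show "iso W (GA A (runit V x))"
    using functor_iso [OF V.category_axioms W.category_axioms G_functor] assms by simp
  have "GA A (runit V x) \<cdot>\<^bsub>W\<^esub> lax_mult A x \<one>\<^bsub>V\<^esub> \<cdot>\<^bsub>W\<^esub> (idn W (GO A x) \<odot>\<^bsub>W\<^esub> lax_unit A) \<cdot>\<^bsub>W\<^esub> inv_arr W (runit W (GO A x))
      = (GA A (runit V x) \<cdot>\<^bsub>W\<^esub> lax_mult A x \<one>\<^bsub>V\<^esub> \<cdot>\<^bsub>W\<^esub> (idn W (GO A x) \<odot>\<^bsub>W\<^esub> lax_unit A)) \<cdot>\<^bsub>W\<^esub> inv_arr W (runit W (GO A x))"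
    using assms by simp
  also have "\<dots> = GA A (runit V x \<cdot>\<^bsub>V\<^esub> inv_arr V (runit V x))"
    unfolding lax_runit [OF assms] using assms by simp
  also have "\<dots> = GA A (runit V x) \<cdot>\<^bsub>W\<^esub> GA A (inv_arr V (runit V x))"
    by (rule G_Comp_Arr) (use assms in auto)
  finally show "GA A (runit V x) \<cdot>\<^bsub>W\<^esub> lax_mult A x \<one>\<^bsub>V\<^esub> \<cdot>\<^bsub>W\<^esub> (idn W (GO A x) \<odot>\<^bsub>W\<^esub> lax_unit A) \<cdot>\<^bsub>W\<^esub> inv_arr W (runit W (GO A x))
      = GA A (runit V x) \<cdot>\<^bsub>W\<^esub> GA A (inv_arr V (runit V x))" .
qed (use assms in auto)

text \<open>The element \<open>elt g\<close> of \<open>G (EHom C y y')\<close> acts as \<open>G\<close> of the action of \<open>g\<close>. So the hom-functor of \<open>G\<^sub>* C\<close>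
  is \<open>G\<close> after that of \<open>C\<close>, once the underlying categories are identified.\<close>

lemma post_elt:
  assumes ob: "x \<in> EObj C" "y \<in> EObj C" "y' \<in> EObj C" and g: "g \<in> hom V \<one>\<^bsub>V\<^esub> (EHom C y y')"
  shows "E'.post x y y' (elt g) = GA A (E.post x y y' g)"
proof -
  let ?h = "EHom C x y"
  have h: "?h \<in> Obj V" using ob by simp
  have D: "g \<in> Arr V" "Dom V g = \<one>\<^bsub>V\<^esub>" "Cod V g = EHom C y y'" using g by (auto simp: hom_def)
  have "E'.post x y y' (elt g) = GA A (EComp C x y y') \<cdot>\<^bsub>W\<^esub> (lax_mult A (EHom C y y') ?h \<cdot>\<^bsub>W\<^esub> (GA A g \<odot>\<^bsub>W\<^esub> idn W (GO A ?h)))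
      \<cdot>\<^bsub>W\<^esub> (lax_unit A \<odot>\<^bsub>W\<^esub> idn W (GO A ?h)) \<cdot>\<^bsub>W\<^esub> inv_arr W (lunit W (GO A ?h))"
    unfolding E'.post_def elt_def using ob h D by simp
  also have "lax_mult A (EHom C y y') ?h \<cdot>\<^bsub>W\<^esub> (GA A g \<odot>\<^bsub>W\<^esub> idn W (GO A ?h)) = GA A (g \<odot>\<^bsub>V\<^esub> idn V ?h) \<cdot>\<^bsub>W\<^esub> lax_mult A \<one>\<^bsub>V\<^esub> ?h"
    using lax_natural_left [of g ?h] D h by simp
  also have "GA A (EComp C x y y') \<cdot>\<^bsub>W\<^esub> \<dots> \<cdot>\<^bsub>W\<^esub> (lax_unit A \<odot>\<^bsub>W\<^esub> idn W (GO A ?h)) \<cdot>\<^bsub>W\<^esub> inv_arr W (lunit W (GO A ?h))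
      = GA A (EComp C x y y') \<cdot>\<^bsub>W\<^esub> GA A (g \<odot>\<^bsub>V\<^esub> idn V ?h) \<cdot>\<^bsub>W\<^esub> (lax_mult A \<one>\<^bsub>V\<^esub> ?h
        \<cdot>\<^bsub>W\<^esub> (lax_unit A \<odot>\<^bsub>W\<^esub> idn W (GO A ?h)) \<cdot>\<^bsub>W\<^esub> inv_arr W (lunit W (GO A ?h)))"
    using ob h D by simp
  also have "\<dots> = GA A (E.post x y y' g)"
    unfolding inv_lunit_change_base [OF h] E.post_def using ob h D by (simp add: G_Comp_Arr)
  finally show ?thesis .
qed

lemma pre_elt:
  assumes ob: "x' \<in> EObj C" "x \<in> EObj C" "y \<in> EObj C" and f: "f \<in> hom V \<one>\<^bsub>V\<^esub> (EHom C x' x)"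
  shows "E'.pre x' x y (elt f) = GA A (E.pre x' x y f)"
proof -
  let ?h = "EHom C x y"
  have h: "?h \<in> Obj V" using ob by simp
  have D: "f \<in> Arr V" "Dom V f = \<one>\<^bsub>V\<^esub>" "Cod V f = EHom C x' x" using f by (auto simp: hom_def)
  have "E'.pre x' x y (elt f) = GA A (EComp C x' x y) \<cdot>\<^bsub>W\<^esub> (lax_mult A ?h (EHom C x' x) \<cdot>\<^bsub>W\<^esub> (idn W (GO A ?h) \<odot>\<^bsub>W\<^esub> GA A f))
      \<cdot>\<^bsub>W\<^esub> (idn W (GO A ?h) \<odot>\<^bsub>W\<^esub> lax_unit A) \<cdot>\<^bsub>W\<^esub> inv_arr W (runit W (GO A ?h))"
    unfolding E'.pre_def elt_def using ob h D by simp
  also have "lax_mult A ?h (EHom C x' x) \<cdot>\<^bsub>W\<^esub> (idn W (GO A ?h) \<odot>\<^bsub>W\<^esub> GA A f) = GA A (idn V ?h \<odot>\<^bsub>V\<^esub> f) \<cdot>\<^bsub>W\<^esub> lax_mult A ?h \<one>\<^bsub>V\<^esub>"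
    using lax_natural_right [of f ?h] D h by simp
  also have "GA A (EComp C x' x y) \<cdot>\<^bsub>W\<^esub> \<dots> \<cdot>\<^bsub>W\<^esub> (idn W (GO A ?h) \<odot>\<^bsub>W\<^esub> lax_unit A) \<cdot>\<^bsub>W\<^esub> inv_arr W (runit W (GO A ?h))
      = GA A (EComp C x' x y) \<cdot>\<^bsub>W\<^esub> GA A (idn V ?h \<odot>\<^bsub>V\<^esub> f) \<cdot>\<^bsub>W\<^esub> (lax_mult A ?h \<one>\<^bsub>V\<^esub>
        \<cdot>\<^bsub>W\<^esub> (idn W (GO A ?h) \<odot>\<^bsub>W\<^esub> lax_unit A) \<cdot>\<^bsub>W\<^esub> inv_arr W (runit W (GO A ?h)))"
    using ob h D by simp
  also have "\<dots> = GA A (E.pre x' x y f)"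
    unfolding inv_runit_change_base [OF h] E.pre_def using ob h D by (simp add: G_Comp_Arr)
  finally show ?thesis .
qed

lemma ehom_arr_change_base:
  assumes "f \<in> hom E.C0 x' x" "g \<in> hom E.C0 y y'"
  shows "ehom_arr W C' (base_arr W A f) (base_arr W A g) = GA A (ehom_arr V C f g)"
  using assms
  by (auto simp: E.hom_underlying base_arr_eq E'.ehom_arr_eq E.ehom_arr_eq post_elt pre_elt G_Comp_Arr)

lemma cat_iso_base_arr:
  assumes eps: "iso V eps" and C0: "category E.C0"
  shows "cat_iso E.C0 E'.C0 (base_arr W A)"
proof -
  interpret C0: category E.C0 by fact
  show ?thesis
  proof
    show "Obj E'.C0 = Obj E.C0" by simp
    have Arr: "Arr E.C0 = (SIGMA x:EObj C. SIGMA y:EObj C. hom V \<one>\<^bsub>V\<^esub> (EHom C x y))"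
      "Arr E'.C0 = (SIGMA x:EObj C. SIGMA y:EObj C. hom W \<one>\<^bsub>W\<^esub> (GO A (EHom C x y)))"
      by (auto simp: underlying_def)
    show "bij_betw (base_arr W A) (Arr E.C0) (Arr E'.C0)"
      unfolding bij_betw_def
    proof (intro conjI equalityI subsetI)
      show "inj_on (base_arr W A) (Arr E.C0)"
        using elt_bij [OF eps E.EHom_Obj] unfolding Arr
        by (auto simp: inj_on_def base_arr_eq bij_betw_def)
      show "h \<in> Arr E'.C0" if "h \<in> base_arr W A ` Arr E.C0" for h
        using that elt_hom unfolding Arr by (auto simp: base_arr_eq)
      show "h \<in> base_arr W A ` Arr E.C0" if h': "h \<in> Arr E'.C0" for h
      proof -
        obtain x y g where h: "h = (x, y, g)" and ob: "x \<in> EObj C" "y \<in> EObj C"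
          and g: "g \<in> hom W \<one>\<^bsub>W\<^esub> (GO A (EHom C x y))"
          using h' unfolding Arr by auto
        obtain f where "f \<in> hom V \<one>\<^bsub>V\<^esub> (EHom C x y)" "g = elt f"
          using elt_bij [OF eps, of "EHom C x y"] ob g by (auto simp: bij_betw_def)
        then show ?thesis
          unfolding Arr h using ob by (intro image_eqI [of _ _ "(x, y, f)"]) (auto simp: base_arr_eq)
      qed
    qed
    fix f g x
    show "f \<in> Arr E.C0 \<Longrightarrow> Dom E'.C0 (base_arr W A f) = Dom E.C0 f"
      "f \<in> Arr E.C0 \<Longrightarrow> Cod E'.C0 (base_arr W A f) = Cod E.C0 f"
      by (cases f; simp add: base_arr_eq)+
    show "x \<in> Obj E.C0 \<Longrightarrow> base_arr W A (idn E.C0 x) = idn E'.C0 x"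
      by (simp add: base_arr_eq elt_def)
    show "base_arr W A (g \<cdot>\<^bsub>E.C0\<^esub> f) = base_arr W A g \<cdot>\<^bsub>E'.C0\<^esub> base_arr W A f"
      if fg: "f \<in> Arr E.C0" "g \<in> Arr E.C0" "Cod E.C0 f = Dom E.C0 g"
    proof -
      obtain x y f0 where f1: "f = (x, y, f0)" by (cases f)
      obtain y' z g0 where g1: "g = (y', z, g0)" by (cases g)
      have y': "y' = y" using fg(3) by (simp add: f1 g1)
      have f: "f = (x, y, f0)" "f0 \<in> hom V \<one>\<^bsub>V\<^esub> (EHom C x y)"
        and g: "g = (y, z, g0)" "g0 \<in> hom V \<one>\<^bsub>V\<^esub> (EHom C y z)" and ob: "x \<in> EObj C" "y \<in> EObj C" "z \<in> EObj C"
        using fg(1,2) f1 g1 y' by simp_all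
      have p: "E.post x y z g0 \<in> hom V (EHom C x y) (EHom C x z)" using ob g by (simp add: hom_def [of V "EHom C x y"])
      have "(y, z, elt g0) \<cdot>\<^bsub>E'.C0\<^esub> (x, y, elt f0) = (x, z, E'.post x y z (elt g0) \<cdot>\<^bsub>W\<^esub> elt f0)"
        by (rule E'.Comp_underlying_post) (use ob elt_hom [OF f(2)] elt_hom [OF g(2)] in simp_all)
      then show ?thesis
        unfolding f(1) g(1) E.Comp_underlying_post [OF ob g(2) f(2)] base_arr_eq elt_Comp [OF f(2) p]
          post_elt [OF ob g(2)] by (rule sym)
    qed
  qed
qed

end


section \<open>Transport of the axioms of a weak enriched model category\<close>

lemma functor_zigzag:
  assumes "is_functor C D Fo Fa" "\<And>w. w \<in> Weq M \<Longrightarrow> Fa w \<in> Weq N" "zigzag C M x r y"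
  shows "zigzag D N (Fo x) (map (map_sum Fa Fa) r) (Fo y)"
  using assms(3)
  by (induction rule: zigzag.induct)
    (auto intro: zigzag.intros functorD(1) [OF assms(1)] functorD(2) [OF assms(1)] assms(2))

lemma functor_zz_equiv:
  assumes F: "is_functor C D Fo Fa" and Weq: "\<And>w. w \<in> Weq M \<Longrightarrow> Fa w \<in> Weq N" and "category C"
    and "zz_equiv C M x y r s"
  shows "zz_equiv D N (Fo x) (Fo y) (map (map_sum Fa Fa) r) (map (map_sum Fa Fa) s)"
  using assms(4)
proof (induction rule: zz_equiv.induct)
  case (zze_refl x r y)
  then show ?case by (intro zz_equiv.zze_refl functor_zigzag [OF F Weq])
next
  case (zze_cong a r x y s t u b)
  then show ?case
    using zz_equiv.zze_cong [OF functor_zigzag [OF F Weq] _ functor_zigzag [OF F Weq]] by simp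
next
  case (zze_idn x)
  then show ?case
    using zz_equiv.zze_idn [OF functorD(1) [OF F zze_idn]] functorD(3) [OF F zze_idn] by simp
next
  case (zze_Comp f x y g z)
  then show ?case
    using zz_equiv.zze_Comp [OF functorD(2) [OF F] functorD(2) [OF F]] functorD(4) [OF F] by simp
next
  case (zze_inv_right w x y)
  then show ?case using zz_equiv.zze_inv_right [OF functorD(2) [OF F] Weq] by simp
next
  case (zze_inv_left w x y)
  then show ?case using zz_equiv.zze_inv_left [OF functorD(2) [OF F] Weq] by simp
qed (auto intro: zz_equiv.intros)

lemma change_base_model_eq: "change_base_model W A M = image_model (base_arr W A) M"
  by (simp add: change_base_model_def image_model_def)

context cat_iso
begin

lemma cofibrant_\<phi>: "cofibrant C M x \<Longrightarrow> cofibrant D (image_model \<phi> M) x"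
  unfolding cofibrant_def Obj_eq hom_eq using initial_\<phi> by auto

lemma fibrant_\<phi>: "fibrant C M x \<Longrightarrow> fibrant D (image_model \<phi> M) x"
  unfolding fibrant_def Obj_eq hom_eq using terminal_\<phi> by auto

lemma image_model_\<psi>:
  assumes "Weq M \<subseteq> Arr C" "Cof M \<subseteq> Arr C" "Fib M \<subseteq> Arr C"
  shows "image_model \<psi> (image_model \<phi> M) = M"
proof -
  have "\<psi> ` \<phi> ` K = K" if "K \<subseteq> Arr C" for K
    using that \<psi>_\<phi> by (force simp: image_iff subset_iff)
  then show ?thesis using assms by (simp add: image_model_def)
qed

lemma zz_equiv_\<phi>_iff:
  assumes M: "Weq M \<subseteq> Arr C" "Cof M \<subseteq> Arr C" "Fib M \<subseteq> Arr C" and f: "f \<in> hom C x y" and g: "g \<in> hom C x y"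
  shows "category.ho_eq D (image_model \<phi> M) x y (\<phi> f) (\<phi> g) \<longleftrightarrow> ho_eq M x y f g"
proof -
  interpret D: category D by (rule category_D)
  interpret I: cat_iso D C \<psi> by (rule cat_iso_\<psi>)
  have "zz_equiv C M x y [Inl f] [Inl g]" if "zz_equiv D (image_model \<phi> M) x y [Inl (\<phi> f)] [Inl (\<phi> g)]"
    using functor_zz_equiv [OF I.functor_\<phi> _ D.category_axioms that, of M] M(1)
    by (force simp: \<psi>_\<phi> \<psi>_\<phi>_hom [OF f] \<psi>_\<phi>_hom [OF g])
  moreover have "zz_equiv D (image_model \<phi> M) x y [Inl (\<phi> f)] [Inl (\<phi> g)]" if "zz_equiv C M x y [Inl f] [Inl g]"
    using functor_zz_equiv [OF functor_\<phi> _ category_axioms that, of "image_model \<phi> M"] by simp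
  ultimately show ?thesis unfolding D.ho_eq_def ho_eq_def by blast
qed

text \<open>The pushout-product axiom and the pullback-corner axiom for two-variable functors to \<open>C\<close> are
  inherited by the functors to \<open>D\<close> obtained by composing with a left Quillen functor.\<close>

lemma pushout_product_transport:
  assumes To: "is_bifunctor C V C To Ta" and F: "is_functor W V Fo Fa" and "category W"
    and F_Cof: "\<And>k. k \<in> Cof MW \<Longrightarrow> k \<in> Arr W \<and> Fa k \<in> Cof MV" "\<And>k. k \<in> Cof MW \<Longrightarrow> k \<in> Weq MW \<Longrightarrow> Fa k \<in> Weq MV"
    and M: "Weq M \<subseteq> Arr C" "Cof M \<subseteq> Arr C"
    and pp: "pushout_product_axiom C M V MV C M To Ta"
  shows "pushout_product_axiom D (image_model \<phi> M) W MW D (image_model \<phi> M)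
    (\<lambda>x w. To x (Fo w)) (\<lambda>f k. \<phi> (Ta (\<psi> f) (Fa k)))"
  unfolding pushout_product_axiom_def
proof (intro ballI allI impI, elim conjE)
  interpret W: category W by fact
  interpret I: cat_iso D C \<psi> by (rule cat_iso_\<psi>)
  fix i' k p s t h
  assume "i' \<in> Cof (image_model \<phi> M)" and k: "k \<in> Cof MW"
    and h: "h \<in> hom D p (To (Cod D i') (Fo (Cod W k)))"
    and po: "is_pushout D (\<phi> (Ta (\<psi> i') (Fa (idn W (Dom W k))))) (\<phi> (Ta (\<psi> (idn D (Dom D i'))) (Fa k))) p s t"
    and hs: "h \<cdot>\<^bsub>D\<^esub> s = \<phi> (Ta (\<psi> (idn D (Cod D i'))) (Fa k))"
    and ht: "h \<cdot>\<^bsub>D\<^esub> t = \<phi> (Ta (\<psi> i') (Fa (idn W (Cod W k))))"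
  then obtain i where i: "i \<in> Cof M" "i' = \<phi> i" by auto
  have iA: "i \<in> Arr C" and kA: "k \<in> Arr W" using i k M F_Cof by auto
  note Fk = functor_simps [OF F kA]
  have ps: "\<psi> i' = i" "Dom D i' = Dom C i" "Cod D i' = Cod C i"
    "\<psi> (idn D (Dom C i)) = idn C (Dom C i)" "\<psi> (idn D (Cod C i)) = idn C (Cod C i)"
    "Fa (idn W (Dom W k)) = idn V (Fo (Dom W k))" "Fa (idn W (Cod W k)) = idn V (Fo (Cod W k))"
    using iA kA by (simp_all add: i \<psi>_\<phi> Dom_\<phi> Cod_\<phi> functorD(3) [OF F] flip: idn_\<phi>)
  have ih: "i \<in> hom C (Dom C i) (Cod C i)" and Fkh: "Fa k \<in> hom V (Fo (Dom W k)) (Fo (Cod W k))"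
    using iA Fk by (auto simp: hom_def)
  note idb = idn_in_hom [OF hom_Obj(2) [OF ih]] and ida = idn_in_hom [OF hom_Obj(1) [OF ih]]
  have Fid: "idn V (Fo (Dom W k)) \<in> hom V (Fo (Dom W k)) (Fo (Dom W k))" "idn V (Fo (Cod W k)) \<in> hom V (Fo (Cod W k)) (Fo (Cod W k))"
    using functorD(2) [OF F W.idn_in_hom, of "Dom W k"] functorD(2) [OF F W.idn_in_hom, of "Cod W k"] kA ps(6,7) by simp_all
  note T = bifunctorD(2) [OF To]
  have po': "is_pushout C (Ta i (idn V (Dom V (Fa k)))) (Ta (idn C (Dom C i)) (Fa k)) p (\<psi> s) (\<psi> t)"
    using I.pushout_\<phi> [OF po] by (simp add: ps Fk \<psi>_\<phi>_hom [OF T [OF ih Fid(1)]] \<psi>_\<phi>_hom [OF T [OF ida Fkh]])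
  note P = pushoutD [OF po]
  have hh: "\<psi> h \<in> hom C p (To (Cod C i) (Cod V (Fa k)))" using hom_\<psi> [OF h] by (simp add: ps Fk)
  have "\<psi> h \<cdot>\<^bsub>C\<^esub> \<psi> s = Ta (idn C (Cod C i)) (Fa k)"
    using \<psi>_Comp [OF P(5) h] \<psi>_\<phi>_hom [OF T [OF idb Fkh]] by (simp add: hs ps)
  moreover have "\<psi> h \<cdot>\<^bsub>C\<^esub> \<psi> t = Ta i (idn V (Cod V (Fa k)))"
    using \<psi>_Comp [OF P(6) h] \<psi>_\<phi>_hom [OF T [OF ih Fid(2)]] by (simp add: ht ps Fk)
  ultimately have "\<psi> h \<in> Cof M \<and> (i \<in> Weq M \<or> Fa k \<in> Weq MV \<longrightarrow> \<psi> h \<in> Weq M)"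
    using pp i(1) F_Cof(1) [OF k] po' hh unfolding pushout_product_axiom_def by blast
  moreover have "h = \<phi> (\<psi> h)" using h by (simp add: \<phi>_\<psi> hom_def)
  moreover have "i' \<in> \<phi> ` Weq M \<longleftrightarrow> i \<in> Weq M" using iA M(1) \<phi>_inject unfolding i by blast
  ultimately show "h \<in> Cof (image_model \<phi> M) \<and> (i' \<in> Weq (image_model \<phi> M) \<or> k \<in> Weq MW \<longrightarrow> h \<in> Weq (image_model \<phi> M))"
    using F_Cof(2) [OF k] by auto
qed

lemma pullback_corner_transport:
  assumes Ho: "\<And>k v' v f x y. k \<in> hom V v' v \<Longrightarrow> f \<in> hom C x y \<Longrightarrow> Ha k f \<in> hom C (Ho v x) (Ho v' y)"
    and F: "is_functor W V Fo Fa" and "category W"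
    and F_Cof: "\<And>k. k \<in> Cof MW \<Longrightarrow> k \<in> Arr W \<and> Fa k \<in> Cof MV" "\<And>k. k \<in> Cof MW \<Longrightarrow> k \<in> Weq MW \<Longrightarrow> Fa k \<in> Weq MV"
    and M: "Weq M \<subseteq> Arr C" "Fib M \<subseteq> Arr C"
    and pc: "pullback_corner_axiom V MV C M C M Ho Ha"
  shows "pullback_corner_axiom W MW D (image_model \<phi> M) D (image_model \<phi> M)
    (\<lambda>w x. Ho (Fo w) x) (\<lambda>k f. \<phi> (Ha (Fa k) (\<psi> f)))"
  unfolding pullback_corner_axiom_def
proof (intro ballI allI impI, elim conjE)
  interpret W: category W by fact
  interpret I: cat_iso D C \<psi> by (rule cat_iso_\<psi>)
  fix k q' p s t h
  assume k: "k \<in> Cof MW" and "q' \<in> Fib (image_model \<phi> M)"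
    and h: "h \<in> hom D (Ho (Fo (Cod W k)) (Dom D q')) p"
    and pb: "is_pullback D (\<phi> (Ha (Fa (idn W (Dom W k))) (\<psi> q'))) (\<phi> (Ha (Fa k) (\<psi> (idn D (Cod D q'))))) p s t"
    and sh: "s \<cdot>\<^bsub>D\<^esub> h = \<phi> (Ha (Fa k) (\<psi> (idn D (Dom D q'))))"
    and th: "t \<cdot>\<^bsub>D\<^esub> h = \<phi> (Ha (Fa (idn W (Cod W k))) (\<psi> q'))"
  then obtain q where q: "q \<in> Fib M" "q' = \<phi> q" by auto
  have qA: "q \<in> Arr C" and kA: "k \<in> Arr W" using q k M F_Cof by auto
  note Fk = functor_simps [OF F kA]
  have ps: "\<psi> q' = q" "Dom D q' = Dom C q" "Cod D q' = Cod C q"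
    "\<psi> (idn D (Dom C q)) = idn C (Dom C q)" "\<psi> (idn D (Cod C q)) = idn C (Cod C q)"
    "Fa (idn W (Dom W k)) = idn V (Fo (Dom W k))" "Fa (idn W (Cod W k)) = idn V (Fo (Cod W k))"
    using qA kA by (simp_all add: q \<psi>_\<phi> Dom_\<phi> Cod_\<phi> functorD(3) [OF F] flip: idn_\<phi>)
  have qh: "q \<in> hom C (Dom C q) (Cod C q)" and Fkh: "Fa k \<in> hom V (Fo (Dom W k)) (Fo (Cod W k))"
    using qA Fk by (auto simp: hom_def)
  note idy = idn_in_hom [OF hom_Obj(2) [OF qh]] and idx = idn_in_hom [OF hom_Obj(1) [OF qh]]
  have Fid: "idn V (Fo (Dom W k)) \<in> hom V (Fo (Dom W k)) (Fo (Dom W k))" "idn V (Fo (Cod W k)) \<in> hom V (Fo (Cod W k)) (Fo (Cod W k))"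
    using functorD(2) [OF F W.idn_in_hom, of "Dom W k"] functorD(2) [OF F W.idn_in_hom, of "Cod W k"] kA ps(6,7) by simp_all
  have pb': "is_pullback C (Ha (idn V (Dom V (Fa k))) q) (Ha (Fa k) (idn C (Cod C q))) p (\<psi> s) (\<psi> t)"
    using I.pullback_\<phi> [OF pb] by (simp add: ps Fk \<psi>_\<phi>_hom [OF Ho [OF Fid(1) qh]] \<psi>_\<phi>_hom [OF Ho [OF Fkh idy]])
  note P = pullbackD [OF pb]
  have hh: "\<psi> h \<in> hom C (Ho (Cod V (Fa k)) (Dom C q)) p" using hom_\<psi> [OF h] by (simp add: ps Fk)
  have "\<psi> s \<cdot>\<^bsub>C\<^esub> \<psi> h = Ha (Fa k) (idn C (Dom C q))"
    using \<psi>_Comp [OF h P(5)] \<psi>_\<phi>_hom [OF Ho [OF Fkh idx]] by (simp add: sh ps)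
  moreover have "\<psi> t \<cdot>\<^bsub>C\<^esub> \<psi> h = Ha (idn V (Cod V (Fa k))) q"
    using \<psi>_Comp [OF h P(6)] \<psi>_\<phi>_hom [OF Ho [OF Fid(2) qh]] by (simp add: th ps Fk)
  ultimately have "\<psi> h \<in> Fib M \<and> (Fa k \<in> Weq MV \<or> q \<in> Weq M \<longrightarrow> \<psi> h \<in> Weq M)"
    using pc q(1) F_Cof(1) [OF k] pb' hh unfolding pullback_corner_axiom_def by blast
  moreover have "h = \<phi> (\<psi> h)" using h by (simp add: \<phi>_\<psi> hom_def)
  moreover have "q' \<in> \<phi> ` Weq M \<longleftrightarrow> q \<in> Weq M" using qA M(1) \<phi>_inject unfolding q by blast
  ultimately show "h \<in> Fib (image_model \<phi> M) \<and> (k \<in> Weq MW \<or> q' \<in> Weq (image_model \<phi> M) \<longrightarrow> h \<in> Weq (image_model \<phi> M))"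
    using F_Cof(2) [OF k] by auto
qed

end

lemma (in category) pullback_unique:
  assumes "is_pullback C f g p s t" "is_pullback C f g p' s' t'"
  obtains j where "j \<in> hom C p p'" "iso C j" "s' \<cdot>\<^bsub>C\<^esub> j = s" "t' \<cdot>\<^bsub>C\<^esub> j = t"
proof -
  note P = pullbackD [OF assms(1)] and P' = pullbackD [OF assms(2)]
  obtain j where j: "j \<in> hom C p p'" "s' \<cdot>\<^bsub>C\<^esub> j = s" "t' \<cdot>\<^bsub>C\<^esub> j = t" using P'(8) [OF P(5-7)] by blast
  obtain k where k: "k \<in> hom C p' p" "s \<cdot>\<^bsub>C\<^esub> k = s'" "t \<cdot>\<^bsub>C\<^esub> k = t'" using P(8) [OF P'(5-7)] by blast
  have "k \<cdot>\<^bsub>C\<^esub> j = idn C p"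
    by (rule pullback_ext [OF assms(1) Comp_in_hom [OF j(1) k(1)] idn_in_hom [OF P(4)]])
      (use Comp_assoc [OF j(1) k(1) P(5)] Comp_assoc [OF j(1) k(1) P(6)] j k Comp_idn_right [OF P(5)] Comp_idn_right [OF P(6)] in simp_all)
  moreover have "j \<cdot>\<^bsub>C\<^esub> k = idn C p'"
    by (rule pullback_ext [OF assms(2) Comp_in_hom [OF k(1) j(1)] idn_in_hom [OF P'(4)]])
      (use Comp_assoc [OF k(1) j(1) P'(5)] Comp_assoc [OF k(1) j(1) P'(6)] j k Comp_idn_right [OF P'(5)] Comp_idn_right [OF P'(6)] in simp_all)
  ultimately show ?thesis using that j isoI [OF j(1) k(1)] by blast
qed

text \<open>A right Quillen functor sends the corner map of a two-variable functor to the corner map of the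
  composite, since it preserves the pullback.\<close>

lemma (in quillen_adjunction) pullback_corner_right_adjoint:
  assumes pc: "pullback_corner_axiom A MA B MB V MV Ho Ha"
    and Ha: "\<And>i a b q x y. i \<in> hom A a b \<Longrightarrow> q \<in> hom B x y \<Longrightarrow> Ha i q \<in> hom V (Ho b x) (Ho a y)"
    and comm: "\<And>i a b q x y. i \<in> hom A a b \<Longrightarrow> q \<in> hom B x y \<Longrightarrow>
      Ha (idn A a) q \<cdot>\<^bsub>V\<^esub> Ha i (idn B x) = Ha i (idn B y) \<cdot>\<^bsub>V\<^esub> Ha (idn A b) q"
    and "category A" "category B" and i: "i \<in> Cof MA" "i \<in> Arr A" and q: "q \<in> Fib MB" "q \<in> Arr B"
    and h: "h \<in> hom W (Go (Ho (Cod A i) (Dom B q))) p"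
    and pb: "is_pullback W (Ga (Ha (idn A (Dom A i)) q)) (Ga (Ha i (idn B (Cod B q)))) p s t"
    and sh: "s \<cdot>\<^bsub>W\<^esub> h = Ga (Ha i (idn B (Dom B q)))" and th: "t \<cdot>\<^bsub>W\<^esub> h = Ga (Ha (idn A (Cod A i)) q)"
  shows "h \<in> Fib MW \<and> (i \<in> Weq MA \<or> q \<in> Weq MB \<longrightarrow> h \<in> Weq MW)"
proof -
  interpret A: category A by fact
  interpret B: category B by fact
  define a b x y where "a = Dom A i" and "b = Cod A i" and "x = Dom B q" and "y = Cod B q"
  note defs = a_def [symmetric] b_def [symmetric] x_def [symmetric] y_def [symmetric]
  have ih: "i \<in> hom A a b" and qh: "q \<in> hom B x y"
    using i q by (simp_all add: hom_def a_def b_def x_def y_def)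
  note ab = A.hom_Obj [OF ih] and xy = B.hom_Obj [OF qh]
  have aq: "Ha (idn A a) q \<in> hom V (Ho a x) (Ho a y)" and bq: "Ha (idn A b) q \<in> hom V (Ho b x) (Ho b y)"
    and ix: "Ha i (idn B x) \<in> hom V (Ho b x) (Ho a x)" and iy: "Ha i (idn B y) \<in> hom V (Ho b y) (Ho a y)"
    using Ha A.idn_in_hom B.idn_in_hom ih qh ab xy by blast+
  have D: "Dom V (Ha (idn A a) q) = Ho a x" "Dom V (Ha i (idn B y)) = Ho b y"
    using aq iy by (auto simp: hom_def)
  obtain P s0 t0 where P: "is_pullback V (Ha (idn A a) q) (Ha i (idn B y)) P s0 t0"
    using V.pullbacks [of "Ha (idn A a) q" "Ha i (idn B y)"] aq iy by (auto simp: hom_def)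
  note PD = pullbackD [OF P, unfolded D]
  obtain k where k: "k \<in> hom V (Ho b x) P" "s0 \<cdot>\<^bsub>V\<^esub> k = Ha i (idn B x)" "t0 \<cdot>\<^bsub>V\<^esub> k = Ha (idn A b) q"
    using PD(8) [OF ix bq comm [OF ih qh]] by blast
  have "k \<in> Fib MV \<and> (i \<in> Weq MA \<or> q \<in> Weq MB \<longrightarrow> k \<in> Weq MV)"
    using pc i(1) q(1) k P unfolding pullback_corner_axiom_def a_def b_def x_def y_def by blast
  then have Gk: "Ga k \<in> Fib MW" "i \<in> Weq MA \<or> q \<in> Weq MB \<Longrightarrow> Ga k \<in> Weq MW"
    using Ga_Fib Ga_acyclic_Fib by blast+
  have Gkh: "Ga k \<in> hom W (Go (Ho b x)) (Go P)" using Ga_hom [OF k(1)] .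
  obtain j where j: "j \<in> hom W (Go P) p" "iso W j" "s \<cdot>\<^bsub>W\<^esub> j = Ga s0" "t \<cdot>\<^bsub>W\<^esub> j = Ga t0"
    by (rule W.pullback_unique [OF pullback_adjoint [OF P] pb [unfolded defs]])
  note PW = pullbackD [OF pb]
  have "j \<cdot>\<^bsub>W\<^esub> Ga k = h"
  proof (rule W.pullback_ext [OF pb])
    show "j \<cdot>\<^bsub>W\<^esub> Ga k \<in> hom W (Go (Ho b x)) p" "h \<in> hom W (Go (Ho b x)) p"
      using W.Comp_in_hom [OF Gkh j(1)] h by (simp_all add: defs)
    show "s \<cdot>\<^bsub>W\<^esub> j \<cdot>\<^bsub>W\<^esub> Ga k = s \<cdot>\<^bsub>W\<^esub> h"
      using W.Comp_assoc [OF Gkh j(1) PW(5)] j(3) Ga_Comp [OF k(1) PD(5)] k(2) sh by (simp add: defs)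
    show "t \<cdot>\<^bsub>W\<^esub> j \<cdot>\<^bsub>W\<^esub> Ga k = t \<cdot>\<^bsub>W\<^esub> h"
      using W.Comp_assoc [OF Gkh j(1) PW(6)] j(4) Ga_Comp [OF k(1) PD(6)] k(3) th by (simp add: defs)
  qed
  moreover have "j \<cdot>\<^bsub>W\<^esub> Ga k \<in> Fib MW" "i \<in> Weq MA \<or> q \<in> Weq MB \<Longrightarrow> j \<cdot>\<^bsub>W\<^esub> Ga k \<in> Weq MW"
    using W.model_Comp(1,3) [of "Ga k" j] W.model_iso [OF j(2)] Gk Gkh j(1) by (auto simp: hom_def)
  ultimately show ?thesis by simp
qed

section \<open>Change of enrichment of weak enriched model categories\<close>

lemma (in enriched) pre_tensoringD:
  assumes "pre_tensoring V C T"
  shows "is_bifunctor C0 V C0 (tO T) (tA T)"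
    "v \<in> Obj V \<Longrightarrow> x \<in> EObj C \<Longrightarrow> y \<in> EObj C \<Longrightarrow> phi T v x y \<in> hom V (EHom C (tO T x v) y) (ihom V v (EHom C x y))"
    "k \<in> hom V v' v \<Longrightarrow> f \<in> hom C0 x' x \<Longrightarrow> g \<in> hom C0 y y' \<Longrightarrow>
         phi T v' x' y' \<cdot>\<^bsub>V\<^esub> ehom_arr V C (tA T f k) g = ihom_arr V k (ehom_arr V C f g) \<cdot>\<^bsub>V\<^esub> phi T v x y"
    "x \<in> EObj C \<Longrightarrow> rho T x \<in> hom C0 (tO T x \<one>\<^bsub>V\<^esub>) x"
    "f \<in> hom C0 x y \<Longrightarrow> rho T y \<cdot>\<^bsub>C0\<^esub> tA T f (idn V \<one>\<^bsub>V\<^esub>) = f \<cdot>\<^bsub>C0\<^esub> rho T x"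
    "x \<in> EObj C \<Longrightarrow> y \<in> EObj C \<Longrightarrow> phi T \<one>\<^bsub>V\<^esub> x y \<cdot>\<^bsub>V\<^esub> ehom_arr V C (rho T x) (idn C0 y) = unit_ihom V (EHom C x y)"
  using assms unfolding pre_tensoring_def Let_def by blast+

lemma (in enriched) pre_cotensoringD:
  assumes "pre_cotensoring V C S"
  shows "is_bifunctor C0 (op_cat V) C0 (cO S) (cA S)"
    "v \<in> Obj V \<Longrightarrow> x \<in> EObj C \<Longrightarrow> y \<in> EObj C \<Longrightarrow> psi S v x y \<in> hom V (EHom C x (cO S y v)) (ihom V v (EHom C x y))"
    "k \<in> hom V v' v \<Longrightarrow> f \<in> hom C0 x' x \<Longrightarrow> g \<in> hom C0 y y' \<Longrightarrow>
         psi S v' x' y' \<cdot>\<^bsub>V\<^esub> ehom_arr V C f (cA S g k) = ihom_arr V k (ehom_arr V C f g) \<cdot>\<^bsub>V\<^esub> psi S v x y"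
    "y \<in> EObj C \<Longrightarrow> eta S y \<in> hom C0 y (cO S y \<one>\<^bsub>V\<^esub>)"
    "f \<in> hom C0 x y \<Longrightarrow> cA S f (idn V \<one>\<^bsub>V\<^esub>) \<cdot>\<^bsub>C0\<^esub> eta S x = eta S y \<cdot>\<^bsub>C0\<^esub> f"
    "x \<in> EObj C \<Longrightarrow> y \<in> EObj C \<Longrightarrow> psi S \<one>\<^bsub>V\<^esub> x y \<cdot>\<^bsub>V\<^esub> ehom_arr V C (idn C0 x) (eta S y) = unit_ihom V (EHom C x y)"
  using assms unfolding pre_cotensoring_def Let_def by blast+

lemma (in enriched) cotensor_hom:
  assumes "pre_cotensoring V C S" "f \<in> hom C0 x y" "k \<in> hom V v' v"
  shows "cA S f k \<in> hom C0 (cO S x v) (cO S y v')"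
  using bifunctorD(2) [OF pre_cotensoringD(1) [OF assms(1)] assms(2), of k v v'] assms(3) by simp

lemma (in enriched) cotensor_Comp:
  assumes "pre_cotensoring V C S" "f \<in> hom C0 x y" "g \<in> hom C0 y z" "k \<in> hom V v' v" "l \<in> hom V v'' v'"
  shows "cA S (g \<cdot>\<^bsub>C0\<^esub> f) (k \<cdot>\<^bsub>V\<^esub> l) = cA S g l \<cdot>\<^bsub>C0\<^esub> cA S f k"
  using bifunctorD(4) [OF pre_cotensoringD(1) [OF assms(1)] assms(2,3), of k v v' l v''] assms(4,5) by simp

locale weak_base_change =
  weak_monoidal_quillen_adjunction U W MW V MV A + change_of_base W V A C
  for U :: "'u itself" and W :: "('wo, 'wm, 'x) smc_scheme" and MW
    and V :: "('vo, 'vm, 'y) smc_scheme" and MV and A and C :: "('c, 'vo, 'vm) vcat" +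
  fixes MC :: "('c \<times> 'c \<times> 'vm) model_structure"
  assumes eps_iso: "iso V eps" and model_C0: "model_category U E.C0 MC"
begin

abbreviation MC' where "MC' \<equiv> image_model (base_arr W A) MC"

sublocale C0: complete_model_category U E.C0 MC
  using model_C0 W.infinite_UNIV by (intro complete_model_category.intro complete_model_category_axioms.intro)

sublocale I: cat_iso E.C0 E'.C0 "base_arr W A"
  by (rule cat_iso_base_arr [OF eps_iso C0.category_axioms])

lemma model_change_base: "model_category U E'.C0 MC'"
  using cat_iso_model_category [OF I.cat_iso_axioms model_C0] .

sublocale C0': complete_model_category U E'.C0 MC'
  using model_change_base W.infinite_UNIV by (intro complete_model_category.intro complete_model_category_axioms.intro)

lemma model_Arr_C0: "Weq MC \<subseteq> Arr E.C0" "Cof MC \<subseteq> Arr E.C0" "Fib MC \<subseteq> Arr E.C0"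
  using C0.model_Arr by blast+

lemma cofibrant_iff: "cofibrant E'.C0 MC' x \<longleftrightarrow> cofibrant E.C0 MC x"
  using I.cofibrant_\<phi> [of MC x] cat_iso.cofibrant_\<phi> [OF I.cat_iso_\<psi>, of MC' x] I.image_model_\<psi> [OF model_Arr_C0] by auto

lemma fibrant_iff: "fibrant E'.C0 MC' x \<longleftrightarrow> fibrant E.C0 MC x"
  using I.fibrant_\<phi> [of MC x] cat_iso.fibrant_\<phi> [OF I.cat_iso_\<psi>, of MC' x] I.image_model_\<psi> [OF model_Arr_C0] by auto

lemma hom_baseE:
  assumes "f \<in> hom E'.C0 x y"
  obtains f0 where "f = base_arr W A f0" "f0 \<in> hom E.C0 x y"
  using assms unfolding I.hom_eq by blast

lemma idn_base: "x \<in> EObj C \<Longrightarrow> idn E'.C0 x = base_arr W A (idn E.C0 x)"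
  using I.idn_\<phi> [of x] by simp

lemma ehom_idn_idn: "x \<in> EObj C \<Longrightarrow> y \<in> EObj C \<Longrightarrow> ehom_arr V C (idn E.C0 x) (idn E.C0 y) = idn V (EHom C x y)"
  by (simp add: E.ehom_arr_idn_left E.post_EId hom_def)

lemma SM7_change_base:
  assumes "SM7 V MV C MC"
  shows "SM7 W MW C' MC'"
  unfolding SM7_def pullback_corner_axiom_def
proof (intro ballI allI impI, elim conjE)
  fix i' q' p s t h
  assume "i' \<in> Cof MC'" "q' \<in> Fib MC'" and h: "h \<in> hom W (EHom C' (Cod E'.C0 i') (Dom E'.C0 q')) p"
    and pb: "is_pullback W (ehom_arr W C' (idn E'.C0 (Dom E'.C0 i')) q') (ehom_arr W C' i' (idn E'.C0 (Cod E'.C0 q'))) p s t"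
    and sh: "s \<cdot>\<^bsub>W\<^esub> h = ehom_arr W C' i' (idn E'.C0 (Dom E'.C0 q'))"
    and th: "t \<cdot>\<^bsub>W\<^esub> h = ehom_arr W C' (idn E'.C0 (Cod E'.C0 i')) q'"
  then obtain i q where i: "i' = base_arr W A i" "i \<in> Cof MC" and q: "q' = base_arr W A q" "q \<in> Fib MC" by auto
  have iA: "i \<in> Arr E.C0" and qA: "q \<in> Arr E.C0" using i q by auto
  have ih: "i \<in> hom E.C0 (Dom E.C0 i) (Cod E.C0 i)" and qh: "q \<in> hom E.C0 (Dom E.C0 q) (Cod E.C0 q)"
    using iA qA by (auto simp: hom_def)
  have D: "Dom E'.C0 i' = Dom E.C0 i" "Cod E'.C0 i' = Cod E.C0 i" "Dom E'.C0 q' = Dom E.C0 q" "Cod E'.C0 q' = Cod E.C0 q"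
    using iA qA by (simp_all add: i q I.Dom_\<phi> I.Cod_\<phi>)
  have ob: "Dom E.C0 i \<in> EObj C" "Cod E.C0 i \<in> EObj C" "Dom E.C0 q \<in> EObj C" "Cod E.C0 q \<in> EObj C"
    using C0.hom_Obj [OF ih] C0.hom_Obj [OF qh] by simp_all
  note id = C0.idn_in_hom [unfolded E.underlying_simps(1)]
  have e: "ehom_arr W C' (idn E'.C0 (Dom E.C0 i)) q' = GA A (ehom_arr V C (idn E.C0 (Dom E.C0 i)) q)"
    "ehom_arr W C' i' (idn E'.C0 (Cod E.C0 q)) = GA A (ehom_arr V C i (idn E.C0 (Cod E.C0 q)))"
    "ehom_arr W C' i' (idn E'.C0 (Dom E.C0 q)) = GA A (ehom_arr V C i (idn E.C0 (Dom E.C0 q)))"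
    "ehom_arr W C' (idn E'.C0 (Cod E.C0 i)) q' = GA A (ehom_arr V C (idn E.C0 (Cod E.C0 i)) q)"
    unfolding i(1) q(1)
    using ehom_arr_change_base ih qh id ob idn_base by metis+
  have "h \<in> Fib MW \<and> (i \<in> Weq MC \<or> q \<in> Weq MC \<longrightarrow> h \<in> Weq MW)"
  proof (rule pullback_corner_right_adjoint [OF assms [unfolded SM7_def] E.ehom_arr_hom E.ehom_arr_interchange
        C0.category_axioms C0.category_axioms i(2) iA q(2) qA])
    show "h \<in> hom W (GO A (EHom C (Cod E.C0 i) (Dom E.C0 q))) p" using h by (simp add: D)
    show "is_pullback W (GA A (ehom_arr V C (idn E.C0 (Dom E.C0 i)) q)) (GA A (ehom_arr V C i (idn E.C0 (Cod E.C0 q)))) p s t"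
      using pb unfolding D e .
    show "s \<cdot>\<^bsub>W\<^esub> h = GA A (ehom_arr V C i (idn E.C0 (Dom E.C0 q)))" using sh unfolding D e .
    show "t \<cdot>\<^bsub>W\<^esub> h = GA A (ehom_arr V C (idn E.C0 (Cod E.C0 i)) q)" using th unfolding D e .
  qed
  moreover have "i' \<in> Weq MC' \<longleftrightarrow> i \<in> Weq MC" "q' \<in> Weq MC' \<longleftrightarrow> q \<in> Weq MC"
    using iA qA model_Arr_C0(1) I.\<phi>_inject unfolding i q by (auto simp: subset_iff image_iff)
  ultimately show "h \<in> Fib MW \<and> (i' \<in> Weq MC' \<or> q' \<in> Weq MC' \<longrightarrow> h \<in> Weq MW)" by simp
qed

lemma change_base_tensor_simps [simp]:
  "tO (change_base_tensor W V A C T) = (\<lambda>x w. tO T x (FO A w))"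
  "tA (change_base_tensor W V A C T) = (\<lambda>f k. base_arr W A (tA T (I.\<psi> f) (FA A k)))"
  "phi (change_base_tensor W V A C T) w x y = th w (EHom C x y) \<cdot>\<^bsub>W\<^esub> GA A (phi T (FO A w) x y)"
  "rho (change_base_tensor W V A C T) x = base_arr W A (rho T x \<cdot>\<^bsub>E.C0\<^esub> tA T (idn E.C0 x) eps)"
  unfolding change_base_tensor_def unbase_arr_def by simp_all

lemma change_base_cotensor_simps [simp]:
  "cO (change_base_cotensor W V A C S) = (\<lambda>y w. cO S y (FO A w))"
  "cA (change_base_cotensor W V A C S) = (\<lambda>f k. base_arr W A (cA S (I.\<psi> f) (FA A k)))"
  "psi (change_base_cotensor W V A C S) w x y = th w (EHom C x y) \<cdot>\<^bsub>W\<^esub> GA A (psi S (FO A w) x y)"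
  "eta (change_base_cotensor W V A C S) y = base_arr W A (cA S (idn E.C0 y) eps \<cdot>\<^bsub>E.C0\<^esub> eta S y)"
  unfolding change_base_cotensor_def unbase_arr_def by simp_all

text \<open>The bifunctor is conjugated by an isomorphism of categories and precomposed with \<open>F\<close>, so the content
  is in the two conditions on the structure map, which come from those for \<open>\<theta>\<close>.\<close>

lemma pre_tensoring_change_base:
  assumes T: "pre_tensoring V C T"
  shows "pre_tensoring W C' (change_base_tensor W V A C T)"
  unfolding pre_tensoring_def Let_def change_base_tensor_simps change_base_simps
proof (intro conjI allI ballI)
  note D = E.pre_tensoringD [OF T]
  note B = bifunctorD [OF D(1)]
  note id = C0.idn_in_hom [unfolded E.underlying_simps(1)]
  note base = I.hom_\<phi> and bComp = I.Comp_\<phi>_hom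
  show "is_bifunctor E'.C0 W E'.C0 (\<lambda>x w. tO T x (FO A w)) (\<lambda>f k. base_arr W A (tA T (I.\<psi> f) (FA A k)))"
  proof (rule bifunctorI)
    show "tO T x (FO A w) \<in> Obj E'.C0" if "x \<in> Obj E'.C0" "w \<in> Obj W" for x w
      using B(1) that by simp
    show "base_arr W A (tA T (I.\<psi> f) (FA A k)) \<in> hom E'.C0 (tO T x (FO A w)) (tO T x' (FO A w'))"
      if "f \<in> hom E'.C0 x x'" "k \<in> hom W w w'" for f x x' k w w'
      by (rule base [OF B(2) [OF I.hom_\<psi> [OF that(1)] F_hom [OF that(2)]]])
    show "base_arr W A (tA T (I.\<psi> (idn E'.C0 x)) (FA A (idn W w))) = idn E'.C0 (tO T x (FO A w))"
      if "x \<in> Obj E'.C0" "w \<in> Obj W" for x w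
      using that B(1,3) [of x "FO A w"] idn_base I.\<psi>_\<phi>_hom [OF id] by simp
    show "base_arr W A (tA T (I.\<psi> (f' \<cdot>\<^bsub>E'.C0\<^esub> f)) (FA A (k' \<cdot>\<^bsub>W\<^esub> k)))
        = base_arr W A (tA T (I.\<psi> f') (FA A k')) \<cdot>\<^bsub>E'.C0\<^esub> base_arr W A (tA T (I.\<psi> f) (FA A k))"
      if "f \<in> hom E'.C0 x x'" "f' \<in> hom E'.C0 x' x''" "k \<in> hom W w w'" "k' \<in> hom W w' w''" for f x x' f' x'' k w w' k' w''
      unfolding I.\<psi>_Comp [OF that(1,2)] F_Comp [OF that(3,4)]
        B(4) [OF I.hom_\<psi> [OF that(1)] I.hom_\<psi> [OF that(2)] F_hom [OF that(3)] F_hom [OF that(4)]]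
      by (rule bComp [OF B(2) B(2), symmetric]) (use that in \<open>auto intro: I.hom_\<psi> F_hom\<close>)
  qed
  fix v x y assume v: "v \<in> Obj W" and x: "x \<in> EObj C" and y: "y \<in> EObj C"
  show "th v (EHom C x y) \<cdot>\<^bsub>W\<^esub> GA A (phi T (FO A v) x y)
      \<in> hom W (GO A (EHom C (tO T x (FO A v)) y)) (ihom W v (GO A (EHom C x y)))"
    using W.Comp_in_hom [OF G_hom [OF D(2)] theta(1)] v x y by simp
next
  note D = E.pre_tensoringD [OF T]
  note B = bifunctorD [OF D(1)]
  fix v' v x' x y y' k f' g'
  assume k: "k \<in> hom W v' v" and f': "f' \<in> hom E'.C0 x' x" and g': "g' \<in> hom E'.C0 y y'"
  obtain f where f: "f' = base_arr W A f" "f \<in> hom E.C0 x' x" using hom_baseE [OF f'] .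
  obtain g where g: "g' = base_arr W A g" "g \<in> hom E.C0 y y'" using hom_baseE [OF g'] .
  note v = W.hom_Obj [OF k]
  have ob: "x' \<in> EObj C" "x \<in> EObj C" "y \<in> EObj C" "y' \<in> EObj C"
    using C0.hom_Obj [OF f(2)] C0.hom_Obj [OF g(2)] by simp_all
  note Fk = F_hom [OF k]
  have fk: "tA T f (FA A k) \<in> hom E.C0 (tO T x' (FO A v')) (tO T x (FO A v))" by (rule B(2) [OF f(2) Fk])
  have Fv: "FO A v \<in> Obj V" "FO A v' \<in> Obj V" using v by simp_all
  show "(th v' (EHom C x' y') \<cdot>\<^bsub>W\<^esub> GA A (phi T (FO A v') x' y')) \<cdot>\<^bsub>W\<^esub>
        ehom_arr W C' (base_arr W A (tA T (I.\<psi> f') (FA A k))) g'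
      = ihom_arr W k (ehom_arr W C' f' g') \<cdot>\<^bsub>W\<^esub> (th v (EHom C x y) \<cdot>\<^bsub>W\<^esub> GA A (phi T (FO A v) x y))"
    unfolding f(1) g(1) I.\<psi>_\<phi>_hom [OF f(2)] ehom_arr_change_base [OF fk g(2)] ehom_arr_change_base [OF f(2) g(2)]
    by (rule theta_comp_natural [OF k D(2) [OF Fv(1) ob(2,3)] D(2) [OF Fv(2) ob(1,4)]
          E.ehom_arr_hom [OF fk g(2)] E.ehom_arr_hom [OF f(2) g(2)] D(3) [OF Fk f(2) g(2)]])
next
  note D = E.pre_tensoringD [OF T]
  note B = bifunctorD [OF D(1)]
  note id = C0.idn_in_hom [unfolded E.underlying_simps(1)]
  have xe: "tA T (idn E.C0 x) eps \<in> hom E.C0 (tO T x (FO A \<one>\<^bsub>W\<^esub>)) (tO T x \<one>\<^bsub>V\<^esub>)" if "x \<in> EObj C" for x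
    by (rule B(2) [OF id [OF that] eps(1)])
  have r: "rho T x \<cdot>\<^bsub>E.C0\<^esub> tA T (idn E.C0 x) eps \<in> hom E.C0 (tO T x (FO A \<one>\<^bsub>W\<^esub>)) x" if "x \<in> EObj C" for x
    by (rule C0.Comp_in_hom [OF xe [OF that] D(4) [OF that]])
  show "base_arr W A (rho T x \<cdot>\<^bsub>E.C0\<^esub> tA T (idn E.C0 x) eps) \<in> hom E'.C0 (tO T x (FO A \<one>\<^bsub>W\<^esub>)) x" if "x \<in> EObj C" for x
    by (rule I.hom_\<phi> [OF r [OF that]])
  show "base_arr W A (rho T y \<cdot>\<^bsub>E.C0\<^esub> tA T (idn E.C0 y) eps) \<cdot>\<^bsub>E'.C0\<^esub> base_arr W A (tA T (I.\<psi> f') (FA A (idn W \<one>\<^bsub>W\<^esub>)))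
      = f' \<cdot>\<^bsub>E'.C0\<^esub> base_arr W A (rho T x \<cdot>\<^bsub>E.C0\<^esub> tA T (idn E.C0 x) eps)" if f': "f' \<in> hom E'.C0 x y" for f' x y
  proof -
    obtain f where f: "f' = base_arr W A f" "f \<in> hom E.C0 x y" using hom_baseE [OF f'] .
    have x: "x \<in> EObj C" and y: "y \<in> EObj C" using C0.hom_Obj [OF f(2)] by simp_all
    have FI: "FO A \<one>\<^bsub>W\<^esub> \<in> Obj V" "\<one>\<^bsub>V\<^esub> \<in> Obj V" by simp_all
    note idF = V.idn_in_hom [OF FI(1)] and idI = V.idn_in_hom [OF FI(2)]
    have fF: "tA T f (idn V (FO A \<one>\<^bsub>W\<^esub>)) \<in> hom E.C0 (tO T x (FO A \<one>\<^bsub>W\<^esub>)) (tO T y (FO A \<one>\<^bsub>W\<^esub>))"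
      by (rule B(2) [OF f(2) idF])
    have fI: "tA T f (idn V \<one>\<^bsub>V\<^esub>) \<in> hom E.C0 (tO T x \<one>\<^bsub>V\<^esub>) (tO T y \<one>\<^bsub>V\<^esub>)"
      by (rule B(2) [OF f(2) idI])
    have "tA T (idn E.C0 y) eps \<cdot>\<^bsub>E.C0\<^esub> tA T f (idn V (FO A \<one>\<^bsub>W\<^esub>)) = tA T f eps"
      using B(4) [OF f(2) id [OF y] idF eps(1)] C0.Comp_idn_left [OF f(2)] V.Comp_idn_right [OF eps(1)] by simp
    moreover have "tA T f (idn V \<one>\<^bsub>V\<^esub>) \<cdot>\<^bsub>E.C0\<^esub> tA T (idn E.C0 x) eps = tA T f eps"
      using B(4) [OF id [OF x] f(2) eps(1) idI] C0.Comp_idn_right [OF f(2)] V.Comp_idn_left [OF eps(1)] by simp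
    ultimately have "(rho T y \<cdot>\<^bsub>E.C0\<^esub> tA T (idn E.C0 y) eps) \<cdot>\<^bsub>E.C0\<^esub> tA T f (idn V (FO A \<one>\<^bsub>W\<^esub>))
        = f \<cdot>\<^bsub>E.C0\<^esub> (rho T x \<cdot>\<^bsub>E.C0\<^esub> tA T (idn E.C0 x) eps)"
      using C0.Comp_assoc [OF fF xe [OF y] D(4) [OF y]] C0.Comp_assoc [OF xe [OF x] fI D(4) [OF y]]
        D(5) [OF f(2)] C0.Comp_assoc [OF xe [OF x] D(4) [OF x] f(2)] by simp
    then show ?thesis
      using I.Comp_\<phi>_hom [OF fF r [OF y]] I.Comp_\<phi>_hom [OF r [OF x] f(2)] I.\<psi>_\<phi>_hom [OF f(2)] by (simp add: f(1))
  qed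
  fix x y assume x: "x \<in> EObj C" and y: "y \<in> EObj C"
  let ?E = "EHom C x y" and ?F = "FO A \<one>\<^bsub>W\<^esub>"
  have FI: "?F \<in> Obj V" and E: "?E \<in> Obj V" using x y by simp_all
  note p = D(2) [OF FI x y] and p1 = D(2) [OF V.munit_Obj x y]
  note e1 = E.ehom_arr_hom [OF xe [OF x] id [OF y]] and e2 = E.ehom_arr_hom [OF D(4) [OF x] id [OF y]]
  note i = V.ihom_arr(1) [OF eps(1) V.idn_in_hom [OF E]]
  have "phi T ?F x y \<cdot>\<^bsub>V\<^esub> ehom_arr V C (rho T x \<cdot>\<^bsub>E.C0\<^esub> tA T (idn E.C0 x) eps) (idn E.C0 y)
      = (phi T ?F x y \<cdot>\<^bsub>V\<^esub> ehom_arr V C (tA T (idn E.C0 x) eps) (idn E.C0 y)) \<cdot>\<^bsub>V\<^esub> ehom_arr V C (rho T x) (idn E.C0 y)"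
    unfolding E.ehom_arr_Comp_left [OF D(4) [OF x] xe [OF x] y] by (rule V.Comp_assoc [OF e2 e1 p])
  also have "\<dots> = ihom_arr V eps (idn V ?E) \<cdot>\<^bsub>V\<^esub> unit_ihom V ?E"
    unfolding D(3) [OF eps(1) id [OF x] id [OF y]] ehom_idn_idn [OF x y] D(6) [OF x y, symmetric]
    by (rule V.Comp_assoc [OF e2 p1 i, symmetric])
  finally have *: "phi T ?F x y \<cdot>\<^bsub>V\<^esub> ehom_arr V C (rho T x \<cdot>\<^bsub>E.C0\<^esub> tA T (idn E.C0 x) eps) (idn E.C0 y)
      = ihom_arr V eps (idn V ?E) \<cdot>\<^bsub>V\<^esub> unit_ihom V ?E" .
  note er = E.ehom_arr_hom [OF r [OF x] id [OF y]]
  show "(th \<one>\<^bsub>W\<^esub> ?E \<cdot>\<^bsub>W\<^esub> GA A (phi T ?F x y)) \<cdot>\<^bsub>W\<^esub>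
      ehom_arr W C' (base_arr W A (rho T x \<cdot>\<^bsub>E.C0\<^esub> tA T (idn E.C0 x) eps)) (idn E'.C0 y) = unit_ihom W (GO A ?E)"
    unfolding idn_base [OF y] ehom_arr_change_base [OF r [OF x] id [OF y]]
    by (rule theta_comp_unit [OF p er *])
qed

lemma pre_cotensoring_change_base:
  assumes S: "pre_cotensoring V C S"
  shows "pre_cotensoring W C' (change_base_cotensor W V A C S)"
  unfolding pre_cotensoring_def Let_def change_base_cotensor_simps change_base_simps
proof (intro conjI allI ballI)
  note D = E.pre_cotensoringD [OF S]
  note B = bifunctorD(1,3) [OF D(1)]
  note cA = E.cotensor_hom [OF S] and cComp = E.cotensor_Comp [OF S]
  note id = C0.idn_in_hom [unfolded E.underlying_simps(1)]
  show "is_bifunctor E'.C0 (op_cat W) E'.C0 (\<lambda>y w. cO S y (FO A w)) (\<lambda>f k. base_arr W A (cA S (I.\<psi> f) (FA A k)))"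
  proof (rule bifunctorI)
    show "cO S x (FO A w) \<in> Obj E'.C0" if "x \<in> Obj E'.C0" "w \<in> Obj (op_cat W)" for x w
      using B(1) that by simp
    show "base_arr W A (cA S (I.\<psi> f) (FA A k)) \<in> hom E'.C0 (cO S x (FO A w)) (cO S x' (FO A w'))"
      if "f \<in> hom E'.C0 x x'" "k \<in> hom (op_cat W) w w'" for f x x' k w w'
      by (rule I.hom_\<phi> [OF cA [OF I.hom_\<psi> [OF that(1)] F_hom]]) (use that(2) in simp)
    show "base_arr W A (cA S (I.\<psi> (idn E'.C0 x)) (FA A (idn (op_cat W) w))) = idn E'.C0 (cO S x (FO A w))"
      if "x \<in> Obj E'.C0" "w \<in> Obj (op_cat W)" for x w
      using that B(1,2) [of x "FO A w"] idn_base I.\<psi>_\<phi>_hom [OF id] by simp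
    show "base_arr W A (cA S (I.\<psi> (f' \<cdot>\<^bsub>E'.C0\<^esub> f)) (FA A (k' \<cdot>\<^bsub>op_cat W\<^esub> k)))
        = base_arr W A (cA S (I.\<psi> f') (FA A k')) \<cdot>\<^bsub>E'.C0\<^esub> base_arr W A (cA S (I.\<psi> f) (FA A k))"
      if f: "f \<in> hom E'.C0 x x'" "f' \<in> hom E'.C0 x' x''" and k: "k \<in> hom (op_cat W) w w'" "k' \<in> hom (op_cat W) w' w''"
      for f x x' f' x'' k w w' k' w''
    proof -
      have k2: "k \<in> hom W w' w" "k' \<in> hom W w'' w'" using k by simp_all
      show ?thesis
        unfolding op_cat_simps I.\<psi>_Comp [OF f] F_Comp [OF k2(2,1)]
          cComp [OF I.hom_\<psi> [OF f(1)] I.hom_\<psi> [OF f(2)] F_hom [OF k2(1)] F_hom [OF k2(2)]]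
        by (rule I.Comp_\<phi>_hom [OF cA cA, symmetric]) (use f k2 in \<open>auto intro: I.hom_\<psi> F_hom\<close>)
    qed
  qed
  fix v x y assume v: "v \<in> Obj W" and x: "x \<in> EObj C" and y: "y \<in> EObj C"
  show "th v (EHom C x y) \<cdot>\<^bsub>W\<^esub> GA A (psi S (FO A v) x y)
      \<in> hom W (GO A (EHom C x (cO S y (FO A v)))) (ihom W v (GO A (EHom C x y)))"
    using W.Comp_in_hom [OF G_hom [OF D(2)] theta(1)] v x y by simp
next
  note D = E.pre_cotensoringD [OF S]
  note cA = E.cotensor_hom [OF S]
  fix v' v x' x y y' k f' g'
  assume k: "k \<in> hom W v' v" and f': "f' \<in> hom E'.C0 x' x" and g': "g' \<in> hom E'.C0 y y'"
  obtain f where f: "f' = base_arr W A f" "f \<in> hom E.C0 x' x" using hom_baseE [OF f'] .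
  obtain g where g: "g' = base_arr W A g" "g \<in> hom E.C0 y y'" using hom_baseE [OF g'] .
  note v = W.hom_Obj [OF k]
  have ob: "x' \<in> EObj C" "x \<in> EObj C" "y \<in> EObj C" "y' \<in> EObj C"
    using C0.hom_Obj [OF f(2)] C0.hom_Obj [OF g(2)] by simp_all
  note Fk = F_hom [OF k]
  have gk: "cA S g (FA A k) \<in> hom E.C0 (cO S y (FO A v)) (cO S y' (FO A v'))" by (rule cA [OF g(2) Fk])
  have Fv: "FO A v \<in> Obj V" "FO A v' \<in> Obj V" using v by simp_all
  show "(th v' (EHom C x' y') \<cdot>\<^bsub>W\<^esub> GA A (psi S (FO A v') x' y')) \<cdot>\<^bsub>W\<^esub>
        ehom_arr W C' f' (base_arr W A (cA S (I.\<psi> g') (FA A k)))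
      = ihom_arr W k (ehom_arr W C' f' g') \<cdot>\<^bsub>W\<^esub> (th v (EHom C x y) \<cdot>\<^bsub>W\<^esub> GA A (psi S (FO A v) x y))"
    unfolding f(1) g(1) I.\<psi>_\<phi>_hom [OF g(2)] ehom_arr_change_base [OF f(2) gk] ehom_arr_change_base [OF f(2) g(2)]
    by (rule theta_comp_natural [OF k D(2) [OF Fv(1) ob(2,3)] D(2) [OF Fv(2) ob(1,4)]
          E.ehom_arr_hom [OF f(2) gk] E.ehom_arr_hom [OF f(2) g(2)] D(3) [OF Fk f(2) g(2)]])
next
  note D = E.pre_cotensoringD [OF S]
  note cA = E.cotensor_hom [OF S] and cComp = E.cotensor_Comp [OF S]
  note id = C0.idn_in_hom [unfolded E.underlying_simps(1)]
  have ye: "cA S (idn E.C0 y) eps \<in> hom E.C0 (cO S y \<one>\<^bsub>V\<^esub>) (cO S y (FO A \<one>\<^bsub>W\<^esub>))" if "y \<in> EObj C" for y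
    by (rule cA [OF id [OF that] eps(1)])
  have r: "cA S (idn E.C0 y) eps \<cdot>\<^bsub>E.C0\<^esub> eta S y \<in> hom E.C0 y (cO S y (FO A \<one>\<^bsub>W\<^esub>))" if "y \<in> EObj C" for y
    by (rule C0.Comp_in_hom [OF D(4) [OF that] ye [OF that]])
  show "base_arr W A (cA S (idn E.C0 y) eps \<cdot>\<^bsub>E.C0\<^esub> eta S y) \<in> hom E'.C0 y (cO S y (FO A \<one>\<^bsub>W\<^esub>))" if "y \<in> EObj C" for y
    by (rule I.hom_\<phi> [OF r [OF that]])
  show "base_arr W A (cA S (I.\<psi> f') (FA A (idn W \<one>\<^bsub>W\<^esub>))) \<cdot>\<^bsub>E'.C0\<^esub> base_arr W A (cA S (idn E.C0 x) eps \<cdot>\<^bsub>E.C0\<^esub> eta S x)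
      = base_arr W A (cA S (idn E.C0 y) eps \<cdot>\<^bsub>E.C0\<^esub> eta S y) \<cdot>\<^bsub>E'.C0\<^esub> f'" if f': "f' \<in> hom E'.C0 x y" for f' x y
  proof -
    obtain f where f: "f' = base_arr W A f" "f \<in> hom E.C0 x y" using hom_baseE [OF f'] .
    have x: "x \<in> EObj C" and y: "y \<in> EObj C" using C0.hom_Obj [OF f(2)] by simp_all
    have FI: "FO A \<one>\<^bsub>W\<^esub> \<in> Obj V" "\<one>\<^bsub>V\<^esub> \<in> Obj V" by simp_all
    note idF = V.idn_in_hom [OF FI(1)] and idI = V.idn_in_hom [OF FI(2)]
    have fF: "cA S f (idn V (FO A \<one>\<^bsub>W\<^esub>)) \<in> hom E.C0 (cO S x (FO A \<one>\<^bsub>W\<^esub>)) (cO S y (FO A \<one>\<^bsub>W\<^esub>))"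
      by (rule cA [OF f(2) idF])
    have fI: "cA S f (idn V \<one>\<^bsub>V\<^esub>) \<in> hom E.C0 (cO S x \<one>\<^bsub>V\<^esub>) (cO S y \<one>\<^bsub>V\<^esub>)"
      by (rule cA [OF f(2) idI])
    have "cA S f (idn V (FO A \<one>\<^bsub>W\<^esub>)) \<cdot>\<^bsub>E.C0\<^esub> cA S (idn E.C0 x) eps = cA S f eps"
      using cComp [OF id [OF x] f(2) eps(1) idF] C0.Comp_idn_right [OF f(2)] V.Comp_idn_right [OF eps(1)] by simp
    moreover have "cA S (idn E.C0 y) eps \<cdot>\<^bsub>E.C0\<^esub> cA S f (idn V \<one>\<^bsub>V\<^esub>) = cA S f eps"
      using cComp [OF f(2) id [OF y] idI eps(1)] C0.Comp_idn_left [OF f(2)] V.Comp_idn_left [OF eps(1)] by simp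
    ultimately have "cA S f (idn V (FO A \<one>\<^bsub>W\<^esub>)) \<cdot>\<^bsub>E.C0\<^esub> (cA S (idn E.C0 x) eps \<cdot>\<^bsub>E.C0\<^esub> eta S x)
        = (cA S (idn E.C0 y) eps \<cdot>\<^bsub>E.C0\<^esub> eta S y) \<cdot>\<^bsub>E.C0\<^esub> f"
      using C0.Comp_assoc [OF D(4) [OF x] ye [OF x] fF] C0.Comp_assoc [OF D(4) [OF x] fI ye [OF y]]
        D(5) [OF f(2)] C0.Comp_assoc [OF f(2) D(4) [OF y] ye [OF y]] by simp
    then show ?thesis
      using I.Comp_\<phi>_hom [OF r [OF x] fF] I.Comp_\<phi>_hom [OF f(2) r [OF y]] I.\<psi>_\<phi>_hom [OF f(2)] by (simp add: f(1))
  qed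
  fix x y assume x: "x \<in> EObj C" and y: "y \<in> EObj C"
  let ?E = "EHom C x y" and ?F = "FO A \<one>\<^bsub>W\<^esub>"
  have FI: "?F \<in> Obj V" and E: "?E \<in> Obj V" using x y by simp_all
  note p = D(2) [OF FI x y] and p1 = D(2) [OF V.munit_Obj x y]
  note e1 = E.ehom_arr_hom [OF id [OF x] ye [OF y]] and e2 = E.ehom_arr_hom [OF id [OF x] D(4) [OF y]]
  note i = V.ihom_arr(1) [OF eps(1) V.idn_in_hom [OF E]]
  have "psi S ?F x y \<cdot>\<^bsub>V\<^esub> ehom_arr V C (idn E.C0 x) (cA S (idn E.C0 y) eps \<cdot>\<^bsub>E.C0\<^esub> eta S y)
      = (psi S ?F x y \<cdot>\<^bsub>V\<^esub> ehom_arr V C (idn E.C0 x) (cA S (idn E.C0 y) eps)) \<cdot>\<^bsub>V\<^esub> ehom_arr V C (idn E.C0 x) (eta S y)"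
    unfolding E.ehom_arr_Comp_right [OF D(4) [OF y] ye [OF y] x] by (rule V.Comp_assoc [OF e2 e1 p])
  also have "\<dots> = ihom_arr V eps (idn V ?E) \<cdot>\<^bsub>V\<^esub> unit_ihom V ?E"
    unfolding D(3) [OF eps(1) id [OF x] id [OF y]] ehom_idn_idn [OF x y] D(6) [OF x y, symmetric]
    by (rule V.Comp_assoc [OF e2 p1 i, symmetric])
  finally have *: "psi S ?F x y \<cdot>\<^bsub>V\<^esub> ehom_arr V C (idn E.C0 x) (cA S (idn E.C0 y) eps \<cdot>\<^bsub>E.C0\<^esub> eta S y)
      = ihom_arr V eps (idn V ?E) \<cdot>\<^bsub>V\<^esub> unit_ihom V ?E" .
  note er = E.ehom_arr_hom [OF id [OF x] r [OF y]]
  show "(th \<one>\<^bsub>W\<^esub> ?E \<cdot>\<^bsub>W\<^esub> GA A (psi S ?F x y)) \<cdot>\<^bsub>W\<^esub>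
      ehom_arr W C' (idn E'.C0 x) (base_arr W A (cA S (idn E.C0 y) eps \<cdot>\<^bsub>E.C0\<^esub> eta S y)) = unit_ihom W (GO A ?E)"
    unfolding idn_base [OF x] ehom_arr_change_base [OF id [OF x] r [OF y]]
    by (rule theta_comp_unit [OF p er *])
qed

text \<open>The structure map of the induced weak tensoring or cotensoring is a weak equivalence since
  \<open>\<theta>\<close> is one and since the given structure map is a weak equivalence between fibrant objects.\<close>

lemma structure_map_Weq:
  assumes w: "cofibrant W MW w" and p: "p \<in> hom V x (ihom V (FO A w) y)" "p \<in> Weq MV"
    and x: "fibrant V MV x" and y: "fibrant V MV y"
  shows "th w y \<cdot>\<^bsub>W\<^esub> GA A p \<in> Weq MW"
proof -
  interpret VQ: quillen_adjunction U V MV V MV "\<lambda>a. a \<otimes>\<^bsub>V\<^esub> FO A w" "\<lambda>f. f \<odot>\<^bsub>V\<^esub> idn V (FO A w)"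
    "ihom V (FO A w)" "ihom_arr V (idn V (FO A w))" "\<lambda>a h. curry_arr V a (FO A w) (Cod V h) h"
    using V.tensor_hom_quillen [OF Fo_cofibrant [OF w]] .
  have "GA A p \<in> Weq MW" by (rule Ga_Weq_fibrant [OF x VQ.Go_fibrant [OF y] p])
  moreover have "th w y \<in> hom W (GO A (ihom V (FO A w) y)) (ihom W w (GO A y))"
    by (rule theta(1) [OF W.cofibrant_Obj [OF w] V.fibrant_Obj [OF y]])
  ultimately show ?thesis
    using W.model_Comp(1) [of "GA A p" "th w y"] theta_Weq [OF w y] G_hom [OF p(1)] by (simp add: hom_def)
qed

lemma absolute_axioms_change_base:
  assumes "absolute_axioms V MV C MC T S"
  shows "absolute_axioms W MW C' MC' (change_base_tensor W V A C T) (change_base_cotensor W V A C S)"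
  using assms Go_fibrant Fo_cofibrant
  unfolding absolute_axioms_def Let_def cofibrant_iff fibrant_iff by simp

lemma weak_tensoring_change_base:
  assumes T: "weak_tensoring V MV C MC T" and abs: "absolute_axioms V MV C MC T S"
  shows "weak_tensoring W MW C' MC' (change_base_tensor W V A C T)"
proof -
  have pre: "pre_tensoring V C T" and pp: "pushout_product_axiom E.C0 MC V MV E.C0 MC (tO T) (tA T)"
    and phi: "\<And>v x y. cofibrant V MV v \<Longrightarrow> cofibrant E.C0 MC x \<Longrightarrow> fibrant E.C0 MC y \<Longrightarrow> phi T v x y \<in> Weq MV"
    using T unfolding weak_tensoring_def Let_def by auto
  have "phi (change_base_tensor W V A C T) w x y \<in> Weq MW"
    if w: "cofibrant W MW w" and x: "cofibrant E.C0 MC x" and y: "fibrant E.C0 MC y" for w x y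
  proof -
    have Fw: "cofibrant V MV (FO A w)" by (rule Fo_cofibrant [OF w])
    have ob: "x \<in> EObj C" "y \<in> EObj C" using C0.cofibrant_Obj [OF x] C0.fibrant_Obj [OF y] by simp_all
    show ?thesis
      unfolding change_base_tensor_simps
      by (rule structure_map_Weq [OF w E.pre_tensoringD(2) [OF pre V.cofibrant_Obj [OF Fw] ob] phi [OF Fw x y]])
        (use abs x y Fw in \<open>simp_all add: absolute_axioms_def Let_def\<close>)
  qed
  then show ?thesis
    unfolding weak_tensoring_def Let_def cofibrant_iff fibrant_iff
    using pre_tensoring_change_base [OF pre]
      I.pushout_product_transport [OF E.pre_tensoringD(1) [OF pre] F_functor W.category_axioms _ F_acyclic_Cof
        model_Arr_C0(1,2) pp] F_Cof by simp
qed

lemma weak_cotensoring_change_base: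
  assumes S: "weak_cotensoring V MV C MC S" and abs: "absolute_axioms V MV C MC T S"
  shows "weak_cotensoring W MW C' MC' (change_base_cotensor W V A C S)"
proof -
  have pre: "pre_cotensoring V C S"
    and pc: "pullback_corner_axiom V MV E.C0 MC E.C0 MC (\<lambda>v x. cO S x v) (\<lambda>k f. cA S f k)"
    and psi: "\<And>v x y. cofibrant V MV v \<Longrightarrow> cofibrant E.C0 MC x \<Longrightarrow> fibrant E.C0 MC y \<Longrightarrow> psi S v x y \<in> Weq MV"
    using S unfolding weak_cotensoring_def Let_def by auto
  have "psi (change_base_cotensor W V A C S) w x y \<in> Weq MW"
    if w: "cofibrant W MW w" and x: "cofibrant E.C0 MC x" and y: "fibrant E.C0 MC y" for w x y
  proof -
    have Fw: "cofibrant V MV (FO A w)" by (rule Fo_cofibrant [OF w])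
    have ob: "x \<in> EObj C" "y \<in> EObj C" using C0.cofibrant_Obj [OF x] C0.fibrant_Obj [OF y] by simp_all
    show ?thesis
      unfolding change_base_cotensor_simps
      by (rule structure_map_Weq [OF w E.pre_cotensoringD(2) [OF pre V.cofibrant_Obj [OF Fw] ob] psi [OF Fw x y]])
        (use abs x y Fw in \<open>simp_all add: absolute_axioms_def Let_def\<close>)
  qed
  then show ?thesis
    unfolding weak_cotensoring_def Let_def cofibrant_iff fibrant_iff
    using pre_cotensoring_change_base [OF pre]
      I.pullback_corner_transport [OF E.cotensor_hom [OF pre] F_functor W.category_axioms _ F_acyclic_Cof
        model_Arr_C0(1,3) pc] F_Cof by simp
qed

text \<open>The bijection \<open>[x, y] \<cong> [\<one>, EHom C x y]\<close> is followed by \<open>[\<one>, E] \<cong> [\<one>, G E]\<close> from \<open>derived_hom_inj\<close> and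
  \<open>derived_hom_surj\<close>, for a cofibrant replacement \<open>Q \<rightarrow> \<one>\<close> and the weak equivalence \<open>F Q \<rightarrow> F \<one> \<rightarrow> \<one>\<close>.\<close>

lemma pi0_axiom_change_base:
  assumes pi0: "pi0_axiom V MV C MC" and abs: "absolute_axioms V MV C MC T S"
  shows "pi0_axiom W MW C' MC'"
  unfolding pi0_axiom_def Let_def cofibrant_iff fibrant_iff
proof (intro allI impI, elim conjE)
  fix x y assume x: "cofibrant E.C0 MC x" and y: "fibrant E.C0 MC y"
  have ob: "x \<in> EObj C" "y \<in> EObj C" using C0.cofibrant_Obj [OF x] C0.fibrant_Obj [OF y] by simp_all
  let ?E = "EHom C x y"
  let ?P = "\<lambda>h. snd (snd h)"
  have E: "fibrant V MV ?E" using abs x y by (simp add: absolute_axioms_def Let_def)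
  have P: "?P h \<in> hom V \<one>\<^bsub>V\<^esub> ?E" if "h \<in> hom E.C0 x y" for h
    using that by (auto simp: E.hom_underlying)
  have P_all: "\<forall>h\<in>hom E.C0 x y. ?P h \<in> hom V \<one>\<^bsub>V\<^esub> ?E" using P by blast
  have rep: "\<forall>r. zigzag E.C0 MC x r y \<longrightarrow> (\<exists>h\<in>hom E.C0 x y. zz_equiv E.C0 MC x y r [Inl h])"
    using C0.zigzag_represented [OF x y] by metis
  have "\<exists>\<kappa>. (\<forall>h\<in>hom E.C0 x y. \<kappa> (ho_class E.C0 MC h) = ho_class V MV (?P h))
      \<and> bij_betw \<kappa> (ho_hom E.C0 MC x y) (ho_hom V MV \<one>\<^bsub>V\<^esub> ?E)"
  proof -
    obtain \<kappa> where "\<forall>f. (x, y, f) \<in> hom E.C0 x y \<longrightarrow> \<kappa> (ho_class E.C0 MC (x, y, f)) = ho_class V MV f"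
      and bij: "bij_betw \<kappa> (ho_hom E.C0 MC x y) (ho_hom V MV \<one>\<^bsub>V\<^esub> ?E)"
      using pi0 x y unfolding pi0_axiom_def Let_def by blast
    moreover have "h = (x, y, ?P h)" if "h \<in> hom E.C0 x y" for h
      using that by (auto simp: E.hom_underlying)
    ultimately show ?thesis by metis
  qed
  then have inj: "\<And>f g. f \<in> hom E.C0 x y \<Longrightarrow> g \<in> hom E.C0 x y \<Longrightarrow>
        V.ho_eq MV \<one>\<^bsub>V\<^esub> ?E (?P f) (?P g) \<longleftrightarrow> C0.ho_eq MC x y f g"
    and surj: "\<And>r. zigzag V MV \<one>\<^bsub>V\<^esub> r ?E \<Longrightarrow> \<exists>f\<in>hom E.C0 x y. zz_equiv V MV \<one>\<^bsub>V\<^esub> ?E r [Inl (?P f)]"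
    unfolding ho_hom_bijection [where \<Phi> = ?P and MD = MV, OF C0.category_axioms V.category_axioms rep P_all] by blast+
  have rep_V: "\<exists>f\<in>hom V \<one>\<^bsub>V\<^esub> ?E. zz_equiv V MV \<one>\<^bsub>V\<^esub> ?E r [Inl f]" if "zigzag V MV \<one>\<^bsub>V\<^esub> r ?E" for r
    using surj [OF that] P by blast
  obtain q where q: "cofibrant_replacement W MW \<one>\<^bsub>W\<^esub> q" "eps \<cdot>\<^bsub>V\<^esub> FA A q \<in> Weq MV"
    using unit_replacement by blast
  define Q where "Q = Dom W q"
  have Q: "cofibrant W MW Q" and qh: "q \<in> hom W Q \<one>\<^bsub>W\<^esub>" "q \<in> Weq MW"
    using q by (auto simp: cofibrant_replacement_def Q_def hom_def)
  have r: "eps \<cdot>\<^bsub>V\<^esub> FA A q \<in> hom V (FO A Q) \<one>\<^bsub>V\<^esub>" by (rule V.Comp_in_hom [OF F_hom [OF qh(1)] eps(1)])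
  have eltq: "sharp Q (f \<cdot>\<^bsub>V\<^esub> (eps \<cdot>\<^bsub>V\<^esub> FA A q)) = elt f \<cdot>\<^bsub>W\<^esub> q" if f: "f \<in> hom V \<one>\<^bsub>V\<^esub> ?E" for f
    using sharp_right [OF qh(1) V.Comp_in_hom [OF eps(1) f]] V.Comp_assoc [OF F_hom [OF qh(1)] eps(1) f]
    by (simp add: elt_sharp [OF f])
  note dinj = derived_hom_inj [OF Q qh r q(2) E elt_hom eltq]
    and dsurj = derived_hom_surj [OF Q qh r q(2) E elt_hom eltq rep_V]
  have rep': "\<forall>r. zigzag E'.C0 MC' x r y \<longrightarrow> (\<exists>h\<in>hom E'.C0 x y. zz_equiv E'.C0 MC' x y r [Inl h])"
    using C0'.zigzag_represented x y unfolding cofibrant_iff fibrant_iff by metis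
  have P': "\<forall>h\<in>hom E'.C0 x y. ?P h \<in> hom W \<one>\<^bsub>W\<^esub> (GO A ?E)"
    by (auto simp: E'.hom_underlying)
  have Pb: "?P (base_arr W A h) = elt (?P h)" for h by (cases h) (simp add: base_arr_eq)
  have "(\<forall>f\<in>hom E'.C0 x y. \<forall>g\<in>hom E'.C0 x y. W.ho_eq MW \<one>\<^bsub>W\<^esub> (GO A ?E) (?P f) (?P g) \<longleftrightarrow> C0'.ho_eq MC' x y f g)
    \<and> (\<forall>r. zigzag W MW \<one>\<^bsub>W\<^esub> r (GO A ?E) \<longrightarrow> (\<exists>f\<in>hom E'.C0 x y. zz_equiv W MW \<one>\<^bsub>W\<^esub> (GO A ?E) r [Inl (?P f)]))"
  proof (intro conjI ballI allI impI)
    fix f' g' assume "f' \<in> hom E'.C0 x y" "g' \<in> hom E'.C0 x y"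
    then obtain f g where f: "f' = base_arr W A f" "f \<in> hom E.C0 x y" and g: "g' = base_arr W A g" "g \<in> hom E.C0 x y"
      using hom_baseE by metis
    have "W.ho_eq MW \<one>\<^bsub>W\<^esub> (GO A ?E) (?P f') (?P g') \<longleftrightarrow> V.ho_eq MV \<one>\<^bsub>V\<^esub> ?E (?P f) (?P g)"
      unfolding f(1) g(1) Pb by (rule dinj [OF _ _ P [OF f(2)] P [OF g(2)]])
    also have "\<dots> \<longleftrightarrow> C0.ho_eq MC x y f g" by (rule inj [OF f(2) g(2)])
    also have "\<dots> \<longleftrightarrow> C0'.ho_eq MC' x y f' g'"
      unfolding f(1) g(1) by (rule I.zz_equiv_\<phi>_iff [OF model_Arr_C0 f(2) g(2), symmetric])
    finally show "W.ho_eq MW \<one>\<^bsub>W\<^esub> (GO A ?E) (?P f') (?P g') \<longleftrightarrow> C0'.ho_eq MC' x y f' g'" .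
  next
    fix r assume "zigzag W MW \<one>\<^bsub>W\<^esub> r (GO A ?E)"
    then obtain f where f: "f \<in> hom V \<one>\<^bsub>V\<^esub> ?E" "zz_equiv W MW \<one>\<^bsub>W\<^esub> (GO A ?E) r [Inl (elt f)]"
      using dsurj by blast
    have "(x, y, elt f) \<in> hom E'.C0 x y" using elt_hom [OF f(1)] ob by (simp add: E'.hom_underlying)
    then show "\<exists>f\<in>hom E'.C0 x y. zz_equiv W MW \<one>\<^bsub>W\<^esub> (GO A ?E) r [Inl (?P f)]"
      using f(2) by (intro bexI [of _ "(x, y, elt f)"]) simp_all
  qed
  then obtain \<kappa> where \<kappa>: "\<forall>h\<in>hom E'.C0 x y. \<kappa> (ho_class E'.C0 MC' h) = ho_class W MW (?P h)"
      "bij_betw \<kappa> (ho_hom E'.C0 MC' x y) (ho_hom W MW \<one>\<^bsub>W\<^esub> (GO A ?E))"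
    unfolding ho_hom_bijection [where \<Phi> = ?P and MD = MW, OF C0'.category_axioms W.category_axioms rep' P', symmetric]
    by blast
  then show "\<exists>\<kappa>. (\<forall>f. (x, y, f) \<in> hom E'.C0 x y \<longrightarrow> \<kappa> (ho_class E'.C0 MC' (x, y, f)) = ho_class W MW f)
      \<and> bij_betw \<kappa> (ho_hom E'.C0 MC' x y) (ho_hom W MW \<one>\<^bsub>W\<^esub> (EHom C' x y))"
    by (intro exI [of _ \<kappa>]) auto
qed

theorem weak_model_category_change_base:
  assumes "weak_model_category U V MV C MC T S"
  shows "weak_model_category U W MW C' (change_base_model W A MC)
    (change_base_tensor W V A C T) (change_base_cotensor W V A C S)"
  using assms enriched_change_base model_change_base SM7_change_base weak_tensoring_change_base
    weak_cotensoring_change_base absolute_axioms_change_base pi0_axiom_change_base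
  unfolding weak_model_category_def change_base_model_eq by blast

text \<open>On elements, the structure map of the induced weak tensoring or cotensoring is, up to the
  bijections \<open>V(\<one>, x) \<cong> W(\<one>, G x)\<close>, the given structure map followed by the bijection induced
  by \<open>\<theta>\<close>.\<close>

lemma structure_map_set_bijective:
  assumes w: "w \<in> Obj W" and p: "p \<in> hom V x (ihom V (FO A w) y)" and y: "y \<in> Obj V"
    and bij: "bij_betw (\<lambda>h. p \<cdot>\<^bsub>V\<^esub> h) (hom V \<one>\<^bsub>V\<^esub> x) (hom V \<one>\<^bsub>V\<^esub> (ihom V (FO A w) y))"
  shows "bij_betw (\<lambda>h. (th w y \<cdot>\<^bsub>W\<^esub> GA A p) \<cdot>\<^bsub>W\<^esub> h) (hom W \<one>\<^bsub>W\<^esub> (GO A x)) (hom W \<one>\<^bsub>W\<^esub> (ihom W w (GO A y)))"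
proof -
  note x = V.hom_Obj [OF p]
  let ?e = "inv_into (hom V \<one>\<^bsub>V\<^esub> x) elt"
  note ex = elt_bij [OF eps_iso x(1)] and eh = elt_bij [OF eps_iso x(2)]
  have "bij_betw ((\<lambda>g. th w y \<cdot>\<^bsub>W\<^esub> g) \<circ> (elt \<circ> ((\<lambda>h. p \<cdot>\<^bsub>V\<^esub> h) \<circ> ?e))) (hom W \<one>\<^bsub>W\<^esub> (GO A x)) (hom W \<one>\<^bsub>W\<^esub> (ihom W w (GO A y)))"
    by (intro bij_betw_trans [OF _ theta_set_bijective [OF eps_iso w y]] bij_betw_trans [OF _ eh] bij_betw_trans [OF _ bij]
        bij_betw_inv_into [OF ex])
  moreover have "((\<lambda>g. th w y \<cdot>\<^bsub>W\<^esub> g) \<circ> (elt \<circ> ((\<lambda>h. p \<cdot>\<^bsub>V\<^esub> h) \<circ> ?e))) h = (th w y \<cdot>\<^bsub>W\<^esub> GA A p) \<cdot>\<^bsub>W\<^esub> h"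
    if h: "h \<in> hom W \<one>\<^bsub>W\<^esub> (GO A x)" for h
  proof -
    have e: "?e h \<in> hom V \<one>\<^bsub>V\<^esub> x" "elt (?e h) = h"
      using bij_betw_inv_into [OF ex] bij_betw_inv_into_right [OF ex h] h by (auto simp: bij_betw_def)
    show ?thesis
      using elt_Comp [OF e(1) p] W.Comp_assoc [OF h G_hom [OF p] theta(1) [OF w y]] by (simp add: e(2))
  qed
  ultimately show ?thesis by (rule bij_betw_cong [THEN iffD1, rotated])
qed

lemma tensor_set_compatible_change_base:
  assumes "pre_tensoring V C T" "tensor_set_compatible V C T"
  shows "tensor_set_compatible W C' (change_base_tensor W V A C T)"
  using assms(2) structure_map_set_bijective [OF _ E.pre_tensoringD(2) [OF assms(1)]]
  unfolding tensor_set_compatible_def by simp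

lemma cotensor_set_compatible_change_base:
  assumes "pre_cotensoring V C S" "cotensor_set_compatible V C S"
  shows "cotensor_set_compatible W C' (change_base_cotensor W V A C S)"
  using assms(2) structure_map_set_bijective [OF _ E.pre_cotensoringD(2) [OF assms(1)]]
  unfolding cotensor_set_compatible_def by simp

lemma tensor_unital_change_base:
  assumes T: "pre_tensoring V C T" and unital: "tensor_unital V C T"
  shows "tensor_unital W C' (change_base_tensor W V A C T)"
  unfolding tensor_unital_def change_base_tensor_simps change_base_simps
proof
  fix x assume x: "x \<in> EObj C"
  note D = E.pre_tensoringD [OF T] and B = bifunctorD [OF E.pre_tensoringD(1) [OF T]]
  note id = C0.idn_in_hom [unfolded E.underlying_simps(1), OF x]
  have "is_functor V E.C0 (tO T x) (tA T (idn E.C0 x))"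
    unfolding is_functor_def using x B(1-3) B(4) [OF id id] id C0.Comp_idn_left [OF id] by auto
  then have "iso E.C0 (tA T (idn E.C0 x) eps)"
    using functor_iso [OF V.category_axioms C0.category_axioms _ eps_iso] by blast
  then have "iso E.C0 (rho T x \<cdot>\<^bsub>E.C0\<^esub> tA T (idn E.C0 x) eps)"
    using C0.iso_Comp unital x D(4) [OF x] B(2) [OF id eps(1)] by (simp add: tensor_unital_def hom_def)
  then show "iso E'.C0 (base_arr W A (rho T x \<cdot>\<^bsub>E.C0\<^esub> tA T (idn E.C0 x) eps))" by (rule I.iso_\<phi>)
qed

lemma cotensor_unital_change_base:
  assumes S: "pre_cotensoring V C S" and unital: "cotensor_unital V C S"
  shows "cotensor_unital W C' (change_base_cotensor W V A C S)"
  unfolding cotensor_unital_def change_base_cotensor_simps change_base_simps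
proof
  fix y assume y: "y \<in> EObj C"
  note D = E.pre_cotensoringD [OF S] and cA = E.cotensor_hom [OF S] and cComp = E.cotensor_Comp [OF S]
  note id = C0.idn_in_hom [unfolded E.underlying_simps(1), OF y]
  have "iso E.C0 (cA S (idn E.C0 y) eps)"
  proof (rule C0.isoI)
    have i: "inv_arr V eps \<in> hom V \<one>\<^bsub>V\<^esub> (FO A \<one>\<^bsub>W\<^esub>)" using eps_iso by (simp add: hom_def)
    show "cA S (idn E.C0 y) eps \<in> hom E.C0 (cO S y \<one>\<^bsub>V\<^esub>) (cO S y (FO A \<one>\<^bsub>W\<^esub>))"
      "cA S (idn E.C0 y) (inv_arr V eps) \<in> hom E.C0 (cO S y (FO A \<one>\<^bsub>W\<^esub>)) (cO S y \<one>\<^bsub>V\<^esub>)"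
      using cA [OF id eps(1)] cA [OF id i] .
    show "cA S (idn E.C0 y) (inv_arr V eps) \<cdot>\<^bsub>E.C0\<^esub> cA S (idn E.C0 y) eps = idn E.C0 (cO S y \<one>\<^bsub>V\<^esub>)"
      "cA S (idn E.C0 y) eps \<cdot>\<^bsub>E.C0\<^esub> cA S (idn E.C0 y) (inv_arr V eps) = idn E.C0 (cO S y (FO A \<one>\<^bsub>W\<^esub>))"
      using cComp [OF id id eps(1) i] cComp [OF id id i eps(1)] C0.Comp_idn_left [OF id] eps_iso y
        bifunctorD(3) [OF D(1), of y] by simp_all
  qed
  then have "iso E.C0 (cA S (idn E.C0 y) eps \<cdot>\<^bsub>E.C0\<^esub> eta S y)"
    using C0.iso_Comp unital y D(4) [OF y] cA [OF id eps(1)] by (simp add: cotensor_unital_def hom_def)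
  then show "iso E'.C0 (base_arr W A (cA S (idn E.C0 y) eps \<cdot>\<^bsub>E.C0\<^esub> eta S y))" by (rule I.iso_\<phi>)
qed

end


section \<open>Adjunctions of two variables\<close>

locale two_variable_adjunction = A: category A + B: category B + D: category D
  for A :: "('ao, 'am, 'x) cat_scheme" and B :: "('bo, 'bm, 'y) cat_scheme" and D :: "('do, 'dm, 'z) cat_scheme" +
  fixes To :: "'ao \<Rightarrow> 'bo \<Rightarrow> 'do" and Ta :: "'am \<Rightarrow> 'bm \<Rightarrow> 'dm"
    and Ho :: "'ao \<Rightarrow> 'do \<Rightarrow> 'bo" and Ha :: "'am \<Rightarrow> 'dm \<Rightarrow> 'bm"
    and Phi :: "'ao \<Rightarrow> 'bo \<Rightarrow> 'dm \<Rightarrow> 'bm"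
  assumes To: "is_bifunctor A B D To Ta"
    and Ho_Obj: "a \<in> Obj A \<Longrightarrow> d \<in> Obj D \<Longrightarrow> Ho a d \<in> Obj B"
    and Ha: "f \<in> hom A a' a \<Longrightarrow> g \<in> hom D d d' \<Longrightarrow> Ha f g \<in> hom B (Ho a d) (Ho a' d')"
    and Phi_bij: "a \<in> Obj A \<Longrightarrow> b \<in> Obj B \<Longrightarrow> d \<in> Obj D \<Longrightarrow>
      bij_betw (Phi a b) (hom D (To a b) d) (hom B b (Ho a d))"
    and Phi_natural: "f \<in> hom A a' a \<Longrightarrow> k \<in> hom B b' b \<Longrightarrow> g \<in> hom D d d' \<Longrightarrow> h \<in> hom D (To a b) d \<Longrightarrow>
      Phi a' b' (g \<cdot>\<^bsub>D\<^esub> h \<cdot>\<^bsub>D\<^esub> Ta f k) = Ha f g \<cdot>\<^bsub>B\<^esub> Phi a b h \<cdot>\<^bsub>B\<^esub> k"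
begin

lemmas Ta = bifunctorD(2) [OF To] and To_Obj = bifunctorD(1) [OF To] and To_idn = bifunctorD(3) [OF To]

lemma Phi_hom: "a \<in> Obj A \<Longrightarrow> b \<in> Obj B \<Longrightarrow> h \<in> hom D (To a b) d \<Longrightarrow> Phi a b h \<in> hom B b (Ho a d)"
  using Phi_bij [of a b d] D.hom_Obj(2) [of h] by (auto simp: bij_betw_def)

lemma Phi_inject:
  "a \<in> Obj A \<Longrightarrow> b \<in> Obj B \<Longrightarrow> h \<in> hom D (To a b) d \<Longrightarrow> h' \<in> hom D (To a b) d \<Longrightarrow> Phi a b h = Phi a b h' \<Longrightarrow> h = h'"
  using Phi_bij [of a b d] D.hom_Obj(2) [of h] by (auto simp: bij_betw_def inj_on_def)

lemma Phi_surj: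
  assumes "a \<in> Obj A" "d \<in> Obj D" "k \<in> hom B b (Ho a d)"
  obtains h where "h \<in> hom D (To a b) d" "Phi a b h = k"
proof -
  have "k \<in> Phi a b ` hom D (To a b) d"
    using Phi_bij [OF assms(1) B.hom_Obj(1) [OF assms(3)] assms(2)] assms(3) unfolding bij_betw_def by blast
  then show ?thesis using that by blast
qed

lemma Phi_natural_A:
  assumes f: "f \<in> hom A a' a" and h: "h \<in> hom D (To a b) d" and b: "b \<in> Obj B"
  shows "Phi a' b (h \<cdot>\<^bsub>D\<^esub> Ta f (idn B b)) = Ha f (idn D d) \<cdot>\<^bsub>B\<^esub> Phi a b h"
proof -
  note d = D.hom_Obj(2) [OF h] and idb = B.idn_in_hom [OF b]
  show ?thesis
    using Phi_natural [OF f idb D.idn_in_hom [OF d] h] D.Comp_idn_left [OF D.Comp_in_hom [OF Ta [OF f idb] h]]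
      B.Comp_idn_right [OF Phi_hom [OF A.hom_Obj(2) [OF f] b h]] by simp
qed

lemma Phi_natural_B:
  assumes k: "k \<in> hom B b' b" and h: "h \<in> hom D (To a b) d" and a: "a \<in> Obj A"
  shows "Phi a b' (h \<cdot>\<^bsub>D\<^esub> Ta (idn A a) k) = Phi a b h \<cdot>\<^bsub>B\<^esub> k"
proof -
  note d = D.hom_Obj(2) [OF h] and b = B.hom_Obj [OF k] and ida = A.idn_in_hom [OF a]
  have "Phi a b (idn D d \<cdot>\<^bsub>D\<^esub> h \<cdot>\<^bsub>D\<^esub> Ta (idn A a) (idn B b)) = Ha (idn A a) (idn D d) \<cdot>\<^bsub>B\<^esub> Phi a b h \<cdot>\<^bsub>B\<^esub> idn B b"
    by (rule Phi_natural [OF ida B.idn_in_hom [OF b(2)] D.idn_in_hom [OF d] h])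
  then have 1: "Ha (idn A a) (idn D d) \<cdot>\<^bsub>B\<^esub> Phi a b h = Phi a b h"
    using To_idn [OF a b(2)] D.Comp_idn_left [OF h] D.Comp_idn_right [OF h] B.Comp_idn_right [OF Phi_hom [OF a b(2) h]] by simp
  show ?thesis
    using Phi_natural [OF ida k D.idn_in_hom [OF d] h] D.Comp_idn_left [OF D.Comp_in_hom [OF Ta [OF ida k] h]]
      B.Comp_assoc [OF k Phi_hom [OF a b(2) h] Ha [OF ida D.idn_in_hom [OF d]]] 1 by simp
qed

lemma Phi_natural_D:
  assumes g: "g \<in> hom D d d'" and h: "h \<in> hom D (To a b) d" and a: "a \<in> Obj A" and b: "b \<in> Obj B"
  shows "Phi a b (g \<cdot>\<^bsub>D\<^esub> h) = Ha (idn A a) g \<cdot>\<^bsub>B\<^esub> Phi a b h"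
  using Phi_natural [OF A.idn_in_hom [OF a] B.idn_in_hom [OF b] g h] To_idn [OF a b] D.Comp_idn_right [OF h]
    B.Comp_idn_right [OF Phi_hom [OF a b h]] by simp

lemma partial_adjunction:
  assumes a: "a \<in> Obj A"
  shows "hom_adjunction B D (To a) (Ta (idn A a)) (Ho a) (Ha (idn A a)) (Phi a)"
proof
  note ida = A.idn_in_hom [OF a]
  show "is_functor B D (To a) (Ta (idn A a))"
    unfolding is_functor_def using To_Obj [OF a] Ta [OF ida] To_idn [OF a] bifunctorD(4) [OF To ida ida]
      A.Comp_idn_left [OF ida] by simp
qed (use a Ho_Obj Ha A.idn_in_hom Phi_bij Phi_natural_D Phi_natural_B in auto)

text \<open>Lifting problems against the corner map \<open>Ho b x \<rightarrow> Ho a x \<times> Ho b y\<close> correspond to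
  lifting problems of the dual corner map.\<close>

lemma lift_corner:
  assumes i: "i \<in> hom A a b" and j: "j \<in> hom B u v" and q: "q \<in> hom D x y"
    and po: "is_pushout D (Ta i (idn B u)) (Ta (idn A a) j) P s1 t1"
    and c: "c \<in> hom D P (To b v)" "c \<cdot>\<^bsub>D\<^esub> s1 = Ta (idn A b) j" "c \<cdot>\<^bsub>D\<^esub> t1 = Ta i (idn B v)"
    and pb: "is_pullback B (Ha (idn A a) q) (Ha i (idn D y)) p s t"
    and h: "h \<in> hom B (Ho b x) p" "s \<cdot>\<^bsub>B\<^esub> h = Ha i (idn D x)" "t \<cdot>\<^bsub>B\<^esub> h = Ha (idn A b) q"
    and lift: "has_lift D c q"
  shows "has_lift B j h"
  unfolding has_lift_def
proof (intro ballI impI)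
  note ab = A.hom_Obj [OF i] and uv = B.hom_Obj [OF j] and xy = D.hom_Obj [OF q]
  note ida = A.idn_in_hom [OF ab(1)] and idb = A.idn_in_hom [OF ab(2)]
  have Dm: "Dom B j = u" "Cod B j = v" "Dom B h = Ho b x" "Cod B h = p" "Dom D c = P" "Cod D c = To b v"
    "Dom D q = x" "Cod D q = y"
    using j h c q by (auto simp: hom_def)
  note iu = Ta [OF i B.idn_in_hom [OF uv(1)]] and aj = Ta [OF ida j]
    and iv = Ta [OF i B.idn_in_hom [OF uv(2)]] and bj = Ta [OF idb j]
  note aq = Ha [OF ida q] and iy = Ha [OF i D.idn_in_hom [OF xy(2)]]
    and bq = Ha [OF idb q] and ix = Ha [OF i D.idn_in_hom [OF xy(1)]]
  have De: "Cod D (Ta i (idn B u)) = To b u" "Cod D (Ta (idn A a) j) = To a v"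
    "Dom B (Ha (idn A a) q) = Ho a x" "Dom B (Ha i (idn D y)) = Ho b y"
    using iu aj aq iy by (auto simp: hom_def)
  note PO = pushoutD [OF po, unfolded De] and PB = pullbackD [OF pb, unfolded De]
  fix \<alpha> \<beta> assume "\<alpha> \<in> hom B (Dom B j) (Dom B h)" "\<beta> \<in> hom B (Cod B j) (Cod B h)" and eq: "h \<cdot>\<^bsub>B\<^esub> \<alpha> = \<beta> \<cdot>\<^bsub>B\<^esub> j"
  then have \<alpha>: "\<alpha> \<in> hom B u (Ho b x)" and \<beta>: "\<beta> \<in> hom B v p" unfolding Dm by blast+
  obtain \<alpha>' where \<alpha>': "\<alpha>' \<in> hom D (To b u) x" "Phi b u \<alpha>' = \<alpha>" using Phi_surj [OF ab(2) xy(1) \<alpha>] .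
  obtain \<gamma> where \<gamma>: "\<gamma> \<in> hom D (To a v) x" "Phi a v \<gamma> = s \<cdot>\<^bsub>B\<^esub> \<beta>"
    using Phi_surj [OF ab(1) xy(1) B.Comp_in_hom [OF \<beta> PB(5)]] .
  obtain \<delta> where \<delta>: "\<delta> \<in> hom D (To b v) y" "Phi b v \<delta> = t \<cdot>\<^bsub>B\<^esub> \<beta>"
    using Phi_surj [OF ab(2) xy(2) B.Comp_in_hom [OF \<beta> PB(6)]] .
  have "Phi a u (\<alpha>' \<cdot>\<^bsub>D\<^esub> Ta i (idn B u)) = Phi a u (\<gamma> \<cdot>\<^bsub>D\<^esub> Ta (idn A a) j)"
    unfolding Phi_natural_A [OF i \<alpha>'(1) uv(1)] Phi_natural_B [OF j \<gamma>(1) ab(1)] \<alpha>'(2) \<gamma>(2) h(2) [symmetric]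
    using B.Comp_assoc [OF \<alpha> h(1) PB(5)] B.Comp_assoc [OF j \<beta> PB(5)] eq by simp
  then have "\<alpha>' \<cdot>\<^bsub>D\<^esub> Ta i (idn B u) = \<gamma> \<cdot>\<^bsub>D\<^esub> Ta (idn A a) j"
    by (rule Phi_inject [OF ab(1) uv(1) D.Comp_in_hom [OF iu \<alpha>'(1)] D.Comp_in_hom [OF aj \<gamma>(1)]])
  then obtain m where m: "m \<in> hom D P x" "m \<cdot>\<^bsub>D\<^esub> s1 = \<alpha>'" "m \<cdot>\<^bsub>D\<^esub> t1 = \<gamma>"
    using PO(8) [OF \<alpha>'(1) \<gamma>(1)] by blast
  have "Phi b u (q \<cdot>\<^bsub>D\<^esub> \<alpha>') = Phi b u (\<delta> \<cdot>\<^bsub>D\<^esub> Ta (idn A b) j)"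
    unfolding Phi_natural_D [OF q \<alpha>'(1) ab(2) uv(1)] Phi_natural_B [OF j \<delta>(1) ab(2)] \<alpha>'(2) \<delta>(2) h(3) [symmetric]
    using B.Comp_assoc [OF \<alpha> h(1) PB(6)] B.Comp_assoc [OF j \<beta> PB(6)] eq by simp
  then have q1: "q \<cdot>\<^bsub>D\<^esub> \<alpha>' = \<delta> \<cdot>\<^bsub>D\<^esub> Ta (idn A b) j"
    by (rule Phi_inject [OF ab(2) uv(1) D.Comp_in_hom [OF \<alpha>'(1) q] D.Comp_in_hom [OF bj \<delta>(1)]])
  have "Phi a v (q \<cdot>\<^bsub>D\<^esub> \<gamma>) = Phi a v (\<delta> \<cdot>\<^bsub>D\<^esub> Ta i (idn B v))"
    unfolding Phi_natural_D [OF q \<gamma>(1) ab(1) uv(2)] Phi_natural_A [OF i \<delta>(1) uv(2)] \<gamma>(2) \<delta>(2)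
    using B.Comp_assoc [OF \<beta> PB(5) aq] B.Comp_assoc [OF \<beta> PB(6) iy] PB(7) by simp
  then have q2: "q \<cdot>\<^bsub>D\<^esub> \<gamma> = \<delta> \<cdot>\<^bsub>D\<^esub> Ta i (idn B v)"
    by (rule Phi_inject [OF ab(1) uv(2) D.Comp_in_hom [OF \<gamma>(1) q] D.Comp_in_hom [OF iv \<delta>(1)]])
  have "q \<cdot>\<^bsub>D\<^esub> m = \<delta> \<cdot>\<^bsub>D\<^esub> c"
    by (rule D.pushout_ext [OF po D.Comp_in_hom [OF m(1) q] D.Comp_in_hom [OF c(1) \<delta>(1)]])
      (use D.Comp_assoc [OF PO(5) m(1) q] D.Comp_assoc [OF PO(5) c(1) \<delta>(1)] D.Comp_assoc [OF PO(6) m(1) q]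
        D.Comp_assoc [OF PO(6) c(1) \<delta>(1)] m c q1 q2 in simp_all)
  then obtain l where l: "l \<in> hom D (To b v) x" "l \<cdot>\<^bsub>D\<^esub> c = m" "q \<cdot>\<^bsub>D\<^esub> l = \<delta>"
    using lift m(1) \<delta>(1) unfolding has_lift_def Dm by blast
  have L: "Phi b v l \<in> hom B v (Ho b x)" by (rule Phi_hom [OF ab(2) uv(2) l(1)])
  have "Phi b v l \<cdot>\<^bsub>B\<^esub> j = \<alpha>"
    unfolding Phi_natural_B [OF j l(1) ab(2), symmetric] c(2) [symmetric]
    using D.Comp_assoc [OF PO(5) c(1) l(1)] l(2) m(2) \<alpha>'(2) by simp
  moreover have "h \<cdot>\<^bsub>B\<^esub> Phi b v l = \<beta>"
  proof (rule B.pullback_ext [OF pb B.Comp_in_hom [OF L h(1)] \<beta>])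
    have "s \<cdot>\<^bsub>B\<^esub> (h \<cdot>\<^bsub>B\<^esub> Phi b v l) = Phi a v (l \<cdot>\<^bsub>D\<^esub> Ta i (idn B v))"
      using B.Comp_assoc [OF L h(1) PB(5)] Phi_natural_A [OF i l(1) uv(2)] h(2) by simp
    also have "l \<cdot>\<^bsub>D\<^esub> Ta i (idn B v) = \<gamma>" unfolding c(3) [symmetric]
      using D.Comp_assoc [OF PO(6) c(1) l(1)] l(2) m(3) by simp
    finally show "s \<cdot>\<^bsub>B\<^esub> (h \<cdot>\<^bsub>B\<^esub> Phi b v l) = s \<cdot>\<^bsub>B\<^esub> \<beta>" using \<gamma>(2) by simp
    show "t \<cdot>\<^bsub>B\<^esub> (h \<cdot>\<^bsub>B\<^esub> Phi b v l) = t \<cdot>\<^bsub>B\<^esub> \<beta>"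
      using B.Comp_assoc [OF L h(1) PB(6)] Phi_natural_D [OF q l(1) ab(2) uv(2)] h(3) l(3) \<delta>(2) by simp
  qed
  ultimately show "\<exists>k\<in>hom B (Cod B j) (Dom B h). k \<cdot>\<^bsub>B\<^esub> j = \<alpha> \<and> h \<cdot>\<^bsub>B\<^esub> k = \<beta>"
    unfolding Dm using L by blast
qed

end

locale two_variable_quillen_adjunction = two_variable_adjunction A B D To Ta Ho Ha Phi
  + A: complete_model_category U A MA + B: complete_model_category U B MB + D: complete_model_category U D MD
  for U :: "'u itself" and A :: "('ao, 'am, 'x) cat_scheme" and MA and B :: "('bo, 'bm, 'y) cat_scheme" and MB
    and D :: "('do, 'dm, 'z) cat_scheme" and MD and To Ta Ho Ha Phi +
  assumes pushout_product_axiom: "pushout_product_axiom A MA B MB D MD To Ta"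
begin

theorem pullback_corner_axiom: "pullback_corner_axiom A MA D MD B MB Ho Ha"
  unfolding pullback_corner_axiom_def
proof (intro ballI allI impI, elim conjE)
  fix i q p s t h
  assume i: "i \<in> Cof MA" and q: "q \<in> Fib MD" and h: "h \<in> hom B (Ho (Cod A i) (Dom D q)) p"
    and pb: "is_pullback B (Ha (idn A (Dom A i)) q) (Ha i (idn D (Cod D q))) p s t"
    and sh: "s \<cdot>\<^bsub>B\<^esub> h = Ha i (idn D (Dom D q))" and th: "t \<cdot>\<^bsub>B\<^esub> h = Ha (idn A (Cod A i)) q"
  have ih: "i \<in> hom A (Dom A i) (Cod A i)" and qh: "q \<in> hom D (Dom D q) (Cod D q)"
    using i q by (auto simp: hom_def)
  note ab = A.hom_Obj [OF ih]
  have lift: "has_lift B j h" if j: "j \<in> Cof MB" and ac: "i \<in> Weq MA \<or> j \<in> Weq MB \<or> q \<in> Weq MD" for j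
  proof -
    have jh: "j \<in> hom B (Dom B j) (Cod B j)" using j by (simp add: hom_def)
    note uv = B.hom_Obj [OF jh]
    note iu = Ta [OF ih B.idn_in_hom [OF uv(1)]] and aj = Ta [OF A.idn_in_hom [OF ab(1)] jh]
      and iv = Ta [OF ih B.idn_in_hom [OF uv(2)]] and bj = Ta [OF A.idn_in_hom [OF ab(2)] jh]
    obtain P s1 t1 where po: "is_pushout D (Ta i (idn B (Dom B j))) (Ta (idn A (Dom A i)) j) P s1 t1"
      using D.pushouts [of "Ta i (idn B (Dom B j))" "Ta (idn A (Dom A i)) j"] iu aj by (auto simp: hom_def)
    have De: "Cod D (Ta i (idn B (Dom B j))) = To (Cod A i) (Dom B j)" "Cod D (Ta (idn A (Dom A i)) j) = To (Dom A i) (Cod B j)"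
      using iu aj by (auto simp: hom_def)
    have "Ta (idn A (Cod A i)) j \<cdot>\<^bsub>D\<^esub> Ta i (idn B (Dom B j)) = Ta i (idn B (Cod B j)) \<cdot>\<^bsub>D\<^esub> Ta (idn A (Dom A i)) j"
      using bifunctorD(4) [OF To ih A.idn_in_hom [OF ab(2)] B.idn_in_hom [OF uv(1)] jh]
        bifunctorD(4) [OF To A.idn_in_hom [OF ab(1)] ih jh B.idn_in_hom [OF uv(2)]]
        A.Comp_idn_left [OF ih] A.Comp_idn_right [OF ih] B.Comp_idn_left [OF jh] B.Comp_idn_right [OF jh] by simp
    then obtain c where c: "c \<in> hom D P (To (Cod A i) (Cod B j))" "c \<cdot>\<^bsub>D\<^esub> s1 = Ta (idn A (Cod A i)) j"
      "c \<cdot>\<^bsub>D\<^esub> t1 = Ta i (idn B (Cod B j))"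
      using pushoutD(8) [OF po, unfolded De, OF bj iv] by blast
    have "c \<in> Cof MD \<and> (i \<in> Weq MA \<or> j \<in> Weq MB \<longrightarrow> c \<in> Weq MD)"
      using pushout_product_axiom i j po c unfolding pushout_product_axiom_def by blast
    then have "has_lift D c q"
      using D.lift_acyclic_Cof [of c q] D.lift_acyclic_Fib [of c q] q ac by blast
    then show ?thesis by (rule lift_corner [OF ih jh qh po c pb h sh th])
  qed
  have hA: "h \<in> Arr B" using h by (simp add: hom_def)
  show "h \<in> Fib MB \<and> (i \<in> Weq MA \<or> q \<in> Weq MD \<longrightarrow> h \<in> Weq MB)"
    using B.FibI [OF hA] B.acyclic_FibI [OF hA] lift by blast
qed

text \<open>The pushout-product of \<open>\<emptyset> \<rightarrow> a\<close> with \<open>k\<close> is \<open>To a k\<close> because \<open>To \<emptyset> b\<close> is initial.\<close>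

lemma partial_quillen_adjunction:
  assumes a: "cofibrant A MA a" and init: "\<And>z b. is_initial A z \<Longrightarrow> b \<in> Obj B \<Longrightarrow> is_initial D (To z b)"
  shows "quillen_adjunction U B MB D MD (To a) (Ta (idn A a)) (Ho a) (Ha (idn A a)) (Phi a)"
proof -
  interpret hom_adjunction B D "To a" "Ta (idn A a)" "Ho a" "Ha (idn A a)" "Phi a"
    using partial_adjunction [OF A.cofibrant_Obj [OF a]] .
  have "is_bifunctor B A D (\<lambda>b a. To a b) (\<lambda>k f. Ta f k)"
    by (rule bifunctorI) (use To_Obj Ta To_idn bifunctorD(4) [OF To] in blast)+
  note * = pushout_product_cofibrant [OF B.category_axioms A.category_axioms D.category_axioms this
      pushout_product_swap [OF pushout_product_axiom] _ _ a init]
  show ?thesis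
    by unfold_locales (use * in auto)
qed

end

section \<open>Tensored and cotensored enriched model categories\<close>

context category
begin

lemma iso_if_precomp_bijective:
  assumes r: "r \<in> hom C a b" and bij: "\<And>y. y \<in> Obj C \<Longrightarrow> bij_betw (\<lambda>h. h \<cdot>\<^bsub>C\<^esub> r) (hom C b y) (hom C a y)"
  shows "iso C r"
proof -
  note ab = hom_Obj [OF r]
  obtain s where s: "s \<in> hom C b a" "s \<cdot>\<^bsub>C\<^esub> r = idn C a"
    using bij [OF ab(1)] idn_in_hom [OF ab(1)] unfolding bij_betw_def by (metis imageE)
  have "(r \<cdot>\<^bsub>C\<^esub> s) \<cdot>\<^bsub>C\<^esub> r = idn C b \<cdot>\<^bsub>C\<^esub> r"
    using Comp_assoc [OF r s(1) r] s(2) Comp_idn_left [OF r] Comp_idn_right [OF r] by simp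
  then have "r \<cdot>\<^bsub>C\<^esub> s = idn C b"
    using bij [OF ab(2)] Comp_in_hom [OF s(1) r] idn_in_hom [OF ab(2)] unfolding bij_betw_def inj_on_def by blast
  then show ?thesis using isoI [OF r s(1) s(2)] by blast
qed

lemma iso_if_postcomp_bijective:
  assumes r: "r \<in> hom C a b" and bij: "\<And>x. x \<in> Obj C \<Longrightarrow> bij_betw (\<lambda>h. r \<cdot>\<^bsub>C\<^esub> h) (hom C x a) (hom C x b)"
  shows "iso C r"
proof -
  note ab = hom_Obj [OF r]
  obtain s where s: "s \<in> hom C b a" "r \<cdot>\<^bsub>C\<^esub> s = idn C b"
    using bij [OF ab(2)] idn_in_hom [OF ab(2)] unfolding bij_betw_def by (metis imageE)
  have "r \<cdot>\<^bsub>C\<^esub> (s \<cdot>\<^bsub>C\<^esub> r) = r \<cdot>\<^bsub>C\<^esub> idn C a"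
    using Comp_assoc [OF r s(1) r] s(2) Comp_idn_left [OF r] Comp_idn_right [OF r] by simp
  then have "s \<cdot>\<^bsub>C\<^esub> r = idn C a"
    using bij [OF ab(1)] Comp_in_hom [OF r s(1)] idn_in_hom [OF ab(1)] unfolding bij_betw_def inj_on_def by blast
  then show ?thesis using isoI [OF r s(1) _ s(2)] by blast
qed

lemma bij_postcomp_iso:
  assumes "iso C f" "f \<in> hom C x y"
  shows "bij_betw (\<lambda>h. f \<cdot>\<^bsub>C\<^esub> h) (hom C a x) (hom C a y)"
  by (rule bij_betw_byWitness [where f' = "\<lambda>h. inv_arr C f \<cdot>\<^bsub>C\<^esub> h"]) (use assms in \<open>auto simp: hom_def\<close>)

end

context symmetric_monoidal_closed
begin

text \<open>The arrow \<open>u \<rightarrow> z\<close> named by an element \<open>k : \<one> \<rightarrow> ihom V u z\<close>.\<close>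

definition arrow_of :: "'o \<Rightarrow> 'o \<Rightarrow> 'm \<Rightarrow> 'm" where
  "arrow_of u z k = ev V u z \<cdot>\<^bsub>V\<^esub> (k \<odot>\<^bsub>V\<^esub> idn V u) \<cdot>\<^bsub>V\<^esub> inv_arr V (lunit V u)"

lemma arrow_of_bij:
  assumes u: "u \<in> Obj V" and z: "z \<in> Obj V"
  shows "bij_betw (arrow_of u z) (hom V \<one>\<^bsub>V\<^esub> (ihom V u z)) (hom V u z)"
proof (rule bij_betw_byWitness [where f' = "\<lambda>g. curry_arr V \<one>\<^bsub>V\<^esub> u z (g \<cdot>\<^bsub>V\<^esub> lunit V u)"])
  have e: "arrow_of u z k \<cdot>\<^bsub>V\<^esub> lunit V u = ev V u z \<cdot>\<^bsub>V\<^esub> (k \<odot>\<^bsub>V\<^esub> idn V u)" if "k \<in> hom V \<one>\<^bsub>V\<^esub> (ihom V u z)" for k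
    using that u z unfolding arrow_of_def by (simp add: hom_def)
  show "\<forall>k\<in>hom V \<one>\<^bsub>V\<^esub> (ihom V u z). curry_arr V \<one>\<^bsub>V\<^esub> u z (arrow_of u z k \<cdot>\<^bsub>V\<^esub> lunit V u) = k"
    using curryI u z e by simp
  have gl: "g \<cdot>\<^bsub>V\<^esub> lunit V u \<in> hom V (\<one>\<^bsub>V\<^esub> \<otimes>\<^bsub>V\<^esub> u) z" if "g \<in> hom V u z" for g
    using that u by (auto simp: hom_def)
  note c = curry [OF munit_Obj u z gl]
  show "(\<lambda>g. curry_arr V \<one>\<^bsub>V\<^esub> u z (g \<cdot>\<^bsub>V\<^esub> lunit V u)) ` hom V u z \<subseteq> hom V \<one>\<^bsub>V\<^esub> (ihom V u z)"
    using c(1) by blast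
  show "arrow_of u z ` hom V \<one>\<^bsub>V\<^esub> (ihom V u z) \<subseteq> hom V u z"
    using u z by (auto simp: arrow_of_def hom_def)
  show "\<forall>g\<in>hom V u z. arrow_of u z (curry_arr V \<one>\<^bsub>V\<^esub> u z (g \<cdot>\<^bsub>V\<^esub> lunit V u)) = g"
  proof
    fix g assume g: "g \<in> hom V u z"
    have "arrow_of u z (curry_arr V \<one>\<^bsub>V\<^esub> u z (g \<cdot>\<^bsub>V\<^esub> lunit V u)) = (g \<cdot>\<^bsub>V\<^esub> lunit V u) \<cdot>\<^bsub>V\<^esub> inv_arr V (lunit V u)"
      unfolding arrow_of_def using Comp_extend [OF c(2) [OF g], of "inv_arr V (lunit V u)"] c(1) [OF g] u z
      by (simp add: hom_def)
    then show "arrow_of u z (curry_arr V \<one>\<^bsub>V\<^esub> u z (g \<cdot>\<^bsub>V\<^esub> lunit V u)) = g" using g u by (simp add: hom_def)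
  qed
qed

lemma arrow_of_natural:
  assumes f: "f \<in> hom V u' u" and g: "g \<in> hom V z z'" and k: "k \<in> hom V \<one>\<^bsub>V\<^esub> (ihom V u z)"
  shows "arrow_of u' z' (ihom_arr V f g \<cdot>\<^bsub>V\<^esub> k) = g \<cdot>\<^bsub>V\<^esub> arrow_of u z k \<cdot>\<^bsub>V\<^esub> f"
proof -
  note ob = hom_Obj [OF f] hom_Obj [OF g]
  have D: "f \<in> Arr V" "Dom V f = u'" "Cod V f = u" "g \<in> Arr V" "Dom V g = z" "Cod V g = z'"
    "k \<in> Arr V" "Dom V k = \<one>\<^bsub>V\<^esub>" "Cod V k = ihom V u z"
    using f g k by (auto simp: hom_def)
  note i = ihom_arr [OF f g]
  have "arrow_of u' z' (ihom_arr V f g \<cdot>\<^bsub>V\<^esub> k) = (g \<cdot>\<^bsub>V\<^esub> ev V u z \<cdot>\<^bsub>V\<^esub> (k \<odot>\<^bsub>V\<^esub> f)) \<cdot>\<^bsub>V\<^esub> inv_arr V (lunit V u')"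
    unfolding arrow_of_def i(2) [OF k, symmetric] using i(1) D ob by (simp add: hom_def)
  also have "\<dots> = g \<cdot>\<^bsub>V\<^esub> ev V u z \<cdot>\<^bsub>V\<^esub> (k \<odot>\<^bsub>V\<^esub> idn V u) \<cdot>\<^bsub>V\<^esub> ((idn V \<one>\<^bsub>V\<^esub> \<odot>\<^bsub>V\<^esub> f) \<cdot>\<^bsub>V\<^esub> inv_arr V (lunit V u'))"
    using D ob by simp
  also have "(idn V \<one>\<^bsub>V\<^esub> \<odot>\<^bsub>V\<^esub> f) \<cdot>\<^bsub>V\<^esub> inv_arr V (lunit V u') = inv_arr V (lunit V u) \<cdot>\<^bsub>V\<^esub> f"
  proof (rule iso_monic [of "lunit V u"])
    show "lunit V u \<cdot>\<^bsub>V\<^esub> (idn V \<one>\<^bsub>V\<^esub> \<odot>\<^bsub>V\<^esub> f) \<cdot>\<^bsub>V\<^esub> inv_arr V (lunit V u') = lunit V u \<cdot>\<^bsub>V\<^esub> inv_arr V (lunit V u) \<cdot>\<^bsub>V\<^esub> f"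
      using Comp_extend [OF lunit_natural [OF f], of "inv_arr V (lunit V u')"] D ob by simp
  qed (use D ob in auto)
  also have "g \<cdot>\<^bsub>V\<^esub> ev V u z \<cdot>\<^bsub>V\<^esub> (k \<odot>\<^bsub>V\<^esub> idn V u) \<cdot>\<^bsub>V\<^esub> \<dots> = g \<cdot>\<^bsub>V\<^esub> arrow_of u z k \<cdot>\<^bsub>V\<^esub> f"
    unfolding arrow_of_def using D ob by simp
  finally show ?thesis .
qed

lemma arrow_of_unit_ihom:
  assumes k: "k \<in> hom V \<one>\<^bsub>V\<^esub> z"
  shows "arrow_of \<one>\<^bsub>V\<^esub> z (unit_ihom V z \<cdot>\<^bsub>V\<^esub> k) = k"
proof -
  note z = hom_Obj(2) [OF k]
  note u = unit_ihom [OF z]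
  have D: "k \<in> Arr V" "Dom V k = \<one>\<^bsub>V\<^esub>" "Cod V k = z" "unit_ihom V z \<in> Arr V" "Dom V (unit_ihom V z) = z"
    "Cod V (unit_ihom V z) = ihom V \<one>\<^bsub>V\<^esub> z"
    using k u(1) by (auto simp: hom_def)
  have "arrow_of \<one>\<^bsub>V\<^esub> z (unit_ihom V z \<cdot>\<^bsub>V\<^esub> k)
      = (ev V \<one>\<^bsub>V\<^esub> z \<cdot>\<^bsub>V\<^esub> (unit_ihom V z \<odot>\<^bsub>V\<^esub> idn V \<one>\<^bsub>V\<^esub>)) \<cdot>\<^bsub>V\<^esub> (k \<odot>\<^bsub>V\<^esub> idn V \<one>\<^bsub>V\<^esub>) \<cdot>\<^bsub>V\<^esub> inv_arr V (lunit V \<one>\<^bsub>V\<^esub>)"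
    unfolding arrow_of_def using D z by simp
  also have "\<dots> = (runit V z \<cdot>\<^bsub>V\<^esub> (k \<odot>\<^bsub>V\<^esub> idn V \<one>\<^bsub>V\<^esub>)) \<cdot>\<^bsub>V\<^esub> inv_arr V (lunit V \<one>\<^bsub>V\<^esub>)"
    unfolding u(2) using D z by simp
  also have "\<dots> = k"
    unfolding runit_natural [OF k] using D by (simp add: lunit_unit_eq_runit_unit)
  finally show ?thesis .
qed

lemma unit_ihom_iso:
  assumes z: "z \<in> Obj V"
  shows "iso V (unit_ihom V z)"
proof (rule isoI [OF unit_ihom(1) [OF z]])
  note u = unit_ihom [OF z]
  have D: "unit_ihom V z \<in> Arr V" "Dom V (unit_ihom V z) = z" "Cod V (unit_ihom V z) = ihom V \<one>\<^bsub>V\<^esub> z"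
    using u(1) by (auto simp: hom_def)
  let ?h = "ihom V \<one>\<^bsub>V\<^esub> z" and ?I = "\<one>\<^bsub>V\<^esub>"
  let ?e = "ev V ?I z \<cdot>\<^bsub>V\<^esub> inv_arr V (runit V ?h)"
  show e: "?e \<in> hom V ?h z" using z by (auto simp: hom_def)
  have n: "inv_arr V (runit V ?h) \<cdot>\<^bsub>V\<^esub> unit_ihom V z = (unit_ihom V z \<odot>\<^bsub>V\<^esub> idn V ?I) \<cdot>\<^bsub>V\<^esub> inv_arr V (runit V z)"
  proof (rule iso_monic [of "runit V ?h"])
    show "runit V ?h \<cdot>\<^bsub>V\<^esub> inv_arr V (runit V ?h) \<cdot>\<^bsub>V\<^esub> unit_ihom V z = runit V ?h \<cdot>\<^bsub>V\<^esub> (unit_ihom V z \<odot>\<^bsub>V\<^esub> idn V ?I) \<cdot>\<^bsub>V\<^esub> inv_arr V (runit V z)"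
      using Comp_extend [OF runit_natural [OF u(1)], of "inv_arr V (runit V z)"] D z by simp
  qed (use D z in auto)
  have "?e \<cdot>\<^bsub>V\<^esub> unit_ihom V z = ev V ?I z \<cdot>\<^bsub>V\<^esub> (inv_arr V (runit V ?h) \<cdot>\<^bsub>V\<^esub> unit_ihom V z)"
    using D z by simp
  also have "\<dots> = (ev V ?I z \<cdot>\<^bsub>V\<^esub> (unit_ihom V z \<odot>\<^bsub>V\<^esub> idn V ?I)) \<cdot>\<^bsub>V\<^esub> inv_arr V (runit V z)"
    unfolding n using D z by simp
  also have "\<dots> = idn V z" unfolding u(2) using z by simp
  finally show "?e \<cdot>\<^bsub>V\<^esub> unit_ihom V z = idn V z" .
  show "unit_ihom V z \<cdot>\<^bsub>V\<^esub> ?e = idn V ?h"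
  proof (rule ihom_ext [OF Comp_in_hom [OF e u(1)] idn_in_hom munit_Obj z])
    show "?h \<in> Obj V" using z by simp
    have "ev V ?I z \<cdot>\<^bsub>V\<^esub> ((unit_ihom V z \<cdot>\<^bsub>V\<^esub> ?e) \<odot>\<^bsub>V\<^esub> idn V ?I) = (ev V ?I z \<cdot>\<^bsub>V\<^esub> (unit_ihom V z \<odot>\<^bsub>V\<^esub> idn V ?I)) \<cdot>\<^bsub>V\<^esub> (?e \<odot>\<^bsub>V\<^esub> idn V ?I)"
      using D z by simp
    also have "\<dots> = ?e \<cdot>\<^bsub>V\<^esub> runit V ?h" unfolding u(2) by (rule runit_natural [OF e])
    also have "\<dots> = ev V ?I z \<cdot>\<^bsub>V\<^esub> (idn V ?h \<odot>\<^bsub>V\<^esub> idn V ?I)" using z by simp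
    finally show "ev V ?I z \<cdot>\<^bsub>V\<^esub> ((unit_ihom V z \<cdot>\<^bsub>V\<^esub> ?e) \<odot>\<^bsub>V\<^esub> idn V ?I) = ev V ?I z \<cdot>\<^bsub>V\<^esub> (idn V ?h \<odot>\<^bsub>V\<^esub> idn V ?I)" .
  qed
qed

end

locale tensored_cotensored = enriched V C
  for V :: "('o, 'm, 'x) smc_scheme" (structure) and C :: "('c, 'o, 'm) vcat" +
  fixes T :: "('c, 'o, 'm) tensor_data" and S :: "('c, 'o, 'm) cotensor_data"
  assumes category_C0: "category C0" and tensoring: "tensoring V C T" and cotensoring: "cotensoring V C S"
begin

sublocale C0: category C0 by (rule category_C0)

lemma pre_T: "pre_tensoring V C T" and phi_iso: "v \<in> Obj V \<Longrightarrow> x \<in> EObj C \<Longrightarrow> y \<in> EObj C \<Longrightarrow> iso V (phi T v x y)"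
  using tensoring by (auto simp: tensoring_def)

lemma pre_S: "pre_cotensoring V C S" and psi_iso: "v \<in> Obj V \<Longrightarrow> x \<in> EObj C \<Longrightarrow> y \<in> EObj C \<Longrightarrow> iso V (psi S v x y)"
  using cotensoring by (auto simp: cotensoring_def)

lemmas T = pre_tensoringD [OF pre_T] and S = pre_cotensoringD [OF pre_S]
lemmas TB = bifunctorD [OF T(1)] and SB = bifunctorD(1,3) [OF S(1)]
lemmas cA = cotensor_hom [OF pre_S]

lemma id0: "x \<in> EObj C \<Longrightarrow> idn C0 x \<in> hom C0 x x"
  using C0.idn_in_hom by simp

lemma tO_Obj: "x \<in> EObj C \<Longrightarrow> v \<in> Obj V \<Longrightarrow> tO T x v \<in> EObj C"
  and cO_Obj: "y \<in> EObj C \<Longrightarrow> v \<in> Obj V \<Longrightarrow> cO S y v \<in> EObj C"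
  using TB(1) SB(1) by simp_all

lemma element_bij:
  assumes "x \<in> EObj C" "y \<in> EObj C"
  shows "bij_betw (\<lambda>h. snd (snd h)) (hom C0 x y) (hom V \<one> (EHom C x y))"
  by (rule bij_betw_byWitness [where f' = "\<lambda>f. (x, y, f)"]) (use assms in \<open>auto simp: hom_underlying\<close>)

lemma element_ehom_arr:
  assumes "f \<in> hom C0 x' x" "g \<in> hom C0 y y'" "h \<in> hom C0 x y"
  shows "snd (snd (g \<cdot>\<^bsub>C0\<^esub> h \<cdot>\<^bsub>C0\<^esub> f)) = ehom_arr V C f g \<cdot> snd (snd h)"
proof -
  obtain h0 where h: "h = (x, y, h0)" using assms(3) by (auto simp: hom_underlying)
  show ?thesis using ehom_arr_element [OF category_C0 assms(1,2) assms(3) [unfolded h]] h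
    by (metis snd_conv)
qed

text \<open>The adjunction bijections \<open>C(x \<otimes> v, y) \<cong> V(v, EHom C x y) \<cong> C(x, y\<^sup>v)\<close>, read off from the isomorphisms
  \<open>\<phi>\<close> and \<open>\<psi>\<close> on elements.\<close>

definition tphi where "tphi x v h = arrow_of v (EHom C x (Cod C0 h)) (phi T v x (Cod C0 h) \<cdot> snd (snd h))"

definition cpsi where "cpsi y v h = arrow_of v (EHom C (Dom C0 h) y) (psi S v (Dom C0 h) y \<cdot> snd (snd h))"

lemma tphi_bij:
  assumes x: "x \<in> EObj C" and v: "v \<in> Obj V" and y: "y \<in> EObj C"
  shows "bij_betw (tphi x v) (hom C0 (tO T x v) y) (hom V v (EHom C x y))"
proof -
  have "bij_betw (arrow_of v (EHom C x y) \<circ> ((\<lambda>h. phi T v x y \<cdot> h) \<circ> (\<lambda>h. snd (snd h)))) (hom C0 (tO T x v) y) (hom V v (EHom C x y))"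
    by (intro bij_betw_trans [OF _ arrow_of_bij] bij_betw_trans [OF element_bij]
        bij_postcomp_iso phi_iso T(2) tO_Obj) (use x v y in simp_all)
  then show ?thesis
    by (rule bij_betw_cong [THEN iffD1, rotated]) (simp add: tphi_def hom_def)
qed

lemma cpsi_bij:
  assumes x: "x \<in> EObj C" and v: "v \<in> Obj V" and y: "y \<in> EObj C"
  shows "bij_betw (cpsi y v) (hom C0 x (cO S y v)) (hom V v (EHom C x y))"
proof -
  have "bij_betw (arrow_of v (EHom C x y) \<circ> ((\<lambda>h. psi S v x y \<cdot> h) \<circ> (\<lambda>h. snd (snd h)))) (hom C0 x (cO S y v)) (hom V v (EHom C x y))"
    by (intro bij_betw_trans [OF _ arrow_of_bij] bij_betw_trans [OF element_bij]
        bij_postcomp_iso psi_iso S(2) cO_Obj) (use x v y in simp_all)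
  then show ?thesis
    by (rule bij_betw_cong [THEN iffD1, rotated]) (simp add: cpsi_def hom_def)
qed

lemma tphi_natural:
  assumes f: "f \<in> hom C0 x' x" and k: "k \<in> hom V v' v" and g: "g \<in> hom C0 y y'" and h: "h \<in> hom C0 (tO T x v) y"
  shows "tphi x' v' (g \<cdot>\<^bsub>C0\<^esub> h \<cdot>\<^bsub>C0\<^esub> tA T f k) = ehom_arr V C f g \<cdot> tphi x v h \<cdot> k"
proof -
  have ob: "x' \<in> EObj C" "x \<in> EObj C" "y \<in> EObj C" "y' \<in> EObj C" "v' \<in> Obj V" "v \<in> Obj V"
    using C0.hom_Obj [OF f] C0.hom_Obj [OF g] hom_Obj [OF k] by simp_all
  note fk = TB(2) [OF f k]
  have ghf: "g \<cdot>\<^bsub>C0\<^esub> h \<cdot>\<^bsub>C0\<^esub> tA T f k \<in> hom C0 (tO T x' v') y'"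
    by (rule C0.Comp_in_hom [OF C0.Comp_in_hom [OF fk h] g])
  have D: "Cod C0 (g \<cdot>\<^bsub>C0\<^esub> h \<cdot>\<^bsub>C0\<^esub> tA T f k) = y'" "Cod C0 h = y" using ghf h by (auto simp: hom_def)
  have h0: "snd (snd h) \<in> hom V \<one> (EHom C (tO T x v) y)" using h by (auto simp: hom_underlying)
  note p = T(2) [OF ob(6,2,3)] and p' = T(2) [OF ob(5,1,4)] and e = ehom_arr_hom [OF fk g] and e' = ehom_arr_hom [OF f g]
  have "phi T v' x' y' \<cdot> snd (snd (g \<cdot>\<^bsub>C0\<^esub> h \<cdot>\<^bsub>C0\<^esub> tA T f k))
      = ihom_arr V k (ehom_arr V C f g) \<cdot> (phi T v x y \<cdot> snd (snd h))"
    using element_ehom_arr [OF fk g h] Comp_assoc [OF h0 e p'] T(3) [OF k f g] Comp_assoc [OF h0 p ihom_arr(1) [OF k e']] by simp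
  then show ?thesis
    unfolding tphi_def D using arrow_of_natural [OF k e' Comp_in_hom [OF h0 p]] by simp
qed

lemma cpsi_natural:
  assumes f: "f \<in> hom C0 x' x" and k: "k \<in> hom V v' v" and g: "g \<in> hom C0 y y'" and h: "h \<in> hom C0 x (cO S y v)"
  shows "cpsi y' v' (cA S g k \<cdot>\<^bsub>C0\<^esub> h \<cdot>\<^bsub>C0\<^esub> f) = ehom_arr V C f g \<cdot> cpsi y v h \<cdot> k"
proof -
  have ob: "x' \<in> EObj C" "x \<in> EObj C" "y \<in> EObj C" "y' \<in> EObj C" "v' \<in> Obj V" "v \<in> Obj V"
    using C0.hom_Obj [OF f] C0.hom_Obj [OF g] hom_Obj [OF k] by simp_all
  note gk = cA [OF g k]
  have ghf: "cA S g k \<cdot>\<^bsub>C0\<^esub> h \<cdot>\<^bsub>C0\<^esub> f \<in> hom C0 x' (cO S y' v')"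
    by (rule C0.Comp_in_hom [OF C0.Comp_in_hom [OF f h] gk])
  have D: "Dom C0 (cA S g k \<cdot>\<^bsub>C0\<^esub> h \<cdot>\<^bsub>C0\<^esub> f) = x'" "Dom C0 h = x" using ghf h by (auto simp: hom_def)
  have h0: "snd (snd h) \<in> hom V \<one> (EHom C x (cO S y v))" using h by (auto simp: hom_underlying)
  note p = S(2) [OF ob(6,2,3)] and p' = S(2) [OF ob(5,1,4)] and e = ehom_arr_hom [OF f gk] and e' = ehom_arr_hom [OF f g]
  have "psi S v' x' y' \<cdot> snd (snd (cA S g k \<cdot>\<^bsub>C0\<^esub> h \<cdot>\<^bsub>C0\<^esub> f))
      = ihom_arr V k (ehom_arr V C f g) \<cdot> (psi S v x y \<cdot> snd (snd h))"
    using element_ehom_arr [OF f gk h] Comp_assoc [OF h0 e p'] S(3) [OF k f g] Comp_assoc [OF h0 p ihom_arr(1) [OF k e']] by simp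
  then show ?thesis
    unfolding cpsi_def D using arrow_of_natural [OF k e' Comp_in_hom [OF h0 p]] by simp
qed

lemma tensor_EHom_adjunction:
  "two_variable_adjunction C0 V C0 (tO T) (tA T) (EHom C) (ehom_arr V C) tphi"
  by unfold_locales (use T(1) ehom_arr_hom tphi_bij tphi_natural in auto)

text \<open>The bijection \<open>C(x \<otimes> v, y) \<cong> C(x, y\<^sup>v)\<close>, obtained by comparing both sides with \<open>V(v, EHom C x y)\<close>.\<close>

definition tpsi where "tpsi v x h = inv_into (hom C0 x (cO S (Cod C0 h) v)) (cpsi (Cod C0 h) v) (tphi x v h)"

lemma tensor_cotensor_adjunction:
  "two_variable_adjunction V C0 C0 (\<lambda>v x. tO T x v) (\<lambda>k f. tA T f k) (\<lambda>v y. cO S y v) (\<lambda>k g. cA S g k) tpsi"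
proof
  show "is_bifunctor V C0 C0 (\<lambda>v x. tO T x v) (\<lambda>k f. tA T f k)"
    by (rule bifunctorI) (use TB in blast)+
  show "cO S d a \<in> Obj C0" if "a \<in> Obj V" "d \<in> Obj C0" for a d using that cO_Obj by simp
  show "cA S g f \<in> hom C0 (cO S d a) (cO S d' a')" if "f \<in> hom V a' a" "g \<in> hom C0 d d'" for f g a a' d d'
    using cA that by blast
  have tp: "bij_betw (tpsi v x) (hom C0 (tO T x v) y) (hom C0 x (cO S y v))"
    "h \<in> hom C0 (tO T x v) y \<Longrightarrow> cpsi y v (tpsi v x h) = tphi x v h"
    if ob: "v \<in> Obj V" "x \<in> EObj C" "y \<in> EObj C" for v x y h
  proof -
    note c = cpsi_bij [OF ob(2,1,3)] and t = tphi_bij [OF ob(2,1,3)]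
    have e: "tpsi v x h = inv_into (hom C0 x (cO S y v)) (cpsi y v) (tphi x v h)" if "h \<in> hom C0 (tO T x v) y" for h
      using that by (simp add: tpsi_def hom_def)
    show "bij_betw (tpsi v x) (hom C0 (tO T x v) y) (hom C0 x (cO S y v))"
      using bij_betw_trans [OF t bij_betw_inv_into [OF c]] by (rule bij_betw_cong [THEN iffD1, rotated]) (simp add: e)
    assume h: "h \<in> hom C0 (tO T x v) y"
    then have "tphi x v h \<in> hom V v (EHom C x y)" using t by (auto simp: bij_betw_def)
    then show "cpsi y v (tpsi v x h) = tphi x v h" unfolding e [OF h] by (rule bij_betw_inv_into_right [OF c])
  qed
  show "bij_betw (tpsi a b) (hom C0 (tO T b a) d) (hom C0 b (cO S d a))" if "a \<in> Obj V" "b \<in> Obj C0" "d \<in> Obj C0" for a b d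
    using tp(1) that by simp
  show "tpsi v' x' (g \<cdot>\<^bsub>C0\<^esub> h \<cdot>\<^bsub>C0\<^esub> tA T f k) = cA S g k \<cdot>\<^bsub>C0\<^esub> tpsi v x h \<cdot>\<^bsub>C0\<^esub> f"
    if k: "k \<in> hom V v' v" and f: "f \<in> hom C0 x' x" and g: "g \<in> hom C0 y y'" and h: "h \<in> hom C0 (tO T x v) y"
    for k v' v f x' x g y y' h
  proof -
    have ob: "x' \<in> EObj C" "x \<in> EObj C" "y \<in> EObj C" "y' \<in> EObj C" "v' \<in> Obj V" "v \<in> Obj V"
      using C0.hom_Obj [OF f] C0.hom_Obj [OF g] hom_Obj [OF k] by simp_all
    have L: "g \<cdot>\<^bsub>C0\<^esub> h \<cdot>\<^bsub>C0\<^esub> tA T f k \<in> hom C0 (tO T x' v') y'"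
      by (rule C0.Comp_in_hom [OF C0.Comp_in_hom [OF TB(2) [OF f k] h] g])
    have th: "tpsi v x h \<in> hom C0 x (cO S y v)" using tp(1) [OF ob(6,2,3)] h by (auto simp: bij_betw_def)
    have R: "cA S g k \<cdot>\<^bsub>C0\<^esub> tpsi v x h \<cdot>\<^bsub>C0\<^esub> f \<in> hom C0 x' (cO S y' v')"
      by (rule C0.Comp_in_hom [OF C0.Comp_in_hom [OF f th] cA [OF g k]])
    have L': "tpsi v' x' (g \<cdot>\<^bsub>C0\<^esub> h \<cdot>\<^bsub>C0\<^esub> tA T f k) \<in> hom C0 x' (cO S y' v')"
      using tp(1) [OF ob(5,1,4)] L by (auto simp: bij_betw_def)
    have "cpsi y' v' (tpsi v' x' (g \<cdot>\<^bsub>C0\<^esub> h \<cdot>\<^bsub>C0\<^esub> tA T f k)) = cpsi y' v' (cA S g k \<cdot>\<^bsub>C0\<^esub> tpsi v x h \<cdot>\<^bsub>C0\<^esub> f)"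
      unfolding tp(2) [OF ob(5,1,4) L] cpsi_natural [OF f k g th] tp(2) [OF ob(6,2,3) h] by (rule tphi_natural [OF f k g h])
    then show ?thesis
      using cpsi_bij [OF ob(1,5,4)] L' R unfolding bij_betw_def inj_on_def by blast
  qed
qed

text \<open>\<open>- \<otimes> v\<close> and \<open>x \<otimes> -\<close> preserve initial objects because they are left adjoints.\<close>

lemma initial_tensor:
  assumes "is_initial C0 z" "v \<in> Obj V"
  shows "is_initial C0 (tO T z v)"
  using hom_adjunction.initial_adjoint [OF two_variable_adjunction.partial_adjunction [OF tensor_cotensor_adjunction assms(2)] assms(1)] .

lemma tensor_initial:
  assumes "is_initial V z" "x \<in> EObj C"
  shows "is_initial C0 (tO T x z)"
  using hom_adjunction.initial_adjoint [OF two_variable_adjunction.partial_adjunction [OF tensor_EHom_adjunction] assms(1)] assms(2)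
  by simp

lemma tensor_set_compatible: "tensor_set_compatible V C T"
  unfolding tensor_set_compatible_def using bij_postcomp_iso phi_iso T(2) by blast

lemma cotensor_set_compatible: "cotensor_set_compatible V C S"
  unfolding cotensor_set_compatible_def using bij_postcomp_iso psi_iso S(2) by blast

text \<open>The equations for \<open>rho\<close> and \<open>eta\<close> say that the map which they induce on hom-objects is
  invertible; so they are invertible by the Yoneda lemma.\<close>

lemma bij_if_Comp_iso:
  assumes "p \<in> hom V b c" "iso V p" "e \<in> hom V a b" "p \<cdot> e = unit_ihom V z" "z \<in> Obj V"
  shows "bij_betw (\<lambda>h. e \<cdot> h) (hom V \<one> a) (hom V \<one> b)"
proof (rule bij_postcomp_iso [OF _ assms(3)])
  have "e = inv_arr V p \<cdot> unit_ihom V z"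
    unfolding assms(4) [symmetric] using assms(1-3) by (simp add: hom_def)
  moreover have "iso V (inv_arr V p \<cdot> unit_ihom V z)"
    by (rule iso_Comp [OF unit_ihom_iso [OF assms(5)] iso_inv [OF assms(2)]])
      (use assms in \<open>auto simp: hom_def simp flip: assms(4)\<close>)
  ultimately show "iso V e" by simp
qed

lemma tensor_unital: "tensor_unital V C T"
  unfolding tensor_unital_def
proof
  fix x assume x: "x \<in> EObj C"
  note r = T(4) [OF x]
  show "iso C0 (rho T x)"
  proof (rule C0.iso_if_precomp_bijective [OF r])
    fix y assume "y \<in> Obj C0"
    then have y: "y \<in> EObj C" by simp
    have x1: "tO T x \<one> \<in> EObj C" using tO_Obj x by simp
    let ?s = "\<lambda>h. snd (snd h)"
    let ?e = "ehom_arr V C (rho T x) (idn C0 y)"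
    have e: "bij_betw (\<lambda>h. ?e \<cdot> h) (hom V \<one> (EHom C x y)) (hom V \<one> (EHom C (tO T x \<one>) y))"
      by (rule bij_if_Comp_iso [OF T(2) phi_iso ehom_arr_hom [OF r id0 [OF y]] T(6)]) (use x y in simp_all)
    note b1 = element_bij [OF x y] and b2 = element_bij [OF x1 y]
    have "bij_betw ((\<lambda>h. ?e \<cdot> h) \<circ> ?s) (hom C0 x y) (hom V \<one> (EHom C (tO T x \<one>) y))"
      by (rule bij_betw_trans [OF b1 e])
    moreover have "((\<lambda>h. ?e \<cdot> h) \<circ> ?s) h = (?s \<circ> (\<lambda>h. h \<cdot>\<^bsub>C0\<^esub> rho T x)) h" if h: "h \<in> hom C0 x y" for h
      using element_ehom_arr [OF r id0 [OF y] h] C0.Comp_idn_left [OF C0.Comp_in_hom [OF r h]] by simp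
    ultimately have "bij_betw (?s \<circ> (\<lambda>h. h \<cdot>\<^bsub>C0\<^esub> rho T x)) (hom C0 x y) (hom V \<one> (EHom C (tO T x \<one>) y))"
      by (rule bij_betw_cong [THEN iffD1, rotated])
    then show "bij_betw (\<lambda>h. h \<cdot>\<^bsub>C0\<^esub> rho T x) (hom C0 x y) (hom C0 (tO T x \<one>) y)"
      using bij_betw_comp_iff2 [OF b2, of "\<lambda>h. h \<cdot>\<^bsub>C0\<^esub> rho T x" "hom C0 x y"] C0.Comp_in_hom [OF r] by blast
  qed
qed

lemma cotensor_unital: "cotensor_unital V C S"
  unfolding cotensor_unital_def
proof
  fix y assume y: "y \<in> EObj C"
  note r = S(4) [OF y]
  show "iso C0 (eta S y)"
  proof (rule C0.iso_if_postcomp_bijective [OF r])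
    fix x assume "x \<in> Obj C0"
    then have x: "x \<in> EObj C" by simp
    have y1: "cO S y \<one> \<in> EObj C" using cO_Obj y by simp
    let ?s = "\<lambda>h. snd (snd h)"
    let ?e = "ehom_arr V C (idn C0 x) (eta S y)"
    have e: "bij_betw (\<lambda>h. ?e \<cdot> h) (hom V \<one> (EHom C x y)) (hom V \<one> (EHom C x (cO S y \<one>)))"
      by (rule bij_if_Comp_iso [OF S(2) psi_iso ehom_arr_hom [OF id0 [OF x] r] S(6)]) (use x y in simp_all)
    note b1 = element_bij [OF x y] and b2 = element_bij [OF x y1]
    have "bij_betw ((\<lambda>h. ?e \<cdot> h) \<circ> ?s) (hom C0 x y) (hom V \<one> (EHom C x (cO S y \<one>)))"
      by (rule bij_betw_trans [OF b1 e])
    moreover have "((\<lambda>h. ?e \<cdot> h) \<circ> ?s) h = (?s \<circ> (\<lambda>h. eta S y \<cdot>\<^bsub>C0\<^esub> h)) h" if h: "h \<in> hom C0 x y" for h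
      using element_ehom_arr [OF id0 [OF x] r h] C0.Comp_idn_right [OF h] by simp
    ultimately have "bij_betw (?s \<circ> (\<lambda>h. eta S y \<cdot>\<^bsub>C0\<^esub> h)) (hom C0 x y) (hom V \<one> (EHom C x (cO S y \<one>)))"
      by (rule bij_betw_cong [THEN iffD1, rotated])
    then show "bij_betw (\<lambda>h. eta S y \<cdot>\<^bsub>C0\<^esub> h) (hom C0 x y) (hom C0 x (cO S y \<one>))"
      using bij_betw_comp_iff2 [OF b2, of "\<lambda>h. eta S y \<cdot>\<^bsub>C0\<^esub> h" "hom C0 x y"] C0.Comp_in_hom [OF _ r] by blast
  qed
qed

text \<open>Precomposition with \<open>x \<otimes> \<one> \<rightarrow> x\<close> turns \<open>f : x \<rightarrow> y\<close> into the map whose adjunct is the element \<open>f\<close> of \<open>EHom C x y\<close>.\<close>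

lemma tphi_rho:
  assumes f: "f \<in> hom C0 x y"
  shows "tphi x \<one> (f \<cdot>\<^bsub>C0\<^esub> rho T x) = snd (snd f)"
proof -
  have ob: "x \<in> EObj C" "y \<in> EObj C" using C0.hom_Obj [OF f] by simp_all
  note r = T(4) [OF ob(1)] and e = ehom_arr_hom [OF T(4) [OF ob(1)] id0 [OF ob(2)]]
  have f0: "snd (snd f) \<in> hom V \<one> (EHom C x y)" using f by (auto simp: hom_underlying)
  have fr: "f \<cdot>\<^bsub>C0\<^esub> rho T x \<in> hom C0 (tO T x \<one>) y" by (rule C0.Comp_in_hom [OF r f])
  have "snd (snd (f \<cdot>\<^bsub>C0\<^esub> rho T x)) = ehom_arr V C (rho T x) (idn C0 y) \<cdot> snd (snd f)"
    using element_ehom_arr [OF r id0 [OF ob(2)] f] C0.Comp_idn_left [OF fr] by simp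
  then have "phi T \<one> x y \<cdot> snd (snd (f \<cdot>\<^bsub>C0\<^esub> rho T x)) = unit_ihom V (EHom C x y) \<cdot> snd (snd f)"
    using Comp_assoc [OF f0 e T(2) [OF munit_Obj ob]] T(6) [OF ob] by simp
  moreover have "Cod C0 (f \<cdot>\<^bsub>C0\<^esub> rho T x) = y" using fr by (simp add: hom_def)
  ultimately show ?thesis unfolding tphi_def using arrow_of_unit_ihom [OF f0] by simp
qed

end

locale enriched_model =
  complete_monoidal_model_category U V MV + tensored_cotensored V C T S + C0: complete_model_category U "underlying V C" MC
  for U :: "'u itself" and V :: "('o, 'm, 'x) smc_scheme" (structure) and MV and C :: "('c, 'o, 'm) vcat" and MC and T S +
  assumes tensor_pushout_product: "pushout_product_axiom (underlying V C) MC V MV (underlying V C) MC (tO T) (tA T)"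
    and tensor_unit: "cofibrant (underlying V C) MC x \<Longrightarrow> cofibrant_replacement V MV \<one> q \<Longrightarrow>
      rho T x \<cdot>\<^bsub>underlying V C\<^esub> tA T (idn (underlying V C) x) q \<in> Weq MC"
begin

lemma tensor_EHom_quillen:
  "two_variable_quillen_adjunction U C0 MC V MV C0 MC (tO T) (tA T) (EHom C) (ehom_arr V C) tphi"
  by (intro two_variable_quillen_adjunction.intro two_variable_quillen_adjunction_axioms.intro
      tensor_EHom_adjunction tensor_pushout_product) unfold_locales

lemma tensor_cotensor_quillen:
  "two_variable_quillen_adjunction U V MV C0 MC C0 MC (\<lambda>v x. tO T x v) (\<lambda>k f. tA T f k) (\<lambda>v y. cO S y v) (\<lambda>k g. cA S g k) tpsi"
  by (intro two_variable_quillen_adjunction.intro two_variable_quillen_adjunction_axioms.intro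
      tensor_cotensor_adjunction pushout_product_swap [OF tensor_pushout_product]) unfold_locales

lemma tensor_left_quillen:
  assumes "cofibrant C0 MC x"
  shows "quillen_adjunction U V MV C0 MC (tO T x) (tA T (idn C0 x)) (EHom C x) (ehom_arr V C (idn C0 x)) (tphi x)"
  by (rule two_variable_quillen_adjunction.partial_quillen_adjunction [OF tensor_EHom_quillen assms initial_tensor])

lemma tensor_right_quillen:
  assumes "cofibrant V MV v"
  shows "quillen_adjunction U C0 MC C0 MC (\<lambda>x. tO T x v) (\<lambda>f. tA T f (idn V v)) (\<lambda>y. cO S y v) (\<lambda>g. cA S g (idn V v)) (tpsi v)"
  by (rule two_variable_quillen_adjunction.partial_quillen_adjunction [OF tensor_cotensor_quillen assms])
    (use tensor_initial in simp)

lemma SM7: "SM7 V MV C MC"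
  unfolding SM7_def by (rule two_variable_quillen_adjunction.pullback_corner_axiom [OF tensor_EHom_quillen])

lemma weak_tensoring: "weak_tensoring V MV C MC T"
  unfolding weak_tensoring_def Let_def
  using pre_T tensor_pushout_product model_iso(1) [OF phi_iso] cofibrant_Obj C0.cofibrant_Obj C0.fibrant_Obj by simp

lemma weak_cotensoring: "weak_cotensoring V MV C MC S"
  unfolding weak_cotensoring_def Let_def
  using pre_S two_variable_quillen_adjunction.pullback_corner_axiom [OF tensor_cotensor_quillen]
    model_iso(1) [OF psi_iso] cofibrant_Obj C0.cofibrant_Obj C0.fibrant_Obj by simp

lemma absolute_axioms: "absolute_axioms V MV C MC T S"
  unfolding absolute_axioms_def Let_def
  using quillen_adjunction.Go_fibrant [OF tensor_left_quillen] quillen_adjunction.Fo_cofibrant [OF tensor_left_quillen]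
    quillen_adjunction.Go_fibrant [OF tensor_right_quillen] by blast

text \<open>For cofibrant \<open>x\<close> and fibrant \<open>y\<close>, the bijection
  \<open>[\<one>, EHom C x y] \<cong> [Q \<one>, EHom C x y] \<cong> [x \<otimes> Q \<one>, y] \<cong> [x, y]\<close> uses the unit axiom in the last step.\<close>

lemma pi0_axiom: "pi0_axiom V MV C MC"
  unfolding pi0_axiom_def Let_def
proof (intro allI impI, elim conjE)
  fix x y assume x: "cofibrant C0 MC x" and y: "fibrant C0 MC y"
  have ob: "x \<in> EObj C" "y \<in> EObj C" using C0.cofibrant_Obj [OF x] C0.fibrant_Obj [OF y] by simp_all
  let ?s = "\<lambda>h. snd (snd h)"
  interpret Q: quillen_adjunction U V MV C0 MC "tO T x" "tA T (idn C0 x)" "EHom C x" "ehom_arr V C (idn C0 x)" "tphi x"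
    by (rule tensor_left_quillen [OF x])
  obtain Q q where Q: "cofibrant V MV Q" and q: "q \<in> hom V Q \<one>" "q \<in> Weq MV"
    using cofibrant_replacement_exists [OF munit_Obj] by blast
  have "cofibrant_replacement V MV \<one> q" using Q q by (simp add: cofibrant_replacement_def hom_def)
  then have rW: "rho T x \<cdot>\<^bsub>C0\<^esub> tA T (idn C0 x) q \<in> Weq MC" by (rule tensor_unit [OF x])
  note xq = TB(2) [OF id0 [OF ob(1)] q(1)]
  have r: "rho T x \<cdot>\<^bsub>C0\<^esub> tA T (idn C0 x) q \<in> hom C0 (tO T x Q) x" by (rule C0.Comp_in_hom [OF xq T(4) [OF ob(1)]])
  have s: "?s f \<in> hom V \<one> (EHom C x y)" if "f \<in> hom C0 x y" for f using that by (auto simp: hom_underlying)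
  have sq: "tphi x Q (f \<cdot>\<^bsub>C0\<^esub> (rho T x \<cdot>\<^bsub>C0\<^esub> tA T (idn C0 x) q)) = ?s f \<cdot> q" if f: "f \<in> hom C0 x y" for f
    using Q.sharp_right [OF q(1) C0.Comp_in_hom [OF T(4) [OF ob(1)] f]] C0.Comp_assoc [OF xq T(4) [OF ob(1)] f] tphi_rho [OF f]
    by simp
  have rep: "\<exists>f\<in>hom C0 x y. zz_equiv C0 MC x y r [Inl f]" if "zigzag C0 MC x r y" for r
    using C0.zigzag_represented [OF x y that] by metis
  have repA: "\<forall>r. zigzag C0 MC x r y \<longrightarrow> (\<exists>f\<in>hom C0 x y. zz_equiv C0 MC x y r [Inl f])" using rep by blast
  have sA: "\<forall>f\<in>hom C0 x y. ?s f \<in> hom V \<one> (EHom C x y)" using s by blast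
  have "(\<forall>f\<in>hom C0 x y. \<forall>g\<in>hom C0 x y. ho_eq MV \<one> (EHom C x y) (?s f) (?s g) \<longleftrightarrow> C0.ho_eq MC x y f g)
    \<and> (\<forall>r. zigzag V MV \<one> r (EHom C x y) \<longrightarrow> (\<exists>f\<in>hom C0 x y. zz_equiv V MV \<one> (EHom C x y) r [Inl (?s f)]))"
    using Q.derived_hom_inj [OF Q q r rW y s sq] Q.derived_hom_surj [OF Q q r rW y s sq rep] by blast
  then obtain \<kappa> where "\<forall>f\<in>hom C0 x y. \<kappa> (ho_class C0 MC f) = ho_class V MV (?s f)"
      "bij_betw \<kappa> (ho_hom C0 MC x y) (ho_hom V MV \<one> (EHom C x y))"
    unfolding ho_hom_bijection [where \<Phi> = ?s and MD = MV, OF C0.category_axioms category_axioms repA sA, symmetric]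
    by blast
  then show "\<exists>\<kappa>. (\<forall>f. (x, y, f) \<in> hom C0 x y \<longrightarrow> \<kappa> (ho_class C0 MC (x, y, f)) = ho_class V MV f)
      \<and> bij_betw \<kappa> (ho_hom C0 MC x y) (ho_hom V MV \<one> (EHom C x y))"
    by (intro exI [of _ \<kappa>]) auto
qed

theorem weak_model_category: "weak_model_category U V MV C MC T S"
  unfolding weak_model_category_def
  using enriched C0.model_category_axioms SM7 weak_tensoring weak_cotensoring absolute_axioms pi0_axiom by blast

end

section \<open>Stability of weak enriched model categories under change of enrichment\<close>

lemma complete_monoidal_model_categoryI:
  assumes "symmetric_monoidal_model_category U V MV" "infinite (UNIV :: 'u set)"
  shows "complete_monoidal_model_category (U :: 'u itself) V MV"
proof -
  interpret symmetric_monoidal_model_category U V MV by fact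
  show ?thesis by unfold_locales (rule assms(2))
qed

lemma weak_monoidal_quillen_adjunctionI:
  assumes "infinite (UNIV :: 'u set)" "symmetric_monoidal_model_category (U :: 'u itself) V MV"
    "symmetric_monoidal_model_category U W MW" "weak_monoidal_Quillen_adjunction W MW V MV A"
  shows "weak_monoidal_quillen_adjunction U W MW V MV A"
proof -
  interpret V: complete_monoidal_model_category U V MV
    by (rule complete_monoidal_model_categoryI [OF assms(2,1)])
  interpret W: complete_monoidal_model_category U W MW
    by (rule complete_monoidal_model_categoryI [OF assms(3,1)])
  show ?thesis
    by unfold_locales (use assms(4) in \<open>auto simp: weak_monoidal_Quillen_adjunction_def\<close>)
qed

theorem theorem7p3:
  fixes U :: "'u itself"
    and V :: "('vo, 'vm) smc" and MV :: "'vm model_structure"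
    and W :: "('wo, 'wm) smc" and MW :: "'wm model_structure"
    and A :: "('wo, 'wm, 'vo, 'vm) lax_adjunction"
    and C :: "('c, 'vo, 'vm) vcat" and MC :: "('c \<times> 'c \<times> 'vm) model_structure"
    and T :: "('c, 'vo, 'vm) tensor_data" and S :: "('c, 'vo, 'vm) cotensor_data"
  assumes "infinite (UNIV :: 'u set)"
    and "symmetric_monoidal_model_category U V MV"
    and "symmetric_monoidal_model_category U W MW"
    and "weak_monoidal_Quillen_adjunction W MW V MV A"
    and "iso V (oplax_counit V A)"
  shows
    "(weak_model_category U V MV C MC T S \<longrightarrow>
        weak_model_category U W MW (change_base W A C) (change_base_model W A MC)
          (change_base_tensor W V A C T) (change_base_cotensor W V A C S)
      \<and> (tensor_set_compatible V C T \<longrightarrow>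
           tensor_set_compatible W (change_base W A C) (change_base_tensor W V A C T))
      \<and> (cotensor_set_compatible V C S \<longrightarrow>
           cotensor_set_compatible W (change_base W A C) (change_base_cotensor W V A C S))
      \<and> (tensor_unital V C T \<longrightarrow>
           tensor_unital W (change_base W A C) (change_base_tensor W V A C T))
      \<and> (cotensor_unital V C S \<longrightarrow>
           cotensor_unital W (change_base W A C) (change_base_cotensor W V A C S)))
    \<and> (enriched_model_category U V MV C MC T S \<longrightarrow>
        weak_model_category U V MV C MC T S
      \<and> tensor_set_compatible V C T \<and> cotensor_set_compatible V C S
      \<and> tensor_unital V C T \<and> cotensor_unital V C S)"
proof (rule conjI; rule impI)
  interpret Q: weak_monoidal_quillen_adjunction U W MW V MV A
    by (rule weak_monoidal_quillen_adjunctionI [OF assms(1-4)])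
  assume weak: "weak_model_category U V MV C MC T S"
  then have C: "enriched_category V C" "model_category U (underlying V C) MC"
    and pre: "pre_tensoring V C T" "pre_cotensoring V C S"
    by (auto simp: weak_model_category_def weak_tensoring_def weak_cotensoring_def Let_def)
  have E: "enriched V C"
    by (intro enriched.intro enriched_axioms.intro Q.V.symmetric_monoidal_closed_axioms C(1))
  interpret weak_base_change U W MW V MV A C MC
    by (intro weak_base_change.intro weak_base_change_axioms.intro change_of_base.intro
        Q.weak_monoidal_quillen_adjunction_axioms Q.lax_monoidal_adjunction_axioms E C(2) assms(5))
  show "weak_model_category U W MW (change_base W A C) (change_base_model W A MC)
          (change_base_tensor W V A C T) (change_base_cotensor W V A C S)
      \<and> (tensor_set_compatible V C T \<longrightarrow>
           tensor_set_compatible W (change_base W A C) (change_base_tensor W V A C T))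
      \<and> (cotensor_set_compatible V C S \<longrightarrow>
           cotensor_set_compatible W (change_base W A C) (change_base_cotensor W V A C S))
      \<and> (tensor_unital V C T \<longrightarrow>
           tensor_unital W (change_base W A C) (change_base_tensor W V A C T))
      \<and> (cotensor_unital V C S \<longrightarrow>
           cotensor_unital W (change_base W A C) (change_base_cotensor W V A C S))"
    using weak_model_category_change_base [OF weak] tensor_set_compatible_change_base [OF pre(1)]
      cotensor_set_compatible_change_base [OF pre(2)] tensor_unital_change_base [OF pre(1)]
      cotensor_unital_change_base [OF pre(2)] by blast
next
  interpret V: complete_monoidal_model_category U V MV
    by (rule complete_monoidal_model_categoryI [OF assms(2,1)])
  assume em: "enriched_model_category U V MV C MC T S"
  note em' = em [unfolded enriched_model_category_def Let_def]
  have C: "enriched_category V C" "model_category U (underlying V C) MC" "tensoring V C T" "cotensoring V C S"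
    "pushout_product_axiom (underlying V C) MC V MV (underlying V C) MC (tO T) (tA T)"
    using em' by blast+
  have un: "rho T x \<cdot>\<^bsub>underlying V C\<^esub> tA T (idn (underlying V C) x) q \<in> Weq MC"
    if "cofibrant (underlying V C) MC x" "cofibrant_replacement V MV \<one>\<^bsub>V\<^esub> q" for x q
    using em' that by blast
  interpret C0: model_category U "underlying V C" MC by (rule C(2))
  interpret E: enriched V C by unfold_locales (rule C(1))
  interpret enriched_model U V MV C MC T S
    by unfold_locales (fact C un assms(1))+
  show "weak_model_category U V MV C MC T S \<and> tensor_set_compatible V C T \<and> cotensor_set_compatible V C S
      \<and> tensor_unital V C T \<and> cotensor_unital V C S"
    using weak_model_category tensor_set_compatible cotensor_set_compatible tensor_unital cotensor_unital by blast
qed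

end
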